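(* Let $\gamma$ be a $C^1$ smooth curve dividing a planar domain $U$ into two connected regions $U^+$ and $U^-$. Let $\tilde u\in C^1(U\setminus\gamma)\cap C^0(U)$ be such that $U\setminus\gamma$ is nonsingular (i.e. $\nabla\tilde u+\vec F\neq0$ on $U\setminus\gamma$). Moreover, suppose $\tilde u$ is a weak solution to $\operatorname{div}\frac{\nabla\tilde u+\vec F}{|\nabla\tilde u+\vec F|}=H$ with $\vec F\in C^1(U)$, $\operatorname{curl}\vec F\ne0$ and $H\in C^1(U)$, in the sense that for every $\varphi\in C_0^\infty(U)$ $$\int_{U\setminus\gamma}\frac{\nabla\tilde u+\vec F}{|\nabla\tilde u+\vec F|}\cdot\nabla\varphi+\int_UH\varphi=0 .$$ Let $p_0\in\gamma$ be a nondegenerate crack point. Then $\tilde u\in C^1(V)$ for some neighborhood $V\subset U$ of $p_0$, and $p_0$ is a singular point of $\tilde u$, that is, $\nabla\tilde u+\vec F=0$ at $p_0$.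
   Context: For $\vec F=(F_1,F_2)$, $\operatorname{curl}\vec F:=(F_2)_x-(F_1)_y$. On $U\setminus\gamma$ write $N=\frac{\nabla\tilde u+\vec F}{|\nabla\tilde u+\vec F|}=(\cos\theta,\sin\theta)$ (locally, for an angular function $\theta$), $N^\perp=(\sin\theta,-\cos\theta)$. Characteristic curves are integral curves of $N^\perp$; seed curves are integral curves of $N$. Crack point: $p_0\in\gamma$ is a crack point if $N_\pm(p_0)$ exists as the limit of $N(q)$ as $q\in U^\pm$, $q\to p_0$, respectively, and $N_+(p_0)\ne N_-(p_0)$. Nondegenerate point: Suppose, after shrinking $U$ to a neighborhood of $p_0$ (divided by $\gamma$ into $U^\pm$), that for any $q\in\gamma$ there are exactly two characteristic curves $\Gamma_q^+,\Gamma_q^-$ issuing from $q$, with $\Gamma_q^\pm\subset U^\pm$. Take $q^\pm\in\Gamma_q^\pm\setminus\{q\}$ and a seed curve $\gamma_\pm$ through $q^\pm$ each point of which emits a characteristic curve in $U^\pm$ hitting $\gamma$. Parametrize $\gamma_\pm$ by arc length $\tau^\pm$ in an open interval containing $\tau_0^\pm$, and let $X_\pm(\tau^\pm)\in\gamma$ be the point where the characteristic curve from $\gamma_\pm(\tau^\pm)$ hits $\gamma$; assume $X_+(\tau_0^+)=X_-(\tau_0^-)=p_0$. Let $(x_\pm,y_\pm,\theta_\pm)(\sigma,\tau^\pm)$ solve $$\frac{dx}{d\sigma}=\sin\theta,\quad \frac{dy}{d\sigma}=-\cos\theta,\quad \frac{d\theta}{d\sigma}=-H(x,y)$$ with $(x_\pm,y_\pm)(0,\tau^\pm)=\gamma_\pm(\tau^\pm)$,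 $\theta_\pm(0,\tau^\pm)=\theta(\gamma_\pm(\tau^\pm))$, let $P_\pm=(x_\pm,y_\pm)$, and write $X_\pm(\tau^\pm)=P_\pm(\sigma_\pm(\tau^\pm),\tau^\pm)$ with $\sigma_\pm$ continuous. The point $p_0$ is nondegenerate if, for both signs, $$\det\frac{\partial(x_\pm,y_\pm)}{\partial(\sigma,\tau^\pm)}\ne0\quad\text{at }(\sigma_\pm(\tau_0^\pm),\tau_0^\pm).$$ This does not depend on the choice of seed curves. A nondegenerate crack point is a crack point which is nondegenerate. *)

theory Defs
  imports "HOL-Analysis.Analysis"
begin

definition C1_on :: "('a::euclidean_space \<Rightarrow> 'b::euclidean_space) \<Rightarrow> 'a set \<Rightarrow> bool" where
  "C1_on f S \<longleftrightarrow>
     (\<exists>D :: 'a \<Rightarrow> 'a \<Rightarrow>\<^sub>L 'b. continuous_on S D \<and> (\<forall>x\<in>S. (f has_derivative blinfun_apply (D x)) (at x)))"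

definition pderivative :: "2 \<Rightarrow> (real^2 \<Rightarrow> 'b::real_normed_vector) \<Rightarrow> real^2 \<Rightarrow> 'b" where
  "pderivative i f p = frechet_derivative f (at p) (axis i 1)"

definition grad :: "(real^2 \<Rightarrow> real) \<Rightarrow> real^2 \<Rightarrow> real^2" where
  "grad u p = (\<chi> i. pderivative i u p)"

definition curl :: "(real^2 \<Rightarrow> real^2) \<Rightarrow> real^2 \<Rightarrow> real" where
  "curl F p = pderivative 1 F p $ 2 - pderivative 2 F p $ 1"

primrec Ck :: "nat \<Rightarrow> (real^2 \<Rightarrow> real) \<Rightarrow> bool" where
  "Ck 0 f \<longleftrightarrow> continuous_on UNIV f"
| "Ck (Suc k) f \<longleftrightarrow> (\<forall>x. f differentiable (at x)) \<and> (\<forall>i. Ck k (pderivative i f))"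

text \<open>Elements of \<open>C\<^sub>0\<^sup>\<infinity>(U)\<close>, extended by zero to the whole plane.\<close>

definition test_function :: "(real^2) set \<Rightarrow> (real^2 \<Rightarrow> real) \<Rightarrow> bool" where
  "test_function U \<phi> \<longleftrightarrow>
     (\<forall>k. Ck k \<phi>) \<and> compact (closure {x. \<phi> x \<noteq> 0}) \<and> closure {x. \<phi> x \<noteq> 0} \<subseteq> U"

definition C1_curve :: "(real^2) set \<Rightarrow> bool" where
  "C1_curve \<gamma> \<longleftrightarrow> connected \<gamma> \<and>
     (\<forall>p\<in>\<gamma>. \<exists>B g h. open B \<and> p \<in> B \<and> homeomorphism {-1<..<1::real} (\<gamma> \<inter> B) g h \<and>
        g C1_differentiable_on {-1<..<1} \<and> (\<forall>t\<in>{-1<..<1}. vector_derivative g (at t) \<noteq> 0))"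

definition divides_domain ::
    "(real^2) set \<Rightarrow> (real^2) set \<Rightarrow> (real^2) set \<Rightarrow> (real^2) set \<Rightarrow> bool" where
  "divides_domain \<gamma> U Up Um \<longleftrightarrow>
     open U \<and> connected U \<and> \<gamma> \<subseteq> U \<and> C1_curve \<gamma> \<and>
     open Up \<and> connected Up \<and> Up \<noteq> {} \<and> open Um \<and> connected Um \<and> Um \<noteq> {} \<and>
     Up \<inter> Um = {} \<and> U - \<gamma> = Up \<union> Um"

definition normal_field :: "(real^2 \<Rightarrow> real) \<Rightarrow> (real^2 \<Rightarrow> real^2) \<Rightarrow> real^2 \<Rightarrow> real^2" where
  "normal_field u F p = (grad u p + F p) /\<^sub>R norm (grad u p + F p)"

definition perp :: "real^2 \<Rightarrow> real^2" where
  "perp v = vector [v $ 2, - v $ 1]"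

definition weak_solution ::
    "(real^2) set \<Rightarrow> (real^2) set \<Rightarrow> (real^2 \<Rightarrow> real) \<Rightarrow> (real^2 \<Rightarrow> real^2) \<Rightarrow> (real^2 \<Rightarrow> real) \<Rightarrow> bool"
  where
  "weak_solution U \<gamma> u F H \<longleftrightarrow>
     (\<forall>\<phi>. test_function U \<phi> \<longrightarrow>
        (LINT x:U - \<gamma>|lborel. normal_field u F x \<bullet> grad \<phi> x) + (LINT x:U|lborel. H x * \<phi> x) = 0)"

definition crack_point ::
    "(real^2 \<Rightarrow> real^2) \<Rightarrow> (real^2) set \<Rightarrow> (real^2) set \<Rightarrow> (real^2) set \<Rightarrow> real^2 \<Rightarrow> bool" where
  "crack_point N \<gamma> Up Um p0 \<longleftrightarrow> p0 \<in> \<gamma> \<and>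
     (\<exists>Np Nm. (N \<longlongrightarrow> Np) (at p0 within Up) \<and> (N \<longlongrightarrow> Nm) (at p0 within Um) \<and> Np \<noteq> Nm)"

text \<open>
  A characteristic curve in the region \<open>W\<close> issuing from the point \<open>q\<close> of its boundary,
  parametrized by arc length measured from \<open>q\<close>.  The field \<open>N\<^sup>\<bottom>\<close> may point towards or away from
  \<open>q\<close>, hence the sign \<open>e\<close>.
\<close>

definition issuing_characteristic ::
    "(real^2 \<Rightarrow> real^2) \<Rightarrow> (real^2) set \<Rightarrow> real^2 \<Rightarrow> real \<Rightarrow> (real \<Rightarrow> real^2) \<Rightarrow> bool" where
  "issuing_characteristic N W q \<delta> c \<longleftrightarrow>
     0 < \<delta> \<and> continuous_on {0..<\<delta>} c \<and> c 0 = q \<and>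
     (\<exists>e\<in>{1, -1}. \<forall>s\<in>{0<..<\<delta>}. c s \<in> W \<and> (c has_vector_derivative e *\<^sub>R perp (N (c s))) (at s))"

text \<open>Curves that are subarcs of one another are counted as the same curve.\<close>

definition unique_issuing_characteristic ::
    "(real^2 \<Rightarrow> real^2) \<Rightarrow> (real^2) set \<Rightarrow> real^2 \<Rightarrow> bool" where
  "unique_issuing_characteristic N W q \<longleftrightarrow>
     (\<exists>\<delta> c. issuing_characteristic N W q \<delta> c) \<and>
     (\<forall>\<delta> c \<delta>' c'. issuing_characteristic N W q \<delta> c \<longrightarrow> issuing_characteristic N W q \<delta>' c' \<longrightarrow>
        (\<forall>s\<in>{0..<min \<delta> \<delta>'}. c s = c' s))"

definition seed_curve ::
    "(real^2 \<Rightarrow> real^2) \<Rightarrow> (real^2) set \<Rightarrow> real set \<Rightarrow> (real \<Rightarrow> real^2) \<Rightarrow> bool" where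
  "seed_curve N W I g \<longleftrightarrow>
     (\<forall>\<tau>\<in>I. g \<tau> \<in> W \<and> (g has_vector_derivative N (g \<tau>)) (at \<tau>))"

text \<open>
  \<open>c\<close> is a characteristic curve starting at \<open>c 0 \<in> W\<close>, staying in \<open>W\<close> until it hits \<open>\<gamma>\<close> at
  parameter \<open>s0\<close>; \<open>s0\<close> is negative if \<open>\<gamma>\<close> is reached against the direction of \<open>N\<^sup>\<bottom>\<close>.
\<close>

definition characteristic_hitting ::
    "(real^2 \<Rightarrow> real^2) \<Rightarrow> (real^2) set \<Rightarrow> (real^2) set \<Rightarrow> (real \<Rightarrow> real^2) \<Rightarrow> real \<Rightarrow> bool" where
  "characteristic_hitting N W \<gamma> c s0 \<longleftrightarrow>
     continuous_on (closed_segment 0 s0) c \<and> c s0 \<in> \<gamma> \<and>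
     (\<forall>s\<in>closed_segment 0 s0 - {s0}. c s \<in> W \<and>
        (c has_vector_derivative perp (N (c s))) (at s within closed_segment 0 s0))"

text \<open>
  \<open>P = (x, y)\<close> and \<open>\<Theta>\<close> solve the characteristic system with initial data on the seed curve
  \<open>g\<close>.  The system involves only \<open>H\<close>, so its solutions extend across \<open>\<gamma>\<close>; the domain \<open>\<Omega>\<close> of
  the solution is an open set of pairs \<open>(\<sigma>, \<tau>)\<close>.
\<close>

definition characteristic_flow ::
    "(real^2 \<Rightarrow> real^2) \<Rightarrow> (real^2 \<Rightarrow> real) \<Rightarrow> (real^2) set \<Rightarrow> real set \<Rightarrow> (real \<Rightarrow> real^2) \<Rightarrow>
     (real \<times> real) set \<Rightarrow> (real \<Rightarrow> real \<Rightarrow> real^2) \<Rightarrow> (real \<Rightarrow> real \<Rightarrow> real) \<Rightarrow> bool" where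
  "characteristic_flow N H U I g \<Omega> P \<Theta> \<longleftrightarrow>
     open \<Omega> \<and>
     (\<forall>\<tau>\<in>I. is_interval {\<sigma>. (\<sigma>, \<tau>) \<in> \<Omega>} \<and> (0, \<tau>) \<in> \<Omega> \<and> P 0 \<tau> = g \<tau> \<and>
        N (g \<tau>) = vector [cos (\<Theta> 0 \<tau>), sin (\<Theta> 0 \<tau>)] \<and>
        (\<forall>\<sigma>. (\<sigma>, \<tau>) \<in> \<Omega> \<longrightarrow> P \<sigma> \<tau> \<in> U \<and>
           ((\<lambda>s. P s \<tau> $ 1) has_real_derivative sin (\<Theta> \<sigma> \<tau>)) (at \<sigma>) \<and>
           ((\<lambda>s. P s \<tau> $ 2) has_real_derivative - cos (\<Theta> \<sigma> \<tau>)) (at \<sigma>) \<and>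
           ((\<lambda>s. \<Theta> s \<tau>) has_real_derivative - H (P \<sigma> \<tau>)) (at \<sigma>))) \<and>
     continuous_on I (\<Theta> 0)"

text \<open>\<open>W\<close> is one of the two regions into which \<open>\<gamma>\<close> divides \<open>U\<close>.\<close>

definition nondegenerate_on_side ::
    "(real^2 \<Rightarrow> real^2) \<Rightarrow> (real^2 \<Rightarrow> real) \<Rightarrow> (real^2) set \<Rightarrow> (real^2) set \<Rightarrow> (real^2) set \<Rightarrow>
     real^2 \<Rightarrow> bool" where
  "nondegenerate_on_side N H U \<gamma> W p0 \<longleftrightarrow>
     (\<exists>a b \<tau>0 g c \<sigma> X \<Omega> P \<Theta>.
        \<tau>0 \<in> {a<..<b} \<and> seed_curve N W {a<..<b} g \<and>
        (\<forall>\<tau>\<in>{a<..<b}. c \<tau> 0 = g \<tau> \<and> characteristic_hitting N W \<gamma> (c \<tau>) (\<sigma> \<tau>) \<and>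
           X \<tau> = c \<tau> (\<sigma> \<tau>)) \<and>
        X \<tau>0 = p0 \<and>
        characteristic_flow N H U {a<..<b} g \<Omega> P \<Theta> \<and>
        (\<forall>\<tau>\<in>{a<..<b}. (\<sigma> \<tau>, \<tau>) \<in> \<Omega> \<and> X \<tau> = P (\<sigma> \<tau>) \<tau>) \<and>
        continuous_on {a<..<b} \<sigma> \<and>
        (\<exists>P\<sigma> P\<tau>. ((\<lambda>s. P s \<tau>0) has_vector_derivative P\<sigma>) (at (\<sigma> \<tau>0)) \<and>
           ((\<lambda>t. P (\<sigma> \<tau>0) t) has_vector_derivative P\<tau>) (at \<tau>0) \<and>
           det (transpose (vector [P\<sigma>, P\<tau>]) :: real^2^2) \<noteq> 0))"

definition nondegenerate_point ::
    "(real^2 \<Rightarrow> real^2) \<Rightarrow> (real^2 \<Rightarrow> real) \<Rightarrow> (real^2) set \<Rightarrow> (real^2) set \<Rightarrow> (real^2) set \<Rightarrow>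
     (real^2) set \<Rightarrow> real^2 \<Rightarrow> bool" where
  "nondegenerate_point N H U \<gamma> Up Um p0 \<longleftrightarrow>
     (\<exists>U'\<subseteq>U. p0 \<in> U' \<and> divides_domain (\<gamma> \<inter> U') U' (Up \<inter> U') (Um \<inter> U') \<and>
        (\<forall>q\<in>\<gamma> \<inter> U'. unique_issuing_characteristic N (Up \<inter> U') q \<and>
                     unique_issuing_characteristic N (Um \<inter> U') q) \<and>
        nondegenerate_on_side N H U' (\<gamma> \<inter> U') (Up \<inter> U') p0 \<and>
        nondegenerate_on_side N H U' (\<gamma> \<inter> U') (Um \<inter> U') p0)"

end

theory Submission
  imports Defs "HOL-Complex_Analysis.Great_Picard"
begin

text \<open>
  Near \<open>p\<^sub>0\<close> the curve is the graph of a \<open>C\<^sup>1\<close> function \<open>f\<close> over its tangent line, in an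
  orthonormal frame \<open>T, \<nu>\<close>.  Blowing up test functions at \<open>p\<^sub>0\<close> in the weak equation gives the jump
  condition \<open>N\<^sub>+ \<bullet> \<nu> = N\<^sub>- \<bullet> \<nu>\<close>, so the two distinct unit vectors have opposite nonzero tangential
  components.  Correct \<open>u\<close> by the potential of the tangential part of \<open>F\<close> along the vertical translates
  of \<open>\<gamma>\<close>.  The corrected function is continuous, and its derivative along these translates has
  opposite signs above and below \<open>\<gamma>\<close>; hence its restriction to \<open>\<gamma>\<close> is both nondecreasing and
  nonincreasing, that is, constant.

  On either side let \<open>D = |\<nabla>u + F|\<close>.  Along a characteristic curve \<open>N \<bullet> \<nu>\<close> satisfies an ordinary
  differential equation with right-hand side \<open>H\<close>, although \<open>N\<close> is merely continuous.  This keeps the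
  horizontal gap between two characteristic curves comparable along their length.  Since
  \<open>\<nabla>u + F\<close> is orthogonal to characteristic curves, its circulation around the region between two of
  them down to \<open>\<gamma>\<close>, where the corrected function is constant, bounds \<open>D\<close> by a multiple of the
  distance to \<open>\<gamma>\<close>.  So \<open>\<nabla>u \<rightarrow> - F\<close> at \<open>\<gamma>\<close> from both sides, and \<open>u\<close> is \<open>C\<^sup>1\<close> across \<open>\<gamma>\<close>.
\<close>

section \<open>Peano existence\<close>

text \<open>Leaves come from Peano's theorem, and uniqueness is recovered afterwards: for two leaves
  the gap \<open>d\<close> and the difference \<open>v\<close> of their normal components obey |v'|
  \<le> L |d| and |d'| \<le> |v| / c^3, so leaves cannot meet. Gaps must be compared only downwards,
  from a given point towards the curve. A gap closing too fast on the way up would vanish within a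
  fixed distance. Non-crossing, together with the fact that leaves continue by a fixed length above
  their starting point, therefore bounds the logarithmic derivative of \<open>d\<close> from below,
  with a constant independent of the distance to the curve. The correction of \<open>u\<close>
  leaves a vertical remainder whose tangential derivative is formally the curl of \<open>F\<close>
  up to sign. Its difference between two leaves is at most a multiple of the gap, so integrating it
  over the height costs gap times height; dividing by the gap at the top gives a bound on
  \<open>D\<close> linear in the height.\<close>

text \<open>Tonelli delay: the right-hand side at time \<open>s\<close> only sees \<open>\<phi>\<close> at times closer to \<open>0\<close>, by \<open>\<delta>\<close> or down to \<open>0\<close>.\<close>

definition delay_op :: "(real \<times> real \<Rightarrow> real) \<Rightarrow> real \<Rightarrow> real \<Rightarrow> real \<Rightarrow> (real \<Rightarrow> real) \<Rightarrow> real \<Rightarrow> real" where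
  "delay_op m R x0 \<delta> \<phi> t = x0 + integral {-R..t} (\<lambda>s. m (\<phi> (s - max (-\<delta>) (min s \<delta>)), s))
     - integral {-R..0} (\<lambda>s. m (\<phi> (s - max (-\<delta>) (min s \<delta>)), s))"

lemma delay_arg:
  fixes s R \<delta> :: real
  assumes "0 < \<delta>" "s \<in> {-R..R}"
  shows "s - max (-\<delta>) (min s \<delta>) \<in> {-R..R}"
    "\<bar>s - max (-\<delta>) (min s \<delta>)\<bar> \<le> max 0 (\<bar>s\<bar> - \<delta>)"
    "\<bar>max (-\<delta>) (min s \<delta>)\<bar> \<le> \<delta>"
  using assms by (auto simp: max_def min_def abs_if)

lemma delay_integrand_cont:
  fixes m :: "real \<times> real \<Rightarrow> real"
  assumes "continuous_on UNIV m" "continuous_on {-R..R} \<phi>" "0 < \<delta>"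
  shows "continuous_on {-R..R} (\<lambda>s. m (\<phi> (s - max (-\<delta>) (min s \<delta>)), s))"
proof -
  have "continuous_on {-R..R} (\<lambda>s. \<phi> (s - max (-\<delta>) (min s \<delta>)))"
    by (rule continuous_on_compose2[OF assms(2)]) (use delay_arg[OF assms(3)] in \<open>auto intro!: continuous_intros\<close>)
  then show ?thesis
    by (intro continuous_on_compose2[OF assms(1)]) (auto intro!: continuous_intros)
qed

lemma integral_diff_Icc:
  fixes f :: "real \<Rightarrow> real"
  assumes "continuous_on {a..b} f" "a \<le> s" "s \<le> t" "t \<le> b"
  shows "integral {a..t} f - integral {a..s} f = integral {s..t} f"
proof -
  have "f integrable_on {a..t}"
    using assms by (intro integrable_continuous_real continuous_on_subset[OF assms(1)]) auto
  from Henstock_Kurzweil_Integration.integral_combine[OF assms(2,3) this]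
  show ?thesis by simp
qed

lemma integral_le_bound:
  fixes f :: "real \<Rightarrow> real"
  assumes "continuous_on {s..t} f" "s \<le> t" "\<And>x. x \<in> {s..t} \<Longrightarrow> \<bar>f x\<bar> \<le> M"
  shows "\<bar>integral {s..t} f\<bar> \<le> M * (t - s)"
  using integral_bound[OF assms(2,1)] assms(3) by simp

lemma lipschitz_integral:
  fixes f :: "real \<Rightarrow> real"
  assumes c: "continuous_on {a..b} f" and "\<And>x. x \<in> {a..b} \<Longrightarrow> \<bar>f x\<bar> \<le> M" "s \<in> {a..b}" "t \<in> {a..b}"
  shows "\<bar>integral {a..t} f - integral {a..s} f\<bar> \<le> M * \<bar>t - s\<bar>"
proof -
  have *: "\<bar>integral {a..v} f - integral {a..u} f\<bar> \<le> M * \<bar>v - u\<bar>"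
    if "u \<in> {a..b}" "v \<in> {a..b}" "u \<le> v" for u v
  proof -
    have "continuous_on {u..v} f" using that by (intro continuous_on_subset[OF c]) auto
    then have "\<bar>integral {u..v} f\<bar> \<le> M * (v - u)"
      using that assms(2) by (intro integral_le_bound) auto
    then show ?thesis using integral_diff_Icc[OF c, of u v] that by simp
  qed
  show ?thesis
  proof (cases "s \<le> t")
    case True then show ?thesis using * assms by blast
  next
    case False
    then have "\<bar>integral {a..s} f - integral {a..t} f\<bar> \<le> M * \<bar>s - t\<bar>" using *[of t s] assms by auto
    then show ?thesis by (simp add: abs_minus_commute)
  qed
qed

lemma delay_op_lipschitz:
  fixes m :: "real \<times> real \<Rightarrow> real"
  assumes "continuous_on UNIV m" "\<And>z. \<bar>m z\<bar> \<le> M" "continuous_on {-R..R} \<phi>" "0 < \<delta>"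
    and "s \<in> {-R..R}" "t \<in> {-R..R}"
  shows "\<bar>delay_op m R x0 \<delta> \<phi> t - delay_op m R x0 \<delta> \<phi> s\<bar> \<le> M * \<bar>t - s\<bar>"
  unfolding delay_op_def
  using lipschitz_integral[OF delay_integrand_cont[OF assms(1,3,4)] assms(2) assms(5,6)] by simp

text \<open>The delay shortens the memory: up to time r + \<delta> the integrand evaluates its
  argument function only at times of modulus at most r. The case split turns the two integrals from
  \<open>-R\<close> into one over the interval between 0 and t.\<close>

lemma delay_op_local:
  fixes m :: "real \<times> real \<Rightarrow> real"
  assumes m: "continuous_on UNIV m" and c: "continuous_on {-R..R} \<phi>" "continuous_on {-R..R} \<psi>" and d: "0 < \<delta>"
    and eq: "\<And>s. s \<in> {-R..R} \<Longrightarrow> \<bar>s\<bar> \<le> r \<Longrightarrow> \<phi> s = \<psi> s" and r: "0 \<le> r"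
    and t: "t \<in> {-R..R}" "\<bar>t\<bar> \<le> r + \<delta>"
  shows "delay_op m R x0 \<delta> \<phi> t = delay_op m R x0 \<delta> \<psi> t"
proof -
  let ?g = "\<lambda>\<phi> s. m (\<phi> (s - max (-\<delta>) (min s \<delta>)), s)"
  have e: "?g \<phi> s = ?g \<psi> s" if "s \<in> {-R..R}" "\<bar>s\<bar> \<le> r + \<delta>" for s
  proof -
    have "\<bar>s - max (-\<delta>) (min s \<delta>)\<bar> \<le> r" using delay_arg(2)[OF d that(1)] that(2) r by linarith
    then show ?thesis using eq delay_arg(1)[OF d that(1)] by metis
  qed
  show ?thesis
  proof (cases "0 \<le> t")
    case True
    have "integral {0..t} (?g \<phi>) = integral {0..t} (?g \<psi>)"
      by (rule Henstock_Kurzweil_Integration.integral_cong) (use e t in auto)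
    then show ?thesis unfolding delay_op_def
      using integral_diff_Icc[OF delay_integrand_cont[OF m c(1) d], of 0 t]
        integral_diff_Icc[OF delay_integrand_cont[OF m c(2) d], of 0 t] t True by simp
  next
    case False
    have "integral {t..0} (?g \<phi>) = integral {t..0} (?g \<psi>)"
      by (rule Henstock_Kurzweil_Integration.integral_cong) (use e t in auto)
    then show ?thesis unfolding delay_op_def
      using integral_diff_Icc[OF delay_integrand_cont[OF m c(1) d], of t 0]
        integral_diff_Icc[OF delay_integrand_cont[OF m c(2) d], of t 0] t False by simp
  qed
qed

text \<open>Iteration from a constant function stabilises: by locality the k-th iterate is already a
  fixed point at times of modulus up to k \<delta>. Finitely many iterations cover {-R..R}, and no
  limit is taken.\<close>

lemma delay_solution:
  fixes m :: "real \<times> real \<Rightarrow> real"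
  assumes m: "continuous_on UNIV m" "\<And>z. \<bar>m z\<bar> \<le> M" and d: "0 < \<delta>" and R: "0 < R"
  shows "\<exists>\<phi>. continuous_on {-R..R} \<phi> \<and> (\<forall>t\<in>{-R..R}. delay_op m R x0 \<delta> \<phi> t = \<phi> t)"
proof -
  define \<xi> where "\<xi> k = (delay_op m R x0 \<delta> ^^ k) (\<lambda>_. x0)" for k
  have \<xi>S: "\<xi> (Suc k) = delay_op m R x0 \<delta> (\<xi> k)" for k by (simp add: \<xi>_def)
  have M: "0 \<le> M" using m(2)[of 0] by linarith
  have cont: "continuous_on {-R..R} (\<xi> k)" for k
  proof (induction k)
    case 0 show ?case by (simp add: \<xi>_def)
  next
    case (Suc k)
    have "M-lipschitz_on {-R..R} (\<xi> (Suc k))"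
      using delay_op_lipschitz[OF m Suc d] M
      unfolding lipschitz_on_def \<xi>S dist_real_def by blast
    then show ?case by (rule lipschitz_on_continuous_on)
  qed
  have eq: "\<xi> (Suc k) t = \<xi> k t" if "t \<in> {-R..R}" "\<bar>t\<bar> \<le> real k * \<delta>" for k t
    using that
  proof (induction k arbitrary: t)
    case 0 then show ?case by (simp add: \<xi>_def delay_op_def)
  next
    case (Suc k)
    show ?case unfolding \<xi>S[of "Suc k"] \<xi>S[of k]
      by (subst \<xi>S[symmetric], rule delay_op_local[where r = "real k * \<delta>"])
        (use Suc m cont d in \<open>auto simp: algebra_simps\<close>)
  qed
  obtain k where "R / \<delta> \<le> real k" using real_arch_simple by blast
  then have k: "R \<le> real k * \<delta>" using d by (simp add: field_simps)
  show ?thesis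
    by (rule exI[of _ "\<xi> k"]) (use cont eq[of _ k] k \<xi>S in force)
qed

text \<open>The delayed solutions share the Lipschitz constant \<open>M\<close> and the value
  \<open>x0\<close> at 0, so Arzela-Ascoli yields a uniformly convergent subsequence. As the delay
  tends to 0, dominated convergence turns the delayed integral equation into the true one.\<close>

lemma peano_centred:
  fixes m :: "real \<times> real \<Rightarrow> real"
  assumes m: "continuous_on UNIV m" and bound: "\<And>z. \<bar>m z\<bar> \<le> M" and R: "0 < R"
  shows "\<exists>\<xi>. \<xi> 0 = x0 \<and> (\<forall>t\<in>{-R<..<R}. (\<xi> has_real_derivative m (\<xi> t, t)) (at t))"
proof -
  define \<delta> where "\<delta> n = 1 / real (Suc n)" for n
  have d: "0 < \<delta> n" for n by (simp add: \<delta>_def)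
  have M: "0 \<le> M" using bound[of 0] by linarith
  obtain F where F: "\<And>n. continuous_on {-R..R} (F n)"
    "\<And>n t. t \<in> {-R..R} \<Longrightarrow> delay_op m R x0 (\<delta> n) (F n) t = F n t"
    using delay_solution[OF m bound d R] by metis
  have lip: "\<bar>F n t - F n s\<bar> \<le> M * \<bar>t - s\<bar>" if "s \<in> {-R..R}" "t \<in> {-R..R}" for n s t
    using delay_op_lipschitz[OF m bound F(1) d that, of x0 n n] F(2) that by simp
  have F0: "F n 0 = x0" for n
    using F(2)[of 0 n] R by (simp add: delay_op_def)
  have bd: "norm (F n t) \<le> \<bar>x0\<bar> + M * R" if "t \<in> {-R..R}" for n t
  proof -
    have "\<bar>F n t - F n 0\<bar> \<le> M * \<bar>t - 0\<bar>" using lip[of 0 t n] that R by auto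
    moreover have "M * \<bar>t - 0\<bar> \<le> M * R" using that M by (intro mult_left_mono) auto
    ultimately show ?thesis using F0 by (auto simp: abs_if split: if_splits)
  qed
  obtain g k where g: "continuous_on {-R..R} g" "strict_mono (k :: nat \<Rightarrow> nat)"
    and conv: "\<And>e. 0 < e \<Longrightarrow> \<exists>N. \<forall>n x. n \<ge> N \<and> x \<in> {-R..R} \<longrightarrow> norm(F (k n) x - g x) < e"
  proof (rule Arzela_Ascoli[of "{-R..R}" F "\<bar>x0\<bar> + M * R"])
    show "\<exists>d>0. \<forall>n y. y \<in> {- R..R} \<and> norm (x - y) < d \<longrightarrow> norm (F n x - F n y) < e"
      if "x \<in> {-R..R}" "0 < e" for x e
    proof (intro exI[of _ "e / (M + 1)"] conjI allI impI)
      show "0 < e / (M + 1)" using that M by simp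
      fix n y assume y: "y \<in> {-R..R} \<and> norm (x - y) < e / (M + 1)"
      have "\<bar>F n x - F n y\<bar> \<le> M * \<bar>x - y\<bar>" using lip[of y x n] that y by auto
      also have "\<dots> \<le> (M + 1) * \<bar>x - y\<bar>" by (intro mult_right_mono) auto
      also have "\<dots> < e" using y M by (simp add: pos_less_divide_eq mult.commute)
      finally show "norm (F n x - F n y) < e" by simp
    qed
  qed (use bd in auto)
  have kd: "(\<lambda>n. \<delta> (k n)) \<longlonglongrightarrow> 0"
    using LIMSEQ_subseq_LIMSEQ[OF LIMSEQ_inverse_real_of_nat g(2)] by (simp add: \<delta>_def inverse_eq_divide o_def)
  have ptw: "(\<lambda>n. F (k n) t) \<longlonglongrightarrow> g t" if "t \<in> {-R..R}" for t
    unfolding LIMSEQ_iff using conv that by meson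
  \<comment> \<open>Equicontinuity absorbs the delay: the shifted time differs from s by at most
    \<open>\<delta> (k n)\<close>, so the values differ by at most M times that.\<close>
  have del: "(\<lambda>n. F (k n) (s - max (-\<delta> (k n)) (min s (\<delta> (k n))))) \<longlonglongrightarrow> g s" if s: "s \<in> {-R..R}" for s
  proof -
    have "(\<lambda>n. F (k n) (s - max (-\<delta> (k n)) (min s (\<delta> (k n)))) - F (k n) s) \<longlonglongrightarrow> 0"
    proof (rule tendsto_0_le[where K = 1 and f = "\<lambda>n. M * \<delta> (k n)"])
      show "(\<lambda>n. M * \<delta> (k n)) \<longlonglongrightarrow> 0" using kd tendsto_mult_right_zero by blast
      show "\<forall>\<^sub>F n in sequentially. norm (F (k n) (s - max (- \<delta> (k n)) (min s (\<delta> (k n)))) - F (k n) s)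
          \<le> norm (M * \<delta> (k n)) * 1"
      proof (rule always_eventually, rule allI)
        fix n
        have "\<bar>F (k n) (s - max (- \<delta> (k n)) (min s (\<delta> (k n)))) - F (k n) s\<bar>
          \<le> M * \<bar>s - max (- \<delta> (k n)) (min s (\<delta> (k n))) - s\<bar>"
          using lip[OF s delay_arg(1)[OF d s]] by simp
        also have "\<dots> \<le> M * \<delta> (k n)"
          using delay_arg(3)[OF d s, of "k n"] M by (intro mult_left_mono) auto
        finally show "norm (F (k n) (s - max (- \<delta> (k n)) (min s (\<delta> (k n)))) - F (k n) s)
          \<le> norm (M * \<delta> (k n)) * 1" by simp
      qed
    qed
    from tendsto_add[OF this ptw[OF s]] show ?thesis by simp
  qed
  have int: "g t = x0 + integral {-R..t} (\<lambda>s. m (g s, s)) - integral {-R..0} (\<lambda>s. m (g s, s))"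
    if t: "t \<in> {-R..R}" for t
  proof -
    have I: "(\<lambda>n. integral {-R..v} (\<lambda>s. m (F (k n) (s - max (-\<delta> (k n)) (min s (\<delta> (k n)))), s)))
        \<longlonglongrightarrow> integral {-R..v} (\<lambda>s. m (g s, s))" if "v \<in> {-R..R}" for v
    proof (rule dominated_convergence(2)[where h = "\<lambda>_. M"])
      show "(\<lambda>s. m (F (k n) (s - max (-\<delta> (k n)) (min s (\<delta> (k n)))), s)) integrable_on {-R..v}" for n
        by (intro integrable_continuous_real continuous_on_subset[OF delay_integrand_cont[OF m F(1) d]])
          (use that in auto)
      show "(\<lambda>n. m (F (k n) (s - max (-\<delta> (k n)) (min s (\<delta> (k n)))), s)) \<longlonglongrightarrow> m (g s, s)" if "s \<in> {-R..v}" for s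
      proof -
        have "isCont m (g s, s)" using m by (simp add: continuous_on_eq_continuous_at)
        moreover have "(\<lambda>n. (F (k n) (s - max (-\<delta> (k n)) (min s (\<delta> (k n)))), s)) \<longlonglongrightarrow> (g s, s)"
          using del[of s] that \<open>v \<in> {-R..R}\<close> by (intro tendsto_intros) auto
        ultimately show ?thesis by (rule isCont_tendsto_compose)
      qed
    qed (use bound in auto)
    have "(\<lambda>n. delay_op m R x0 (\<delta> (k n)) (F (k n)) t) \<longlonglongrightarrow>
        x0 + integral {-R..t} (\<lambda>s. m (g s, s)) - integral {-R..0} (\<lambda>s. m (g s, s))"
      unfolding delay_op_def using t R by (intro tendsto_intros I) auto
    then show ?thesis using F(2)[OF t] ptw[OF t] LIMSEQ_unique by auto
  qed
  have cm: "continuous_on {-R..R} (\<lambda>s. m (g s, s))"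
    by (intro continuous_on_compose2[OF m]) (auto intro!: continuous_intros g)
  show ?thesis
  proof (intro exI[of _ g] conjI ballI)
    show "g 0 = x0" using int[of 0] R by simp
    fix t assume t: "t \<in> {-R<..<R}"
    have "((\<lambda>t. integral {-R..t} (\<lambda>s. m (g s, s))) has_real_derivative m (g t, t)) (at t within {-R..R})"
      by (rule integral_has_real_derivative[OF cm]) (use t in auto)
    then have 1: "((\<lambda>t. integral {-R..t} (\<lambda>s. m (g s, s))) has_real_derivative m (g t, t)) (at t)"
      using t by (simp add: at_within_Icc_at)
    have "((\<lambda>t. x0 + integral {-R..t} (\<lambda>s. m (g s, s)) - integral {-R..0} (\<lambda>s. m (g s, s)))
        has_real_derivative m (g t, t)) (at t)"
      using DERIV_add[OF DERIV_const[of x0] DERIV_diff[OF 1 DERIV_const]] by (simp add: add_diff_eq)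
    then show "(g has_real_derivative m (g t, t)) (at t)"
      by (rule has_field_derivative_transform_within_open[where S = "{-R<..<R}"]) (use t int in auto)
  qed
qed

lemma peano_existence:
  fixes m :: "real \<times> real \<Rightarrow> real"
  assumes m: "continuous_on UNIV m" and bound: "\<And>z. \<bar>m z\<bar> \<le> M" and R: "0 < R"
  shows "\<exists>\<xi>. \<xi> t0 = x0 \<and> (\<forall>t\<in>{t0 - R<..<t0 + R}. (\<xi> has_real_derivative m (\<xi> t, t)) (at t))"
proof -
  let ?m = "\<lambda>z. m (fst z, snd z + t0)"
  have "continuous_on UNIV ?m" by (intro continuous_on_compose2[OF m]) (auto intro!: continuous_intros)
  from peano_centred[OF this bound R, of x0] obtain \<xi> where
    x: "\<xi> 0 = x0" "\<And>t. t \<in> {-R<..<R} \<Longrightarrow> (\<xi> has_real_derivative m (\<xi> t, t + t0)) (at t)" by auto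
  show ?thesis
  proof (intro exI[of _ "\<lambda>t. \<xi> (t - t0)"] conjI ballI)
    fix t assume "t \<in> {t0 - R<..<t0 + R}"
    then have "(\<xi> has_real_derivative m (\<xi> (t - t0), t)) (at (t - t0))" using x(2)[of "t - t0"] by auto
    moreover have "((\<lambda>t. t - t0) has_real_derivative 1) (at t)" by (auto intro!: derivative_eq_intros)
    ultimately have "((\<lambda>t. \<xi> (t - t0)) has_real_derivative m (\<xi> (t - t0), t) * 1) (at t)"
      by (rule DERIV_chain2[where f = \<xi> and g = "\<lambda>t. t - t0"])
    then show "((\<lambda>t. \<xi> (t - t0)) has_real_derivative m (\<xi> (t - t0), t)) (at t)" by simp
  qed (use x in simp)
qed

section \<open>Differential inequalities along leaves\<close>

text \<open>A substitute for uniqueness of leaves. \<open>Z = d^2 + v^2\<close> satisfies |Z'| \<le>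
  (C + L) Z, so by Gronwall in both directions it vanishes everywhere once it vanishes somewhere;
  and at a zero of \<open>d\<close> the two curves meet, which forces \<open>v = 0\<close> as
  well.\<close>

lemma gap_positive:
  fixes d v :: "real \<Rightarrow> real"
  assumes d: "\<And>y. y \<in> {\<alpha><..<\<beta>} \<Longrightarrow> (d has_real_derivative d' y) (at y)"
    and v: "\<And>y. y \<in> {\<alpha><..<\<beta>} \<Longrightarrow> (v has_real_derivative v' y) (at y)"
    and v': "\<And>y. y \<in> {\<alpha><..<\<beta>} \<Longrightarrow> \<bar>v' y\<bar> \<le> L * \<bar>d y\<bar>"
    and d': "\<And>y. y \<in> {\<alpha><..<\<beta>} \<Longrightarrow> \<bar>d' y\<bar> \<le> C * \<bar>v y\<bar>"
    and zero: "\<And>y. y \<in> {\<alpha><..<\<beta>} \<Longrightarrow> d y = 0 \<Longrightarrow> v y = 0"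
    and y0: "y0 \<in> {\<alpha><..<\<beta>}" "0 < d y0" and C: "0 \<le> C" "0 \<le> L"
    and y1: "y1 \<in> {\<alpha><..<\<beta>}"
  shows "0 < d y1"
proof (rule ccontr)
  assume n: "\<not> 0 < d y1"
  have cont: "continuous_on {\<alpha><..<\<beta>} d"
    by (intro continuous_at_imp_continuous_on ballI DERIV_isCont[OF d])
  have "\<exists>z\<in>{\<alpha><..<\<beta>}. d z = 0"
  proof (cases "y0 \<le> y1")
    case True
    moreover have "continuous_on {y0..y1} d" using y0 y1 by (intro continuous_on_subset[OF cont]) auto
    ultimately obtain z where "y0 \<le> z" "z \<le> y1" "d z = 0"
      using IVT2'[of d y1 0 y0] n y0 by auto
    then show ?thesis using y0 y1 by auto
  next
    case False
    moreover have "continuous_on {y1..y0} d" using y0 y1 by (intro continuous_on_subset[OF cont]) auto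
    ultimately obtain z where "y1 \<le> z" "z \<le> y0" "d z = 0"
      using IVT'[of d y1 0 y0] n y0 by auto
    then show ?thesis using y0 y1 by auto
  qed
  then obtain z where z: "z \<in> {\<alpha><..<\<beta>}" "d z = 0" by blast
  define Z where "Z y = (d y)\<^sup>2 + (v y)\<^sup>2" for y
  define Z' where "Z' y = 2 * d y * d' y + 2 * v y * v' y" for y
  define K where "K = C + L"
  have Zd: "(Z has_real_derivative Z' y) (at y)" if "y \<in> {\<alpha><..<\<beta>}" for y
    unfolding Z_def Z'_def by (auto intro!: derivative_eq_intros d v that)
  have Zb: "\<bar>Z' y\<bar> \<le> K * Z y" if "y \<in> {\<alpha><..<\<beta>}" for y
  proof -
    have "\<bar>Z' y\<bar> \<le> 2 * \<bar>d y\<bar> * \<bar>d' y\<bar> + 2 * \<bar>v y\<bar> * \<bar>v' y\<bar>"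
      unfolding Z'_def using abs_triangle_ineq[of "2 * d y * d' y" "2 * v y * v' y"] by (simp add: abs_mult)
    also have "\<dots> \<le> 2 * \<bar>d y\<bar> * (C * \<bar>v y\<bar>) + 2 * \<bar>v y\<bar> * (L * \<bar>d y\<bar>)"
      using v'[OF that] d'[OF that] by (intro add_mono mult_left_mono) auto
    also have "\<dots> = K * (2 * \<bar>d y\<bar> * \<bar>v y\<bar>)" by (simp add: K_def algebra_simps)
    also have "\<dots> \<le> K * Z y"
      using sum_squares_bound[of "\<bar>d y\<bar>" "\<bar>v y\<bar>"] C by (intro mult_left_mono) (auto simp: Z_def K_def)
    finally show ?thesis .
  qed
  have Zz: "Z z = 0" using zero z by (simp add: Z_def)
  have "Z y0 \<le> 0"
  proof (cases "z \<le> y0")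
    case True
    have "Z y0 * exp (- K * y0) \<le> Z z * exp (- K * z)"
    proof (rule DERIV_nonpos_imp_nonincreasing[OF True, where f = "\<lambda>y. Z y * exp (- K * y)"])
      fix y assume "z \<le> y" "y \<le> y0"
      then have y: "y \<in> {\<alpha><..<\<beta>}" using z y0 by auto
      have "((\<lambda>y. Z y * exp (- K * y)) has_real_derivative (Z' y - K * Z y) * exp (- K * y)) (at y)"
        by (auto intro!: derivative_eq_intros Zd y simp: algebra_simps)
      moreover have "(Z' y - K * Z y) * exp (- K * y) \<le> 0"
        using Zb[OF y] by (intro mult_nonpos_nonneg) auto
      ultimately show "\<exists>D. ((\<lambda>y. Z y * exp (- K * y)) has_real_derivative D) (at y) \<and> D \<le> 0" by blast
    qed
    then show ?thesis using Zz by (simp add: mult_le_0_iff)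
  next
    case False
    then have "y0 \<le> z" by simp
    have "Z y0 * exp (K * y0) \<le> Z z * exp (K * z)"
    proof (rule DERIV_nonneg_imp_nondecreasing[OF \<open>y0 \<le> z\<close>, where f = "\<lambda>y. Z y * exp (K * y)"])
      fix y assume "y0 \<le> y" "y \<le> z"
      then have y: "y \<in> {\<alpha><..<\<beta>}" using z y0 by auto
      have "((\<lambda>y. Z y * exp (K * y)) has_real_derivative (Z' y + K * Z y) * exp (K * y)) (at y)"
        by (auto intro!: derivative_eq_intros Zd y simp: algebra_simps)
      moreover have "(Z' y + K * Z y) * exp (K * y) \<ge> 0"
        using Zb[OF y] by (intro mult_nonneg_nonneg) auto
      ultimately show "\<exists>D. ((\<lambda>y. Z y * exp (K * y)) has_real_derivative D) (at y) \<and> D \<ge> 0" by blast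
    qed
    then show ?thesis using Zz by (simp add: mult_le_0_iff)
  qed
  moreover have "0 < (d y0)\<^sup>2" "0 \<le> (v y0)\<^sup>2" using y0 by auto
  ultimately show False unfolding Z_def by linarith
qed

text \<open>If \<open>m = - v y\<close> were larger, \<open>v\<close> would stay below
  \<open>- m / 2\<close> for a further length \<open>R\<close>: while \<open>d\<close> decreases,
  \<open>v\<close> can recover at most L R d(y) < m / 2. Then \<open>d\<close> would lose more than
  R m / 2 > d(y) and become negative, so \<open>2 * L * R\<close> and \<open>2 / R\<close> are
  exactly the two thresholds used.\<close>

lemma gap_slope_bound:
  fixes d v :: "real \<Rightarrow> real"
  assumes d: "\<And>y. y \<in> {\<alpha><..<\<beta>} \<Longrightarrow> (d has_real_derivative d' y) (at y)"
    and v: "\<And>y. y \<in> {\<alpha><..<\<beta>} \<Longrightarrow> (v has_real_derivative v' y) (at y)"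
    and v': "\<And>y. y \<in> {\<alpha><..<\<beta>} \<Longrightarrow> \<bar>v' y\<bar> \<le> L * d y"
    and d': "\<And>y. y \<in> {\<alpha><..<\<beta>} \<Longrightarrow> v y \<le> 0 \<Longrightarrow> d' y \<le> v y"
    and pos: "\<And>y. y \<in> {\<alpha><..<\<beta>} \<Longrightarrow> 0 < d y"
    and R: "0 < R" "0 \<le> L" and y: "\<alpha> < y" "y + R < \<beta>"
  shows "- v y \<le> (2 * L * R + 2 / R) * d y"
proof (rule ccontr)
  assume n: "\<not> - v y \<le> (2 * L * R + 2 / R) * d y"
  define m where "m = - v y"
  have dy: "0 < d y" using pos y R by auto
  have m1: "m > 2 * L * R * d y" and m2: "R * m > 2 * d y"
  proof -
    have "(2 * L * R + 2 / R) * d y = 2 * L * R * d y + 2 / R * d y" by (simp add: algebra_simps)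
    moreover have "0 \<le> 2 * L * R * d y" "0 < 2 / R * d y" using R dy by auto
    ultimately have a: "m > 2 * L * R * d y" "m > 2 / R * d y" using n by (auto simp: m_def)
    then show "m > 2 * L * R * d y" by simp
    have "R * (2 / R * d y) < R * m" using a(2) R by (intro mult_strict_left_mono)
    then show "R * m > 2 * d y" using R by simp
  qed
  have m0: "m > 0" using m1 R dy by (smt (verit) mult_nonneg_nonneg)
  have dec: "d t \<le> d y + (t - y) * (- m / 2)" if t: "y \<le> t" "t \<le> y + R"
      "\<And>s. y \<le> s \<Longrightarrow> s < t \<Longrightarrow> v s < - m / 2" for t
  proof -
    have "d t - (t - y) * (- m / 2) \<le> d y - (y - y) * (- m / 2)"
    proof -
      let ?f = "\<lambda>t. (t - y) * (- m / 2) - d t"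
      have "?f y \<le> ?f t"
      proof (rule DERIV_nonneg_imp_increasing_open[OF t(1)])
        fix s assume s: "y < s" "s < t"
        then have sa: "s \<in> {\<alpha><..<\<beta>}" using y t by auto
        have "v s < - m / 2" using t(3)[of s] s by auto
        then have "d' s \<le> - m / 2" using d'[OF sa] m0 by auto
        moreover have "(?f has_real_derivative (- m / 2 - d' s)) (at s)"
          by (auto intro!: derivative_eq_intros d sa)
        ultimately show "\<exists>D. (?f has_real_derivative D) (at s) \<and> 0 \<le> D" by force
      next
        have "continuous_on {y..t} d"
          using t(2) y by (intro continuous_at_imp_continuous_on ballI DERIV_isCont[OF d]) auto
        then show "continuous_on {y..t} ?f" by (intro continuous_intros)
      qed
      then show ?thesis by simp
    qed
    then show ?thesis by simp
  qed
  have vneg: "v t < - m / 2" if t: "t \<in> {y..y+R}" for t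
  proof (rule ccontr)
    assume nt: "\<not> v t < - m / 2"
    let ?S = "{y..y+R} \<inter> v -` {- m / 2..}"
    have "continuous_on {y..y+R} v"
      using y by (intro continuous_at_imp_continuous_on ballI DERIV_isCont[OF v]) auto
    then have "closed ?S" by (intro continuous_closed_preimage) auto
    then have "compact ?S" using compact_Int_closed[OF compact_Icc, of ?S y "y + R"] by (simp add: Int_assoc[symmetric])
    moreover have "t \<in> ?S" using t nt by auto
    ultimately obtain s where s: "s \<in> ?S" "\<And>r. r \<in> ?S \<Longrightarrow> s \<le> r"
      using compact_attains_inf[of ?S] by blast
    have before: "v r < - m / 2" if "y \<le> r" "r < s" for r
      using s(2)[of r] that s(1) by (force simp: not_less)
    have dle: "d r \<le> d y" if "y \<le> r" "r \<le> s" for r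
    proof -
      have "d r \<le> d y + (r - y) * (- m / 2)" using that s(1) before by (intro dec) auto
      moreover have "(r - y) * (- m / 2) \<le> 0" using that m0 by (intro mult_nonneg_nonpos) auto
      ultimately show ?thesis by linarith
    qed
    have "v s - L * d y * s \<le> v y - L * d y * y"
    proof (rule DERIV_nonpos_imp_nonincreasing[where f = "\<lambda>s. v s - L * d y * s"])
      fix r assume r: "y \<le> r" "r \<le> s"
      then have ra: "r \<in> {\<alpha><..<\<beta>}" using s(1) y by auto
      have "((\<lambda>s. v s - L * d y * s) has_real_derivative v' r - L * d y) (at r)"
        by (auto intro!: derivative_eq_intros v ra)
      moreover have "v' r \<le> L * d y"
        using v'[OF ra] mult_left_mono[OF dle[OF r] R(2)] by linarith
      ultimately show "\<exists>D. ((\<lambda>s. v s - L * d y * s) has_real_derivative D) (at r) \<and> D \<le> 0" by force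
    qed (use s in auto)
    moreover have "L * d y * (s - y) \<le> L * d y * R" using s(1) R dy by (intro mult_left_mono) auto
    ultimately have "v s \<le> - m + L * R * d y" by (simp add: m_def algebra_simps)
    then show False using m1 s(1) by auto
  qed
  have "d (y + R) \<le> d y + (y + R - y) * (- m / 2)"
    using vneg R by (intro dec) auto
  then have "d (y + R) < 0" using m2 by (simp add: algebra_simps)
  then show False using pos[of "y+R"] y R by auto
qed

text \<open>The bound on \<open>- v\<close> makes the logarithmic derivative of \<open>d\<close> at
  least - C (2 L R + 2 / R). Only this lower bound is available, hence the lower gap is estimated by
  the higher one, and the higher point needs a margin \<open>R\<close> below the end of the
  leaves.\<close>

lemma gap_growth:
  fixes d v :: "real \<Rightarrow> real"
  assumes d: "\<And>y. y \<in> {\<alpha><..<\<beta>} \<Longrightarrow> (d has_real_derivative d' y) (at y)"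
    and v: "\<And>y. y \<in> {\<alpha><..<\<beta>} \<Longrightarrow> (v has_real_derivative v' y) (at y)"
    and v': "\<And>y. y \<in> {\<alpha><..<\<beta>} \<Longrightarrow> \<bar>v' y\<bar> \<le> L * \<bar>d y\<bar>"
    and d'1: "\<And>y. y \<in> {\<alpha><..<\<beta>} \<Longrightarrow> 0 \<le> v y \<Longrightarrow> v y \<le> d' y \<and> d' y \<le> C * v y"
    and d'2: "\<And>y. y \<in> {\<alpha><..<\<beta>} \<Longrightarrow> v y \<le> 0 \<Longrightarrow> C * v y \<le> d' y \<and> d' y \<le> v y"
    and zero: "\<And>y. y \<in> {\<alpha><..<\<beta>} \<Longrightarrow> d y = 0 \<Longrightarrow> v y = 0"
    and y0: "y0 \<in> {\<alpha><..<\<beta>}" "0 < d y0" and C: "0 \<le> C" "0 \<le> L" and R: "0 < R"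
    and y: "\<alpha> < y" "y \<le> y'" "y' + R < \<beta>"
  shows "d y \<le> exp (C * (2 * L * R + 2 / R) * (y' - y)) * d y'"
proof -
  define M where "M = 2 * L * R + 2 / R"
  have M: "0 \<le> M" using C R by (simp add: M_def)
  have pos: "0 < d y" if "y \<in> {\<alpha><..<\<beta>}" for y
  proof (rule gap_positive[OF d v v' _ zero y0 C that])
    show "\<bar>d' y\<bar> \<le> C * \<bar>v y\<bar>" if "y \<in> {\<alpha><..<\<beta>}" for y
      using d'1[OF that] d'2[OF that] by (cases "0 \<le> v y") auto
  qed
  have v'': "\<bar>v' y\<bar> \<le> L * d y" if "y \<in> {\<alpha><..<\<beta>}" for y using v'[OF that] pos[OF that] by simp
  have sl: "- v y \<le> M * d y" if "\<alpha> < y" "y + R < \<beta>" for y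
    unfolding M_def by (rule gap_slope_bound[OF d v v'' _ pos R C(2) that]) (use d'2 in auto)
  have "d y * exp (C * M * y) \<le> d y' * exp (C * M * y')"
  proof (rule DERIV_nonneg_imp_nondecreasing[OF y(2), where f = "\<lambda>y. d y * exp (C * M * y)"])
    fix t assume t: "y \<le> t" "t \<le> y'"
    then have ta: "t \<in> {\<alpha><..<\<beta>}" using y R by auto
    have "((\<lambda>y. d y * exp (C * M * y)) has_real_derivative (d' t + C * M * d t) * exp (C * M * t)) (at t)"
      by (auto intro!: derivative_eq_intros d ta simp: algebra_simps)
    moreover have "0 \<le> d' t + C * M * d t"
    proof (cases "0 \<le> v t")
      case True
      then show ?thesis using d'1[OF ta] C M pos[OF ta] by (smt (verit) mult_nonneg_nonneg)
    next
      case False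
      then have "C * v t \<le> d' t" using d'2[OF ta] by auto
      moreover have "C * (- v t) \<le> C * (M * d t)" using sl[of t] t y C by (intro mult_left_mono) auto
      ultimately show ?thesis by (simp add: mult.assoc)
    qed
    ultimately show "\<exists>D. ((\<lambda>y. d y * exp (C * M * y)) has_real_derivative D) (at t) \<and> 0 \<le> D"
      by (meson mult_nonneg_nonneg exp_ge_zero)
  qed
  then have "d y * exp (C * M * y) / exp (C * M * y) \<le> d y' * exp (C * M * y') / exp (C * M * y)"
    by (rule divide_right_mono) simp
  also have "\<dots> = exp (C * M * (y' - y)) * d y'"
    by (simp add: exp_diff right_diff_distrib)
  finally show ?thesis by (simp add: M_def)
qed

text \<open>As a function of \<open>b\<close>, the quotient is \<open>b / sqrt (1 - b^2)\<close>,
  whose derivative is the inverse cube of the root; the root lies between \<open>c\<close> and 1,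
  and the mean value theorem applies.\<close>

lemma slope_comparison:
  fixes a b a' b' c :: real
  assumes c: "0 < c" and a: "c \<le> a" "a\<^sup>2 + b\<^sup>2 = 1" and a': "c \<le> a'" "a'\<^sup>2 + b'\<^sup>2 = 1" and le: "b' \<le> b"
  shows "b - b' \<le> b / a - b' / a'" "b / a - b' / a' \<le> (b - b') / c ^ 3"
proof -
  have as: "a = sqrt (1 - b\<^sup>2)" "a' = sqrt (1 - b'\<^sup>2)"
    using a a' c real_sqrt_unique[of a "1 - b\<^sup>2"] real_sqrt_unique[of a' "1 - b'\<^sup>2"] by auto
  have "\<exists>z>0. b / a - b' / a' = (b - b') * (1 / z ^ 3) \<and> c \<le> z \<and> z \<le> 1" if ne: "b' < b"
  proof -
    let ?g = "\<lambda>w::real. w / sqrt (1 - w\<^sup>2)"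
    have rng: "c\<^sup>2 \<le> 1 - w\<^sup>2" if "b' \<le> w" "w \<le> b" for w
    proof -
      have "w\<^sup>2 \<le> max (b\<^sup>2) (b'\<^sup>2)"
      proof (cases "0 \<le> w")
        case True then show ?thesis using that by (simp add: power_mono le_max_iff_disj)
      next
        case False
        then have "(-w)\<^sup>2 \<le> (-b')\<^sup>2" using that by (intro power_mono) auto
        then show ?thesis by auto
      qed
      moreover have "c\<^sup>2 \<le> a\<^sup>2" "c\<^sup>2 \<le> a'\<^sup>2" using c a a' by (auto intro!: power_mono)
      ultimately show ?thesis using a a' by auto
    qed
    have "\<exists>z>b'. z < b \<and> ?g b - ?g b' = (b - b') * (1 / sqrt (1 - z\<^sup>2) ^ 3)"
    proof (rule MVT2[OF ne])
      fix w assume w: "b' \<le> w" "w \<le> b"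
      have p: "0 < 1 - w\<^sup>2" using rng[OF w] c by (smt (verit) zero_less_power)
      define q where "q = sqrt (1 - w\<^sup>2)"
      have q: "0 < q" "q\<^sup>2 = 1 - w\<^sup>2" using p by (auto simp: q_def)
      have "(?g has_real_derivative (1 * q - w * ((- (2 * w)) * (inverse q / 2))) / (q * q)) (at w)"
        using p q unfolding q_def by (auto intro!: derivative_eq_intros)
      moreover have "(1 * q - w * ((- (2 * w)) * (inverse q / 2))) / (q * q) = 1 / q ^ 3"
      proof -
        have "q + w\<^sup>2 / q = 1 / q" using q by (simp add: field_simps power2_eq_square)
        then show ?thesis using q by (simp add: field_simps power2_eq_square power3_eq_cube)
      qed
      ultimately show "(?g has_real_derivative 1 / sqrt (1 - w\<^sup>2) ^ 3) (at w)" by (simp add: q_def)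
    qed
    then obtain z where z: "b' < z" "z < b" "?g b - ?g b' = (b - b') * (1 / sqrt (1 - z\<^sup>2) ^ 3)" by blast
    have "c\<^sup>2 \<le> 1 - z\<^sup>2" using rng[of z] z by auto
    then have "c \<le> sqrt (1 - z\<^sup>2)" by (rule real_le_rsqrt)
    moreover have "sqrt (1 - z\<^sup>2) \<le> 1" by simp
    ultimately show ?thesis using z as c by (intro exI[of _ "sqrt (1 - z\<^sup>2)"]) (auto simp del: real_sqrt_gt_0_iff)
  qed
  then have *: "b - b' \<le> b / a - b' / a' \<and> b / a - b' / a' \<le> (b - b') / c ^ 3" if ne: "b' < b"
  proof -
    obtain z where z: "0 < z" "b / a - b' / a' = (b - b') * (1 / z ^ 3)" "c \<le> z" "z \<le> 1"
      using \<open>b' < b \<Longrightarrow> \<exists>z>0. b / a - b' / a' = (b - b') * (1 / z ^ 3) \<and> c \<le> z \<and> z \<le> 1\<close> ne by blast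
    have "1 \<le> 1 / z ^ 3" using z by (simp add: power_le_one)
    moreover have "1 / z ^ 3 \<le> 1 / c ^ 3" using z c by (intro divide_left_mono power_mono) auto
    ultimately have "(b - b') * 1 \<le> (b - b') * (1 / z ^ 3)" "(b - b') * (1 / z ^ 3) \<le> (b - b') * (1 / c ^ 3)"
      using ne by (intro mult_left_mono; simp)+
    then show ?thesis using z(2) by simp
  qed
  have "b - b' \<le> b / a - b' / a' \<and> b / a - b' / a' \<le> (b - b') / c ^ 3"
  proof (cases "b' = b")
    case True then show ?thesis using as by simp
  qed (use * le in auto)
  then show "b - b' \<le> b / a - b' / a'" "b / a - b' / a' \<le> (b - b') / c ^ 3" by auto
qed

section \<open>Balance laws and leaves\<close>

text \<open>Continuity is required of the x-derivative alone, the y-derivative needs to exist only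
  at the point. This suits primitives, whose derivative in the variable of integration is continuous
  by construction. The proof exchanges the variables to put the continuous partial second.\<close>

lemma has_derivative_partials_real:
  fixes f :: "real \<Rightarrow> real \<Rightarrow> real" and A :: "real \<times> real \<Rightarrow> real"
  assumes S: "open S" "(x, y) \<in> S"
    and fx: "\<And>z. z \<in> S \<Longrightarrow> ((\<lambda>x. f x (snd z)) has_real_derivative A z) (at (fst z))"
    and cont: "continuous_on S A"
    and fy: "((\<lambda>y. f x y) has_real_derivative B) (at y)"
  shows "((\<lambda>z. f (fst z) (snd z)) has_derivative (\<lambda>v. A (x, y) * fst v + B * snd v)) (at (x, y))"
proof -
  obtain X Y where XY: "open X" "open Y" "(x, y) \<in> X \<times> Y" "X \<times> Y \<subseteq> S"
    using open_prod_elim[OF S] by metis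
  obtain e where e: "e > 0" "ball x e \<subseteq> X" using XY by (auto elim: openE)
  let ?X = "ball x e"
  have sub: "?X \<times> Y \<subseteq> S" using XY e by auto
  have "((\<lambda>(y, x). f x y) has_derivative (\<lambda>(ty, tx). B * ty + blinfun_apply (blinfun_scaleR_left (A (x, y))) tx))
      (at (y, x) within Y \<times> ?X)"
  proof (rule has_derivative_partialsI[where fy = "\<lambda>y x. blinfun_scaleR_left (A (x, y))"])
    show "((\<lambda>y. f x y) has_derivative (*) B) (at y within Y)"
      using fy unfolding has_field_derivative_def by (rule has_derivative_at_withinI)
    show "((\<lambda>x. f x y') has_derivative blinfun_apply (blinfun_scaleR_left (A (x', y')))) (at x' within ?X)"
      if "y' \<in> Y" "x' \<in> ?X" for x' y'
    proof -
      have "((\<lambda>x. f x y') has_real_derivative A (x', y')) (at x')" using fx[of "(x', y')"] subsetD[OF sub, of "(x', y')"] that by auto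
      then show ?thesis unfolding has_field_derivative_def
        by (rule has_derivative_at_withinI[THEN has_derivative_eq_rhs]) (auto simp: mult.commute)
    qed
    have "continuous_on (Y \<times> ?X) (\<lambda>(y, x). A (x, y))"
      unfolding split_beta by (intro continuous_on_compose2[OF cont]) (use sub in \<open>auto intro!: continuous_intros\<close>)
    then have "continuous_on (Y \<times> ?X) (\<lambda>(y, x). blinfun_scaleR_left (A (x, y)) :: real \<Rightarrow>\<^sub>L real)"
      unfolding split_beta by (intro continuous_intros)
    then show "continuous (at (y, x) within Y \<times> ?X) (\<lambda>(y, x). blinfun_scaleR_left (A (x, y)) :: real \<Rightarrow>\<^sub>L real)"
      using XY e by (simp add: continuous_on_eq_continuous_within)
  qed (use e in auto)
  then have "((\<lambda>(y, x). f x y) has_derivative (\<lambda>(ty, tx). B * ty + tx * A (x, y))) (at (y, x))"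
    using XY e by (subst (asm) at_within_open) (auto intro!: open_Times)
  then have 1: "((\<lambda>(y, x). f x y) has_derivative (\<lambda>(ty, tx). B * ty + tx * A (x, y))) (at (snd (x, y), fst (x, y)))"
    by simp
  have 2: "((\<lambda>z. (snd z, fst z)) has_derivative (\<lambda>z. (snd z, fst z))) (at (x, y))"
    by (intro derivative_intros)
  from has_derivative_compose[OF 2, of "\<lambda>(y, x). f x y", simplified, OF 1[simplified]]
  show ?thesis by (simp add: algebra_simps)
qed

lemma chain_two:
  fixes F :: "real \<times> real \<Rightarrow> real"
  assumes F: "(F has_derivative (\<lambda>v. A * fst v + B * snd v)) (at (g t, k t))"
    and g: "(g has_real_derivative p) (at t)" and k: "(k has_real_derivative q) (at t)"
  shows "((\<lambda>t. F (g t, k t)) has_real_derivative A * p + B * q) (at t)"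
proof -
  have "((\<lambda>t. (g t, k t)) has_derivative (\<lambda>x. (p * x, q * x))) (at t)"
    using g k unfolding has_field_derivative_def by (intro has_derivative_Pair)
  from has_derivative_compose[OF this F]
  show ?thesis unfolding has_field_derivative_def by (rule has_derivative_eq_rhs) (auto simp: algebra_simps)
qed

text \<open>The divergence equation \<open>n1_x + n2_y = h\<close> in integral form: outward flux
  through the boundary of each rectangle equals the integral of \<open>h\<close>. It makes sense for
  fields that are merely continuous.\<close>

definition balance_on :: "(real \<times> real) set \<Rightarrow> (real \<times> real \<Rightarrow> real) \<Rightarrow> (real \<times> real \<Rightarrow> real) \<Rightarrow>
    (real \<times> real \<Rightarrow> real) \<Rightarrow> bool" where
  "balance_on S n1 n2 h \<longleftrightarrow> (\<forall>a b c d. a < b \<longrightarrow> c < d \<longrightarrow> {a..b} \<times> {c..d} \<subseteq> S \<longrightarrow>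
     integral {c..d} (\<lambda>y. n1 (b, y) - n1 (a, y)) + integral {a..b} (\<lambda>x. n2 (x, d) - n2 (x, c))
     = integral {c..d} (\<lambda>y. integral {a..b} (\<lambda>x. h (x, y))))"

text \<open>The function is a stream function of \<open>n\<close> corrected for the source. Its
  x-derivative is \<open>n2\<close> by construction; differentiating the balance law in the upper
  edge of the rectangle gives the y-derivative, in which \<open>n1\<close> at the left edge and the
  integral of \<open>h\<close> remain.\<close>

lemma stream_function:
  fixes n1 n2 h :: "real \<times> real \<Rightarrow> real"
  assumes bal: "balance_on S n1 n2 h" and sub: "{a..b} \<times> {c..d} \<subseteq> S"
    and cont: "continuous_on S n1" "continuous_on S n2" "continuous_on S h"
    and x: "x \<in> {a<..<b}" and y: "y \<in> {c<..<d}"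
  shows "((\<lambda>z. integral {a..fst z} (\<lambda>t. n2 (t, snd z))) has_derivative
    (\<lambda>v. n2 (x, y) * fst v + (integral {a..x} (\<lambda>t. h (t, y)) - n1 (x, y) + n1 (a, y)) * snd v)) (at (x, y))"
proof (rule has_derivative_partials_real[where S = "{a<..<b} \<times> {c<..<d}"])
  have cs: "continuous_on T (\<lambda>t. g (p t, q t))"
    if "continuous_on S g" "continuous_on T p" "continuous_on T q" "\<And>t. t \<in> T \<Longrightarrow> (p t, q t) \<in> {a..b} \<times> {c..d}"
    for T :: "'t::topological_space set" and p q and g :: "real \<times> real \<Rightarrow> real"
    using that sub by (intro continuous_on_compose2[OF that(1)]) (auto intro!: continuous_intros)
  show "open ({a<..<b} \<times> {c<..<d})" by (intro open_Times) auto
  show "(x, y) \<in> {a<..<b} \<times> {c<..<d}" using x y by simp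
  show "continuous_on ({a<..<b} \<times> {c<..<d}) n2"
    using sub by (intro continuous_on_subset[OF cont(2)]) auto
  show "((\<lambda>x. integral {a..x} (\<lambda>t. n2 (t, snd z))) has_real_derivative n2 z) (at (fst z))"
    if z: "z \<in> {a<..<b} \<times> {c<..<d}" for z
  proof -
    have "continuous_on {a..b} (\<lambda>t. n2 (t, snd z))"
      using z by (intro cs[OF cont(2)]) (auto intro!: continuous_intros)
    from integral_has_real_derivative[OF this, of "fst z"]
    have "((\<lambda>x. integral {a..x} (\<lambda>t. n2 (t, snd z))) has_real_derivative n2 z) (at (fst z) within {a..b})"
      using z by auto
    then show ?thesis using z by (auto simp: at_within_Icc_at)
  qed
  let ?g = "\<lambda>s. integral {a..x} (\<lambda>t. h (t, s)) - n1 (x, s) + n1 (a, s)"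
  have ch: "continuous_on {c..d} (\<lambda>s. integral {a..x} (\<lambda>t. h (t, s)))"
  proof -
    have "continuous_on ({c..d} \<times> cbox a x) (\<lambda>(s, t). h (t, s))"
      unfolding split_beta by (intro cs[OF cont(3)]) (use x in \<open>auto intro!: continuous_intros\<close>)
    from integral_continuous_on_param[OF this] show ?thesis by simp
  qed
  have cn: "continuous_on {c..d} (\<lambda>s. n1 (x', s))" if "x' \<in> {a..b}" for x'
    by (intro cs[OF cont(1)]) (use that in \<open>auto intro!: continuous_intros\<close>)
  have cg: "continuous_on {c..d} ?g" by (intro continuous_intros ch cn) (use x in auto)
  have "((\<lambda>y. integral {c..y} ?g) has_real_derivative ?g y) (at y within {c..d})"
    by (rule integral_has_real_derivative[OF cg]) (use y in auto)
  then have 1: "((\<lambda>y. integral {a..x} (\<lambda>t. n2 (t, c)) + integral {c..y} ?g) has_real_derivative ?g y) (at y)"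
    using y by (auto simp: at_within_Icc_at intro!: derivative_eq_intros)
  have eq: "integral {a..x} (\<lambda>t. n2 (t, c)) + integral {c..s} ?g = integral {a..x} (\<lambda>t. n2 (t, s))"
    if s: "s \<in> {c<..<d}" for s
  proof -
    have "integral {c..s} (\<lambda>y. n1 (x, y) - n1 (a, y)) + integral {a..x} (\<lambda>t. n2 (t, s) - n2 (t, c))
      = integral {c..s} (\<lambda>y. integral {a..x} (\<lambda>t. h (t, y)))"
    proof -
      have "{a..x} \<times> {c..s} \<subseteq> S" using sub x s by auto
      then show ?thesis using bal x s unfolding balance_on_def by auto
    qed
    moreover have "integral {a..x} (\<lambda>t. n2 (t, s) - n2 (t, c)) = integral {a..x} (\<lambda>t. n2 (t, s)) - integral {a..x} (\<lambda>t. n2 (t, c))"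
      using x s by (intro Henstock_Kurzweil_Integration.integral_diff integrable_continuous_real cs[OF cont(2)])
        (auto intro!: continuous_intros)
    moreover have "integral {c..s} ?g = integral {c..s} (\<lambda>y. integral {a..x} (\<lambda>t. h (t, y)))
        - integral {c..s} (\<lambda>y. n1 (x, y) - n1 (a, y))"
    proof -
      have "integral {c..s} (\<lambda>y. integral {a..x} (\<lambda>t. h (t, y)) - (n1 (x, y) - n1 (a, y)))
        = integral {c..s} (\<lambda>y. integral {a..x} (\<lambda>t. h (t, y))) - integral {c..s} (\<lambda>y. n1 (x, y) - n1 (a, y))"
        using x s by (intro Henstock_Kurzweil_Integration.integral_diff integrable_continuous_real
          continuous_intros continuous_on_subset[OF ch] continuous_on_subset[OF cn]) auto
      then show ?thesis by (simp add: algebra_simps)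
    qed
    ultimately show ?thesis by simp
  qed
  show "((\<lambda>y. integral {a..x} (\<lambda>t. n2 (t, y))) has_real_derivative ?g y) (at y)"
    by (rule has_field_derivative_transform_within_open[OF 1, where S = "{c<..<d}"]) (use y eq in auto)
qed

text \<open>Dafermos' argument: comparing the fluxes of \<open>n\<close> across a leaf and across a horizontal
  translate of it, the Cauchy-Schwarz inequality plays the role of convexity of the flux.\<close>

lemma translate_flux_inequality:
  fixes n1 n2 h :: "real \<times> real \<Rightarrow> real"
  assumes bal: "balance_on S n1 n2 h" and sub: "{a..b} \<times> {c..d} \<subseteq> S"
    and cont: "continuous_on S n1" "continuous_on S n2" "continuous_on S h"
    and unit: "\<And>z. z \<in> S \<Longrightarrow> (n1 z)\<^sup>2 + (n2 z)\<^sup>2 = 1" and pos: "\<And>z. z \<in> S \<Longrightarrow> 0 < n1 z"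
    and leaf: "\<And>y. y \<in> {c<..<d} \<Longrightarrow> (\<xi> has_real_derivative - n2 (\<xi> y, y) / n1 (\<xi> y, y)) (at y)"
    and rng: "\<And>y. y \<in> {c<..<d} \<Longrightarrow> \<xi> y \<in> {a<..<b} \<and> \<xi> y + e \<in> {a<..<b}"
    and h: "\<And>z. z \<in> {a..b} \<times> {c..d} \<Longrightarrow> \<bar>h z - h0\<bar> \<le> \<eta>"
    and y: "c < y1" "y1 \<le> y2" "y2 < d"
  defines "Q \<equiv> \<lambda>y. integral {a..\<xi> y + e} (\<lambda>t. n2 (t, y)) - integral {a..\<xi> y} (\<lambda>t. n2 (t, y))"
  shows "(e * h0 - \<bar>e\<bar> * \<eta>) * (y2 - y1) \<le> Q y2 - Q y1"
proof -
  have "Q y1 - (e * h0 - \<bar>e\<bar> * \<eta>) * y1 \<le> Q y2 - (e * h0 - \<bar>e\<bar> * \<eta>) * y2"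
  proof (rule DERIV_nonneg_imp_nondecreasing[OF y(2), where f = "\<lambda>y. Q y - (e * h0 - \<bar>e\<bar> * \<eta>) * y"])
    fix y assume "y1 \<le> y" "y \<le> y2"
    then have yc: "y \<in> {c<..<d}" using y by auto
    let ?\<Psi> = "\<lambda>z. integral {a..fst z} (\<lambda>t. n2 (t, snd z))"
    let ?G = "\<lambda>x. integral {a..x} (\<lambda>t. h (t, y))"
    let ?m = "- n2 (\<xi> y, y) / n1 (\<xi> y, y)"
    have xe: "((\<lambda>y. \<xi> y + e) has_real_derivative ?m) (at y)"
      using DERIV_add[OF leaf[OF yc] DERIV_const[of e]] by simp
    have id: "((\<lambda>y. y) has_real_derivative 1) (at y)" by (rule DERIV_ident)
    have D1: "((\<lambda>y. ?\<Psi> (\<xi> y + e, y)) has_real_derivative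
        n2 (\<xi> y + e, y) * ?m + (?G (\<xi> y + e) - n1 (\<xi> y + e, y) + n1 (a, y)) * 1) (at y)"
      using rng[OF yc] yc by (intro chain_two[OF _ xe id] stream_function[OF bal sub cont]) auto
    have D2: "((\<lambda>y. ?\<Psi> (\<xi> y, y)) has_real_derivative
        n2 (\<xi> y, y) * ?m + (?G (\<xi> y) - n1 (\<xi> y, y) + n1 (a, y)) * 1) (at y)"
      using rng[OF yc] yc by (intro chain_two[OF _ leaf[OF yc] id] stream_function[OF bal sub cont]) auto
    define p q p' q' where "p = n1 (\<xi> y, y)" and "q = n2 (\<xi> y, y)"
      and "p' = n1 (\<xi> y + e, y)" and "q' = n2 (\<xi> y + e, y)"
    have inS: "(\<xi> y, y) \<in> S" "(\<xi> y + e, y) \<in> S" using rng[OF yc] yc sub by auto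
    have pq: "p\<^sup>2 + q\<^sup>2 = 1" "p'\<^sup>2 + q'\<^sup>2 = 1" "0 < p" using unit pos inS by (auto simp: p_def q_def p'_def q'_def)
    have G: "e * h0 - \<bar>e\<bar> * \<eta> \<le> ?G (\<xi> y + e) - ?G (\<xi> y)"
    proof -
      have Gd: "(?G has_real_derivative h (x, y)) (at x)" if "a < x" "x < b" for x
      proof -
        have "continuous_on {a..b} (\<lambda>t. h (t, y))"
          using sub yc by (intro continuous_on_compose2[OF cont(3)]) (auto intro!: continuous_intros)
        from integral_has_real_derivative[OF this, of x] show ?thesis
          using that by (simp add: at_within_Icc_at)
      qed
      have hb: "\<bar>h (x, y) - h0\<bar> \<le> \<eta>" if "a < x" "x < b" for x using h[of "(x, y)"] that yc by auto
      have r: "a < \<xi> y" "\<xi> y < b" "a < \<xi> y + e" "\<xi> y + e < b" using rng[OF yc] by auto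
      \<comment> \<open>Mean value theorem for \<open>?G\<close>, on the interval to the right or to
        the left of the leaf; the term |e| \<eta> covers both signs of the translation.\<close>
      consider "e = 0" | "e > 0" | "e < 0" by linarith
      then show ?thesis
      proof cases
        case 2
        then obtain z where z: "\<xi> y < z" "z < \<xi> y + e" "?G (\<xi> y + e) - ?G (\<xi> y) = (\<xi> y + e - \<xi> y) * h (z, y)"
          using MVT2[of "\<xi> y" "\<xi> y + e" ?G "\<lambda>x. h (x, y)"] Gd r by auto
        have "e * (h0 - \<eta>) \<le> e * h (z, y)"
        proof (rule mult_left_mono)
          show "h0 - \<eta> \<le> h (z, y)" using hb[of z] z r by linarith
        qed (use 2 in simp)
        then show ?thesis using z 2 by (simp add: algebra_simps)
      next
        case 3
        then obtain z where z: "\<xi> y + e < z" "z < \<xi> y" "?G (\<xi> y) - ?G (\<xi> y + e) = (\<xi> y - (\<xi> y + e)) * h (z, y)"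
          using MVT2[of "\<xi> y + e" "\<xi> y" ?G "\<lambda>x. h (x, y)"] Gd r by auto
        have "e * (h0 + \<eta>) \<le> e * h (z, y)"
        proof (rule mult_left_mono_neg)
          show "h (z, y) \<le> h0 + \<eta>" using hb[of z] z r by linarith
        qed (use 3 in simp)
        then show ?thesis using z 3 by (simp add: algebra_simps)
      qed auto
    qed
    have Qd: "((\<lambda>y. Q y - (e * h0 - \<bar>e\<bar> * \<eta>) * y) has_real_derivative
        (q' * (- q / p) + (?G (\<xi> y + e) - p' + n1 (a, y)) * 1 - (q * (- q / p) + (?G (\<xi> y) - p + n1 (a, y)) * 1)
         - (e * h0 - \<bar>e\<bar> * \<eta>))) (at y)"
    proof -
      have "((\<lambda>y. (e * h0 - \<bar>e\<bar> * \<eta>) * y) has_real_derivative (e * h0 - \<bar>e\<bar> * \<eta>)) (at y)"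
        by (auto intro!: derivative_eq_intros)
      from DERIV_diff[OF DERIV_diff[OF D1 D2] this] show ?thesis
        unfolding Q_def p_def q_def p'_def q'_def by simp
    qed
    \<comment> \<open>Since \<open>(- q / p, 1)\<close> is the direction of the leaf, the flux terms
      combine to (1 - n . n') / p with unit vectors n = (p, q) and n' = (p', q').\<close>
    have CS: "0 \<le> q' * (- q / p) - p' - (q * (- q / p) - p)"
    proof -
      have "2 * (p * p' + q * q') = 2 - (p - p')\<^sup>2 - (q - q')\<^sup>2" using pq by (simp add: power2_diff algebra_simps)
      then have "2 * (p * p' + q * q') \<le> 2 * 1"
        using add_nonneg_nonneg[OF zero_le_power2[of "p - p'"] zero_le_power2[of "q - q'"]] by simp
      then have "p * p' + q * q' \<le> 1" by simp
      moreover have "q' * (- q / p) - p' - (q * (- q / p) - p) = (p\<^sup>2 + q\<^sup>2 - (p * p' + q * q')) / p"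
        using pq(3) by (simp add: field_simps power2_eq_square)
      ultimately show ?thesis using pq by simp
    qed
    show "\<exists>D. ((\<lambda>y. Q y - (e * h0 - \<bar>e\<bar> * \<eta>) * y) has_real_derivative D) (at y) \<and> 0 \<le> D"
    proof (rule exI, rule conjI, rule Qd)
      have *: "0 \<le> A + (G1 - p' + n) * 1 - (A' + (G2 - p + n) * 1) - E"
        if "0 \<le> A - p' - (A' - p)" "E \<le> G1 - G2" for A A' G1 G2 n E :: real
        using that by argo
      show "0 \<le> q' * (- q / p) + (?G (\<xi> y + e) - p' + n1 (a, y)) * 1 - (q * (- q / p) + (?G (\<xi> y) - p + n1 (a, y)) * 1)
         - (e * h0 - \<bar>e\<bar> * \<eta>)"
        by (rule *[OF CS G])
    qed
  qed
  then show ?thesis by (simp add: algebra_simps)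
qed

text \<open>The flux inequality is divided by the width \<open>e\<close> of the strip. As
  \<open>e\<close> tends to 0 from the right it bounds the increments of \<open>n2\<close> along the
  leaf from below by nearly \<open>h\<close>, and from the left, where the division reverses it,
  from above. So \<open>n2\<close> is differentiable along the leaf although \<open>n2\<close>
  itself need not be.\<close>

lemma leaf_balance:
  fixes n1 n2 h :: "real \<times> real \<Rightarrow> real"
  assumes bal: "balance_on S n1 n2 h" and S: "open S" "(\<xi> y0, y0) \<in> S"
    and cont: "continuous_on S n1" "continuous_on S n2" "continuous_on S h"
    and unit: "\<And>z. z \<in> S \<Longrightarrow> (n1 z)\<^sup>2 + (n2 z)\<^sup>2 = 1" and pos: "\<And>z. z \<in> S \<Longrightarrow> 0 < n1 z"
    and y0: "\<alpha> < y0" "y0 < \<beta>"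
    and leaf: "\<And>y. y \<in> {\<alpha><..<\<beta>} \<Longrightarrow> (\<xi> has_real_derivative - n2 (\<xi> y, y) / n1 (\<xi> y, y)) (at y)"
  shows "((\<lambda>y. n2 (\<xi> y, y)) has_real_derivative h (\<xi> y0, y0)) (at y0)"
proof -
  define h0 where "h0 = h (\<xi> y0, y0)"
  have key: "\<exists>\<delta>>0. \<forall>y1 y2. y0 - \<delta> < y1 \<longrightarrow> y1 \<le> y2 \<longrightarrow> y2 < y0 + \<delta> \<longrightarrow>
     \<bar>n2 (\<xi> y2, y2) - n2 (\<xi> y1, y1) - h0 * (y2 - y1)\<bar> \<le> \<eta> * (y2 - y1)" if \<eta>: "\<eta> > 0" for \<eta>
  proof -
    have "isCont h (\<xi> y0, y0)" using cont(3) S by (simp add: continuous_on_eq_continuous_at)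
    then obtain r0 where r0: "r0 > 0" "\<And>z. dist z (\<xi> y0, y0) < r0 \<Longrightarrow> dist (h z) h0 < \<eta>"
      using \<eta> unfolding continuous_at_eps_delta h0_def by metis
    obtain r1 where r1: "r1 > 0" "ball (\<xi> y0, y0) r1 \<subseteq> S" using S by (auto elim: openE)
    \<comment> \<open>The leaf stays within r of its centre, translations are shorter than r, and
      the rectangle has half-width 2 r and half-height at most r. All its points are then within 3 r
      of the centre, safely inside the radius 5 r.\<close>
    define r where "r = min r0 r1 / 5"
    have r: "r > 0" using r0 r1 by (simp add: r_def)
    have isC: "isCont \<xi> y0" using leaf[of y0] y0 by (auto intro: DERIV_isCont)
    then obtain \<delta>0 where \<delta>0: "\<delta>0 > 0" "\<And>y. dist y y0 < \<delta>0 \<Longrightarrow> dist (\<xi> y) (\<xi> y0) < r"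
      using r unfolding continuous_at_eps_delta by metis
    define \<delta> where "\<delta> = Min {\<delta>0, r, y0 - \<alpha>, \<beta> - y0}"
    have \<delta>: "\<delta> > 0" "\<delta> \<le> \<delta>0" "\<delta> \<le> r" "\<delta> \<le> y0 - \<alpha>" "\<delta> \<le> \<beta> - y0" using \<delta>0 r y0 by (auto simp: \<delta>_def)
    define a b c d where "a = \<xi> y0 - 2 * r" and "b = \<xi> y0 + 2 * r" and "c = y0 - \<delta>" and "d = y0 + \<delta>"
    have near: "dist z (\<xi> y0, y0) < 5 * r" if "z \<in> {a..b} \<times> {c..d}" for z
    proof -
      have "dist z (\<xi> y0, y0) \<le> dist (fst z) (\<xi> y0) + dist (snd z) y0"
        unfolding dist_prod_def using sqrt_sum_squares_le_sum[OF zero_le_dist zero_le_dist] by (metis fst_conv snd_conv)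
      also have "\<dots> \<le> 2 * r + r"
        using that \<delta> by (intro add_mono) (auto simp: dist_real_def a_def b_def c_def d_def)
      finally show ?thesis using r by linarith
    qed
    have sub: "{a..b} \<times> {c..d} \<subseteq> S"
    proof
      fix z assume "z \<in> {a..b} \<times> {c..d}"
      then have "dist z (\<xi> y0, y0) < r1" using near[of z] by (simp add: r_def)
      then show "z \<in> S" using r1 by (auto simp: dist_commute)
    qed
    have hb: "\<bar>h z - h0\<bar> \<le> \<eta>" if "z \<in> {a..b} \<times> {c..d}" for z
      using r0(2)[of z] near[OF that] by (simp add: r_def dist_real_def)
    have rng: "\<xi> y \<in> {a<..<b} \<and> \<xi> y + e \<in> {a<..<b}" if "y \<in> {c<..<d}" "\<bar>e\<bar> < r" for y e
    proof -
      have "dist (\<xi> y) (\<xi> y0) < r" using \<delta>0(2)[of y] that \<delta> by (auto simp: c_def d_def dist_real_def)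
      then show ?thesis using that r by (auto simp: a_def b_def dist_real_def)
    qed
    have leaf': "(\<xi> has_real_derivative - n2 (\<xi> y, y) / n1 (\<xi> y, y)) (at y)" if "y \<in> {c<..<d}" for y
      using leaf[of y] that \<delta> by (auto simp: c_def d_def)
    let ?I = "\<lambda>y x. integral {a..x} (\<lambda>t. n2 (t, y))"
    let ?Q = "\<lambda>e y. ?I y (\<xi> y + e) - ?I y (\<xi> y)"
    have lim: "((\<lambda>e. ?Q e y / e) \<longlongrightarrow> n2 (\<xi> y, y)) (at 0)" if y: "y \<in> {c<..<d}" for y
    proof -
      have "continuous_on {a..b} (\<lambda>t. n2 (t, y))"
        using sub y by (intro continuous_on_compose2[OF cont(2)]) (auto intro!: continuous_intros)
      from integral_has_real_derivative[OF this, of "\<xi> y"]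
      have "(?I y has_real_derivative n2 (\<xi> y, y)) (at (\<xi> y))"
        using rng[OF y, of 0] r by (simp add: at_within_Icc_at)
      then show ?thesis unfolding DERIV_def .
    qed
    show ?thesis
    proof (intro exI[of _ \<delta>] conjI allI impI)
      fix y1 y2 assume y: "y0 - \<delta> < y1" "y1 \<le> y2" "y2 < y0 + \<delta>"
      then have yc: "c < y1" "y2 < d" "y1 \<in> {c<..<d}" "y2 \<in> {c<..<d}" by (auto simp: c_def d_def)
      have ineq: "(e * h0 - \<bar>e\<bar> * \<eta>) * (y2 - y1) \<le> ?Q e y2 - ?Q e y1" if "\<bar>e\<bar> < r" for e
        by (rule translate_flux_inequality[OF bal sub cont unit pos leaf' rng[OF _ that] hb yc(1) y(2) yc(2)])
      have L: "((\<lambda>e. (?Q e y2 - ?Q e y1) / e) \<longlongrightarrow> n2 (\<xi> y2, y2) - n2 (\<xi> y1, y1)) (at 0)"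
        using tendsto_diff[OF lim[OF yc(4)] lim[OF yc(3)]] by (simp add: diff_divide_distrib)
      have "(h0 - \<eta>) * (y2 - y1) \<le> n2 (\<xi> y2, y2) - n2 (\<xi> y1, y1)"
      proof (rule tendsto_lowerbound[OF filterlim_at_split[THEN iffD1, OF L, THEN conjunct2]])
        have "\<forall>\<^sub>F e in at_right 0. 0 < e \<and> e < r"
          using r eventually_at_right_real by (simp add: eventually_conj eventually_at_right_less eventually_at_right_field)
        then show "\<forall>\<^sub>F e in at_right 0. (h0 - \<eta>) * (y2 - y1) \<le> (?Q e y2 - ?Q e y1) / e"
        proof eventually_elim
          case (elim e)
          then have "(h0 - \<eta>) * (y2 - y1) * e \<le> ?Q e y2 - ?Q e y1" using ineq[of e] by (simp add: algebra_simps)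
          then show ?case using elim by (simp add: pos_le_divide_eq)
        qed
      qed simp
      moreover have "n2 (\<xi> y2, y2) - n2 (\<xi> y1, y1) \<le> (h0 + \<eta>) * (y2 - y1)"
      proof (rule tendsto_upperbound[OF filterlim_at_split[THEN iffD1, OF L, THEN conjunct1]])
        have "\<forall>\<^sub>F e in at_left 0. - r < e \<and> e < 0"
          using eventually_at_left_real[of "- r" 0] r by (simp add: eventually_at_left_field)
        then show "\<forall>\<^sub>F e in at_left 0. (?Q e y2 - ?Q e y1) / e \<le> (h0 + \<eta>) * (y2 - y1)"
        proof eventually_elim
          case (elim e)
          then have "(h0 + \<eta>) * (y2 - y1) * e \<le> ?Q e y2 - ?Q e y1" using ineq[of e] by (simp add: algebra_simps)
          then show ?case using elim by (simp add: neg_divide_le_eq)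
        qed
      qed simp
      ultimately show "\<bar>n2 (\<xi> y2, y2) - n2 (\<xi> y1, y1) - h0 * (y2 - y1)\<bar> \<le> \<eta> * (y2 - y1)"
        by (simp add: abs_le_iff algebra_simps)
    qed (rule \<delta>)
  qed
  let ?w = "\<lambda>y. n2 (\<xi> y, y)"
  have "((\<lambda>y. (?w y - ?w y0) / (y - y0)) \<longlongrightarrow> h0) (at y0)"
  proof (rule tendstoI)
    fix e :: real assume e: "e > 0"
    then obtain \<delta> where \<delta>: "\<delta> > 0" "\<And>y1 y2. y0 - \<delta> < y1 \<Longrightarrow> y1 \<le> y2 \<Longrightarrow> y2 < y0 + \<delta> \<Longrightarrow>
       \<bar>?w y2 - ?w y1 - h0 * (y2 - y1)\<bar> \<le> (e / 2) * (y2 - y1)" using key[of "e / 2"] by auto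
    have *: "dist ((?w y - ?w y0) / (y - y0)) h0 < e" if y: "y \<noteq> y0" "dist y y0 < \<delta>" for y
    proof -
      have "\<bar>?w y - ?w y0 - h0 * (y - y0)\<bar> \<le> (e / 2) * \<bar>y - y0\<bar>"
      proof (cases "y0 \<le> y")
        case True then show ?thesis using \<delta>(2)[of y0 y] y \<delta>(1) by (simp add: dist_real_def)
      next
        case False
        then have "\<bar>?w y0 - ?w y - h0 * (y0 - y)\<bar> \<le> (e / 2) * (y0 - y)"
          using \<delta>(2)[of y y0] y \<delta>(1) by (auto simp: dist_real_def)
        moreover have "?w y - ?w y0 - h0 * (y - y0) = - (?w y0 - ?w y - h0 * (y0 - y))" by (simp add: algebra_simps)
        ultimately show ?thesis using False by (simp only: abs_minus_cancel) simp
      qed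
      moreover have "(?w y - ?w y0) / (y - y0) - h0 = (?w y - ?w y0 - h0 * (y - y0)) / (y - y0)"
        using y by (simp add: field_simps)
      ultimately have "\<bar>(?w y - ?w y0) / (y - y0) - h0\<bar> \<le> e / 2"
        using y by (simp add: abs_divide divide_le_eq)
      then show ?thesis using e by (simp add: dist_real_def)
    qed
    then show "\<forall>\<^sub>F y in at y0. dist ((?w y - ?w y0) / (y - y0)) h0 < e"
      unfolding eventually_at using \<delta>(1) by blast
  qed
  then show ?thesis unfolding has_field_derivative_iff h0_def .
qed

section \<open>The estimate on one side of the curve\<close>

text \<open>Coordinates: x along the tangent, y along the normal, and \<open>s = y - f x\<close> is
  the height above the curve. \<open>n1\<close>, \<open>n2\<close> are the components of
  \<open>N\<close>, \<open>h\<close> is \<open>H\<close>, \<open>uh\<close> is the corrected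
  function in (x, s), \<open>D\<close> is |\<nabla>u + F|, and \<open>B\<close> is the vertical part
  of \<open>F\<close> that the correction leaves. The bound \<open>c / 2\<close> on
  \<open>f'\<close> against \<open>c \<le> n1\<close> keeps leaves transverse to every vertical
  translate of the curve. The boundary condition is one-sided because only an upper bound of
  increments is wanted. The abstract form serves both sides of the curve.\<close>

locale transverse_side =
  fixes \<rho> \<kappa> c L K :: real and f f' :: "real \<Rightarrow> real" and n1 n2 h uh :: "real \<times> real \<Rightarrow> real"
    and D B :: "real \<Rightarrow> real \<Rightarrow> real"
  assumes params: "0 < \<rho>" "0 < \<kappa>" "0 < c" "0 \<le> L" "0 \<le> K"
    and f_deriv: "\<And>x. \<bar>x\<bar> < \<rho> \<Longrightarrow> (f has_real_derivative f' x) (at x)"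
    and f'_le: "\<And>x. \<bar>x\<bar> < \<rho> \<Longrightarrow> \<bar>f' x\<bar> \<le> c / 2"
    and f_le: "\<And>x. \<bar>x\<bar> < \<rho> \<Longrightarrow> \<bar>f x\<bar> < \<kappa> / 2"
    and n_cont: "continuous_on {z. \<bar>fst z\<bar> < \<rho> \<and> f (fst z) < snd z \<and> snd z < \<kappa>} n1"
      "continuous_on {z. \<bar>fst z\<bar> < \<rho> \<and> f (fst z) < snd z \<and> snd z < \<kappa>} n2"
    and n_unit: "\<And>x y. \<bar>x\<bar> < \<rho> \<Longrightarrow> f x < y \<Longrightarrow> y < \<kappa> \<Longrightarrow> (n1 (x, y))\<^sup>2 + (n2 (x, y))\<^sup>2 = 1"
    and n_ge: "\<And>x y. \<bar>x\<bar> < \<rho> \<Longrightarrow> f x < y \<Longrightarrow> y < \<kappa> \<Longrightarrow> c \<le> n1 (x, y)"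
    and h_cont: "continuous_on {z. \<bar>fst z\<bar> < \<rho> \<and> f (fst z) < snd z \<and> snd z < \<kappa>} h"
    and h_lip: "\<And>x x' y. \<bar>x\<bar> < \<rho> \<Longrightarrow> \<bar>x'\<bar> < \<rho> \<Longrightarrow> f x < y \<Longrightarrow> f x' < y \<Longrightarrow> y < \<kappa> \<Longrightarrow>
        \<bar>h (x, y) - h (x', y)\<bar> \<le> L * \<bar>x - x'\<bar>"
    and balance: "balance_on {z. \<bar>fst z\<bar> < \<rho> \<and> f (fst z) < snd z \<and> snd z < \<kappa>} n1 n2 h"
    and uh_deriv: "\<And>x s. \<bar>x\<bar> < \<rho> \<Longrightarrow> 0 < s \<Longrightarrow> s < \<kappa> / 2 \<Longrightarrow>
        (uh has_derivative (\<lambda>v. (D x s * (n1 (x, f x + s) + n2 (x, f x + s) * f' x)) * fst v +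
          (D x s * n2 (x, f x + s) - B x s) * snd v)) (at (x, s))"
    and D_pos: "\<And>x s. \<bar>x\<bar> < \<rho> \<Longrightarrow> 0 < s \<Longrightarrow> s < \<kappa> / 2 \<Longrightarrow> 0 < D x s"
    and B_lip: "\<And>x x' s. \<bar>x\<bar> < \<rho> \<Longrightarrow> \<bar>x'\<bar> < \<rho> \<Longrightarrow> 0 < s \<Longrightarrow> s < \<kappa> / 2 \<Longrightarrow>
        \<bar>B x s - B x' s\<bar> \<le> K * \<bar>x - x'\<bar>"
    and uh_cont: "continuous_on ({-\<rho><..<\<rho>} \<times> {0..<\<kappa> / 2}) uh"
    and uh_boundary: "\<And>x x'. \<bar>x\<bar> < \<rho> \<Longrightarrow> \<bar>x'\<bar> < \<rho> \<Longrightarrow> x \<le> x' \<Longrightarrow> uh (x', 0) \<le> uh (x, 0)"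
begin

definition "\<Sigma> = {z. \<bar>fst z\<bar> < \<rho> \<and> f (fst z) < snd z \<and> snd z < \<kappa>}"

text \<open>A characteristic curve written as a graph over y: \<open>- n2 / n1\<close> is the slope
  of the direction orthogonal to \<open>(n1, n2)\<close>, and \<open>n1 \<ge> c\<close> makes it
  finite.\<close>

definition leaf :: "(real \<Rightarrow> real) \<Rightarrow> real \<Rightarrow> real \<Rightarrow> bool" where
  "leaf \<xi> \<alpha> \<beta> \<longleftrightarrow> (\<forall>y\<in>{\<alpha><..<\<beta>}. (\<xi> y, y) \<in> \<Sigma> \<and>
     (\<xi> has_real_derivative - n2 (\<xi> y, y) / n1 (\<xi> y, y)) (at y))"

section \<open>The strip above the graph: openness, slopes and Lipschitz bounds\<close>

lemma f_cont: "continuous_on {-\<rho><..<\<rho>} f"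
  by (intro continuous_at_imp_continuous_on ballI DERIV_isCont[OF f_deriv]) auto

lemma open_\<Sigma>: "open \<Sigma>"
proof -
  let ?S = "{-\<rho><..<\<rho>} \<times> {..<\<kappa>}"
  have "continuous_on ?S (\<lambda>z. snd z - f (fst z))"
    by (intro continuous_intros continuous_on_compose2[OF f_cont]) auto
  then have "open (?S \<inter> (\<lambda>z. snd z - f (fst z)) -` {0<..})"
    by (intro continuous_open_preimage) (auto intro!: open_Times)
  also have "?S \<inter> (\<lambda>z. snd z - f (fst z)) -` {0<..} = \<Sigma>" by (auto simp: \<Sigma>_def)
  finally show ?thesis .
qed

lemma n_\<Sigma>: "z \<in> \<Sigma> \<Longrightarrow> (n1 z)\<^sup>2 + (n2 z)\<^sup>2 = 1" "z \<in> \<Sigma> \<Longrightarrow> c \<le> n1 z"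
  using n_unit[of "fst z" "snd z"] n_ge[of "fst z" "snd z"] by (auto simp: \<Sigma>_def)

lemma slope_le: assumes "z \<in> \<Sigma>" shows "\<bar>- n2 z / n1 z\<bar> \<le> 1 / c"
proof -
  have "(n2 z)\<^sup>2 \<le> 1" using n_\<Sigma>(1)[OF assms] zero_le_power2[of "n1 z"] by linarith
  then have "\<bar>n2 z\<bar> \<le> 1" by (simp add: abs_square_le_1)
  then have "\<bar>n2 z\<bar> / \<bar>n1 z\<bar> \<le> 1 / c"
    using n_\<Sigma>(2)[OF assms] params by (intro frac_le) auto
  then show ?thesis by (simp add: abs_divide)
qed

lemma c_le_1: "c \<le> 1"
proof -
  have z: "(0, \<kappa> * 3 / 4) \<in> \<Sigma>" using params f_le[of 0] by (auto simp: \<Sigma>_def)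
  have "c\<^sup>2 \<le> (n1 (0, \<kappa> * 3 / 4))\<^sup>2" using n_\<Sigma>(2)[OF z] params by (intro power_mono) auto
  also have "\<dots> \<le> 1\<^sup>2" using n_\<Sigma>(1)[OF z] zero_le_power2[of "n2 (0, \<kappa> * 3 / 4)"] unfolding one_power2 by linarith
  finally show ?thesis by (rule power2_le_imp_le) simp
qed

lemma f_diff:
  assumes "\<bar>x\<bar> < \<rho>" "\<bar>x'\<bar> < \<rho>"
  shows "\<bar>f x - f x'\<bar> \<le> c / 2 * \<bar>x - x'\<bar>"
proof -
  have "norm (f x - f x') \<le> c / 2 * norm (x - x')"
    by (rule field_differentiable_bound[of "{-\<rho><..<\<rho>}" f f', OF _ has_field_derivative_at_within[OF f_deriv]])
      (use assms f'_le in auto)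
  then show ?thesis by simp
qed

section \<open>Height above the curve along a leaf\<close>

lemma leaf_diff:
  assumes "leaf \<xi> \<alpha> \<beta>" "y \<in> {\<alpha><..<\<beta>}" "y' \<in> {\<alpha><..<\<beta>}"
  shows "\<bar>\<xi> y - \<xi> y'\<bar> \<le> \<bar>y - y'\<bar> / c"
proof -
  have "norm (\<xi> y - \<xi> y') \<le> 1 / c * norm (y - y')"
  proof (rule field_differentiable_bound[of "{\<alpha><..<\<beta>}" \<xi> "\<lambda>y. - n2 (\<xi> y, y) / n1 (\<xi> y, y)"])
    fix z assume z: "z \<in> {\<alpha><..<\<beta>}"
    then have "(\<xi> has_field_derivative - n2 (\<xi> z, z) / n1 (\<xi> z, z)) (at z)"
      using assms(1) unfolding leaf_def by simp
    then show "(\<xi> has_field_derivative - n2 (\<xi> z, z) / n1 (\<xi> z, z)) (at z within {\<alpha><..<\<beta>})"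
      by (rule has_field_derivative_at_within)
    show "norm (- n2 (\<xi> z, z) / n1 (\<xi> z, z)) \<le> 1 / c"
      using slope_le[of "(\<xi> z, z)"] assms z unfolding leaf_def by simp
  qed (use assms in auto)
  then show ?thesis by simp
qed

text \<open>The leaf has slope at most 1 / c and the graph slope at most c / 2, so their product
  takes at most 1 / 2 away from the unit growth of y. This is what fixes the bound on
  \<open>f'\<close> in the locale.\<close>

lemma leaf_level_deriv:
  assumes "leaf \<xi> \<alpha> \<beta>" "y \<in> {\<alpha><..<\<beta>}"
  shows "((\<lambda>y. y - f (\<xi> y)) has_real_derivative 1 - f' (\<xi> y) * (- n2 (\<xi> y, y) / n1 (\<xi> y, y))) (at y)"
    and "1 / 2 \<le> 1 - f' (\<xi> y) * (- n2 (\<xi> y, y) / n1 (\<xi> y, y))"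
proof -
  have \<xi>: "(\<xi> y, y) \<in> \<Sigma>" "(\<xi> has_real_derivative - n2 (\<xi> y, y) / n1 (\<xi> y, y)) (at y)"
    using assms by (auto simp: leaf_def)
  then have x: "\<bar>\<xi> y\<bar> < \<rho>" by (simp add: \<Sigma>_def)
  show "((\<lambda>y. y - f (\<xi> y)) has_real_derivative 1 - f' (\<xi> y) * (- n2 (\<xi> y, y) / n1 (\<xi> y, y))) (at y)"
    using DERIV_diff[OF DERIV_ident DERIV_chain2[OF f_deriv[OF x] \<xi>(2)]] .
  have "\<bar>f' (\<xi> y) * (- n2 (\<xi> y, y) / n1 (\<xi> y, y))\<bar> \<le> c / 2 * (1 / c)"
    unfolding abs_mult by (intro mult_mono f'_le x slope_le \<xi>(1)) (use params in auto)
  also have "\<dots> = 1 / 2" using params by simp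
  finally show "1 / 2 \<le> 1 - f' (\<xi> y) * (- n2 (\<xi> y, y) / n1 (\<xi> y, y))" by linarith
qed

lemma leaf_level_increasing:
  assumes "leaf \<xi> \<alpha> \<beta>" "y \<in> {\<alpha><..<\<beta>}" "y' \<in> {\<alpha><..<\<beta>}" "y \<le> y'"
  shows "(y' - y) / 2 \<le> (y' - f (\<xi> y')) - (y - f (\<xi> y))"
proof -
  have "(y - f (\<xi> y)) - y / 2 \<le> (y' - f (\<xi> y')) - y' / 2"
  proof (rule DERIV_nonneg_imp_nondecreasing[OF assms(4), where f = "\<lambda>y. (y - f (\<xi> y)) - y / 2"])
    fix t assume "y \<le> t" "t \<le> y'"
    then have t: "t \<in> {\<alpha><..<\<beta>}" using assms by auto
    have "((\<lambda>y. (y - f (\<xi> y)) - y / 2) has_real_derivative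
        1 - f' (\<xi> t) * (- n2 (\<xi> t, t) / n1 (\<xi> t, t)) - 1 / 2) (at t)"
      by (rule DERIV_diff[OF leaf_level_deriv(1)[OF assms(1) t]]) (auto intro!: derivative_eq_intros)
    moreover have "0 \<le> 1 - f' (\<xi> t) * (- n2 (\<xi> t, t) / n1 (\<xi> t, t)) - 1 / 2"
      using leaf_level_deriv(2)[OF assms(1) t] by (simp only: le_diff_eq add_0)
    ultimately show "\<exists>D. ((\<lambda>y. (y - f (\<xi> y)) - y / 2) has_real_derivative D) (at t) \<and> 0 \<le> D" by blast
  qed
  then show ?thesis by (simp add: field_simps)
qed

text \<open>The circulation is compared level by level, so the leaf is reparametrised by its height
  above the curve. The height grows at rate at least 1 / 2; hence its inverse is Lipschitz with
  constant 2, in particular continuous, and the inverse function rule applies.\<close>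

lemma leaf_level_inverse:
  assumes lf: "leaf \<xi> \<alpha> \<beta>" and ab: "\<alpha> < a" "a \<le> b" "b < \<beta>"
  shows "\<exists>Y. Y (a - f (\<xi> a)) = a \<and> Y (b - f (\<xi> b)) = b \<and>
    (\<forall>s\<in>{a - f (\<xi> a)..b - f (\<xi> b)}. Y s \<in> {a..b} \<and> Y s - f (\<xi> (Y s)) = s \<and>
      (Y has_real_derivative 1 / (1 - f' (\<xi> (Y s)) * (- n2 (\<xi> (Y s), Y s) / n1 (\<xi> (Y s), Y s)))) (at s))"
proof -
  define S where "S y = y - f (\<xi> y)" for y
  define S' where "S' y = 1 - f' (\<xi> y) * (- n2 (\<xi> y, y) / n1 (\<xi> y, y))" for y
  have Sd: "(S has_real_derivative S' y) (at y)" "1 / 2 \<le> S' y" if "y \<in> {\<alpha><..<\<beta>}" for y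
    using leaf_level_deriv[OF lf that] by (auto simp: S_def[abs_def] S'_def)
  have Sinc: "(y' - y) / 2 \<le> S y' - S y" if "y \<in> {\<alpha><..<\<beta>}" "y' \<in> {\<alpha><..<\<beta>}" "y \<le> y'" for y y'
    using leaf_level_increasing[OF lf that] by (simp add: S_def)
  have inj: "inj_on S {\<alpha><..<\<beta>}"
  proof (rule inj_onI)
    fix y y' assume y: "y \<in> {\<alpha><..<\<beta>}" "y' \<in> {\<alpha><..<\<beta>}" "S y = S y'"
    show "y = y'"
    proof (cases "y \<le> y'")
      case True then show ?thesis using Sinc[OF y(1,2) True] y(3) by simp
    next
      case False
      then have "y' \<le> y" by simp
      then show ?thesis using Sinc[OF y(2,1)] y(3) by simp
    qed
  qed
  define Y where "Y = the_inv_into {\<alpha><..<\<beta>} S"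
  have YS: "Y (S y) = y" if "y \<in> {\<alpha><..<\<beta>}" for y using the_inv_into_f_f[OF inj that] by (simp add: Y_def)
  have contS: "continuous_on {\<alpha><..<\<beta>} S" by (intro continuous_at_imp_continuous_on ballI DERIV_isCont[OF Sd(1)])
  have surj: "Y s \<in> {p..q} \<and> S (Y s) = s" if pq: "\<alpha> < p" "p \<le> q" "q < \<beta>" and s: "s \<in> {S p..S q}" for p q s
  proof -
    have "continuous_on {p..q} S" using pq by (intro continuous_on_subset[OF contS]) auto
    moreover have "S p \<le> s" "s \<le> S q" using s by auto
    ultimately obtain y where y: "p \<le> y" "y \<le> q" "S y = s" using IVT'[of S p s q] pq(2) by blast
    have "Y s = y" using YS[of y] pq y by auto
    then show ?thesis using y by auto
  qed
  obtain a' where a': "\<alpha> < a'" "a' < a" using dense ab by blast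
  obtain b' where b': "b < b'" "b' < \<beta>" using dense ab by blast
  have Sa: "S a' < S a" "S b < S b'" "S a \<le> S b" using Sinc[of a' a] Sinc[of b b'] Sinc[of a b] a' b' ab by (simp_all)
  have Yd: "(Y has_real_derivative 1 / S' (Y s)) (at s)" if s: "s \<in> {S a..S b}" for s
  proof -
    have r: "S a' < s" "s < S b'" using s Sa by auto
    have "Y s \<in> {a..b}" using surj[OF ab s] by blast
    then have Ys: "Y s \<in> {\<alpha><..<\<beta>}" using ab by auto
    have lip: "\<bar>Y t - Y s\<bar> \<le> 2 * \<bar>t - s\<bar>" if "t \<in> {S a'..S b'}" for t
    proof -
      have "Y t \<in> {a'..b'} \<and> S (Y t) = t" by (rule surj) (use that a' b' ab in auto)
      moreover have "S (Y s) = s" using surj[OF ab s] by blast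
      ultimately have t: "Y t \<in> {\<alpha><..<\<beta>}" "S (Y t) = t" "S (Y s) = s" using a' b' by auto
      show ?thesis
      proof (cases "Y s \<le> Y t")
        case True then show ?thesis using Sinc[OF Ys t(1) True] unfolding t(2,3) abs_if by argo
      next
        case False
        then have "Y t \<le> Y s" by simp
        then show ?thesis using Sinc[OF t(1) Ys \<open>Y t \<le> Y s\<close>] unfolding t(2,3) abs_if by argo
      qed
    qed
    have isC: "isCont Y s"
      unfolding continuous_at_eps_delta
    proof (intro allI impI)
      fix e :: real assume e: "0 < e"
      let ?d = "min (e / 2) (min (s - S a') (S b' - s))"
      have "\<forall>t. dist t s < ?d \<longrightarrow> dist (Y t) (Y s) < e"
      proof (intro allI impI)
        fix t assume "dist t s < ?d"
        then have t: "t \<in> {S a'..S b'}" "\<bar>t - s\<bar> < e / 2" by (auto simp: dist_real_def)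
        then show "dist (Y t) (Y s) < e" using lip[OF t(1)] by (simp add: dist_real_def)
      qed
      moreover have "0 < ?d" using e r by simp
      ultimately show "\<exists>d>0. \<forall>t. dist t s < d \<longrightarrow> dist (Y t) (Y s) < e" by blast
    qed
    have "(Y has_real_derivative inverse (S' (Y s))) (at s)"
    proof (rule DERIV_inverse_function[OF Sd(1)[OF Ys] _ r(1) r(2) _ isC])
      show "S' (Y s) \<noteq> 0" using Sd(2)[OF Ys] by linarith
      fix t assume "S a' < t" "t < S b'"
      then have "Y t \<in> {a'..b'} \<and> S (Y t) = t" by (intro surj) (use a' b' ab in auto)
      then show "S (Y t) = t" by blast
    qed
    then show ?thesis by (simp add: inverse_eq_divide)
  qed
  show ?thesis
  proof (intro exI[of _ Y] conjI ballI)
    show "Y (a - f (\<xi> a)) = a" "Y (b - f (\<xi> b)) = b" using YS[of a] YS[of b] ab by (auto simp: S_def)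
    fix s assume "s \<in> {a - f (\<xi> a)..b - f (\<xi> b)}"
    then have s: "s \<in> {S a..S b}" by (simp add: S_def)
    show "Y s \<in> {a..b}" "Y s - f (\<xi> (Y s)) = s" using surj[OF ab s] by (auto simp: S_def)
    show "(Y has_real_derivative 1 / (1 - f' (\<xi> (Y s)) * (- n2 (\<xi> (Y s), Y s) / n1 (\<xi> (Y s), Y s)))) (at s)"
      using Yd[OF s] by (simp add: S'_def)
  qed
qed

text \<open>Clamping points into the strip extends the slope to a bounded continuous field on the
  plane, to which Peano's theorem applies. \<open>R\<close> is so small that clamping stays inactive
  until the height has dropped to \<eta> / 2: horizontally the solution drifts by at most 4 R / c
  \<le> \<rho> / 2, and vertically it stays below 7 \<kappa> / 8.\<close>

lemma leaf_exists:
  fixes R :: real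
  defines "R \<equiv> min (\<rho> * c / 8) (\<kappa> / 16)"
  assumes x: "\<bar>x0\<bar> < R" and \<eta>: "0 < \<eta>" "\<eta> < s" "s < R"
  shows "\<exists>\<xi> \<alpha> a. \<alpha> < a \<and> a \<le> f x0 + s \<and> leaf \<xi> \<alpha> (f x0 + s + 4 * R) \<and> \<xi> (f x0 + s) = x0 \<and> a - f (\<xi> a) = \<eta> \<and>
    (\<forall>y\<in>{\<alpha><..<f x0 + s + 4 * R}. \<bar>\<xi> y\<bar> \<le> 3 * \<rho> / 4)"
proof -
  have R: "0 < R" "R \<le> \<rho> * c / 8" "R \<le> \<kappa> / 16" using params by (auto simp: R_def)
  have R2: "R \<le> \<rho> / 8" "4 * R / c \<le> \<rho> / 2"
  proof -
    have "\<rho> * c / 8 \<le> \<rho> * 1 / 8" using c_le_1 params by (intro divide_right_mono mult_left_mono) auto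
    then show "R \<le> \<rho> / 8" using R by simp
    show "4 * R / c \<le> \<rho> / 2" using R params by (simp add: field_simps)
  qed
  have x0: "\<bar>x0\<bar> < \<rho>" using x R2 params by linarith
  define y0 where "y0 = f x0 + s"
  define cl where "cl x = max (- (3 * \<rho> / 4)) (min x (3 * \<rho> / 4))" for x
  have clb: "\<bar>cl x\<bar> \<le> 3 * \<rho> / 4" for x using params by (auto simp: cl_def)
  have clb': "\<bar>cl x\<bar> < \<rho>" for x using params by (intro le_less_trans[OF clb]) simp
  \<comment> \<open>The retraction into the strip: x is cut at 3 \<rho> / 4, y from above at 7
    \<kappa> / 8 and from below at height \<eta> / 2. The two cuts on y do not conflict, since f +
    \<eta> / 2 lies below 7 \<kappa> / 8.\<close>
  define P where "P z = (cl (fst z), max (min (snd z) (7 * \<kappa> / 8)) (f (cl (fst z)) + \<eta> / 2))" for z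
  have P\<Sigma>: "P z \<in> \<Sigma>" for z
    using clb'[of "fst z"] f_le[OF clb', of "fst z"] \<eta> R params by (auto simp: P_def \<Sigma>_def)
  define m where "m z = - n2 (P z) / n1 (P z)" for z
  have contcl: "continuous_on UNIV (\<lambda>z::real \<times> real. cl (fst z))"
    unfolding cl_def by (intro continuous_intros)
  have contf: "continuous_on UNIV (\<lambda>z::real \<times> real. f (cl (fst z)))"
    by (rule continuous_on_compose2[OF f_cont contcl]) (use clb' in \<open>simp add: image_subset_iff abs_less_iff minus_less_iff\<close>)
  have contP: "continuous_on UNIV P"
    unfolding P_def by (intro continuous_intros contcl contf)
  have contnP: "continuous_on UNIV (\<lambda>z. n1 (P z))" "continuous_on UNIV (\<lambda>z. n2 (P z))"
    by (rule continuous_on_compose2[OF n_cont(1)[folded \<Sigma>_def] contP], use P\<Sigma> in blast,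
        rule continuous_on_compose2[OF n_cont(2)[folded \<Sigma>_def] contP], use P\<Sigma> in blast)
  have nz: "n1 (P z) \<noteq> 0" for z using n_\<Sigma>(2)[OF P\<Sigma>[of z]] params by linarith
  have contm: "continuous_on UNIV m"
    unfolding m_def by (intro continuous_on_divide continuous_on_minus contnP ballI nz)
  have mb: "\<bar>m z\<bar> \<le> 1 / c" for z unfolding m_def by (rule slope_le[OF P\<Sigma>])
  have R4: "0 < 4 * R" using R by simp
  have "\<exists>\<xi>. \<xi> y0 = x0 \<and> (\<forall>t\<in>{y0 - 4 * R<..<y0 + 4 * R}. (\<xi> has_real_derivative m (\<xi> t, t)) (at t))"
    by (rule peano_existence[OF contm mb R4])
  then obtain \<xi> where \<xi>0: "\<xi> y0 = x0 \<and> (\<forall>t\<in>{y0 - 4 * R<..<y0 + 4 * R}. (\<xi> has_real_derivative m (\<xi> t, t)) (at t))" ..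
  note \<xi> = \<xi>0[THEN conjunct1] \<xi>0[THEN conjunct2, THEN bspec]
  let ?I = "{y0 - 4 * R<..<y0 + 4 * R}"
  have \<xi>b: "\<bar>\<xi> y\<bar> \<le> 3 * \<rho> / 4" if "y \<in> ?I" for y
  proof -
    have "norm (\<xi> y - \<xi> y0) \<le> 1 / c * norm (y - y0)"
      by (rule field_differentiable_bound[of ?I \<xi> "\<lambda>t. m (\<xi> t, t)", OF _ has_field_derivative_at_within[OF \<xi>(2)]])
        (use that R mb in auto)
    also have "\<dots> \<le> 1 / c * (4 * R)" using that params by (intro mult_left_mono) auto
    finally have "\<bar>\<xi> y - x0\<bar> \<le> \<rho> / 2" using R2 \<xi> by simp
    then show ?thesis using x R2 by linarith
  qed
  then have cl\<xi>: "cl (\<xi> y) = \<xi> y" if "y \<in> ?I" for y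
    using \<xi>b[OF that] unfolding cl_def max_def min_def abs_le_iff by auto
  have \<xi>\<rho>: "\<bar>\<xi> y\<bar> < \<rho>" if "y \<in> ?I" for y using clb'[of "\<xi> y"] cl\<xi>[OF that] by simp
  have y\<kappa>: "y \<le> 7 * \<kappa> / 8" if "y \<in> ?I" for y
    using that f_le[OF x0] \<eta> R by (auto simp: y0_def)
  define S where "S y = y - f (\<xi> y)" for y
  have Sd: "\<exists>D. (S has_real_derivative D) (at y) \<and> 1 / 2 \<le> D" if "y \<in> ?I" for y
  proof -
    have "\<bar>f' (\<xi> y) * m (\<xi> y, y)\<bar> \<le> c / 2 * (1 / c)"
      unfolding abs_mult by (intro mult_mono f'_le mb \<xi>\<rho> that) (use params in auto)
    then have "1 / 2 \<le> 1 - f' (\<xi> y) * m (\<xi> y, y)" using params by simp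
    moreover have "(S has_real_derivative 1 - f' (\<xi> y) * m (\<xi> y, y)) (at y)"
      unfolding S_def[abs_def] using DERIV_diff[OF DERIV_ident DERIV_chain2[OF f_deriv[OF \<xi>\<rho>[OF that]] \<xi>(2)[OF that]]] .
    ultimately show ?thesis by blast
  qed
  have Sinc: "(y' - y) / 2 \<le> S y' - S y" if "y \<in> ?I" "y' \<in> ?I" "y \<le> y'" for y y'
  proof -
    have "S y - y / 2 \<le> S y' - y' / 2"
    proof (rule DERIV_nonneg_imp_nondecreasing[OF that(3), where f = "\<lambda>y. S y - y / 2"])
      fix t assume "y \<le> t" "t \<le> y'"
      then have "t \<in> ?I" using that by auto
      from Sd[OF this] obtain D where D: "(S has_real_derivative D) (at t)" "1 / 2 \<le> D" by blast
      have "((\<lambda>y. S y - y / 2) has_real_derivative D - 1 / 2) (at t)"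
        by (rule DERIV_diff[OF D(1)]) (auto intro!: derivative_eq_intros)
      moreover have "0 \<le> D - 1 / 2" using D(2) by simp
      ultimately show "\<exists>D. ((\<lambda>y. S y - y / 2) has_real_derivative D) (at t) \<and> 0 \<le> D" by blast
    qed
    then show ?thesis by (simp add: field_simps)
  qed
  have contS: "continuous_on ?I S" using Sd by (intro continuous_at_imp_continuous_on ballI) (metis DERIV_isCont)
  have Sy0: "S y0 = s" using \<xi> by (simp add: S_def y0_def)
  \<comment> \<open>The height changes at rate at least 1 / 2, so a descent by 3 R from a height s <
    R ends below the curve; every level in between is therefore attained.\<close>
  have low: "S (y0 - 3 * R) < 0"
  proof -
    have "(y0 - (y0 - 3 * R)) / 2 \<le> S y0 - S (y0 - 3 * R)" by (rule Sinc) (use R in auto)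
    then show ?thesis using R Sy0 \<eta> by (simp add: field_simps)
  qed
  have level: "\<exists>y. y0 - 3 * R \<le> y \<and> y \<le> y0 \<and> S y = t" if "0 < t" "t \<le> s" for t
  proof -
    have "continuous_on {y0 - 3 * R..y0} S" using R by (intro continuous_on_subset[OF contS]) auto
    then show ?thesis using IVT'[of S "y0 - 3 * R" t y0] low that Sy0 R by (simp add: conj_assoc)
  qed
  \<comment> \<open>The leaf is continued down to level \<eta> / 2, so that the point
    \<open>a\<close> at level \<eta> is interior to it.\<close>
  obtain \<alpha> where \<alpha>: "y0 - 3 * R \<le> \<alpha>" "\<alpha> \<le> y0" "S \<alpha> = \<eta> / 2" using level[of "\<eta> / 2"] \<eta> by auto
  obtain a where a: "y0 - 3 * R \<le> a" "a \<le> y0" "S a = \<eta>" using level[of \<eta>] \<eta> by auto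
  have in_I: "y \<in> ?I" if "y \<in> {\<alpha><..<y0 + 4 * R}" for y using that \<alpha> R by auto
  have "\<alpha> < a"
  proof (rule ccontr)
    assume "\<not> \<alpha> < a"
    then have "(\<alpha> - a) / 2 \<le> S \<alpha> - S a" by (intro Sinc) (use R a \<alpha> in auto)
    then show False using a \<alpha> \<eta> \<open>\<not> \<alpha> < a\<close> by argo
  qed
  moreover have "leaf \<xi> \<alpha> (y0 + 4 * R)"
    unfolding leaf_def
  proof (intro ballI conjI)
    fix y assume y: "y \<in> {\<alpha><..<y0 + 4 * R}"
    note yI = in_I[OF y]
    have "(y - \<alpha>) / 2 \<le> S y - S \<alpha>" by (rule Sinc) (use y \<alpha> R in auto)
    then have "S y > \<eta> / 2" using y \<alpha> by (simp add: field_simps)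
    then have P: "P (\<xi> y, y) = (\<xi> y, y)" using cl\<xi>[OF yI] y\<kappa>[OF yI] by (auto simp: P_def S_def)
    show "(\<xi> y, y) \<in> \<Sigma>" using P\<Sigma>[of "(\<xi> y, y)"] P by simp
    show "(\<xi> has_real_derivative - n2 (\<xi> y, y) / n1 (\<xi> y, y)) (at y)"
      using \<xi>(2)[OF yI] P by (simp add: m_def)
  qed
  moreover have "\<forall>y\<in>{\<alpha><..<y0 + 4 * R}. \<bar>\<xi> y\<bar> \<le> 3 * \<rho> / 4" using \<xi>b in_I by blast
  ultimately show ?thesis
    using a \<xi>(1) unfolding y0_def S_def by blast
qed

text \<open>Along each leaf \<open>n2\<close> has derivative \<open>h\<close>, so the difference
  \<open>?v\<close> satisfies |v'| \<le> L |d|, and the slope comparison places \<open>d'\<close>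
  between \<open>v\<close> and v / c^3. The difference is taken as first minus second leaf because
  the slope \<open>- n2 / n1\<close> decreases in \<open>n2\<close>. Where the leaves meet, both
  values of \<open>n2\<close> are taken at the same point.\<close>

lemma leaf_gap:
  assumes l1: "leaf \<xi>1 \<alpha> \<beta>" and l2: "leaf \<xi>2 \<alpha> \<beta>" and y0: "y0 \<in> {\<alpha><..<\<beta>}" "\<xi>1 y0 < \<xi>2 y0"
    and R: "0 < R" and y: "\<alpha> < y" "y \<le> y'" "y' + R < \<beta>"
  shows "0 < \<xi>2 y - \<xi>1 y"
    "\<xi>2 y - \<xi>1 y \<le> exp (1 / c ^ 3 * (2 * L * R + 2 / R) * (y' - y)) * (\<xi>2 y' - \<xi>1 y')"
proof -
  define w where "w \<xi> y = n2 (\<xi> y, y)" for \<xi> :: "real \<Rightarrow> real" and y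
  define p where "p \<xi> y = n1 (\<xi> y, y)" for \<xi> :: "real \<Rightarrow> real" and y
  have in\<Sigma>: "(\<xi>1 y, y) \<in> \<Sigma>" "(\<xi>2 y, y) \<in> \<Sigma>" if "y \<in> {\<alpha><..<\<beta>}" for y
    using l1 l2 that by (auto simp: leaf_def)
  have pw: "c \<le> p \<xi>1 y" "(p \<xi>1 y)\<^sup>2 + (w \<xi>1 y)\<^sup>2 = 1" "c \<le> p \<xi>2 y" "(p \<xi>2 y)\<^sup>2 + (w \<xi>2 y)\<^sup>2 = 1"
    if "y \<in> {\<alpha><..<\<beta>}" for y
    using in\<Sigma>[OF that] n_\<Sigma> by (auto simp: p_def w_def)
  have xd: "(\<xi> has_real_derivative - w \<xi> y / p \<xi> y) (at y)" if "leaf \<xi> \<alpha> \<beta>" "y \<in> {\<alpha><..<\<beta>}" for \<xi> y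
    using that by (auto simp: leaf_def w_def p_def)
  have wd: "(w \<xi> has_real_derivative h (\<xi> y, y)) (at y)" if lf: "leaf \<xi> \<alpha> \<beta>" and "y \<in> {\<alpha><..<\<beta>}" for \<xi> y
    unfolding w_def[abs_def]
  proof (rule leaf_balance[OF balance[folded \<Sigma>_def] open_\<Sigma> _ n_cont[folded \<Sigma>_def] h_cont[folded \<Sigma>_def] n_\<Sigma>(1)])
    show "(\<xi> y, y) \<in> \<Sigma>" using that by (auto simp: leaf_def)
    show "0 < n1 z" if "z \<in> \<Sigma>" for z using n_\<Sigma>(2)[OF that] params by linarith
    show "\<alpha> < y" "y < \<beta>" using that by auto
    show "(\<xi> has_real_derivative - n2 (\<xi> y, y) / n1 (\<xi> y, y)) (at y)" if "y \<in> {\<alpha><..<\<beta>}" for y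
      using lf that by (auto simp: leaf_def)
  qed
  let ?d = "\<lambda>y. \<xi>2 y - \<xi>1 y" and ?v = "\<lambda>y. w \<xi>1 y - w \<xi>2 y"
  let ?d' = "\<lambda>y. - w \<xi>2 y / p \<xi>2 y - (- w \<xi>1 y / p \<xi>1 y)" and ?v' = "\<lambda>y. h (\<xi>1 y, y) - h (\<xi>2 y, y)"
  have d: "(?d has_real_derivative ?d' y) (at y)" if "y \<in> {\<alpha><..<\<beta>}" for y
    by (intro DERIV_diff xd l1 l2 that)
  have v: "(?v has_real_derivative ?v' y) (at y)" if "y \<in> {\<alpha><..<\<beta>}" for y
    by (intro DERIV_diff wd l1 l2 that)
  have v': "\<bar>?v' y\<bar> \<le> L * \<bar>?d y\<bar>" if "y \<in> {\<alpha><..<\<beta>}" for y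
    using h_lip[of "\<xi>1 y" "\<xi>2 y" y] in\<Sigma>[OF that] by (auto simp: \<Sigma>_def abs_minus_commute)
  have d1: "?v y \<le> ?d' y \<and> ?d' y \<le> 1 / c ^ 3 * ?v y" if y: "y \<in> {\<alpha><..<\<beta>}" "0 \<le> ?v y" for y
    using slope_comparison[OF params(3) pw(1,2)[OF y(1)] pw(3,4)[OF y(1)]] y by (simp add: divide_inverse mult.commute)
  have d2: "1 / c ^ 3 * ?v y \<le> ?d' y \<and> ?d' y \<le> ?v y" if y: "y \<in> {\<alpha><..<\<beta>}" "?v y \<le> 0" for y
  proof -
    have "w \<xi>2 y - w \<xi>1 y \<le> - ?d' y" "- ?d' y \<le> (w \<xi>2 y - w \<xi>1 y) / c ^ 3"
      using slope_comparison[OF params(3) pw(3,4)[OF y(1)] pw(1,2)[OF y(1)]] y by auto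
    moreover have "(w \<xi>2 y - w \<xi>1 y) / c ^ 3 = - (1 / c ^ 3 * ?v y)" by (simp add: field_simps diff_divide_distrib)
    ultimately show ?thesis by linarith
  qed
  have zero: "?v y = 0" if "?d y = 0" for y using that by (simp add: w_def)
  have y0': "0 < ?d y0" using y0 by simp
  have C: "0 \<le> 1 / c ^ 3" using params by simp
  show "?d y \<le> exp (1 / c ^ 3 * (2 * L * R + 2 / R) * (y' - y)) * ?d y'"
    by (rule gap_growth[OF d v v' d1 d2 zero y0(1) y0' C params(4) R y])
  show "0 < ?d y"
  proof (rule gap_positive[OF d v v' _ zero y0(1) y0' C params(4)])
    show "y \<in> {\<alpha><..<\<beta>}" using y R by auto
    fix y assume y: "y \<in> {\<alpha><..<\<beta>}"
    have *: "\<bar>p\<bar> \<le> C * \<bar>q\<bar>" if "0 \<le> q \<Longrightarrow> q \<le> p \<and> p \<le> C * q" "q \<le> 0 \<Longrightarrow> C * q \<le> p \<and> p \<le> q" for C p q :: real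
      using that by (cases "0 \<le> q") auto
    show "\<bar>?d' y\<bar> \<le> 1 / c ^ 3 * \<bar>?v y\<bar>" by (rule *[OF d1[OF y] d2[OF y]])
  qed
qed

text \<open>Gaps are controlled at equal y, the circulation at equal height above the curve. Two
  points on one level differ in y by at most c / 2 times their horizontal distance, and a leaf of
  slope at most 1 / c converts this into at most half of that distance. The larger ordinate is used
  because leaves are known to continue upwards.\<close>

lemma level_gap:
  assumes l1: "leaf \<xi>1 \<alpha>1 \<beta>1" and l2: "leaf \<xi>2 \<alpha>2 \<beta>2"
    and Y: "y1 \<in> {\<alpha>1<..<\<beta>1}" "y2 \<in> {\<alpha>2<..<\<beta>2}" "max y1 y2 < \<beta>1" "max y1 y2 < \<beta>2"
    and s: "y1 - f (\<xi>1 y1) = y2 - f (\<xi>2 y2)"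
  shows "\<bar>(\<xi>2 (max y1 y2) - \<xi>1 (max y1 y2)) - (\<xi>2 y2 - \<xi>1 y1)\<bar> \<le> \<bar>\<xi>2 y2 - \<xi>1 y1\<bar> / 2"
proof -
  have x: "\<bar>\<xi>1 y1\<bar> < \<rho>" "\<bar>\<xi>2 y2\<bar> < \<rho>" using l1 l2 Y by (auto simp: leaf_def \<Sigma>_def)
  have "\<bar>y1 - y2\<bar> = \<bar>f (\<xi>2 y2) - f (\<xi>1 y1)\<bar>" using s by (simp add: abs_if algebra_simps)
  also have "\<dots> \<le> c / 2 * \<bar>\<xi>2 y2 - \<xi>1 y1\<bar>" by (rule f_diff[OF x(2,1)])
  finally have "\<bar>y1 - y2\<bar> / c \<le> c / 2 * \<bar>\<xi>2 y2 - \<xi>1 y1\<bar> / c" using params by (intro divide_right_mono) auto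
  then have yy: "\<bar>y1 - y2\<bar> / c \<le> \<bar>\<xi>2 y2 - \<xi>1 y1\<bar> / 2" using params by simp
  show ?thesis
  proof (cases "y2 \<le> y1")
    case True
    have "\<bar>\<xi>2 y1 - \<xi>2 y2\<bar> \<le> \<bar>y1 - y2\<bar> / c" by (rule leaf_diff[OF l2]) (use True Y in auto)
    from order_trans[OF this yy] show ?thesis using True by (simp add: max_absorb1)
  next
    case False
    then have "y1 \<le> y2" by simp
    have "\<bar>\<xi>1 y1 - \<xi>1 y2\<bar> \<le> \<bar>y1 - y2\<bar> / c" by (rule leaf_diff[OF l1]) (use False Y in auto)
    from order_trans[OF this yy] show ?thesis using \<open>y1 \<le> y2\<close> by (simp add: max_absorb2)
  qed
qed

text \<open>\<nabla>u + F is \<open>D\<close> times the normal and the leaf is orthogonal to the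
  normal, so \<open>D\<close> cancels. The corrected function sees only the vertical remainder
  \<open>B\<close>. In the proof \<open>e\<close> is the derivative of y with respect to the
  height.\<close>

lemma uh_along_leaf:
  assumes lf: "leaf \<xi> \<alpha> \<beta>" and Y: "Y s \<in> {\<alpha><..<\<beta>}" "Y s - f (\<xi> (Y s)) = s" and s: "0 < s" "s < \<kappa> / 2"
    and Yd: "(Y has_real_derivative 1 / (1 - f' (\<xi> (Y s)) * (- n2 (\<xi> (Y s), Y s) / n1 (\<xi> (Y s), Y s)))) (at s)"
  shows "((\<lambda>s. uh (\<xi> (Y s), s)) has_real_derivative - B (\<xi> (Y s)) s) (at s)"
proof -
  define x p q m e where "x = \<xi> (Y s)" and "p = n1 (x, Y s)" and "q = n2 (x, Y s)" and "m = - q / p"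
    and "e = 1 / (1 - f' x * m)"
  have \<xi>: "(x, Y s) \<in> \<Sigma>" "(\<xi> has_real_derivative m) (at (Y s))"
    using lf Y by (auto simp: leaf_def x_def p_def q_def m_def)
  have p: "p > 0" using n_\<Sigma>(2)[OF \<xi>(1)] params unfolding p_def by linarith
  have x: "\<bar>x\<bar> < \<rho>" "f x + s = Y s" using \<xi>(1) Y(2) by (auto simp: \<Sigma>_def x_def)
  have Y': "(Y has_real_derivative e) (at s)" using Yd by (simp add: e_def m_def p_def q_def x_def)
  have X: "((\<lambda>s. \<xi> (Y s)) has_real_derivative m * e) (at s)" by (rule DERIV_chain2[OF \<xi>(2) Y'])
  have "1 / 2 \<le> 1 - f' x * m" using leaf_level_deriv(2)[OF lf Y(1)] by (simp add: m_def p_def q_def x_def)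
  then have e: "(1 - f' x * m) * e = 1" by (simp add: e_def)
  have "((\<lambda>s. uh (\<xi> (Y s), s)) has_real_derivative
      (D x s * (p + q * f' x)) * (m * e) + (D x s * q - B x s) * 1) (at s)"
    by (rule chain_two[OF _ X DERIV_ident]) (use uh_deriv[OF x(1) s] x(2) in \<open>simp add: x_def p_def q_def\<close>)
  moreover have "(D x s * (p + q * f' x)) * (m * e) + (D x s * q - B x s) * 1 = - B x s"
  proof -
    have pm: "p * m = - q" using p by (simp add: m_def)
    have "(D x s * (p + q * f' x)) * (m * e) = D x s * e * (p * m + q * (f' x * m))" by (simp add: algebra_simps)
    also have "\<dots> = D x s * - q * ((1 - f' x * m) * e)" unfolding pm by (simp add: algebra_simps)
    finally show ?thesis unfolding e by simp
  qed
  ultimately have "((\<lambda>s. uh (\<xi> (Y s), s)) has_real_derivative - B x s) (at s)" by (simp only:)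
  then show ?thesis unfolding x_def .
qed

definition "R = min (\<rho> * c / 8) (\<kappa> / 16)"
text \<open>The factor of the gap estimate for a descent of length 2 R: the height falls at rate at
  least 1 / 2 and starts below \<open>R\<close>.\<close>

definition "growth = exp (1 / c ^ 3 * (2 * L * R + 2 / R) * (2 * R))"

section \<open>Circulation between two leaves and the bound on D\<close>

lemma R_bounds: "0 < R" "R \<le> \<kappa> / 16" "R < \<rho>"
proof -
  show "0 < R" "R \<le> \<kappa> / 16" using params by (auto simp: R_def)
  have "\<rho> * c / 8 \<le> \<rho> * 1 / 8" using c_le_1 params by (intro divide_right_mono mult_left_mono) auto
  also have "\<dots> < \<rho>" using params by simp
  finally show "R < \<rho>" by (simp add: R_def min_less_iff_disj)
qed

text \<open>The derivative of the level increment between two leaves is a difference of values of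
  \<open>B\<close>, at most \<open>K\<close> times the gap. The factor 3 is 2 times 3 / 2, from
  passing between equal level and equal y at the two ends. The strip stops at height \<eta> > 0,
  where the leaves still exist; the bound 3 \<rho> / 4 keeps their feet in a compact set independent
  of \<eta>.\<close>

lemma level_strip:
  assumes x: "\<bar>x1\<bar> < R" "\<bar>x2\<bar> < R" "x1 < x2" and \<eta>: "0 < \<eta>" "\<eta> < s" "s < R"
  shows "\<exists>p q. p \<le> q \<and> \<bar>p\<bar> \<le> 3 * \<rho> / 4 \<and> \<bar>q\<bar> \<le> 3 * \<rho> / 4 \<and>
    uh (x2, s) - uh (x1, s) \<le> uh (q, \<eta>) - uh (p, \<eta>) + K * (3 * growth * (x2 - x1)) * s"
proof -
  note R = R_bounds
  have s\<kappa>: "s < \<kappa> / 2" using \<eta> R params by linarith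
  have x\<rho>: "\<bar>x1\<bar> < \<rho>" "\<bar>x2\<bar> < \<rho>" using x R by auto
  obtain \<xi>1 \<alpha>1 a1 where L1: "\<alpha>1 < a1" "a1 \<le> f x1 + s" "leaf \<xi>1 \<alpha>1 (f x1 + s + 4 * R)" "\<xi>1 (f x1 + s) = x1"
      "a1 - f (\<xi>1 a1) = \<eta>" "\<forall>y\<in>{\<alpha>1<..<f x1 + s + 4 * R}. \<bar>\<xi>1 y\<bar> \<le> 3 * \<rho> / 4"
    using leaf_exists[of x1, folded R_def, OF x(1) \<eta>] by blast
  obtain \<xi>2 \<alpha>2 a2 where L2: "\<alpha>2 < a2" "a2 \<le> f x2 + s" "leaf \<xi>2 \<alpha>2 (f x2 + s + 4 * R)" "\<xi>2 (f x2 + s) = x2"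
      "a2 - f (\<xi>2 a2) = \<eta>" "\<forall>y\<in>{\<alpha>2<..<f x2 + s + 4 * R}. \<bar>\<xi>2 y\<bar> \<le> 3 * \<rho> / 4"
    using leaf_exists[of x2, folded R_def, OF x(2) \<eta>] by blast
  define b1 b2 \<beta>1 \<beta>2 where "b1 = f x1 + s" and "b2 = f x2 + s" and "\<beta>1 = b1 + 4 * R" and "\<beta>2 = b2 + 4 * R"
  have lf: "leaf \<xi>1 \<alpha>1 \<beta>1" "leaf \<xi>2 \<alpha>2 \<beta>2" using L1 L2 by (auto simp: b1_def b2_def \<beta>1_def \<beta>2_def)
  have b\<beta>: "b1 < \<beta>1" "b2 < \<beta>2" using R by (auto simp: \<beta>1_def \<beta>2_def)
  have ab: "\<alpha>1 < a1" "a1 \<le> b1" "\<alpha>2 < a2" "a2 \<le> b2" using L1 L2 by (auto simp: b1_def b2_def)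
  have lev: "b1 - f (\<xi>1 b1) = s" "b2 - f (\<xi>2 b2) = s" using L1 L2 by (auto simp: b1_def b2_def)
  obtain Y1 where Y1: "Y1 \<eta> = a1" "Y1 s = b1" "\<And>t. t \<in> {\<eta>..s} \<Longrightarrow> Y1 t \<in> {a1..b1} \<and> Y1 t - f (\<xi>1 (Y1 t)) = t \<and>
      (Y1 has_real_derivative 1 / (1 - f' (\<xi>1 (Y1 t)) * (- n2 (\<xi>1 (Y1 t), Y1 t) / n1 (\<xi>1 (Y1 t), Y1 t)))) (at t)"
    using leaf_level_inverse[OF lf(1) ab(1,2) b\<beta>(1)] unfolding lev L1(5) by blast
  obtain Y2 where Y2: "Y2 \<eta> = a2" "Y2 s = b2" "\<And>t. t \<in> {\<eta>..s} \<Longrightarrow> Y2 t \<in> {a2..b2} \<and> Y2 t - f (\<xi>2 (Y2 t)) = t \<and>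
      (Y2 has_real_derivative 1 / (1 - f' (\<xi>2 (Y2 t)) * (- n2 (\<xi>2 (Y2 t), Y2 t) / n1 (\<xi>2 (Y2 t), Y2 t)))) (at t)"
    using leaf_level_inverse[OF lf(2) ab(3,4) b\<beta>(2)] unfolding lev L2(5) by blast
  have in1: "Y1 t \<in> {\<alpha>1<..<\<beta>1}" and in2: "Y2 t \<in> {\<alpha>2<..<\<beta>2}" if "t \<in> {\<eta>..s}" for t
    using Y1(3)[OF that] Y2(3)[OF that] ab b\<beta> by auto
  define X1 X2 where "X1 t = \<xi>1 (Y1 t)" and "X2 t = \<xi>2 (Y2 t)" for t
  define \<alpha> \<beta> where "\<alpha> = max \<alpha>1 \<alpha>2" and "\<beta> = min \<beta>1 \<beta>2"
  define y where "y t = max (Y1 t) (Y2 t)" for t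
  \<comment> \<open>The starting ordinates differ by at most \<open>R\<close> and each leaf
    continues 4 R beyond its own. Both therefore exist up to more than \<open>R\<close> above the
    higher one, which is the margin the gap estimate consumes.\<close>
  have bb: "\<bar>b1 - b2\<bar> \<le> R"
  proof -
    have "\<bar>f x1 - f x2\<bar> \<le> c / 2 * \<bar>x1 - x2\<bar>" by (rule f_diff[OF x\<rho>])
    also have "\<dots> \<le> 1 / 2 * \<bar>x1 - x2\<bar>" using c_le_1 by (intro mult_right_mono) auto
    also have "\<dots> \<le> R" using x by simp
    finally show ?thesis by (simp add: b1_def b2_def)
  qed
  have top: "max b1 b2 + R < \<beta>" using bb R by (auto simp: \<beta>_def \<beta>1_def \<beta>2_def)
  have yb: "y t \<le> max b1 b2" "\<alpha> < y t" if "t \<in> {\<eta>..s}" for t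
    using Y1(3)[OF that] Y2(3)[OF that] ab by (auto simp: y_def \<alpha>_def)
  have ys: "y s = max b1 b2" by (simp add: y_def Y1 Y2)
  have lf': "leaf \<xi>1 \<alpha> \<beta>" "leaf \<xi>2 \<alpha> \<beta>" using lf by (auto simp: leaf_def \<alpha>_def \<beta>_def)
  have gap: "\<bar>(\<xi>2 (y t) - \<xi>1 (y t)) - (X2 t - X1 t)\<bar> \<le> \<bar>X2 t - X1 t\<bar> / 2" if t: "t \<in> {\<eta>..s}" for t
    unfolding y_def X1_def X2_def
    by (rule level_gap[OF lf in1[OF t] in2[OF t]])
      (use yb(1)[OF t] top R Y1(3)[OF t] Y2(3)[OF t] in \<open>auto simp: y_def \<beta>_def\<close>)
  have sI: "s \<in> {\<eta>..s}" using \<eta> by simp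
  have Xs: "X1 s = x1" "X2 s = x2" using L1 L2 by (auto simp: X1_def X2_def Y1 Y2 b1_def b2_def)
  have ds: "\<xi>1 (y s) < \<xi>2 (y s)" "\<xi>2 (y s) - \<xi>1 (y s) \<le> 3 / 2 * (x2 - x1)"
    using gap[OF sI] x(3) unfolding Xs abs_if by argo+
  have ysI: "y s \<in> {\<alpha><..<\<beta>}" using yb[OF sI] top R by auto
  have yt: "y t \<le> y s" "y s - y t \<le> 2 * R" if t: "t \<in> {\<eta>..s}" for t
  proof -
    show "y t \<le> y s" using yb(1)[OF t] ys by simp
    have "(b1 - Y1 t) / 2 \<le> (b1 - f (\<xi>1 b1)) - (Y1 t - f (\<xi>1 (Y1 t)))"
      by (rule leaf_level_increasing[OF lf(1) in1[OF t]]) (use in1[OF sI] Y1 Y1(3)[OF t] in auto)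
    moreover have "(b2 - Y2 t) / 2 \<le> (b2 - f (\<xi>2 b2)) - (Y2 t - f (\<xi>2 (Y2 t)))"
      by (rule leaf_level_increasing[OF lf(2) in2[OF t]]) (use in2[OF sI] Y2 Y2(3)[OF t] in auto)
    ultimately have "b1 - Y1 t \<le> 2 * R" "b2 - Y2 t \<le> 2 * R"
      using lev Y1(3)[OF t] Y2(3)[OF t] \<eta> t by (auto simp: field_simps)
    then show "y s - y t \<le> 2 * R" unfolding y_def Y1(2) Y2(2) by (auto simp: max_def)
  qed
  have X: "0 < X2 t - X1 t" "X2 t - X1 t \<le> 3 * growth * (x2 - x1)" if t: "t \<in> {\<eta>..s}" for t
  proof -
    have ytR: "y s + R < \<beta>" using ys top by simp
    note g = leaf_gap[OF lf' ysI ds(1) R(1) yb(2)[OF t] yt(1)[OF t] ytR]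
    show "0 < X2 t - X1 t" using g(1) gap[OF t] unfolding abs_if by argo
    then have "X2 t - X1 t \<le> 2 * (\<xi>2 (y t) - \<xi>1 (y t))" using gap[OF t] unfolding abs_if by argo
    also have "\<dots> \<le> 2 * (exp (1 / c ^ 3 * (2 * L * R + 2 / R) * (y s - y t)) * (\<xi>2 (y s) - \<xi>1 (y s)))"
      using g(2) by simp
    also have "\<dots> \<le> 2 * (growth * (3 / 2 * (x2 - x1)))"
    proof -
      have "exp (1 / c ^ 3 * (2 * L * R + 2 / R) * (y s - y t)) \<le> growth"
        unfolding growth_def exp_le_cancel_iff using params R by (intro mult_left_mono yt(2)[OF t]) auto
      then show ?thesis using ds by (intro mult_left_mono mult_mono) (auto simp: growth_def)
    qed
    also have "\<dots> = 3 * growth * (x2 - x1)" by simp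
    finally show "X2 t - X1 t \<le> 3 * growth * (x2 - x1)" .
  qed
  \<comment> \<open>\<open>E\<close> is the increment of \<open>uh\<close> between the two leaves at
    level t, and \<open>?M\<close> bounds its derivative on the whole strip.\<close>
  define E where "E t = uh (X2 t, t) - uh (X1 t, t)" for t
  let ?M = "K * (3 * growth * (x2 - x1))"
  have g0: "0 \<le> ?M" using x(3) params by (intro mult_nonneg_nonneg) (auto simp: growth_def)
  have "E s - ?M * s \<le> E \<eta> - ?M * \<eta>"
  proof (rule DERIV_nonpos_imp_nonincreasing[where f = "\<lambda>t. E t - ?M * t"])
    fix t assume "\<eta> \<le> t" "t \<le> s"
    then have t: "t \<in> {\<eta>..s}" "0 < t" "t < \<kappa> / 2" using \<eta> s\<kappa> by auto
    have "(E has_real_derivative - B (X2 t) t - (- B (X1 t) t)) (at t)"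
      unfolding E_def[abs_def] X1_def X2_def
      by (rule DERIV_diff[OF uh_along_leaf[where Y = Y2 and s = t, OF lf(2) in2[OF t(1)] _ t(2,3)]
            uh_along_leaf[where Y = Y1 and s = t, OF lf(1) in1[OF t(1)] _ t(2,3)]])
        (use Y1(3)[OF t(1)] Y2(3)[OF t(1)] in blast)+
    then have "((\<lambda>t. E t - ?M * t) has_real_derivative (- B (X2 t) t - (- B (X1 t) t)) - ?M) (at t)"
      by (rule DERIV_diff) (auto intro!: derivative_eq_intros)
    moreover have "(- B (X2 t) t - (- B (X1 t) t)) - ?M \<le> 0"
    proof -
      have "\<bar>X1 t\<bar> < \<rho>" "\<bar>X2 t\<bar> < \<rho>" using lf in1[OF t(1)] in2[OF t(1)] by (auto simp: leaf_def \<Sigma>_def X1_def X2_def)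
      then have "\<bar>B (X1 t) t - B (X2 t) t\<bar> \<le> K * \<bar>X1 t - X2 t\<bar>" by (rule B_lip[OF _ _ t(2,3)])
      also have "\<dots> \<le> ?M" using X[OF t(1)] params by (intro mult_left_mono) auto
      finally show ?thesis by linarith
    qed
    ultimately show "\<exists>D. ((\<lambda>t. E t - ?M * t) has_real_derivative D) (at t) \<and> D \<le> 0" by blast
  qed (use \<eta> in simp)
  moreover have "0 \<le> ?M * \<eta>" using g0 \<eta> by simp
  ultimately have "E s \<le> E \<eta> + ?M * s" by linarith
  moreover have "\<eta> \<in> {\<eta>..s}" using \<eta> by simp
  moreover have "\<bar>X1 \<eta>\<bar> \<le> 3 * \<rho> / 4" "\<bar>X2 \<eta>\<bar> \<le> 3 * \<rho> / 4"
    using L1(6) L2(6) in1[OF \<open>\<eta> \<in> {\<eta>..s}\<close>] in2[OF \<open>\<eta> \<in> {\<eta>..s}\<close>]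
    unfolding X1_def X2_def \<beta>1_def \<beta>2_def b1_def b2_def by blast+
  ultimately show ?thesis using X(1)[of \<eta>] unfolding E_def Xs
    by (intro exI[of _ "X1 \<eta>"] exI[of _ "X2 \<eta>"]) auto
qed

text \<open>Limit \<eta> to 0 in the strip estimate. The feet p, q depend on \<eta>, so pointwise
  continuity at the curve is not enough and uniform continuity on a compact rectangle is used; the
  boundary term then has the right sign.\<close>

lemma uh_level_increment:
  assumes x: "\<bar>x1\<bar> < R" "\<bar>x2\<bar> < R" "x1 < x2" and s: "0 < s" "s < R"
  shows "uh (x2, s) - uh (x1, s) \<le> K * (3 * growth * (x2 - x1)) * s"
proof (rule field_le_epsilon)
  fix e :: real assume e: "0 < e"
  let ?S = "{- (3 * \<rho> / 4)..3 * \<rho> / 4} \<times> {0..\<kappa> / 4}"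
  have "uniformly_continuous_on ?S uh"
    by (intro compact_uniformly_continuous continuous_on_subset[OF uh_cont] compact_Times compact_Icc)
      (use params in auto)
  then obtain d where d: "d > 0" "\<And>z z'. z \<in> ?S \<Longrightarrow> z' \<in> ?S \<Longrightarrow> dist z' z < d \<Longrightarrow> dist (uh z') (uh z) < e / 2"
    using e unfolding uniformly_continuous_on_def by (metis half_gt_zero)
  define \<eta> where "\<eta> = min (d / 2) (s / 2)"
  have \<eta>: "0 < \<eta>" "\<eta> < s" "\<eta> < d" using d s by (auto simp: \<eta>_def)
  obtain p q where pq: "p \<le> q" "\<bar>p\<bar> \<le> 3 * \<rho> / 4" "\<bar>q\<bar> \<le> 3 * \<rho> / 4"
    "uh (x2, s) - uh (x1, s) \<le> uh (q, \<eta>) - uh (p, \<eta>) + K * (3 * growth * (x2 - x1)) * s"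
    using level_strip[OF x \<eta>(1,2) s(2)] by blast
  have \<eta>\<kappa>: "\<eta> \<le> \<kappa> / 4" using \<eta> s R_bounds params by linarith
  have c: "\<bar>uh (v, \<eta>) - uh (v, 0)\<bar> < e / 2" if "\<bar>v\<bar> \<le> 3 * \<rho> / 4" for v
  proof -
    have "(v, 0) \<in> ?S" "(v, \<eta>) \<in> ?S" using that \<eta> \<eta>\<kappa> params by (auto simp: abs_le_iff)
    moreover have "dist (v, \<eta>) (v, 0) < d" using \<eta> by (simp add: dist_prod_def dist_real_def)
    ultimately show ?thesis using d(2) unfolding dist_real_def by blast
  qed
  have "uh (q, 0) \<le> uh (p, 0)" by (rule uh_boundary) (use pq params in auto)
  then have "uh (q, \<eta>) - uh (p, \<eta>) \<le> e" using c[OF pq(2)] c[OF pq(3)] by linarith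
  then show "uh (x2, s) - uh (x1, s) \<le> K * (3 * growth * (x2 - x1)) * s + e" using pq(4) by linarith
qed

text \<open>A derivative of \<open>uh\<close> in x exceeding 3 K growth s would produce level
  increments that are too large. This derivative is \<open>D\<close> times
  \<open>n1 + n2 * f'\<close>, and that factor is at least c - c / 2.\<close>

theorem D_le_height:
  assumes x: "\<bar>x\<bar> < R" and s: "0 < s" "s < R"
  shows "D x s \<le> 6 * K * growth / c * s"
proof -
  note R = R_bounds
  have x\<rho>: "\<bar>x\<bar> < \<rho>" and s\<kappa>: "s < \<kappa> / 2" using x s R params by linarith+
  let ?M = "3 * K * growth * s"
  let ?a = "D x s * (n1 (x, f x + s) + n2 (x, f x + s) * f' x)"
  have \<Sigma>: "(x, f x + s) \<in> \<Sigma>" using x\<rho> s s\<kappa> f_le[OF x\<rho>] by (auto simp: \<Sigma>_def)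
  have "((\<lambda>t. uh (t, s)) has_real_derivative ?a * 1 + (D x s * n2 (x, f x + s) - B x s) * 0) (at x)"
    by (rule chain_two[where F = uh and g = "\<lambda>t. t" and k = "\<lambda>_. s", OF uh_deriv[OF x\<rho> s(1) s\<kappa>]]) auto
  then have a: "((\<lambda>t. uh (t, s)) has_real_derivative ?a) (at x)" by simp
  have "?a \<le> ?M"
  proof (rule ccontr)
    assume "\<not> ?a \<le> ?M"
    moreover have "((\<lambda>t. uh (t, s) - ?M * t) has_real_derivative ?a - ?M) (at x)"
      by (rule DERIV_diff[OF a]) (auto intro!: derivative_eq_intros)
    ultimately obtain d where d: "d > 0" "\<And>k. 0 < k \<Longrightarrow> k < d \<Longrightarrow> uh (x, s) - ?M * x < uh (x + k, s) - ?M * (x + k)"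
      using DERIV_pos_inc_right[of "\<lambda>t. uh (t, s) - ?M * t" "?a - ?M" x] by auto
    define k where "k = min (d / 2) ((R - x) / 2)"
    have k: "0 < k" "k < d" "k < R - x" using d x by (auto simp: k_def min_def)
    have "uh (x + k, s) - uh (x, s) \<le> K * (3 * growth * (x + k - x)) * s"
      by (rule uh_level_increment) (use x s k in auto)
    then show False using d(2)[OF k(1,2)] by (simp add: algebra_simps)
  qed
  moreover have "D x s * (c / 2) \<le> ?a"
  proof (rule mult_left_mono)
    have "\<bar>n2 (x, f x + s) * f' x\<bar> \<le> 1 * (c / 2)"
      unfolding abs_mult
    proof (rule mult_mono)
      have "(n2 (x, f x + s))\<^sup>2 \<le> 1" using n_\<Sigma>(1)[OF \<Sigma>] zero_le_power2[of "n1 (x, f x + s)"] by linarith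
      then show "\<bar>n2 (x, f x + s)\<bar> \<le> 1" by (simp add: abs_square_le_1)
    qed (use f'_le[OF x\<rho>] in auto)
    then show "c / 2 \<le> n1 (x, f x + s) + n2 (x, f x + s) * f' x" using n_\<Sigma>(2)[OF \<Sigma>] by linarith
  qed (use D_pos[OF x\<rho> s(1) s\<kappa>] in simp)
  ultimately have "D x s * (c / 2) \<le> ?M" by linarith
  then show ?thesis using params by (simp add: field_simps)
qed

end

section \<open>Bump functions\<close>

text \<open>The derivative is quantified existentially, so closure properties are proved by
  exhibiting it.\<close>

primrec smooth_upto :: "nat \<Rightarrow> (real \<Rightarrow> real) \<Rightarrow> bool" where
  "smooth_upto 0 f \<longleftrightarrow> continuous_on UNIV f"
| "smooth_upto (Suc k) f \<longleftrightarrow> (\<exists>f'. (\<forall>x. (f has_real_derivative f' x) (at x)) \<and> smooth_upto k f')"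

section \<open>Closure properties of smoothness in one variable\<close>

lemma smooth_upto_continuous: "smooth_upto k f \<Longrightarrow> continuous_on UNIV f"
proof (cases k)
  case (Suc j)
  assume "smooth_upto k f"
  then obtain f' where "\<And>x. (f has_real_derivative f' x) (at x)" using Suc by auto
  then show ?thesis by (intro continuous_at_imp_continuous_on ballI DERIV_isCont)
qed simp

lemma smooth_upto_lower: "smooth_upto (Suc k) f \<Longrightarrow> smooth_upto k f"
proof (induction k arbitrary: f)
  case 0
  then show ?case using smooth_upto_continuous[of "Suc 0" f] by simp
next
  case (Suc k)
  then obtain f' where "\<forall>x. (f has_real_derivative f' x) (at x)" "smooth_upto (Suc k) f'" by auto
  then show ?case using Suc.IH by auto
qed

lemma smooth_upto_add: "smooth_upto k f \<Longrightarrow> smooth_upto k g \<Longrightarrow> smooth_upto k (\<lambda>x. f x + g x)"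
proof (induction k arbitrary: f g)
  case 0
  then show ?case by (auto intro: continuous_intros)
next
  case (Suc k)
  then obtain f' g' where "\<forall>x. (f has_real_derivative f' x) (at x)" "smooth_upto k f'"
    "\<forall>x. (g has_real_derivative g' x) (at x)" "smooth_upto k g'" by auto
  then show ?case using Suc.IH[of f' g'] by (auto intro!: exI[of _ "\<lambda>x. f' x + g' x"] DERIV_add)
qed

lemma smooth_upto_cmult: "smooth_upto k f \<Longrightarrow> smooth_upto k (\<lambda>x. c * f x)"
proof (induction k arbitrary: f)
  case 0
  then show ?case by (auto intro: continuous_intros)
next
  case (Suc k)
  then obtain f' where "\<forall>x. (f has_real_derivative f' x) (at x)" "smooth_upto k f'" by auto
  then show ?case using Suc.IH[of f'] by (auto intro!: exI[of _ "\<lambda>x. c * f' x"] DERIV_cmult)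
qed

lemma smooth_upto_mult: "smooth_upto k f \<Longrightarrow> smooth_upto k g \<Longrightarrow> smooth_upto k (\<lambda>x. f x * g x)"
proof (induction k arbitrary: f g)
  case 0
  then show ?case by (auto intro: continuous_intros)
next
  case (Suc k)
  then obtain f' g' where *: "\<And>x. (f has_real_derivative f' x) (at x)" "smooth_upto k f'"
    "\<And>x. (g has_real_derivative g' x) (at x)" "smooth_upto k g'" by auto
  have "smooth_upto k (\<lambda>x. f' x * g x + g' x * f x)"
    using Suc.IH * Suc.prems smooth_upto_lower by (intro smooth_upto_add) blast+
  moreover have "((\<lambda>x. f x * g x) has_real_derivative f' x * g x + g' x * f x) (at x)" for x
    by (rule DERIV_mult[OF *(1) *(3)])
  ultimately show ?case
    unfolding smooth_upto.simps by (intro exI[of _ "\<lambda>x. f' x * g x + g' x * f x"]) auto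
qed

lemma smooth_upto_affine: "smooth_upto k f \<Longrightarrow> smooth_upto k (\<lambda>x. f (a * x + b))"
proof (induction k arbitrary: f)
  case 0
  then show ?case by (auto intro!: continuous_on_compose2[of UNIV f] continuous_intros)
next
  case (Suc k)
  then obtain f' where *: "\<And>x. (f has_real_derivative f' x) (at x)" "smooth_upto k f'" by auto
  have "((\<lambda>x. a * x + b) has_real_derivative a) (at x)" for x
    by (auto intro!: derivative_eq_intros)
  from DERIV_chain2[OF *(1) this] have "((\<lambda>x. f (a * x + b)) has_real_derivative a * f' (a * x + b)) (at x)" for x
    by (subst mult.commute)
  moreover have "smooth_upto k (\<lambda>x. a * f' (a * x + b))"
    using Suc.IH[OF *(2)] by (rule smooth_upto_cmult)
  ultimately show ?case
    unfolding smooth_upto.simps by (intro exI[of _ "\<lambda>x. a * f' (a * x + b)"]) auto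
qed

text \<open>Indexed by the order of the pole, these functions have derivatives that are linear
  combinations of members of the family, so one induction gives smoothness of all of them.\<close>

definition flat_exp :: "nat \<Rightarrow> real \<Rightarrow> real" where
  "flat_exp n x = (if 0 < x then exp (- 1 / x) / x ^ n else 0)"

lemma flat_exp_tendsto_0: "(flat_exp n \<longlongrightarrow> 0) (at_right 0)"
proof -
  have "((\<lambda>x. x ^ n / exp x) \<longlongrightarrow> (0::real)) at_top" by (rule tendsto_power_div_exp_0)
  from filterlim_compose[OF this filterlim_inverse_at_top_right]
  have "((\<lambda>x. inverse x ^ n / exp (inverse x)) \<longlongrightarrow> (0::real)) (at_right 0)" .
  then show ?thesis
    by (rule Lim_transform_eventually)
      (auto simp: eventually_at_filter flat_exp_def exp_minus field_simps inverse_eq_divide)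
qed

lemma flat_exp_deriv: "(flat_exp n has_real_derivative flat_exp (n + 2) x - real n * flat_exp (n + 1) x) (at x)"
proof -
  consider "x < 0" | "x = 0" | "x > 0" by linarith
  then show ?thesis
  proof cases
    case 1
    have "((\<lambda>_. 0) has_real_derivative 0) (at x)" by simp
    then have "(flat_exp n has_real_derivative 0) (at x)"
      by (rule has_field_derivative_transform_within_open[where S = "{..<0}"]) (use 1 in \<open>auto simp: flat_exp_def\<close>)
    then show ?thesis using 1 by (simp add: flat_exp_def)
  next
    case 2
    have "((\<lambda>h. (flat_exp n h - flat_exp n 0) / (h - 0)) \<longlongrightarrow> 0) (at 0)"
      unfolding filterlim_at_split
    proof
      have "\<forall>\<^sub>F h in at_left 0. (flat_exp n h - flat_exp n 0) / (h - 0) = 0"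
        by (auto simp: eventually_at_filter flat_exp_def)
      then show "((\<lambda>h. (flat_exp n h - flat_exp n 0) / (h - 0)) \<longlongrightarrow> 0) (at_left 0)"
        by (rule tendsto_eventually)
      \<comment> \<open>The right difference quotient at 0 is the next member of the family, which
        tends to 0.\<close>
      have "\<forall>\<^sub>F h in at_right 0. flat_exp (n + 1) h = (flat_exp n h - flat_exp n 0) / (h - 0)"
        by (auto simp: eventually_at_filter flat_exp_def)
      then show "((\<lambda>h. (flat_exp n h - flat_exp n 0) / (h - 0)) \<longlongrightarrow> 0) (at_right 0)"
        by (rule Lim_transform_eventually[OF flat_exp_tendsto_0])
    qed
    then show ?thesis unfolding 2 has_field_derivative_iff by (simp add: flat_exp_def)
  next
    case 3
    have "((\<lambda>x. exp (- 1 / x) / x ^ n) has_real_derivative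
        exp (- 1 / x) / x ^ (n + 2) - real n * (exp (- 1 / x) / x ^ (n + 1))) (at x)"
    proof -
      have e: "((\<lambda>x. exp (- 1 / x)) has_real_derivative exp (- 1 / x) / x\<^sup>2) (at x)"
        using 3 by (auto intro!: derivative_eq_intros simp: power2_eq_square)
      have "x ^ n \<noteq> 0" using 3 by simp
      from DERIV_divide[OF e DERIV_pow this]
      have "((\<lambda>x. exp (- 1 / x) / x ^ n) has_real_derivative
        (exp (- 1 / x) / x\<^sup>2 * x ^ n - exp (- 1 / x) * (real n * x ^ (n - Suc 0))) / (x ^ n * x ^ n)) (at x)" .
      moreover have "(E / x\<^sup>2 * x ^ n - E * (real n * x ^ (n - Suc 0))) / (x ^ n * x ^ n)
          = E / x ^ (n + 2) - real n * (E / x ^ (n + 1))" for E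
      proof -
        have p: "real n * x ^ (n - Suc 0) = real n * x ^ n / x" using 3 by (cases n) auto
        have g: "(E / x\<^sup>2 * z - E * (k * z / x)) / (z * z) = E / (z * x\<^sup>2) - k * (E / (z * x))"
          if "z \<noteq> 0" for z k :: real
          using that 3 by (simp add: field_simps power2_eq_square)
        show ?thesis unfolding p g[OF \<open>x ^ n \<noteq> 0\<close>] by (simp add: power_add power2_eq_square ac_simps)
      qed
      ultimately show ?thesis by (simp only:)
    qed
    then have "(flat_exp n has_real_derivative exp (- 1 / x) / x ^ (n + 2) - real n * (exp (- 1 / x) / x ^ (n + 1))) (at x)"
      by (rule has_field_derivative_transform_within_open[where S = "{0<..}"]) (use 3 in \<open>auto simp: flat_exp_def\<close>)
    then show ?thesis using 3 by (simp add: flat_exp_def)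
  qed
qed

lemma smooth_flat_exp: "smooth_upto k (flat_exp n)"
proof (induction k arbitrary: n)
  case 0
  show ?case by (auto intro!: continuous_at_imp_continuous_on DERIV_isCont flat_exp_deriv)
next
  case (Suc k)
  have "smooth_upto k (\<lambda>x. flat_exp (n + 2) x + (- real n) * flat_exp (n + 1) x)"
    by (intro smooth_upto_add smooth_upto_cmult Suc)
  then show ?case using flat_exp_deriv[of n]
    by (auto intro!: exI[of _ "\<lambda>x. flat_exp (n + 2) x - real n * flat_exp (n + 1) x"])
qed

section \<open>A compactly supported bump and a smoothed step\<close>

definition bump :: "real \<Rightarrow> real" where "bump x = flat_exp 0 (x + 1) * flat_exp 0 (1 - x)"

lemma smooth_bump: "smooth_upto k bump"
proof -
  have "smooth_upto k (\<lambda>x. flat_exp 0 (1 * x + 1) * flat_exp 0 ((-1) * x + 1))"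
    by (intro smooth_upto_mult smooth_upto_affine smooth_flat_exp)
  then show ?thesis by (simp add: bump_def[abs_def] add.commute)
qed

lemma bump_props: "0 \<le> bump x" "\<bar>x\<bar> < 1 \<Longrightarrow> 0 < bump x" "1 \<le> \<bar>x\<bar> \<Longrightarrow> bump x = 0"
  by (auto simp: bump_def flat_exp_def abs_less_iff)

lemma continuous_bump: "continuous_on S bump"
  using smooth_upto_continuous[OF smooth_bump] continuous_on_subset by blast

lemma integral_bump_pos: "0 < integral {-1..1} bump"
proof -
  have "integral {-1..1} bump \<noteq> 0"
  proof
    assume "integral {-1..1} bump = 0"
    then have "(bump has_integral 0) (cbox (-1) 1)"
      using integrable_integral[OF integrable_continuous_real[OF continuous_bump, of "-1" 1]] by simp
    then have "bump 0 = 0"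
      by (rule has_integral_0_cbox_imp_0[rotated 2]) (auto intro: continuous_bump bump_props)
    then show False using bump_props(2)[of 0] by simp
  qed
  moreover have "0 \<le> integral {-1..1} bump" by (intro integral_nonneg integrable_continuous_real continuous_bump bump_props)
  ultimately show ?thesis by simp
qed

text \<open>Normalised primitive of \<open>bump\<close>. The lower limit \<open>-2\<close> lies
  strictly to the left of the support, so that differentiation under a variable upper limit also
  works at -1.\<close>

definition step :: "real \<Rightarrow> real" where "step x = integral {-2..x} bump / integral {-1..1} bump"

lemma step_deriv: "(step has_real_derivative bump x / integral {-1..1} bump) (at x)"
proof (cases "x < -1")
  case True
  have "step y = 0" if "y < - 1" for y
  proof -
    have "integral {-2..y} bump = integral {-2..y} (\<lambda>_. 0)"
      by (rule Henstock_Kurzweil_Integration.integral_cong) (use that bump_props(3) in auto)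
    then show ?thesis by (simp add: step_def)
  qed
  then have "(step has_real_derivative 0) (at x)"
    using True by (intro has_field_derivative_transform_within_open[OF DERIV_const[of 0], where S = "{..<-1}"]) auto
  then show ?thesis using True bump_props(3)[of x] by simp
next
  case False
  have "((\<lambda>x. integral {-2..x} bump) has_real_derivative bump x) (at x within {-2..x+1})"
    by (rule integral_has_real_derivative[OF continuous_bump]) (use False in auto)
  then have "((\<lambda>x. integral {-2..x} bump) has_real_derivative bump x) (at x)"
    using False by (simp add: at_within_Icc_at)
  then show ?thesis unfolding step_def[abs_def] by (rule DERIV_cdivide)
qed

lemma step_values: "x \<le> -1 \<Longrightarrow> step x = 0" "1 \<le> x \<Longrightarrow> step x = 1"
proof -
  assume "x \<le> -1"
  then have "integral {-2..x} bump = integral {-2..x} (\<lambda>_. 0)"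
    by (intro Henstock_Kurzweil_Integration.integral_cong) (use bump_props(3) in auto)
  then show "step x = 0" by (simp add: step_def)
next
  assume x: "1 \<le> x"
  have i: "bump integrable_on {a..b}" for a b by (intro integrable_continuous_real continuous_bump)
  have z: "integral {a..b} bump = 0" if "1 \<le> a \<or> b \<le> -1" for a b
  proof -
    have "integral {a..b} bump = integral {a..b} (\<lambda>_. 0)"
      by (rule Henstock_Kurzweil_Integration.integral_cong) (use bump_props(3) that in auto)
    then show ?thesis by simp
  qed
  have "integral {-2..x} bump = integral {-2..-1} bump + integral {-1..x} bump"
    using x by (subst Henstock_Kurzweil_Integration.integral_combine[OF _ _ i]) auto
  also have "integral {-1..x} bump = integral {-1..1} bump + integral {1..x} bump"
    using x by (subst Henstock_Kurzweil_Integration.integral_combine[OF _ _ i]) auto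
  finally have "integral {-2..x} bump = integral {-1..1} bump" using z by simp
  then show "step x = 1" using integral_bump_pos by (simp add: step_def)
qed

lemma smooth_step: "smooth_upto k step"
proof (cases k)
  case 0
  then show ?thesis by (auto intro!: continuous_at_imp_continuous_on DERIV_isCont step_deriv)
next
  case (Suc j)
  have "smooth_upto j (\<lambda>x. (1 / integral {-1..1} bump) * bump x)" by (intro smooth_upto_cmult smooth_bump)
  then show ?thesis using step_deriv unfolding Suc by (auto intro!: exI[of _ "\<lambda>x. bump x / integral {-1..1} bump"])
qed

section \<open>Frames and test functions\<close>

definition frame_point :: "real^2 \<Rightarrow> real^2 \<Rightarrow> real^2 \<Rightarrow> real \<times> real \<Rightarrow> real^2" where
  "frame_point p T \<nu> z = p + fst z *\<^sub>R T + snd z *\<^sub>R \<nu>"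

definition orthoframe :: "real^2 \<Rightarrow> real^2 \<Rightarrow> bool" where
  "orthoframe T \<nu> \<longleftrightarrow> T \<bullet> T = 1 \<and> \<nu> \<bullet> \<nu> = 1 \<and> T \<bullet> \<nu> = 0"

text \<open>In the plane \<open>\<nu>\<close> is the quarter turn of \<open>T\<close> times the
  determinant \<open>e\<close>, and e^2 = 1. No orientation is fixed, so that \<open>T\<close> may
  be reversed while \<open>\<nu>\<close> is kept.\<close>

lemma orthoframe_expand:
  assumes "orthoframe T \<nu>"
  shows "v = (v \<bullet> T) *\<^sub>R T + (v \<bullet> \<nu>) *\<^sub>R \<nu>"
proof -
  define a b c d where "a = T $ 1" and "b = T $ 2" and "c = \<nu> $ 1" and "d = \<nu> $ 2"
  have n: "a * a + b * b = 1" "c * c + d * d = 1" "a * c + b * d = 0"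
    using assms by (auto simp: orthoframe_def inner_vec_def sum_2 a_def b_def c_def d_def)
  define e where "e = a * d - b * c"
  have ce: "c = - b * e" "d = a * e"
  proof -
    have "c = c * (a * a + b * b) - a * (a * c + b * d)" using n by simp
    then show "c = - b * e" by (simp add: e_def algebra_simps)
    have "d = d * (a * a + b * b) - b * (a * c + b * d)" using n by simp
    then show "d = a * e" by (simp add: e_def algebra_simps)
  qed
  have "e * e * (a * a + b * b) = 1" using n(2) unfolding ce by (simp add: algebra_simps)
  then have e: "e * e = 1" using n by simp
  have "a * a + c * c = a * a + b * b * (e * e)" "b * b + d * d = b * b + a * a * (e * e)"
    "a * b + c * d = a * b - a * b * (e * e)"
    unfolding ce by (simp_all add: algebra_simps)
  then have m: "a * a + c * c = 1" "b * b + d * d = 1" "a * b + c * d = 0" using e n by auto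
  define x y where "x = v $ 1" and "y = v $ 2"
  have "(x * a + y * b) * a + (x * c + y * d) * c = x * (a * a + c * c) + y * (a * b + c * d)"
    "(x * a + y * b) * b + (x * c + y * d) * d = x * (a * b + c * d) + y * (b * b + d * d)"
    by (simp_all add: algebra_simps)
  then show ?thesis using m
    by (auto simp: vec_eq_iff forall_2 inner_vec_def sum_2 x_def y_def a_def b_def c_def d_def)
qed

lemma orthoframe_inner:
  assumes "orthoframe T \<nu>"
  shows "v \<bullet> w = (v \<bullet> T) * (w \<bullet> T) + (v \<bullet> \<nu>) * (w \<bullet> \<nu>)"
proof -
  have "v \<bullet> w = ((v \<bullet> T) *\<^sub>R T + (v \<bullet> \<nu>) *\<^sub>R \<nu>) \<bullet> w" using orthoframe_expand[OF assms, of v] by simp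
  then show ?thesis by (simp add: inner_add_left inner_commute[of w])
qed

lemma frame_point_coords:
  assumes "orthoframe T \<nu>"
  shows "(frame_point p T \<nu> z - p) \<bullet> T = fst z" "(frame_point p T \<nu> z - p) \<bullet> \<nu> = snd z"
    "frame_point p T \<nu> ((q - p) \<bullet> T, (q - p) \<bullet> \<nu>) = q"
proof -
  show "(frame_point p T \<nu> z - p) \<bullet> T = fst z" "(frame_point p T \<nu> z - p) \<bullet> \<nu> = snd z"
    using assms by (auto simp: frame_point_def orthoframe_def inner_add_left inner_commute[of \<nu> T])
  show "frame_point p T \<nu> ((q - p) \<bullet> T, (q - p) \<bullet> \<nu>) = q"
    using orthoframe_expand[OF assms, of "q - p"] by (simp add: frame_point_def algebra_simps)
qed

lemma continuous_frame_point: "continuous_on S (frame_point p T \<nu>)"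
  unfolding frame_point_def by (intro continuous_intros)

lemma grad_eqI:
  assumes "(u has_derivative (\<lambda>v. w \<bullet> v)) (at z)"
  shows "grad u z = w"
proof -
  have "frechet_derivative u (at z) = (\<lambda>v. w \<bullet> v)" using frechet_derivative_at[OF assms] by simp
  then show ?thesis by (simp add: grad_def pderivative_def vec_eq_iff inner_axis)
qed

section \<open>Tensor products as test functions in the plane\<close>

lemma Ck_add: "Ck k f \<Longrightarrow> Ck k g \<Longrightarrow> Ck k (\<lambda>x. f x + g x)"
proof (induction k arbitrary: f g)
  case 0
  then show ?case by (auto intro: continuous_intros)
next
  case (Suc k)
  then have d: "\<And>x. f differentiable (at x)" "\<And>x. g differentiable (at x)" by auto
  have "pderivative i (\<lambda>x. f x + g x) = (\<lambda>x. pderivative i f x + pderivative i g x)" for i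
    unfolding pderivative_def fun_eq_iff using frechet_derivative_at[OF has_derivative_add[OF
      d(1)[unfolded frechet_derivative_works] d(2)[unfolded frechet_derivative_works]]] by metis
  then show ?case using Suc d by auto
qed

lemma Ck_cmult: "Ck k f \<Longrightarrow> Ck k (\<lambda>x. c * f x)"
proof (induction k arbitrary: f)
  case 0
  then show ?case by (auto intro: continuous_intros)
next
  case (Suc k)
  then have d: "\<And>x. f differentiable (at x)" by auto
  have "((\<lambda>x. c * f x) has_derivative (\<lambda>v. c * frechet_derivative f (at x) v)) (at x)" for x
    by (intro has_derivative_mult_right frechet_derivative_works[THEN iffD1] d)
  then have "pderivative i (\<lambda>x. c * f x) = (\<lambda>x. c * pderivative i f x)" for i
    unfolding pderivative_def fun_eq_iff by (metis frechet_derivative_at)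
  then show ?case using Suc d by auto
qed

lemma tensor_has_derivative:
  fixes \<alpha> \<beta> :: "real \<Rightarrow> real" and p T \<nu> :: "real^2"
  assumes a: "\<And>x. (\<alpha> has_real_derivative \<alpha>' x) (at x)" and b: "\<And>x. (\<beta> has_real_derivative \<beta>' x) (at x)"
  shows "((\<lambda>z. \<alpha> ((z - p) \<bullet> T) * \<beta> ((z - p) \<bullet> \<nu>)) has_derivative
    (\<lambda>v. ((\<alpha>' ((z - p) \<bullet> T) * \<beta> ((z - p) \<bullet> \<nu>)) *\<^sub>R T + (\<alpha> ((z - p) \<bullet> T) * \<beta>' ((z - p) \<bullet> \<nu>)) *\<^sub>R \<nu>) \<bullet> v)) (at z)"
proof -
  have l: "((\<lambda>z. (z - p) \<bullet> w) has_derivative (\<lambda>v. v \<bullet> w)) (at z)" for w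
    by (auto intro!: derivative_eq_intros)
  have A: "((\<lambda>z. \<alpha> ((z - p) \<bullet> T)) has_derivative (\<lambda>v. \<alpha>' ((z - p) \<bullet> T) * (v \<bullet> T))) (at z)"
    using has_derivative_compose[OF l a[unfolded has_field_derivative_def]] .
  have B: "((\<lambda>z. \<beta> ((z - p) \<bullet> \<nu>)) has_derivative (\<lambda>v. \<beta>' ((z - p) \<bullet> \<nu>) * (v \<bullet> \<nu>))) (at z)"
    using has_derivative_compose[OF l b[unfolded has_field_derivative_def]] .
  show ?thesis
    by (rule has_derivative_eq_rhs[OF has_derivative_mult[OF A B]])
      (auto simp: fun_eq_iff inner_add_left inner_commute algebra_simps)
qed

text \<open>A partial derivative of a tensor product is a linear combination of tensor products in
  the same frame, with one factor differentiated; hence the induction over all factors at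
  once.\<close>

lemma Ck_tensor:
  fixes \<alpha> \<beta> :: "real \<Rightarrow> real" and p T \<nu> :: "real^2"
  assumes "smooth_upto k \<alpha>" "smooth_upto k \<beta>"
  shows "Ck k (\<lambda>z. \<alpha> ((z - p) \<bullet> T) * \<beta> ((z - p) \<bullet> \<nu>))"
  using assms
proof (induction k arbitrary: \<alpha> \<beta>)
  case 0
  then show ?case
    by (auto intro!: continuous_intros continuous_on_compose2[of UNIV \<alpha>] continuous_on_compose2[of UNIV \<beta>])
next
  case (Suc k)
  from Suc.prems obtain \<alpha>' \<beta>' where a: "\<And>x. (\<alpha> has_real_derivative \<alpha>' x) (at x)" "smooth_upto k \<alpha>'"
    and b: "\<And>x. (\<beta> has_real_derivative \<beta>' x) (at x)" "smooth_upto k \<beta>'" by auto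
  note d = tensor_has_derivative[where \<alpha> = \<alpha> and \<beta> = \<beta>, OF a(1) b(1)]
  let ?\<phi> = "\<lambda>z. \<alpha> ((z - p) \<bullet> T) * \<beta> ((z - p) \<bullet> \<nu>)"
  have "pderivative i ?\<phi> = (\<lambda>z. T $ i * (\<alpha>' ((z - p) \<bullet> T) * \<beta> ((z - p) \<bullet> \<nu>)) +
      \<nu> $ i * (\<alpha> ((z - p) \<bullet> T) * \<beta>' ((z - p) \<bullet> \<nu>)))" for i
    unfolding pderivative_def fun_eq_iff
    by (subst frechet_derivative_at[OF d, symmetric]) (auto simp: inner_add_left inner_axis algebra_simps)
  moreover have "Ck k (\<lambda>z. T $ i * (\<alpha>' ((z - p) \<bullet> T) * \<beta> ((z - p) \<bullet> \<nu>)) +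
      \<nu> $ i * (\<alpha> ((z - p) \<bullet> T) * \<beta>' ((z - p) \<bullet> \<nu>)))" for i
    using Suc a b smooth_upto_lower by (intro Ck_add Ck_cmult Suc.IH) blast+
  moreover have "?\<phi> differentiable (at z)" for z using d unfolding differentiable_def by blast
  ultimately show ?case by simp
qed

lemma test_function_tensor:
  assumes fr: "orthoframe T \<nu>" and sm: "\<And>k. smooth_upto k \<alpha>" "\<And>k. smooth_upto k \<beta>"
    and supp: "\<And>x. x \<notin> {a..b} \<Longrightarrow> \<alpha> x = 0" "\<And>y. y \<notin> {c..d} \<Longrightarrow> \<beta> y = 0"
    and sub: "frame_point p T \<nu> ` ({a..b} \<times> {c..d}) \<subseteq> U"
  shows "test_function U (\<lambda>z. \<alpha> ((z - p) \<bullet> T) * \<beta> ((z - p) \<bullet> \<nu>))" (is "test_function U ?\<phi>")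
proof -
  let ?K = "frame_point p T \<nu> ` ({a..b} \<times> {c..d})"
  have K: "compact ?K" by (intro compact_continuous_image continuous_frame_point compact_Times compact_Icc)
  have "{x. ?\<phi> x \<noteq> 0} \<subseteq> ?K"
  proof
    fix x assume "x \<in> {x. ?\<phi> x \<noteq> 0}"
    then have "((x - p) \<bullet> T, (x - p) \<bullet> \<nu>) \<in> {a..b} \<times> {c..d}" using supp by fastforce
    then show "x \<in> ?K" using frame_point_coords(3)[OF fr, of p x] by (metis image_eqI)
  qed
  then have *: "closure {x. ?\<phi> x \<noteq> 0} \<subseteq> ?K" by (intro closure_minimal compact_imp_closed K)
  then have "compact (closure {x. ?\<phi> x \<noteq> 0})"
    using K by (meson bounded_subset closed_closure compact_eq_bounded_closed)
  then show ?thesis using * sub Ck_tensor[OF sm(1) sm(2)] by (auto simp: test_function_def)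
qed

section \<open>Lebesgue measure in frame coordinates\<close>

lemma continuous_vector2: "continuous_on UNIV (\<lambda>z::real \<times> real. vector [fst z, snd z] :: real^2)"
proof -
  have "(vector [a, b] :: real^2) = a *\<^sub>R axis 1 1 + b *\<^sub>R axis 2 1" for a b :: real
    by (simp add: vec_eq_iff forall_2 axis_def)
  then show ?thesis by (auto intro!: continuous_intros)
qed

text \<open>Boxes pull back to boxes of the same volume, and their volumes determine Lebesgue
  measure. This links the plane as a space of vectors to the plane as a product, where iterated
  integrals are taken.\<close>

lemma distr_lborel_vector2:
  "distr lborel borel (\<lambda>z::real \<times> real. vector [fst z, snd z] :: real^2) = lborel"
proof (rule lborel_eqI[symmetric])
  have m: "(\<lambda>z::real \<times> real. vector [fst z, snd z] :: real^2) \<in> borel_measurable borel"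
    by (rule borel_measurable_continuous_onI[OF continuous_vector2])
  fix l u :: "real^2" assume le: "\<And>b. b \<in> Basis \<Longrightarrow> l \<bullet> b \<le> u \<bullet> b"
  have le': "l $ i \<le> u $ i" for i using le[of "axis i 1"] by (simp add: inner_axis axis_in_Basis_iff)
  have pre: "(\<lambda>z::real \<times> real. vector [fst z, snd z] :: real^2) -` box l u = box (l $ 1, l $ 2) (u $ 1, u $ 2)"
    by (auto simp: mem_box_cart forall_2 mem_box Basis_prod_def)
  have "emeasure (distr lborel borel (\<lambda>z::real \<times> real. vector [fst z, snd z] :: real^2)) (box l u)
    = emeasure lborel (box (l $ 1, l $ 2) (u $ 1, u $ 2))"
    using m by (subst emeasure_distr) (auto simp: pre)
  also have "\<dots> = ennreal (\<Prod>b\<in>Basis. ((u $ 1, u $ 2) - (l $ 1, l $ 2)) \<bullet> b)"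
    by (rule emeasure_lborel_box) (use le' in \<open>auto simp: Basis_prod_def\<close>)
  also have "(\<Prod>b\<in>Basis. ((u $ 1, u $ 2) - (l $ 1, l $ 2)) \<bullet> b) = (u $ 1 - l $ 1) * (u $ 2 - l $ 2)"
    by (simp add: Basis_prod_def prod.union_disjoint)
  also have "\<dots> = (\<Prod>b\<in>Basis. (u - l) \<bullet> b)"
  proof -
    have "(\<Prod>b\<in>Basis. (u - l) \<bullet> b) = (\<Prod>i\<in>UNIV. (u - l) $ i)"
    proof -
      have B: "(Basis :: (real^2) set) = range (\<lambda>i. axis i 1)" by (auto simp: Basis_vec_def)
      have "inj (\<lambda>i. axis i (1::real) :: real^2)" by (auto simp: inj_on_def axis_eq_axis)
      then show ?thesis unfolding B by (subst prod.reindex) (auto simp: inner_axis)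
    qed
    then show ?thesis by (simp add: UNIV_2)
  qed
  finally show "emeasure (distr lborel borel (\<lambda>z::real \<times> real. vector [fst z, snd z] :: real^2)) (box l u)
    = ennreal (\<Prod>b\<in>Basis. (u - l) \<bullet> b)" .
qed simp

lemma distr_lborel_orthogonal:
  fixes f :: "real^2 \<Rightarrow> real^2"
  assumes f: "orthogonal_transformation f"
  shows "distr lborel borel f = lborel"
proof (rule lborel_eqI[symmetric])
  have lin: "linear f" using f by (rule orthogonal_transformation_linear)
  have m: "f \<in> borel_measurable borel" by (intro borel_measurable_continuous_onI linear_continuous_on linear_conv_bounded_linear[THEN iffD1] lin)
  fix l u :: "real^2" assume le: "\<And>b. b \<in> Basis \<Longrightarrow> l \<bullet> b \<le> u \<bullet> b"
  have bij: "bij f" using orthogonal_transformation_bij[OF f] .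
  have inv: "orthogonal_transformation (inv f)" by (rule orthogonal_transformation_inv[OF f])
  have pre: "f -` box l u = inv f ` box l u" using bij by (simp add: bij_vimage_eq_inv_image)
  have meas: "f -` box l u \<in> sets borel" using measurable_sets[OF m, of "box l u"] by simp
  have lm: "box l u \<in> lmeasurable" by simp
  have lm': "inv f ` box l u \<in> lmeasurable" by (rule measurable_orthogonal_image[OF inv lm])
  have "emeasure (distr lborel borel f) (box l u) = emeasure lborel (f -` box l u)"
    using m by (subst emeasure_distr) auto
  also have "\<dots> = emeasure lebesgue (inv f ` box l u)" using meas by (simp add: pre[symmetric])
  also have "\<dots> = ennreal (measure lebesgue (inv f ` box l u))" using lm' by (simp add: emeasure_eq_measure2 fmeasurableD2)
  also have "\<dots> = ennreal (measure lebesgue (box l u))" by (simp add: measure_orthogonal_image[OF inv lm])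
  also have "\<dots> = emeasure lebesgue (box l u)" using lm by (simp add: emeasure_eq_measure2 fmeasurableD2)
  also have "\<dots> = ennreal (\<Prod>b\<in>Basis. (u - l) \<bullet> b)" using le by (simp add: emeasure_lborel_box)
  finally show "emeasure (distr lborel borel f) (box l u) = ennreal (\<Prod>b\<in>Basis. (u - l) \<bullet> b)" .
qed simp

text \<open>The map factors into passage from pairs to vectors, an orthogonal map and a translation,
  each of which preserves Lebesgue measure.\<close>

lemma distr_lborel_frame_point:
  assumes fr: "orthoframe T \<nu>"
  shows "distr lborel borel (frame_point p T \<nu>) = lborel"
proof -
  let ?V = "\<lambda>z::real \<times> real. vector [fst z, snd z] :: real^2"
  let ?L = "\<lambda>v::real^2. (v $ 1) *\<^sub>R T + (v $ 2) *\<^sub>R \<nu>"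
  have lin: "linear ?L" by (auto intro!: linearI simp: algebra_simps)
  have orth: "orthogonal_transformation ?L"
    unfolding orthogonal_transformation_def
  proof (intro conjI allI lin)
    fix v w :: "real^2"
    have "v \<bullet> w = v $ 1 * w $ 1 + v $ 2 * w $ 2" by (simp add: inner_vec_def sum_2)
    then show "?L v \<bullet> ?L w = v \<bullet> w"
      using fr by (simp add: orthoframe_def inner_add_left inner_add_right inner_commute[of \<nu> T])
  qed
  have mV: "?V \<in> borel_measurable borel"
    by (rule borel_measurable_continuous_onI[OF continuous_vector2])
  have mL: "?L \<in> borel_measurable borel"
    by (intro borel_measurable_continuous_onI linear_continuous_on linear_conv_bounded_linear[THEN iffD1] lin)
  have "frame_point p T \<nu> = (+) p \<circ> (?L \<circ> ?V)" by (auto simp: frame_point_def fun_eq_iff)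
  moreover have "?L \<circ> ?V \<in> borel_measurable borel" using mV mL by (rule measurable_comp)
  ultimately have "distr lborel borel (frame_point p T \<nu>) = distr (distr lborel borel (?L \<circ> ?V)) borel ((+) p)"
    by (simp only:) (rule distr_distr[symmetric]; simp)
  also have "distr lborel borel (?L \<circ> ?V) = distr (distr lborel borel ?V) borel ?L"
    by (rule distr_distr[symmetric]) (use mV mL in simp_all)
  finally show ?thesis
    unfolding distr_lborel_vector2 distr_lborel_orthogonal[OF orth] by (simp add: lborel_distr_plus)
qed

lemma integral_frame_point:
  fixes g :: "real^2 \<Rightarrow> real"
  assumes "orthoframe T \<nu>" "g \<in> borel_measurable borel"
  shows "(LINT z|lborel. g z) = (LINT w|lborel. g (frame_point p T \<nu> w))"
proof -
  have "frame_point p T \<nu> \<in> borel_measurable borel"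
    by (rule borel_measurable_continuous_onI[OF continuous_frame_point])
  then have "(LINT z|distr lborel borel (frame_point p T \<nu>). g z) = (LINT w|lborel. g (frame_point p T \<nu> w))"
    using assms(2) by (intro integral_distr) simp_all
  then show ?thesis by (simp add: distr_lborel_frame_point[OF assms(1)])
qed

section \<open>Weak equations in an orthonormal frame\<close>

text \<open>The derivative of the rescaled \<open>step\<close>; hence an approximate identity of
  mass one whose primitive is a smoothed jump at y.\<close>

definition mollifier :: "real \<Rightarrow> real \<Rightarrow> real \<Rightarrow> real" where
  "mollifier \<delta> y t = bump ((t - y) / \<delta>) / (integral {-1..1} bump * \<delta>)"

lemma step_shift_deriv:
  assumes "0 < \<delta>"
  shows "((\<lambda>t. step ((t - y) / \<delta>)) has_real_derivative mollifier \<delta> y t) (at t)"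
proof -
  have "((\<lambda>t. (t - y) / \<delta>) has_real_derivative 1 / \<delta>) (at t)"
    using assms by (auto intro!: derivative_eq_intros)
  from DERIV_chain2[OF step_deriv this] show ?thesis by (simp add: mollifier_def)
qed

lemma mollifier_props:
  assumes "0 < \<delta>"
  shows "0 \<le> mollifier \<delta> y t" "\<delta> \<le> \<bar>t - y\<bar> \<Longrightarrow> mollifier \<delta> y t = 0"
proof -
  show "0 \<le> mollifier \<delta> y t"
    unfolding mollifier_def using assms integral_bump_pos by (intro divide_nonneg_pos mult_pos_pos bump_props) auto
  assume "\<delta> \<le> \<bar>t - y\<bar>"
  then have "1 \<le> \<bar>(t - y) / \<delta>\<bar>" using assms by (simp add: abs_divide)
  then show "mollifier \<delta> y t = 0" using bump_props(3) by (simp add: mollifier_def)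
qed

lemma continuous_mollifier: "continuous_on S (mollifier \<delta> y)"
  unfolding mollifier_def divide_inverse
  by (intro continuous_intros continuous_on_compose2[OF continuous_bump[of UNIV]]) auto

lemma mollifier_integral:
  assumes "0 < \<delta>" "\<delta> \<le> y - c" "\<delta> \<le> d - y"
  shows "integral {c..d} (mollifier \<delta> y) = 1"
proof -
  have "(mollifier \<delta> y has_integral step ((d - y) / \<delta>) - step ((c - y) / \<delta>)) {c..d}"
    using assms
    by (intro fundamental_theorem_of_calculus
      step_shift_deriv[OF assms(1), THEN has_field_derivative_at_within,
        unfolded has_real_derivative_iff_has_vector_derivative]) auto
  moreover have "step ((d - y) / \<delta>) = 1" using assms by (intro step_values) simp
  moreover have "step ((c - y) / \<delta>) = 0" using assms by (intro step_values) (simp add: field_simps)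
  ultimately show ?thesis by (simp add: integral_unique)
qed

lemma mollifier_limit:
  fixes C :: "real \<Rightarrow> real"
  assumes C: "continuous_on {c..d} C" and y: "c < y" "y < d" and \<eta>: "0 < \<eta>"
  shows "\<exists>\<delta>0>0. \<forall>\<delta>. 0 < \<delta> \<and> \<delta> < \<delta>0 \<longrightarrow> \<bar>integral {c..d} (\<lambda>t. mollifier \<delta> y t * C t) - C y\<bar> \<le> \<eta>"
proof -
  obtain \<delta>1 where \<delta>1: "\<delta>1 > 0" "\<And>t. t \<in> {c..d} \<Longrightarrow> dist t y < \<delta>1 \<Longrightarrow> dist (C t) (C y) < \<eta>"
    using C y \<eta> unfolding continuous_on_iff by (metis atLeastAtMost_iff less_imp_le)
  define \<delta>0 where "\<delta>0 = min \<delta>1 (min (y - c) (d - y))"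
  have "\<bar>integral {c..d} (\<lambda>t. mollifier \<delta> y t * C t) - C y\<bar> \<le> \<eta>" if \<delta>: "0 < \<delta>" "\<delta> < \<delta>0" for \<delta>
  proof -
    have i: "integral {c..d} (mollifier \<delta> y) = 1" using \<delta> by (intro mollifier_integral) (auto simp: \<delta>0_def)
    have int: "(\<lambda>t. mollifier \<delta> y t * C t) integrable_on {c..d}" "mollifier \<delta> y integrable_on {c..d}"
      by (intro integrable_continuous_real continuous_intros continuous_mollifier C)+
    have "integral {c..d} (\<lambda>t. mollifier \<delta> y t * C t) - C y
        = integral {c..d} (\<lambda>t. mollifier \<delta> y t * C t) - integral {c..d} (\<lambda>t. mollifier \<delta> y t * C y)"
      by (simp add: i)
    also have "\<dots> = integral {c..d} (\<lambda>t. mollifier \<delta> y t * C t - mollifier \<delta> y t * C y)"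
      by (rule Henstock_Kurzweil_Integration.integral_diff[symmetric])
        (intro int integrable_on_mult_left)+
    also have "norm \<dots> \<le> integral {c..d} (\<lambda>t. mollifier \<delta> y t * \<eta>)"
    proof (rule integral_norm_bound_integral)
      show "norm (mollifier \<delta> y t * C t - mollifier \<delta> y t * C y) \<le> mollifier \<delta> y t * \<eta>" if t: "t \<in> {c..d}" for t
      proof (cases "\<bar>t - y\<bar> < \<delta>")
        case True
        then have "\<bar>C t - C y\<bar> \<le> \<eta>" using \<delta>1(2)[OF t] \<delta> by (auto simp: dist_real_def \<delta>0_def)
        then have "mollifier \<delta> y t * \<bar>C t - C y\<bar> \<le> mollifier \<delta> y t * \<eta>"
          using mollifier_props(1)[OF \<delta>(1)] by (intro mult_left_mono)
        then show ?thesis using mollifier_props(1)[OF \<delta>(1), of y t]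
          by (simp add: right_diff_distrib[symmetric] abs_mult)
      next
        case False
        then show ?thesis using mollifier_props(2)[OF \<delta>(1), of t y] by simp
      qed
    qed (intro int integrable_on_mult_left integrable_continuous_real continuous_intros continuous_mollifier C)+
    also have "\<dots> = \<eta>" by (simp add: i)
    finally show ?thesis by simp
  qed
  moreover have "\<delta>0 > 0" using \<delta>1 y by (simp add: \<delta>0_def)
  ultimately show ?thesis by blast
qed

text \<open>Subtracting a primitive \<open>P\<close> of \<open>B\<close> from \<open>A\<close>
  reduces the claim to constancy of \<open>C = A - P\<close>, which annihilates all \<beta>'.
  Testing with a smoothed indicator of the interval from y1 to y2 makes \<beta>' the difference of
  two mollifiers, so the averages of \<open>C\<close> near y1 and y2 agree.\<close>

lemma du_bois_reymond:
  fixes A B :: "real \<Rightarrow> real"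
  assumes A: "continuous_on {c..d} A" and B: "continuous_on {c..d} B"
    and weak: "\<And>\<beta> \<beta>' c' d'. (\<And>k. smooth_upto k \<beta>) \<Longrightarrow> (\<And>x. (\<beta> has_real_derivative \<beta>' x) (at x)) \<Longrightarrow>
      c < c' \<Longrightarrow> d' < d \<Longrightarrow> (\<And>t. t \<notin> {c'..d'} \<Longrightarrow> \<beta> t = 0) \<Longrightarrow> integral {c..d} (\<lambda>t. A t * \<beta>' t + B t * \<beta> t) = 0"
    and y: "c < y1" "y1 < y2" "y2 < d"
  shows "A y2 - A y1 = integral {y1..y2} B"
proof -
  define P where "P y = integral {c..y} B" for y
  have P: "(P has_real_derivative B y) (at y within {c..d})" if "y \<in> {c..d}" for y
    unfolding P_def[abs_def] by (rule integral_has_real_derivative[OF B that])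
  have Pc: "continuous_on {c..d} P"
    using P by (intro DERIV_continuous_on[of "{c..d}" P B]) auto
  define C where "C y = A y - P y" for y
  have Cc: "continuous_on {c..d} C" unfolding C_def by (intro continuous_intros A Pc)
  have key: "\<bar>C y1 - C y2\<bar> \<le> e" if e: "e > 0" for e
  proof -
    obtain \<delta>1 where \<delta>1: "\<delta>1 > 0" "\<And>\<delta>. 0 < \<delta> \<Longrightarrow> \<delta> < \<delta>1 \<Longrightarrow> \<bar>integral {c..d} (\<lambda>t. mollifier \<delta> y1 t * C t) - C y1\<bar> \<le> e / 2"
      using mollifier_limit[OF Cc, of y1 "e / 2"] y e by auto
    obtain \<delta>2 where \<delta>2: "\<delta>2 > 0" "\<And>\<delta>. 0 < \<delta> \<Longrightarrow> \<delta> < \<delta>2 \<Longrightarrow> \<bar>integral {c..d} (\<lambda>t. mollifier \<delta> y2 t * C t) - C y2\<bar> \<le> e / 2"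
      using mollifier_limit[OF Cc, of y2 "e / 2"] y e by auto
    define \<delta> where "\<delta> = Min {\<delta>1, \<delta>2, y1 - c, d - y2} / 2"
    have \<delta>: "0 < \<delta>" "\<delta> < \<delta>1" "\<delta> < \<delta>2" "\<delta> < y1 - c" "\<delta> < d - y2"
      using \<delta>1 \<delta>2 y by (auto simp: \<delta>_def min_def)
    let ?\<beta> = "\<lambda>t. step ((t - y1) / \<delta>) - step ((t - y2) / \<delta>)"
    let ?\<beta>' = "\<lambda>t. mollifier \<delta> y1 t - mollifier \<delta> y2 t"
    have \<beta>': "(?\<beta> has_real_derivative ?\<beta>' t) (at t)" for t
      by (intro DERIV_diff step_shift_deriv \<delta>)
    have sm: "smooth_upto k ?\<beta>" for k
    proof -
      have "smooth_upto k (\<lambda>t. step ((1 / \<delta>) * t + (- y1 / \<delta>)) + (-1) * step ((1 / \<delta>) * t + (- y2 / \<delta>)))"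
        by (intro smooth_upto_add smooth_upto_cmult smooth_upto_affine smooth_step)
      then show ?thesis by (simp add: diff_divide_distrib)
    qed
    have out: "?\<beta> t = 0" if t: "t \<notin> {y1 - \<delta>..y2 + \<delta>}" for t
    proof (cases "t < y1 - \<delta>")
      case True
      then have "(t - y1) / \<delta> \<le> -1" "(t - y2) / \<delta> \<le> -1" using y \<delta> by (simp_all add: field_simps)
      then show ?thesis by (simp add: step_values)
    next
      case False
      then have "1 \<le> (t - y1) / \<delta>" "1 \<le> (t - y2) / \<delta>" using y \<delta> t by (simp_all add: field_simps)
      then show ?thesis by (simp add: step_values)
    qed
    have w: "integral {c..d} (\<lambda>t. A t * ?\<beta>' t + B t * ?\<beta> t) = 0"
      by (rule weak[OF sm \<beta>' _ _ out]) (use \<delta> in auto)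
    have \<beta>c: "continuous_on {c..d} ?\<beta>" by (intro continuous_at_imp_continuous_on ballI DERIV_isCont[OF \<beta>'])
    \<comment> \<open>Integration by parts for \<open>P\<close>: the weak identity holds for the
      pair (P, B) as well, so it may be subtracted.\<close>
    have hi: "((\<lambda>t. P t * ?\<beta>' t + B t * ?\<beta> t) has_integral P d * ?\<beta> d - P c * ?\<beta> c) {c..d}"
    proof (rule fundamental_theorem_of_calculus)
      fix t assume t: "t \<in> {c..d}"
      have "((\<lambda>t. P t * ?\<beta> t) has_real_derivative B t * ?\<beta> t + ?\<beta>' t * P t) (at t within {c..d})"
        by (rule DERIV_mult[OF P[OF t] has_field_derivative_at_within[OF \<beta>']])
      then show "((\<lambda>t. P t * ?\<beta> t) has_vector_derivative P t * ?\<beta>' t + B t * ?\<beta> t) (at t within {c..d})"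
        by (simp add: has_real_derivative_iff_has_vector_derivative algebra_simps)
    qed (use y in simp)
    have "P d * ?\<beta> d - P c * ?\<beta> c = 0" using out[of c] out[of d] \<delta> by simp
    then have p: "integral {c..d} (\<lambda>t. P t * ?\<beta>' t + B t * ?\<beta> t) = 0"
      unfolding integral_unique[OF hi] .
    have "integral {c..d} (\<lambda>t. (A t * ?\<beta>' t + B t * ?\<beta> t) - (P t * ?\<beta>' t + B t * ?\<beta> t))
        = integral {c..d} (\<lambda>t. A t * ?\<beta>' t + B t * ?\<beta> t) - integral {c..d} (\<lambda>t. P t * ?\<beta>' t + B t * ?\<beta> t)"
      by (intro Henstock_Kurzweil_Integration.integral_diff integrable_continuous_real continuous_on_add
        continuous_on_mult continuous_on_diff[of _ "mollifier \<delta> y1"] A B Pc \<beta>c continuous_mollifier)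
    then have "integral {c..d} (\<lambda>t. (A t * ?\<beta>' t + B t * ?\<beta> t) - (P t * ?\<beta>' t + B t * ?\<beta> t)) = 0"
      unfolding w p by simp
    moreover have "(A t * ?\<beta>' t + B t * ?\<beta> t) - (P t * ?\<beta>' t + B t * ?\<beta> t) = mollifier \<delta> y1 t * C t - mollifier \<delta> y2 t * C t" for t
      by (simp add: C_def algebra_simps)
    ultimately have "integral {c..d} (\<lambda>t. mollifier \<delta> y1 t * C t - mollifier \<delta> y2 t * C t) = 0" by simp
    moreover have "integral {c..d} (\<lambda>t. mollifier \<delta> y1 t * C t - mollifier \<delta> y2 t * C t)
        = integral {c..d} (\<lambda>t. mollifier \<delta> y1 t * C t) - integral {c..d} (\<lambda>t. mollifier \<delta> y2 t * C t)"
      by (intro Henstock_Kurzweil_Integration.integral_diff integrable_continuous_real continuous_intros Cc continuous_mollifier)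
    ultimately have "integral {c..d} (\<lambda>t. mollifier \<delta> y1 t * C t) = integral {c..d} (\<lambda>t. mollifier \<delta> y2 t * C t)" by simp
    then show ?thesis using \<delta>1(2)[OF \<delta>(1,2)] \<delta>2(2)[OF \<delta>(1,3)] by linarith
  qed
  have "\<bar>C y1 - C y2\<bar> \<le> 0"
  proof (rule field_le_epsilon)
    fix e :: real assume "0 < e"
    from key[OF this] show "\<bar>C y1 - C y2\<bar> \<le> 0 + e" by (simp only: add_0)
  qed
  then have "A y2 - A y1 = P y2 - P y1" by (simp add: C_def)
  also have "\<dots> = integral {y1..y2} B"
  proof -
    have "B integrable_on {c..y2}" using y by (intro integrable_continuous_real continuous_on_subset[OF B]) auto
    from Henstock_Kurzweil_Integration.integral_combine[OF _ _ this, of y1] y show ?thesis by (simp add: P_def)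
  qed
  finally show ?thesis .
qed

section \<open>The weak equation tested with tensor products\<close>

lemma deriv_outside_support:
  fixes \<alpha> :: "real \<Rightarrow> real"
  assumes "(\<alpha> has_real_derivative D) (at x)" "\<And>x. x \<notin> {a..b} \<Longrightarrow> \<alpha> x = 0" "x \<notin> {a..b}"
  shows "D = 0"
proof -
  have "(\<alpha> has_real_derivative 0) (at x)"
    by (rule has_field_derivative_transform_within_open[OF DERIV_const[of 0], where S = "- {a..b}"])
      (use assms in \<open>auto intro: open_Compl\<close>)
  then show ?thesis using DERIV_unique assms(1) by blast
qed

text \<open>Tensor products adapted to the frame separate the tangential and the normal part of the
  flux. The same formula serves the balance law off the curve and the blow-up on it, so the support
  may meet \<gamma> and both indicators are kept.\<close>

lemma weak_tensor:
  fixes p T \<nu> :: "real^2"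
  assumes fr: "orthoframe T \<nu>" and U: "open U" "open (U - \<gamma>)"
    and N: "continuous_on (U - \<gamma>) (normal_field u F)" and H: "continuous_on U H"
    and weak: "weak_solution U \<gamma> u F H"
    and sm: "\<And>k. smooth_upto k \<alpha>" "\<And>k. smooth_upto k \<beta>"
    and d: "\<And>x. (\<alpha> has_real_derivative \<alpha>' x) (at x)" "\<And>x. (\<beta> has_real_derivative \<beta>' x) (at x)"
    and cd: "continuous_on UNIV \<alpha>'" "continuous_on UNIV \<beta>'"
    and supp: "\<And>x. x \<notin> {a..b} \<Longrightarrow> \<alpha> x = 0" "\<And>y. y \<notin> {c..d} \<Longrightarrow> \<beta> y = 0"
    and sub: "frame_point p T \<nu> ` ({a..b} \<times> {c..d}) \<subseteq> U"
  defines "Z \<equiv> frame_point p T \<nu>"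
  shows "(LINT w|lborel. indicator (U - \<gamma>) (Z w) * ((normal_field u F (Z w) \<bullet> T) * (\<alpha>' (fst w) * \<beta> (snd w))
      + (normal_field u F (Z w) \<bullet> \<nu>) * (\<alpha> (fst w) * \<beta>' (snd w))))
    + (LINT w|lborel. indicator U (Z w) * (H (Z w) * (\<alpha> (fst w) * \<beta> (snd w)))) = (0::real)"
proof -
  let ?\<phi> = "\<lambda>z. \<alpha> ((z - p) \<bullet> T) * \<beta> ((z - p) \<bullet> \<nu>)"
  let ?g = "\<lambda>z. (\<alpha>' ((z - p) \<bullet> T) * \<beta> ((z - p) \<bullet> \<nu>)) *\<^sub>R T + (\<alpha> ((z - p) \<bullet> T) * \<beta>' ((z - p) \<bullet> \<nu>)) *\<^sub>R \<nu>"
  have ca: "continuous_on UNIV \<alpha>" "continuous_on UNIV \<beta>"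
    using smooth_upto_continuous[OF sm(1)] smooth_upto_continuous[OF sm(2)] by auto
  have cc: "continuous_on S (\<lambda>z. q ((z - p) \<bullet> w))" if "continuous_on UNIV q" for q :: "real \<Rightarrow> real" and w S
    by (rule continuous_on_compose2[OF that]) (auto intro!: continuous_intros)
  have cg: "continuous_on S ?g" and c\<phi>: "continuous_on S ?\<phi>" for S
    by (intro continuous_intros cc ca cd)+
  have g: "grad ?\<phi> = ?g"
    by (rule ext, rule grad_eqI, rule tensor_has_derivative[OF d])
  have tf: "test_function U ?\<phi>" by (rule test_function_tensor[OF fr sm supp sub])
  have W: "(LINT z|lborel. indicator (U - \<gamma>) z *\<^sub>R (normal_field u F z \<bullet> ?g z)) +
      (LINT z|lborel. indicator U z *\<^sub>R (H z * ?\<phi> z)) = 0"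
    using weak[unfolded weak_solution_def, rule_format, OF tf] unfolding set_lebesgue_integral_def g .
  have m1: "(\<lambda>z. indicator (U - \<gamma>) z *\<^sub>R (normal_field u F z \<bullet> ?g z)) \<in> borel_measurable borel"
    using U by (intro borel_measurable_continuous_on_indicator continuous_on_inner N cg) auto
  have m2: "(\<lambda>z. indicator U z *\<^sub>R (H z * ?\<phi> z)) \<in> borel_measurable borel"
    using U by (intro borel_measurable_continuous_on_indicator continuous_on_mult H c\<phi>) auto
  show ?thesis
    using W unfolding integral_frame_point[OF fr m1, of p] integral_frame_point[OF fr m2, of p]
    by (simp add: frame_point_coords[OF fr] Z_def inner_add_right mult.commute)
qed

lemma LINT_indicator_cbox:
  fixes F :: "real \<times> real \<Rightarrow> real"
  assumes "continuous_on (cbox a b) F"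
  shows "integrable lborel (\<lambda>w. indicator (cbox a b) w * F w)"
    "(LINT w|lborel. indicator (cbox a b) w * F w) = integral (cbox a b) F"
proof -
  have i: "integrable lborel (\<lambda>w. indicator (cbox a b) w *\<^sub>R F w)"
    by (rule borel_integrable_compact[OF compact_cbox assms])
  then show "integrable lborel (\<lambda>w. indicator (cbox a b) w * F w)" by simp
  show "(LINT w|lborel. indicator (cbox a b) w * F w) = integral (cbox a b) F"
    using set_borel_integral_eq_integral(2)[of "cbox a b" F] i
    by (simp add: set_integrable_def set_lebesgue_integral_def)
qed

section \<open>Integrals of continuous functions over rectangles\<close>

lemma cbox_Pair: "cbox (a, c) (b, d) = {a..b} \<times> {c..d}" for a b c d :: real
  by (auto simp: cbox_Pair_iff)

lemma continuous_section:
  fixes g :: "real \<times> real \<Rightarrow> real"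
  assumes "continuous_on ({a..b} \<times> {c..d}) g"
  shows "y \<in> {c..d} \<Longrightarrow> continuous_on {a..b} (\<lambda>x. g (x, y))"
    "x \<in> {a..b} \<Longrightarrow> continuous_on {c..d} (\<lambda>y. g (x, y))"
    "continuous_on {c..d} (\<lambda>y. integral {a..b} (\<lambda>x. g (x, y)))"
    "continuous_on {a..b} (\<lambda>x. integral {c..d} (\<lambda>y. g (x, y)))"
    "integral {a..b} (\<lambda>x. integral {c..d} (\<lambda>y. g (x, y))) = integral {c..d} (\<lambda>y. integral {a..b} (\<lambda>x. g (x, y)))"
    "integral ({a..b} \<times> {c..d}) g = integral {c..d} (\<lambda>y. integral {a..b} (\<lambda>x. g (x, y)))"
proof -
  show "y \<in> {c..d} \<Longrightarrow> continuous_on {a..b} (\<lambda>x. g (x, y))"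
    by (rule continuous_on_compose2[OF assms]) (auto intro!: continuous_intros)
  show "x \<in> {a..b} \<Longrightarrow> continuous_on {c..d} (\<lambda>y. g (x, y))"
    by (rule continuous_on_compose2[OF assms]) (auto intro!: continuous_intros)
  have "continuous_on ({c..d} \<times> cbox a b) (\<lambda>(y, x). g (x, y))"
    unfolding split_beta by (rule continuous_on_compose2[OF assms]) (auto intro!: continuous_intros)
  from integral_continuous_on_param[OF this]
  show "continuous_on {c..d} (\<lambda>y. integral {a..b} (\<lambda>x. g (x, y)))" by simp
  have "continuous_on ({a..b} \<times> cbox c d) (\<lambda>(x, y). g (x, y))"
    unfolding split_beta by (rule continuous_on_compose2[OF assms]) (auto intro!: continuous_intros)
  from integral_continuous_on_param[OF this]
  show "continuous_on {a..b} (\<lambda>x. integral {c..d} (\<lambda>y. g (x, y)))" by simp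
  have c: "continuous_on (cbox (a, c) (b, d)) (\<lambda>(x, y). g (x, y))" using assms by (simp add: cbox_Pair)
  from integral_swap_continuous[OF this]
  show sw: "integral {a..b} (\<lambda>x. integral {c..d} (\<lambda>y. g (x, y))) = integral {c..d} (\<lambda>y. integral {a..b} (\<lambda>x. g (x, y)))"
    by simp
  have "continuous_on (cbox (a, c) (b, d)) g" using assms by (simp add: cbox_Pair)
  from integral_prod_continuous[OF this] sw
  show "integral ({a..b} \<times> {c..d}) g = integral {c..d} (\<lambda>y. integral {a..b} (\<lambda>x. g (x, y)))"
    by (simp add: cbox_Pair)
qed

text \<open>Test functions that reproduce the fluxes through the edges of a closed rectangle need
  room outside it; compactness provides a uniform margin.\<close>

lemma enlarge_rectangle:
  fixes S :: "(real \<times> real) set"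
  assumes "open S" "{a..b} \<times> {c..d} \<subseteq> S" "a \<le> b" "c \<le> d"
  shows "\<exists>e>0. {a - e..b + e} \<times> {c - e..d + e} \<subseteq> S"
proof -
  have "compact ({a..b} \<times> {c..d})" by (intro compact_Times compact_Icc)
  from compact_subset_open_imp_ball_epsilon_subset[OF this assms(1,2)]
  obtain \<epsilon> where \<epsilon>: "\<epsilon> > 0" "(\<Union>x\<in>{a..b} \<times> {c..d}. ball x \<epsilon>) \<subseteq> S" by blast
  have "{a - \<epsilon> / 3..b + \<epsilon> / 3} \<times> {c - \<epsilon> / 3..d + \<epsilon> / 3} \<subseteq> S"
  proof
    fix z assume z: "z \<in> {a - \<epsilon> / 3..b + \<epsilon> / 3} \<times> {c - \<epsilon> / 3..d + \<epsilon> / 3}"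
    define q where "q = (max a (min (fst z) b), max c (min (snd z) d))"
    have q: "q \<in> {a..b} \<times> {c..d}" using assms by (auto simp: q_def)
    have "dist q z \<le> dist (fst q) (fst z) + dist (snd q) (snd z)"
      unfolding dist_prod_def using sqrt_sum_squares_le_sum[OF zero_le_dist zero_le_dist] by blast
    also have "\<dots> \<le> \<epsilon> / 3 + \<epsilon> / 3"
    proof (rule add_mono)
      have cl: "dist (max l (min t r)) t \<le> e" if "l - e \<le> t" "t \<le> r + e" "l \<le> r" "0 \<le> e" for l r t e :: real
        using that by (auto simp: dist_real_def max_def min_def)
      show "dist (fst q) (fst z) \<le> \<epsilon> / 3" "dist (snd q) (snd z) \<le> \<epsilon> / 3"
        unfolding q_def fst_conv snd_conv by (rule cl; use z \<epsilon>(1) assms in force)+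
    qed
    also have "\<dots> < \<epsilon>" using \<epsilon>(1) by simp
    finally have "z \<in> ball q \<epsilon>" by simp
    then show "z \<in> S" using \<epsilon>(2) q by blast
  qed
  then show ?thesis using \<epsilon>(1) by (intro exI[of _ "\<epsilon> / 3"]) auto
qed

text \<open>The du Bois-Reymond lemma is used once in each variable. For fixed
  \<open>\<alpha>\<close> it integrates the weak equation in y over {c..d}; the outcome, as an
  identity in \<open>\<alpha>\<close>, is again a weak equation, now in x, whose integration over
  {a..b} gives the fluxes through the vertical edges.\<close>

lemma weak_balance:
  fixes p T \<nu> :: "real^2"
  assumes fr: "orthoframe T \<nu>" and U: "open U" "open (U - \<gamma>)"
    and N: "continuous_on (U - \<gamma>) (normal_field u F)" and H: "continuous_on U H"
    and weak: "weak_solution U \<gamma> u F H"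
    and S: "open S" "frame_point p T \<nu> ` S \<subseteq> U - \<gamma>"
  defines "Z \<equiv> frame_point p T \<nu>"
  shows "balance_on S (\<lambda>z. normal_field u F (Z z) \<bullet> T) (\<lambda>z. normal_field u F (Z z) \<bullet> \<nu>) (\<lambda>z. H (Z z))"
  unfolding balance_on_def
proof (intro allI impI)
  fix a b c d :: real
  assume ab: "a < b" and cd: "c < d" and sub: "{a..b} \<times> {c..d} \<subseteq> S"
  define n1 n2 h where "n1 z = normal_field u F (Z z) \<bullet> T" and "n2 z = normal_field u F (Z z) \<bullet> \<nu>"
    and "h z = H (Z z)" for z
  have cont: "continuous_on S n1" "continuous_on S n2" "continuous_on S h"
    unfolding n1_def n2_def h_def Z_def using S(2)
    by (auto intro!: continuous_intros continuous_on_compose2[OF N] continuous_on_compose2[OF H] continuous_frame_point)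
  obtain e where e: "e > 0" "{a - e..b + e} \<times> {c - e..d + e} \<subseteq> S"
    using enlarge_rectangle[OF S(1) sub] ab cd by auto
  define a0 b0 c0 d0 where "a0 = a - e" and "b0 = b + e" and "c0 = c - e" and "d0 = d + e"
  let ?K = "{a0..b0} \<times> {c0..d0}"
  have K: "?K \<subseteq> S" using e by (simp add: a0_def b0_def c0_def d0_def)
  have ord: "a0 < a" "b < b0" "c0 < c" "d < d0" using e by (auto simp: a0_def b0_def c0_def d0_def)
  have cK: "continuous_on ?K n1" "continuous_on ?K n2" "continuous_on ?K h"
    using cont K by (auto intro: continuous_on_subset)
  have ZK: "Z w \<in> U - \<gamma>" if "w \<in> ?K" for w using S(2) K that by (auto simp: Z_def)
  have step1: "integral ?K (\<lambda>w. n1 w * (\<alpha>' (fst w) * \<beta> (snd w)) + n2 w * (\<alpha> (fst w) * \<beta>' (snd w))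
      + h w * (\<alpha> (fst w) * \<beta> (snd w))) = 0"
    if \<alpha>: "\<And>k. smooth_upto k \<alpha>" "\<And>x. (\<alpha> has_real_derivative \<alpha>' x) (at x)" "continuous_on UNIV \<alpha>'"
        "\<And>x. x \<notin> {a'..b'} \<Longrightarrow> \<alpha> x = 0" "a0 < a'" "b' < b0"
      and \<beta>: "\<And>k. smooth_upto k \<beta>" "\<And>x. (\<beta> has_real_derivative \<beta>' x) (at x)" "continuous_on UNIV \<beta>'"
        "\<And>x. x \<notin> {c'..d'} \<Longrightarrow> \<beta> x = 0" "c0 < c'" "d' < d0"
    for \<alpha> \<alpha>' \<beta> \<beta>' a' b' c' d'
  proof -
    let ?F1 = "\<lambda>w. n1 w * (\<alpha>' (fst w) * \<beta> (snd w)) + n2 w * (\<alpha> (fst w) * \<beta>' (snd w))"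
    let ?F2 = "\<lambda>w. h w * (\<alpha> (fst w) * \<beta> (snd w))"
    have "{a'..b'} \<times> {c'..d'} \<subseteq> ?K" using \<alpha> \<beta> by auto
    then have "frame_point p T \<nu> ` ({a'..b'} \<times> {c'..d'}) \<subseteq> U" using ZK by (auto simp: Z_def)
    from weak_tensor[OF fr U N H weak \<alpha>(1) \<beta>(1) \<alpha>(2) \<beta>(2) \<alpha>(3) \<beta>(3) \<alpha>(4) \<beta>(4) this, folded Z_def]
    have W: "(LINT w|lborel. indicator (U - \<gamma>) (Z w) * ?F1 w) + (LINT w|lborel. indicator U (Z w) * ?F2 w) = 0"
      by (simp add: n1_def n2_def h_def)
    have z: "?F1 w = 0 \<and> ?F2 w = 0" if "w \<notin> ?K" for w
    proof -
      from that have "fst w \<notin> {a'..b'} \<or> snd w \<notin> {c'..d'}" using \<alpha>(5,6) \<beta>(5,6) by (cases w) auto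
      then show ?thesis
      proof
        assume *: "fst w \<notin> {a'..b'}"
        then show ?thesis using deriv_outside_support[OF \<alpha>(2) \<alpha>(4) *] \<alpha>(4)[OF *] by simp
      next
        assume *: "snd w \<notin> {c'..d'}"
        then show ?thesis using deriv_outside_support[OF \<beta>(2) \<beta>(4) *] \<beta>(4)[OF *] by simp
      qed
    qed
    \<comment> \<open>Off the rectangle the test functions and their derivatives vanish, and on it
      \<open>Z\<close> has values in \<open>U - \<gamma>\<close>; the indicator of the region can be
      exchanged for that of the rectangle.\<close>
    have e1: "indicator (U - \<gamma>) (Z w) * ?F1 w = indicator ?K w * ?F1 w" for w
      using z[of w] ZK[of w] by (cases "w \<in> ?K") auto
    have e2: "indicator U (Z w) * ?F2 w = indicator ?K w * ?F2 w" for w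
      using z[of w] ZK[of w] by (cases "w \<in> ?K") auto
    have cc: "continuous_on ?K (\<lambda>w. q (fst w))" "continuous_on ?K (\<lambda>w. q (snd w))" if "continuous_on UNIV q" for q :: "real \<Rightarrow> real"
      by (rule continuous_on_compose2[OF that], auto intro!: continuous_intros)+
    have c1: "continuous_on ?K ?F1" and c2: "continuous_on ?K ?F2"
      by (intro continuous_intros cK cc \<alpha>(3) \<beta>(3) smooth_upto_continuous[OF \<alpha>(1)] smooth_upto_continuous[OF \<beta>(1)])+
    have "integral ?K ?F1 + integral ?K ?F2 = 0"
      using W unfolding e1 e2 using LINT_indicator_cbox(2)[of "(a0, c0)" "(b0, d0)" ?F1]
        LINT_indicator_cbox(2)[of "(a0, c0)" "(b0, d0)" ?F2] c1 c2 by (simp add: cbox_Pair)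
    moreover have "integral ?K (\<lambda>w. ?F1 w + ?F2 w) = integral ?K ?F1 + integral ?K ?F2"
      using c1 c2 by (intro Henstock_Kurzweil_Integration.integral_add)
        (auto simp: cbox_Pair[symmetric] intro: integrable_continuous)
    ultimately show ?thesis by simp
  qed
  \<comment> \<open>Integrated in y only: \<open>\<alpha>\<close> stays an arbitrary test function
    in x, ready for the second application.\<close>
  have step2: "integral {a0..b0} (\<lambda>x. n2 (x, d) * \<alpha> x) - integral {a0..b0} (\<lambda>x. n2 (x, c) * \<alpha> x)
      = integral {c..d} (\<lambda>y. integral {a0..b0} (\<lambda>x. n1 (x, y) * \<alpha>' x + h (x, y) * \<alpha> x))"
    if \<alpha>: "\<And>k. smooth_upto k \<alpha>" "\<And>x. (\<alpha> has_real_derivative \<alpha>' x) (at x)" "continuous_on UNIV \<alpha>'"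
        "\<And>x. x \<notin> {a'..b'} \<Longrightarrow> \<alpha> x = 0" "a0 < a'" "b' < b0" for \<alpha> \<alpha>' a' b'
  proof -
    have cc: "continuous_on ?K (\<lambda>w. q (fst w))" "continuous_on ?K (\<lambda>w. q (snd w))" if "continuous_on UNIV q" for q :: "real \<Rightarrow> real"
      by (rule continuous_on_compose2[OF that], auto intro!: continuous_intros)+
    have ca: "continuous_on UNIV \<alpha>" by (rule smooth_upto_continuous[OF \<alpha>(1)])
    let ?a = "\<lambda>w. n2 w * \<alpha> (fst w)" and ?b = "\<lambda>w. n1 w * \<alpha>' (fst w) + h w * \<alpha> (fst w)"
    have c: "continuous_on ?K ?a" "continuous_on ?K ?b" by (intro continuous_intros cK cc \<alpha>(3) ca)+
    have "integral {a0..b0} (\<lambda>x. ?a (x, d)) - integral {a0..b0} (\<lambda>x. ?a (x, c))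
        = integral {c..d} (\<lambda>y. integral {a0..b0} (\<lambda>x. ?b (x, y)))"
    proof (rule du_bois_reymond[OF continuous_section(3)[OF c(1)] continuous_section(3)[OF c(2)] _ ord(3) cd ord(4)])
      fix \<beta> \<beta>' c' d'
      assume \<beta>: "\<And>k. smooth_upto k \<beta>" "\<And>x. (\<beta> has_real_derivative \<beta>' x) (at x)"
        "c0 < c'" "d' < d0" "\<And>x. x \<notin> {c'..d'} \<Longrightarrow> \<beta> x = 0"
      have cb: "continuous_on UNIV \<beta>" by (rule smooth_upto_continuous[OF \<beta>(1)])
      have cb': "continuous_on UNIV \<beta>'"
      proof -
        obtain q where q: "\<And>x. (\<beta> has_real_derivative q x) (at x)" "continuous_on UNIV q"
          using \<beta>(1)[of "Suc 0"] by auto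
        have "\<beta>' = q" using DERIV_unique[OF \<beta>(2) q(1)] by auto
        then show ?thesis using q by simp
      qed
      let ?F = "\<lambda>w. n1 w * (\<alpha>' (fst w) * \<beta> (snd w)) + n2 w * (\<alpha> (fst w) * \<beta>' (snd w)) + h w * (\<alpha> (fst w) * \<beta> (snd w))"
      have cF: "continuous_on ?K ?F" by (intro continuous_intros cK cc \<alpha>(3) ca cb cb')
      have "0 = integral ?K ?F" using step1[OF \<alpha> \<beta>(1,2) cb' \<beta>(5,3,4)] by simp
      also have "\<dots> = integral {c0..d0} (\<lambda>y. integral {a0..b0} (\<lambda>x. ?F (x, y)))" by (rule continuous_section(6)[OF cF])
      also have "\<dots> = integral {c0..d0} (\<lambda>t. integral {a0..b0} (\<lambda>x. ?a (x, t)) * \<beta>' t + integral {a0..b0} (\<lambda>x. ?b (x, t)) * \<beta> t)"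
      proof (rule Henstock_Kurzweil_Integration.integral_cong)
        fix t assume t: "t \<in> {c0..d0}"
        have i: "(\<lambda>x. ?a (x, t)) integrable_on {a0..b0}" "(\<lambda>x. ?b (x, t)) integrable_on {a0..b0}"
          using continuous_section(1)[OF c(1) t] continuous_section(1)[OF c(2) t] by (auto intro: integrable_continuous_real)
        have "integral {a0..b0} (\<lambda>x. ?F (x, t)) = integral {a0..b0} (\<lambda>x. ?a (x, t) * \<beta>' t + ?b (x, t) * \<beta> t)"
          by (rule arg_cong[where f = "integral {a0..b0}"]) (auto simp: fun_eq_iff algebra_simps)
        also have "\<dots> = integral {a0..b0} (\<lambda>x. ?a (x, t) * \<beta>' t) + integral {a0..b0} (\<lambda>x. ?b (x, t) * \<beta> t)"
          by (intro Henstock_Kurzweil_Integration.integral_add integrable_on_mult_left i)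
        finally show "integral {a0..b0} (\<lambda>x. ?F (x, t))
            = integral {a0..b0} (\<lambda>x. ?a (x, t)) * \<beta>' t + integral {a0..b0} (\<lambda>x. ?b (x, t)) * \<beta> t"
          by simp
      qed
      finally show "integral {c0..d0} (\<lambda>t. integral {a0..b0} (\<lambda>x. ?a (x, t)) * \<beta>' t + integral {a0..b0} (\<lambda>x. ?b (x, t)) * \<beta> t) = 0"
        by simp
    qed
    then show ?thesis by simp
  qed
  let ?L = "{a0..b0} \<times> {c..d}"
  have cL: "continuous_on ?L n1" "continuous_on ?L n2" "continuous_on ?L h"
    using cK ord by (auto intro!: continuous_on_subset[OF cK(1)] continuous_on_subset[OF cK(2)] continuous_on_subset[OF cK(3)])
  have sec: "continuous_on {a0..b0} (\<lambda>x. n2 (x, y))" if "y \<in> {c..d}" for y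
    by (rule continuous_section(1)[OF cL(2) that])
  let ?A = "\<lambda>x. integral {c..d} (\<lambda>y. n1 (x, y))"
  let ?B = "\<lambda>x. integral {c..d} (\<lambda>y. h (x, y)) - (n2 (x, d) - n2 (x, c))"
  have cA: "continuous_on {a0..b0} ?A" by (rule continuous_section(4)[OF cL(1)])
  have cB: "continuous_on {a0..b0} ?B"
    using cd by (intro continuous_intros continuous_section(4)[OF cL(3)] sec) auto
  \<comment> \<open>Second application, in x: \<open>?A\<close> is the horizontal flux through a
    vertical segment, and \<open>?B\<close> is the integral of \<open>h\<close> on it minus the
    vertical fluxes at its ends.\<close>
  have "?A b - ?A a = integral {a..b} ?B"
  proof (rule du_bois_reymond[OF cA cB _ ord(1) ab ord(2)])
    fix \<alpha> \<alpha>' a' b'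
    assume \<alpha>: "\<And>k. smooth_upto k \<alpha>" "\<And>x. (\<alpha> has_real_derivative \<alpha>' x) (at x)"
      "a0 < a'" "b' < b0" "\<And>x. x \<notin> {a'..b'} \<Longrightarrow> \<alpha> x = 0"
    have ca: "continuous_on S \<alpha>" for S using smooth_upto_continuous[OF \<alpha>(1)] continuous_on_subset by blast
    have ca': "continuous_on UNIV \<alpha>'"
    proof -
      obtain q where q: "\<And>x. (\<alpha> has_real_derivative q x) (at x)" "continuous_on UNIV q"
        using \<alpha>(1)[of "Suc 0"] by auto
      have "\<alpha>' = q" using DERIV_unique[OF \<alpha>(2) q(1)] by auto
      then show ?thesis using q by simp
    qed
    then have ca'': "continuous_on S \<alpha>'" for S using continuous_on_subset by blast
    let ?g = "\<lambda>w. n1 w * \<alpha>' (fst w) + h w * \<alpha> (fst w)"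
    have cg: "continuous_on ?L ?g"
      by (intro continuous_intros cL continuous_on_compose2[OF ca[of UNIV]] continuous_on_compose2[OF ca']) auto
    have i: "(\<lambda>y. n1 (x, y)) integrable_on {c..d}" "(\<lambda>y. h (x, y)) integrable_on {c..d}" if "x \<in> {a0..b0}" for x
      using continuous_section(2)[OF cL(1) that] continuous_section(2)[OF cL(3) that] by (auto intro: integrable_continuous_real)
    have "integral {a0..b0} (\<lambda>x. n2 (x, d) * \<alpha> x) - integral {a0..b0} (\<lambda>x. n2 (x, c) * \<alpha> x)
      = integral {c..d} (\<lambda>y. integral {a0..b0} (\<lambda>x. ?g (x, y)))"
      using step2[OF \<alpha>(1,2) ca' \<alpha>(5,3,4)] by simp
    also have "\<dots> = integral {a0..b0} (\<lambda>x. integral {c..d} (\<lambda>y. ?g (x, y)))"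
      by (rule continuous_section(5)[OF cg, symmetric])
    also have "\<dots> = integral {a0..b0} (\<lambda>x. ?A x * \<alpha>' x + integral {c..d} (\<lambda>y. h (x, y)) * \<alpha> x)"
    proof (rule Henstock_Kurzweil_Integration.integral_cong)
      fix x assume x: "x \<in> {a0..b0}"
      show "integral {c..d} (\<lambda>y. ?g (x, y)) = ?A x * \<alpha>' x + integral {c..d} (\<lambda>y. h (x, y)) * \<alpha> x"
        using Henstock_Kurzweil_Integration.integral_add[OF integrable_on_mult_left[OF i(1)[OF x], of "\<alpha>' x"] integrable_on_mult_left[OF i(2)[OF x], of "\<alpha> x"]]
        by simp
    qed
    finally have E: "integral {a0..b0} (\<lambda>x. n2 (x, d) * \<alpha> x) - integral {a0..b0} (\<lambda>x. n2 (x, c) * \<alpha> x)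
      = integral {a0..b0} (\<lambda>x. ?A x * \<alpha>' x + integral {c..d} (\<lambda>y. h (x, y)) * \<alpha> x)" .
    have j: "(\<lambda>x. n2 (x, d) * \<alpha> x) integrable_on {a0..b0}" "(\<lambda>x. n2 (x, c) * \<alpha> x) integrable_on {a0..b0}"
      "(\<lambda>x. ?A x * \<alpha>' x + integral {c..d} (\<lambda>y. h (x, y)) * \<alpha> x) integrable_on {a0..b0}"
      using cd by (auto intro!: integrable_continuous_real continuous_on_mult continuous_on_add sec ca ca'' cA continuous_section(4)[OF cL(3)])
    have "integral {a0..b0} (\<lambda>x. ?A x * \<alpha>' x + ?B x * \<alpha> x)
      = integral {a0..b0} (\<lambda>x. (?A x * \<alpha>' x + integral {c..d} (\<lambda>y. h (x, y)) * \<alpha> x) - (n2 (x, d) * \<alpha> x - n2 (x, c) * \<alpha> x))"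
      by (rule arg_cong[where f = "integral {a0..b0}"]) (auto simp: fun_eq_iff algebra_simps)
    also have "\<dots> = integral {a0..b0} (\<lambda>x. ?A x * \<alpha>' x + integral {c..d} (\<lambda>y. h (x, y)) * \<alpha> x)
      - (integral {a0..b0} (\<lambda>x. n2 (x, d) * \<alpha> x) - integral {a0..b0} (\<lambda>x. n2 (x, c) * \<alpha> x))"
      unfolding Henstock_Kurzweil_Integration.integral_diff[OF j(1,2), symmetric]
      by (rule Henstock_Kurzweil_Integration.integral_diff[OF j(3) integrable_diff[OF j(1,2)]])
    also have "\<dots> = 0" using E by simp
    finally show "integral {a0..b0} (\<lambda>x. ?A x * \<alpha>' x + ?B x * \<alpha> x) = 0" .
  qed
  moreover have "?A b - ?A a = integral {c..d} (\<lambda>y. n1 (b, y) - n1 (a, y))"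
    using ab ord by (intro Henstock_Kurzweil_Integration.integral_diff[symmetric] integrable_continuous_real continuous_section(2)[OF cL(1)]) auto
  moreover have "integral {a..b} ?B = integral {a..b} (\<lambda>x. integral {c..d} (\<lambda>y. h (x, y))) - integral {a..b} (\<lambda>x. n2 (x, d) - n2 (x, c))"
    using ab ord cd by (intro Henstock_Kurzweil_Integration.integral_diff integrable_continuous_real continuous_on_diff
      continuous_on_subset[OF continuous_section(4)[OF cL(3)]] continuous_on_subset[OF sec]) auto
  moreover have "integral {a..b} (\<lambda>x. integral {c..d} (\<lambda>y. h (x, y))) = integral {c..d} (\<lambda>y. integral {a..b} (\<lambda>x. h (x, y)))"
    using ord by (intro continuous_section(5) continuous_on_subset[OF cL(3)]) auto
  ultimately show "integral {c..d} (\<lambda>y. normal_field u F (Z (b, y)) \<bullet> T - normal_field u F (Z (a, y)) \<bullet> T) +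
      integral {a..b} (\<lambda>x. normal_field u F (Z (x, d)) \<bullet> \<nu> - normal_field u F (Z (x, c)) \<bullet> \<nu>) =
      integral {c..d} (\<lambda>y. integral {a..b} (\<lambda>x. H (Z (x, y))))"
    unfolding n1_def n2_def h_def by simp
qed

section \<open>The jump condition\<close>

lemma lborel_integral_scale:
  fixes g :: "real \<times> real \<Rightarrow> real"
  assumes e: "0 < e" and g: "g \<in> borel_measurable borel"
  shows "(LINT w|lborel. g w) = e\<^sup>2 * (LINT v|lborel. g (e *\<^sub>R v))"
proof -
  have m: "(\<lambda>x::real \<times> real. 0 + e *\<^sub>R x) \<in> measurable lborel borel" by simp
  have "(LINT w|lborel. g w) = (LINT w|density (distr lborel borel (\<lambda>x::real \<times> real. 0 + e *\<^sub>R x)) (\<lambda>_. ennreal (e\<^sup>2)). g w)"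
  proof -
    have "e \<noteq> 0" using e by simp
    from lborel_affine[OF this, of "0 :: real \<times> real"] have "(lborel :: (real \<times> real) measure)
        = density (distr lborel borel (\<lambda>x::real \<times> real. 0 + e *\<^sub>R x)) (\<lambda>_. ennreal (e\<^sup>2))"
      by (simp only: DIM_prod DIM_real one_add_one power2_abs)
    then show ?thesis by (rule arg_cong[where f = "\<lambda>M. integral\<^sup>L M g"])
  qed
  also have "\<dots> = (LINT w|distr lborel borel (\<lambda>x::real \<times> real. 0 + e *\<^sub>R x). e\<^sup>2 *\<^sub>R g w)"
    using g by (subst integral_density) auto
  also have "\<dots> = (LINT v|lborel. e\<^sup>2 * g (0 + e *\<^sub>R v))"
    using g m by (subst integral_distr) auto
  finally show ?thesis by simp
qed

text \<open>Off this line a rescaled point lies eventually on one definite side of the curve, which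
  gives convergence almost everywhere in the blow-up.\<close>

lemma AE_snd_nonzero: "AE v in (lborel :: (real \<times> real) measure). snd v \<noteq> 0"
proof -
  let ?S = "{v :: real \<times> real. v \<bullet> (0, 1) = 0}"
  have "negligible ?S" by (rule negligible_standard_hyperplane) (simp add: Basis_prod_def)
  then have "?S \<in> null_sets lebesgue" by (simp add: negligible_iff_null_sets)
  moreover have "?S \<in> sets borel" by (intro borel_closed closed_Collect_eq continuous_intros)
  ultimately have "?S \<in> null_sets lborel"
    by (auto simp: null_sets_def)
  then have "AE v in lborel. v \<notin> ?S" by (rule AE_not_in)
  then show ?thesis by (simp add: inner_prod_def)
qed

text \<open>The derivative of the bump integrates to 0 over its support in x, so the tangential
  coefficient \<open>c1\<close> drops out. This is why the weak equation constrains only the normal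
  component across the curve.\<close>

lemma integral_bump_quadrant:
  fixes b' :: "real \<Rightarrow> real"
  assumes d: "\<And>x. (bump has_real_derivative b' x) (at x)" and c: "continuous_on UNIV b'" and pq: "p \<le> q"
  shows "integral (cbox (-1, p) (1, q)) (\<lambda>v. c1 * (b' (fst v) * bump (snd v)) + c2 * (bump (fst v) * b' (snd v)))
    = c2 * (integral {-1..1} bump * (bump q - bump p))"
proof -
  have F: "(b' has_integral bump t - bump s) {s..t}" if "s \<le> t" for s t
    using that d[THEN has_field_derivative_at_within, unfolded has_real_derivative_iff_has_vector_derivative]
    by (intro fundamental_theorem_of_calculus) auto
  let ?g = "\<lambda>v. c1 * (b' (fst v) * bump (snd v)) + c2 * (bump (fst v) * b' (snd v))"
  have "continuous_on (cbox (-1, p) (1, q)) ?g"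
    by (intro continuous_intros continuous_on_compose2[OF c] continuous_on_compose2[OF continuous_bump[of UNIV]]) auto
  then have "integral (cbox (-1, p) (1, q)) ?g = integral {-1..1} (\<lambda>x. integral {p..q} (\<lambda>y. ?g (x, y)))"
    by (simp only: integral_prod_continuous box_real)
  also have "\<dots> = integral {-1..1} (\<lambda>x. (c1 * integral {p..q} bump) * b' x + (c2 * (bump q - bump p)) * bump x)"
  proof (rule Henstock_Kurzweil_Integration.integral_cong)
    fix x :: real
    have "((\<lambda>y. c1 * b' x * bump y + c2 * bump x * b' y) has_integral
        c1 * b' x * integral {p..q} bump + c2 * bump x * (bump q - bump p)) {p..q}"
      by (intro has_integral_add has_integral_mult_right F pq integrable_integral integrable_continuous_real continuous_bump)
    then show "integral {p..q} (\<lambda>y. ?g (x, y)) = (c1 * integral {p..q} bump) * b' x + (c2 * (bump q - bump p)) * bump x"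
      by (simp add: integral_unique algebra_simps)
  qed
  also have "\<dots> = (c1 * integral {p..q} bump) * (bump 1 - bump (-1)) + (c2 * (bump q - bump p)) * integral {-1..1} bump"
    by (intro integral_unique has_integral_add has_integral_mult_right F integrable_integral integrable_continuous_real continuous_bump) simp
  finally show ?thesis using bump_props(3)[of 1] bump_props(3)[of "-1"] by simp
qed

text \<open>Where the vector vanishes the quotient is 0 by the convention for division by zero. So
  the bound holds at every point, also on the curve, and can serve as a global majorant.\<close>

lemma norm_normal_field_le_1: "norm (normal_field u F z) \<le> 1"
  by (cases "grad u z + F z = 0") (auto simp: normal_field_def)

text \<open>Bumps concentrated at scale \<epsilon> around p make the gradient term larger than the
  \<open>H\<close> term by a factor 1 / \<epsilon>. After rescaling, only the gradient term
  survives, with \<open>N\<close> frozen at its one-sided limits on the two halves of a square. The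
  tangential parts integrate to zero and the normal parts to (N2 - N1) . \<nu> times a positive
  constant.\<close>

lemma normal_jump:
  fixes p T \<nu> :: "real^2"
  assumes fr: "orthoframe T \<nu>" and U: "open U" "open (U - \<gamma>)"
    and N: "continuous_on (U - \<gamma>) (normal_field u F)" and H: "continuous_on U H"
    and weak: "weak_solution U \<gamma> u F H"
    and r: "0 < r"
    and up: "\<And>x y. \<bar>x\<bar> < r \<Longrightarrow> \<bar>y\<bar> < r \<Longrightarrow> f x < y \<Longrightarrow> frame_point p T \<nu> (x, y) \<in> W1"
    and dn: "\<And>x y. \<bar>x\<bar> < r \<Longrightarrow> \<bar>y\<bar> < r \<Longrightarrow> y < f x \<Longrightarrow> frame_point p T \<nu> (x, y) \<in> W2"
    and W: "W1 \<subseteq> U - \<gamma>" "W2 \<subseteq> U - \<gamma>"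
    and inU: "\<And>x y. \<bar>x\<bar> < r \<Longrightarrow> \<bar>y\<bar> < r \<Longrightarrow> frame_point p T \<nu> (x, y) \<in> U"
    and f: "(f has_real_derivative 0) (at 0)" "f 0 = 0"
    and lim: "(normal_field u F \<longlongrightarrow> N1) (at p within W1)" "(normal_field u F \<longlongrightarrow> N2) (at p within W2)"
  shows "N1 \<bullet> \<nu> = N2 \<bullet> \<nu>"
proof -
  define Z where "Z = frame_point p T \<nu>"
  let ?N = "normal_field u F"
  obtain b' where b': "\<And>x. (bump has_real_derivative b' x) (at x)" "continuous_on UNIV b'"
    using smooth_bump[of "Suc 0"] by auto
  have b0: "bump x = 0" "b' x = 0" if "x \<notin> {-1..1}" for x
  proof -
    have z: "bump x = 0" if "x \<notin> {-1..1}" for x using bump_props(3)[of x] that by auto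
    then show "bump x = 0" using that by blast
    show "b' x = 0" by (rule deriv_outside_support[OF b'(1) z that])
  qed
  define \<epsilon> where "\<epsilon> n = r / (2 * real (Suc n))" for n
  have \<epsilon>0: "0 < \<epsilon> n" "\<epsilon> n \<le> r / 2" for n
    using r by (auto simp: \<epsilon>_def divide_simps)
  have \<epsilon>lim: "\<epsilon> \<longlonglongrightarrow> 0"
  proof -
    have "(\<lambda>n. r / 2 * inverse (real (Suc n))) \<longlonglongrightarrow> r / 2 * 0"
      by (rule tendsto_mult[OF tendsto_const LIMSEQ_inverse_real_of_nat])
    moreover have "\<epsilon> = (\<lambda>n. r / 2 * inverse (real (Suc n)))"
      unfolding \<epsilon>_def[abs_def] by (simp only: inverse_eq_divide times_divide_times_eq mult_1_right)
    ultimately show ?thesis by (simp only: mult_zero_right)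
  qed
  have ZU: "Z v \<in> U" if "\<bar>fst v\<bar> < r" "\<bar>snd v\<bar> < r" for v
    using inU[of "fst v" "snd v"] that by (simp add: Z_def)
  define G where "G = Z -` (U - \<gamma>)"
  define G' where "G' = Z -` U"
  have oG: "open G" "open G'" unfolding G_def G'_def Z_def
    using U continuous_frame_point by (auto intro: open_vimage)
  have cN: "continuous_on G (\<lambda>w. ?N (Z w))" and cH: "continuous_on G' (\<lambda>w. H (Z w))"
    by (rule continuous_on_compose2[OF N], auto simp: Z_def G_def intro: continuous_frame_point,
        rule continuous_on_compose2[OF H], auto simp: Z_def G'_def intro: continuous_frame_point)
  have ccomp: "continuous_on S (\<lambda>w. q (s * fst w))" "continuous_on S (\<lambda>w. q (s * snd w))" if "continuous_on UNIV q"
    for q :: "real \<Rightarrow> real" and s and S :: "(real \<times> real) set"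
    by (rule continuous_on_compose2[OF that], auto intro!: continuous_intros)+
  note cbump = continuous_bump[of UNIV]
  \<comment> \<open>The factor 1 / e from differentiating the bump is left out; cleared from the
    equation, it reappears as the factor \<epsilon> in front of \<open>k\<close>.\<close>
  define g where "g e w = indicator (U - \<gamma>) (Z w) * ((?N (Z w) \<bullet> T) * (b' (1 / e * fst w) * bump (1 / e * snd w))
      + (?N (Z w) \<bullet> \<nu>) * (bump (1 / e * fst w) * b' (1 / e * snd w)))" for e w
  define k where "k e w = indicator U (Z w) * (H (Z w) * (bump (1 / e * fst w) * bump (1 / e * snd w)))" for e w
  have gm: "g e \<in> borel_measurable borel" for e
  proof -
    have "(\<lambda>w. indicator G w *\<^sub>R ((?N (Z w) \<bullet> T) * (b' (1 / e * fst w) * bump (1 / e * snd w))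
      + (?N (Z w) \<bullet> \<nu>) * (bump (1 / e * fst w) * b' (1 / e * snd w)))) \<in> borel_measurable borel"
      by (intro borel_measurable_continuous_on_indicator borel_open oG continuous_intros cN ccomp cbump b'(2))
    then show ?thesis by (simp add: g_def[abs_def] G_def indicator_vimage)
  qed
  have km: "k e \<in> borel_measurable borel" for e
  proof -
    have "(\<lambda>w. indicator G' w *\<^sub>R (H (Z w) * (bump (1 / e * fst w) * bump (1 / e * snd w)))) \<in> borel_measurable borel"
      by (intro borel_measurable_continuous_on_indicator borel_open oG continuous_intros cH ccomp cbump)
    then show ?thesis by (simp add: k_def[abs_def] G'_def indicator_vimage)
  qed
  have W0: "(LINT w|lborel. g (\<epsilon> n) w) + \<epsilon> n * (LINT w|lborel. k (\<epsilon> n) w) = 0" for n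
  proof -
    let ?e = "\<epsilon> n"
    let ?\<alpha> = "\<lambda>x. bump (1 / ?e * x)" and ?\<alpha>' = "\<lambda>x. b' (1 / ?e * x) * (1 / ?e)"
    have sm: "smooth_upto k ?\<alpha>" for k using smooth_upto_affine[OF smooth_bump, of k "1 / ?e" 0] by simp
    have d: "(?\<alpha> has_real_derivative ?\<alpha>' x) (at x)" for x
      by (rule DERIV_chain2[OF b'(1)]) (use \<epsilon>0(1)[of n] in \<open>auto intro!: derivative_eq_intros\<close>)
    have c: "continuous_on UNIV ?\<alpha>'"
      by (intro continuous_intros continuous_on_compose2[OF b'(2)]) auto
    have s: "?\<alpha> x = 0" if "x \<notin> {- ?e..?e}" for x
      using that \<epsilon>0(1)[of n] by (intro b0(1)) (auto simp: field_simps)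
    have "frame_point p T \<nu> ` ({- ?e..?e} \<times> {- ?e..?e}) \<subseteq> U"
      using ZU \<epsilon>0[of n] r by (auto simp: Z_def)
    from weak_tensor[OF fr U N H weak sm sm d d c c s s this, folded Z_def]
    have "(LINT w|lborel. g ?e w * (1 / ?e)) + (LINT w|lborel. k ?e w) = 0"
      by (simp add: g_def k_def algebra_simps)
    then have "(LINT w|lborel. g ?e w) * (1 / ?e) + (LINT w|lborel. k ?e w) = 0" by simp
    then show ?thesis using \<epsilon>0(1)[of n] by (simp add: field_simps)
  qed
  define K where "K n v = g (\<epsilon> n) (\<epsilon> n *\<^sub>R v)" for n v
  define R where "R n v = \<epsilon> n * k (\<epsilon> n) (\<epsilon> n *\<^sub>R v)" for n v
  have KR: "(LINT v|lborel. K n v) + (LINT v|lborel. R n v) = 0" for n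
  proof -
    have "(\<epsilon> n)\<^sup>2 * ((LINT v|lborel. K n v) + (LINT v|lborel. R n v)) = 0"
      using W0[of n] unfolding lborel_integral_scale[OF \<epsilon>0(1)[of n] gm] lborel_integral_scale[OF \<epsilon>0(1)[of n] km]
      by (simp add: K_def R_def algebra_simps)
    then show ?thesis using \<epsilon>0(1)[of n] by simp
  qed
  let ?Q = "cbox (-1, -1) (1, 1) :: (real \<times> real) set"
  have Kv: "K n v = indicator (U - \<gamma>) (Z (\<epsilon> n *\<^sub>R v)) * ((?N (Z (\<epsilon> n *\<^sub>R v)) \<bullet> T) * (b' (fst v) * bump (snd v))
      + (?N (Z (\<epsilon> n *\<^sub>R v)) \<bullet> \<nu>) * (bump (fst v) * b' (snd v)))" for n v
    using \<epsilon>0(1)[of n] by (simp add: K_def g_def)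
  have Rv: "R n v = \<epsilon> n * (indicator U (Z (\<epsilon> n *\<^sub>R v)) * (H (Z (\<epsilon> n *\<^sub>R v)) * (bump (fst v) * bump (snd v))))" for n v
    using \<epsilon>0(1)[of n] by (simp add: R_def k_def)
  have out: "b' (fst v) * bump (snd v) = 0 \<and> bump (fst v) * b' (snd v) = 0 \<and> bump (fst v) * bump (snd v) = 0" if "v \<notin> ?Q" for v
    using that b0[of "fst v"] b0[of "snd v"] by (cases v) (auto simp: cbox_Pair)
  have outK: "K n v = 0" "R n v = 0" if "v \<notin> ?Q" for n v
  proof -
    note o = out[OF that, THEN conjunct1] out[OF that, THEN conjunct2, THEN conjunct1] out[OF that, THEN conjunct2, THEN conjunct2]
    show "K n v = 0" "R n v = 0" unfolding Kv Rv o by simp_all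
  qed
  have scale_m: "(\<lambda>v::real \<times> real. s *\<^sub>R v) \<in> borel_measurable borel" for s by simp
  have Km: "K n \<in> borel_measurable lborel" for n
    unfolding K_def[abs_def] using measurable_compose[OF scale_m gm] by simp
  have Rm: "R n \<in> borel_measurable lborel" for n
    unfolding R_def[abs_def] using measurable_compose[OF scale_m km] by (intro borel_measurable_times) auto
  \<comment> \<open>The limit integrand. Since \<open>f' 0 = 0\<close>, the rescaled regions above
    and below the curve tend to the two halves of the square.\<close>
  define L where "L v = indicator (cbox (-1, 0) (1, 1)) v * ((N1 \<bullet> T) * (b' (fst v) * bump (snd v)) + (N1 \<bullet> \<nu>) * (bump (fst v) * b' (snd v)))
    + indicator (cbox (-1, -1) (1, 0)) v * ((N2 \<bullet> T) * (b' (fst v) * bump (snd v)) + (N2 \<bullet> \<nu>) * (bump (fst v) * b' (snd v)))"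
    for v :: "real \<times> real"
  have ctens: "continuous_on S (\<lambda>v. c1 * (b' (fst v) * bump (snd v)) + c2 * (bump (fst v) * b' (snd v)))" for c1 c2 and S :: "(real \<times> real) set"
    by (intro continuous_intros continuous_on_compose2[OF b'(2)] continuous_on_compose2[OF cbump]) auto
  have Lint: "integrable lborel (\<lambda>v. indicator (cbox p q) v * (c1 * (b' (fst v) * bump (snd v)) + c2 * (bump (fst v) * b' (snd v))))"
    for p q :: "real \<times> real" and c1 c2
    by (rule LINT_indicator_cbox(1)[OF ctens])
  have Lm: "L \<in> borel_measurable lborel"
    unfolding L_def[abs_def] by (intro borel_measurable_add borel_measurable_integrable Lint)
  have eps_at: "filterlim \<epsilon> (at 0) sequentially"
    unfolding filterlim_at using \<epsilon>lim \<epsilon>0(1) by (auto intro!: always_eventually simp: less_imp_neq[symmetric])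
  \<comment> \<open>This is the derivative of f at 0, taken along the ray of slope x; the curve
    flattens to the line where the second coordinate is 0.\<close>
  have fsmall: "(\<lambda>n. f (x * \<epsilon> n) / \<epsilon> n) \<longlonglongrightarrow> 0" for x
  proof -
    have "((\<lambda>t. x * t) has_real_derivative x) (at 0)" by (auto intro!: derivative_eq_intros)
    moreover have "(f has_real_derivative 0) (at (x * 0))" using f by simp
    ultimately have "((\<lambda>t. f (x * t)) has_real_derivative 0 * x) (at 0)" by (rule DERIV_chain2[rotated])
    then have "((\<lambda>h. f (x * h) / h) \<longlongrightarrow> 0) (at 0)" by (simp add: DERIV_def f)
    from filterlim_compose[OF this eps_at] show ?thesis .
  qed
  have Zlim: "(\<lambda>n. Z (\<epsilon> n *\<^sub>R v)) \<longlonglongrightarrow> p" for v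
  proof -
    have "(\<lambda>n. p + (\<epsilon> n * fst v) *\<^sub>R T + (\<epsilon> n * snd v) *\<^sub>R \<nu>) \<longlonglongrightarrow> p + (0 * fst v) *\<^sub>R T + (0 * snd v) *\<^sub>R \<nu>"
      by (intro tendsto_intros \<epsilon>lim)
    then show ?thesis by (simp add: Z_def frame_point_def)
  qed
  have Zne: "Z (\<epsilon> n *\<^sub>R v) \<noteq> p" if "snd v \<noteq> 0" for n v
    using frame_point_coords(2)[OF fr, of p "\<epsilon> n *\<^sub>R v"] that \<epsilon>0(1)[of n] by (auto simp: Z_def)
  have small: "\<bar>\<epsilon> n * t\<bar> < r" if "t \<in> {-1..1}" for n t
  proof -
    have "\<bar>\<epsilon> n * t\<bar> \<le> (r / 2) * 1" unfolding abs_mult using \<epsilon>0[of n] that by (intro mult_mono) auto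
    then show ?thesis using r by simp
  qed
  have ptw: "(\<lambda>n. K n v) \<longlonglongrightarrow> L v" if v: "snd v \<noteq> 0" for v
  proof (cases "v \<in> ?Q")
    case False
    then have "v \<notin> cbox (-1, 0) (1, 1)" "v \<notin> cbox (-1, -1) (1, 0)" by (auto simp: cbox_Pair)
    then show ?thesis using outK[OF False] by (simp add: L_def)
  next
    case True
    then have xy: "fst v \<in> {-1..1}" "snd v \<in> {-1..1}" by (auto simp: cbox_Pair)
    have *: "(\<lambda>n. K n v) \<longlonglongrightarrow> (N0 \<bullet> T) * (b' (fst v) * bump (snd v)) + (N0 \<bullet> \<nu>) * (bump (fst v) * b' (snd v))"
      if W0: "W0 \<subseteq> U - \<gamma>" "(?N \<longlongrightarrow> N0) (at p within W0)" "\<forall>\<^sub>F n in sequentially. Z (\<epsilon> n *\<^sub>R v) \<in> W0" for W0 N0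
    proof -
      have "filterlim (\<lambda>n. Z (\<epsilon> n *\<^sub>R v)) (at p within W0) sequentially"
        unfolding filterlim_at using Zlim W0(3) Zne[OF v] by (auto elim: eventually_mono)
      from filterlim_compose[OF W0(2) this] have "(\<lambda>n. ?N (Z (\<epsilon> n *\<^sub>R v))) \<longlonglongrightarrow> N0" .
      then have "(\<lambda>n. (?N (Z (\<epsilon> n *\<^sub>R v)) \<bullet> T) * (b' (fst v) * bump (snd v)) + (?N (Z (\<epsilon> n *\<^sub>R v)) \<bullet> \<nu>) * (bump (fst v) * b' (snd v)))
        \<longlonglongrightarrow> (N0 \<bullet> T) * (b' (fst v) * bump (snd v)) + (N0 \<bullet> \<nu>) * (bump (fst v) * b' (snd v))"
        by (intro tendsto_intros)
      then show ?thesis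
        by (rule Lim_transform_eventually) (use W0(3) W0(1) in \<open>auto elim!: eventually_mono simp: Kv\<close>)
    qed
    have ev: "\<forall>\<^sub>F n in sequentially. \<bar>f (fst v * \<epsilon> n) / \<epsilon> n\<bar> < \<bar>snd v\<bar>"
      using tendstoD[OF fsmall[of "fst v"], of "\<bar>snd v\<bar>"] v by (simp add: dist_real_def)
    show ?thesis
    proof (cases "0 < snd v")
      case True
      have "\<forall>\<^sub>F n in sequentially. Z (\<epsilon> n *\<^sub>R v) \<in> W1"
        using ev
      proof eventually_elim
        case (elim n)
        then have "f (fst v * \<epsilon> n) / \<epsilon> n < snd v" using True by linarith
        then have "f (\<epsilon> n * fst v) < \<epsilon> n * snd v" using \<epsilon>0(1)[of n] by (simp add: pos_divide_less_eq mult.commute)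
        from up[OF small[OF xy(1)] small[OF xy(2)] this] show ?case by (simp add: Z_def scaleR_prod_def)
      qed
      from *[OF W(1) lim(1) this] show ?thesis using True xy by (simp add: L_def cbox_Pair mem_Times_iff)
    next
      case False
      have "\<forall>\<^sub>F n in sequentially. Z (\<epsilon> n *\<^sub>R v) \<in> W2"
        using ev
      proof eventually_elim
        case (elim n)
        then have "snd v < f (fst v * \<epsilon> n) / \<epsilon> n" using False by linarith
        then have "\<epsilon> n * snd v < f (\<epsilon> n * fst v)" using \<epsilon>0(1)[of n] by (simp add: pos_less_divide_eq mult.commute)
        from dn[OF small[OF xy(1)] small[OF xy(2)] this] show ?case by (simp add: Z_def scaleR_prod_def)
      qed
      from *[OF W(2) lim(2) this] show ?thesis using False v xy by (simp add: L_def cbox_Pair mem_Times_iff)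
    qed
  qed
  have NT: "\<bar>?N z \<bullet> w\<bar> \<le> 1" if "w \<bullet> w = 1" for z w
  proof -
    have "norm w = 1" using that by (simp add: norm_eq_sqrt_inner)
    then have "\<bar>?N z \<bullet> w\<bar> \<le> norm (?N z) * 1" using Cauchy_Schwarz_ineq2[of "?N z" w] by simp
    then show ?thesis using norm_normal_field_le_1[of u F z] by linarith
  qed
  have limK: "(\<lambda>n. LINT v|lborel. K n v) \<longlonglongrightarrow> (LINT v|lborel. L v)"
  proof (rule integral_dominated_convergence[OF Lm Km])
    show "integrable lborel (\<lambda>v. indicator ?Q v * (\<bar>b' (fst v) * bump (snd v)\<bar> + \<bar>bump (fst v) * b' (snd v)\<bar>))"
      by (intro LINT_indicator_cbox(1) continuous_intros continuous_on_compose2[OF b'(2)] continuous_on_compose2[OF cbump]) auto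
    show "AE v in lborel. (\<lambda>n. K n v) \<longlonglongrightarrow> L v"
      using AE_snd_nonzero by eventually_elim (rule ptw)
    show "AE v in lborel. norm (K n v) \<le> indicator ?Q v * (\<bar>b' (fst v) * bump (snd v)\<bar> + \<bar>bump (fst v) * b' (snd v)\<bar>)" for n
    proof (rule AE_I2)
      fix v
      show "norm (K n v) \<le> indicator ?Q v * (\<bar>b' (fst v) * bump (snd v)\<bar> + \<bar>bump (fst v) * b' (snd v)\<bar>)"
      proof (cases "v \<in> ?Q")
        case False then show ?thesis using outK[OF False] by simp
      next
        case True
        let ?z = "Z (\<epsilon> n *\<^sub>R v)"
        have "\<bar>K n v\<bar> \<le> 1 * \<bar>(?N ?z \<bullet> T) * (b' (fst v) * bump (snd v)) + (?N ?z \<bullet> \<nu>) * (bump (fst v) * b' (snd v))\<bar>"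
          unfolding Kv abs_mult by (intro mult_right_mono) (auto simp: indicator_def)
        also have "\<dots> \<le> \<bar>?N ?z \<bullet> T\<bar> * \<bar>b' (fst v) * bump (snd v)\<bar> + \<bar>?N ?z \<bullet> \<nu>\<bar> * \<bar>bump (fst v) * b' (snd v)\<bar>"
          unfolding mult_1 abs_mult[symmetric] by (rule abs_triangle_ineq)
        also have "\<dots> \<le> 1 * \<bar>b' (fst v) * bump (snd v)\<bar> + 1 * \<bar>bump (fst v) * b' (snd v)\<bar>"
          using fr by (intro add_mono mult_right_mono NT) (auto simp: orthoframe_def)
        finally show ?thesis using True by simp
      qed
    qed
  qed
  \<comment> \<open>\<open>H\<close> is bounded near p, so the lower-order term is dominated by
    \<epsilon> times a fixed integrable function.\<close>
  have limR: "(\<lambda>n. LINT v|lborel. R n v) \<longlonglongrightarrow> integral\<^sup>L lborel (\<lambda>_::real \<times> real. 0::real)"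
  proof -
    have cZ: "compact (Z ` cbox (- r / 2, - r / 2) (r / 2, r / 2))"
      unfolding Z_def by (intro compact_continuous_image continuous_frame_point compact_cbox)
    have sub: "Z ` cbox (- r / 2, - r / 2) (r / 2, r / 2) \<subseteq> U"
      using ZU r by (auto simp: cbox_Pair abs_less_iff)
    have "bounded (H ` Z ` cbox (- r / 2, - r / 2) (r / 2, r / 2))"
      by (rule compact_imp_bounded[OF compact_continuous_image[OF continuous_on_subset[OF H sub] cZ]])
    then obtain M where M: "\<And>w. w \<in> cbox (- r / 2, - r / 2) (r / 2, r / 2) \<Longrightarrow> \<bar>H (Z w)\<bar> \<le> M"
      unfolding bounded_iff by auto
    have HM: "\<bar>H (Z (\<epsilon> n *\<^sub>R v))\<bar> \<le> M" if "v \<in> ?Q" for n v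
    proof (rule M)
      have bt: "\<bar>\<epsilon> n * t\<bar> \<le> r / 2" if "t \<in> {-1..1}" for t
      proof -
        have "\<bar>\<epsilon> n * t\<bar> \<le> (r / 2) * 1" unfolding abs_mult using \<epsilon>0[of n] that by (intro mult_mono) auto
        then show ?thesis by simp
      qed
      have "fst v \<in> {-1..1}" "snd v \<in> {-1..1}" using that by (auto simp: cbox_Pair)
      from this[THEN bt] show "\<epsilon> n *\<^sub>R v \<in> cbox (- r / 2, - r / 2) (r / 2, r / 2)"
        unfolding cbox_Pair mem_Times_iff by (auto simp: abs_le_iff)
    qed
    have Rb: "\<bar>R n v\<bar> \<le> \<epsilon> n * (indicator ?Q v * (\<bar>M\<bar> * \<bar>bump (fst v) * bump (snd v)\<bar>))" for n v
    proof (cases "v \<in> ?Q")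
      case False then show ?thesis using outK[OF False] by simp
    next
      case True
      let ?z = "Z (\<epsilon> n *\<^sub>R v)"
      have "\<bar>indicator U ?z * (H ?z * (bump (fst v) * bump (snd v)))\<bar> \<le> 1 * (\<bar>M\<bar> * \<bar>bump (fst v) * bump (snd v)\<bar>)"
        unfolding abs_mult[of "indicator U ?z"] abs_mult[of "H ?z"]
        using HM[OF True, of n] by (intro mult_mono) (auto simp: indicator_def)
      then have "\<epsilon> n * \<bar>indicator U ?z * (H ?z * (bump (fst v) * bump (snd v)))\<bar> \<le> \<epsilon> n * (\<bar>M\<bar> * \<bar>bump (fst v) * bump (snd v)\<bar>)"
        using \<epsilon>0(1)[of n] by (intro mult_left_mono) auto
      then show ?thesis using True \<epsilon>0(1)[of n] by (simp add: Rv abs_mult)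
    qed
    show ?thesis
    proof (rule integral_dominated_convergence[where f = "\<lambda>_. 0", OF _ Rm])
      show "integrable lborel (\<lambda>v. r / 2 * (indicator ?Q v * (\<bar>M\<bar> * \<bar>bump (fst v) * bump (snd v)\<bar>)))"
        by (intro integrable_mult_right LINT_indicator_cbox(1) continuous_intros continuous_on_compose2[OF cbump]) auto
      show "AE v in lborel. (\<lambda>n. R n v) \<longlonglongrightarrow> 0"
      proof (rule AE_I2)
        fix v
        have "(\<lambda>n. \<epsilon> n * (indicator ?Q v * (\<bar>M\<bar> * \<bar>bump (fst v) * bump (snd v)\<bar>))) \<longlonglongrightarrow> 0"
          using tendsto_mult_left_zero[OF \<epsilon>lim] .
        then show "(\<lambda>n. R n v) \<longlonglongrightarrow> 0"
          by (rule Lim_null_comparison[rotated]) (use Rb in \<open>auto intro!: always_eventually\<close>)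
      qed
      show "AE v in lborel. norm (R n v) \<le> r / 2 * (indicator ?Q v * (\<bar>M\<bar> * \<bar>bump (fst v) * bump (snd v)\<bar>))" for n
      proof (rule AE_I2)
        fix v
        have "\<epsilon> n * (indicator ?Q v * (\<bar>M\<bar> * \<bar>bump (fst v) * bump (snd v)\<bar>)) \<le> r / 2 * (indicator ?Q v * (\<bar>M\<bar> * \<bar>bump (fst v) * bump (snd v)\<bar>))"
          using \<epsilon>0(2)[of n] by (intro mult_right_mono) auto
        then show "norm (R n v) \<le> r / 2 * (indicator ?Q v * (\<bar>M\<bar> * \<bar>bump (fst v) * bump (snd v)\<bar>))"
          using Rb[of n v] by simp
      qed
    qed simp
  qed
  have "(\<lambda>n. (LINT v|lborel. K n v) + (LINT v|lborel. R n v)) \<longlonglongrightarrow> (LINT v|lborel. L v) + 0"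
    using tendsto_add[OF limK limR] by simp
  then have "(\<lambda>n::nat. 0::real) \<longlonglongrightarrow> (LINT v|lborel. L v) + 0" unfolding KR .
  from LIMSEQ_unique[OF this tendsto_const] have L0: "(LINT v|lborel. L v) = 0" by (simp only: add_0_right)
  have "(LINT v|lborel. L v) = (N1 \<bullet> \<nu>) * (integral {-1..1} bump * (bump 1 - bump 0)) + (N2 \<bullet> \<nu>) * (integral {-1..1} bump * (bump 0 - bump (-1)))"
    unfolding L_def
    by (simp only: Bochner_Integration.integral_add[OF Lint Lint] LINT_indicator_cbox(2)[OF ctens]
      integral_bump_quadrant[OF b'(1,2), of "0" 1, simplified] integral_bump_quadrant[OF b'(1,2), of "-1" 0, simplified])
  also have "\<dots> = (N2 \<bullet> \<nu> - N1 \<bullet> \<nu>) * (integral {-1..1} bump * bump 0)"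
    using bump_props(3)[of 1] bump_props(3)[of "-1"] by (simp add: algebra_simps)
  finally show ?thesis using L0 integral_bump_pos bump_props(2)[of 0] by simp
qed

section \<open>Gauge correction and the local graph\<close>

text \<open>\<open>A\<close> integrates the tangential part of \<open>F\<close> along each vertical
  translate of the graph, so adding it to \<open>u\<close> cancels \<open>F\<close> in the
  derivative along these translates. What remains vertically is \<open>F2 - As\<close>; its
  x-derivative is formally \<open>F2x - F1y\<close>, the curl up to orientation, whence the
  Lipschitz bound. Integration starts at -\<rho>, inside the larger interval given by
  \<rho>0.\<close>

lemma gauge_potential:
  fixes f f' :: "real \<Rightarrow> real" and F1 F2 F1x F1y F2x F2y :: "real \<times> real \<Rightarrow> real"
  assumes \<rho>: "0 < \<rho>" "\<rho> < \<rho>0" and M: "0 \<le> M"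
    and f: "\<And>x. \<bar>x\<bar> < \<rho>0 \<Longrightarrow> (f has_real_derivative f' x) (at x)" "continuous_on {-\<rho>0<..<\<rho>0} f'"
      "\<And>x. \<bar>x\<bar> < \<rho>0 \<Longrightarrow> \<bar>f x\<bar> < \<kappa> / 2" "\<And>x. \<bar>x\<bar> < \<rho>0 \<Longrightarrow> \<bar>f' x\<bar> \<le> 1"
    and F: "\<And>z. \<bar>fst z\<bar> < \<rho>0 \<Longrightarrow> \<bar>snd z\<bar> < \<kappa> \<Longrightarrow> (F1 has_derivative (\<lambda>v. F1x z * fst v + F1y z * snd v)) (at z)"
      "\<And>z. \<bar>fst z\<bar> < \<rho>0 \<Longrightarrow> \<bar>snd z\<bar> < \<kappa> \<Longrightarrow> (F2 has_derivative (\<lambda>v. F2x z * fst v + F2y z * snd v)) (at z)"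
    and c: "continuous_on {z. \<bar>fst z\<bar> < \<rho>0 \<and> \<bar>snd z\<bar> < \<kappa>} F1y" "continuous_on {z. \<bar>fst z\<bar> < \<rho>0 \<and> \<bar>snd z\<bar> < \<kappa>} F2y"
    and b: "\<And>z. \<bar>fst z\<bar> < \<rho>0 \<Longrightarrow> \<bar>snd z\<bar> < \<kappa> \<Longrightarrow> \<bar>F1y z\<bar> \<le> M \<and> \<bar>F2x z\<bar> \<le> M \<and> \<bar>F2y z\<bar> \<le> M"
  shows "\<exists>A As. (\<forall>x s. \<bar>x\<bar> < \<rho> \<longrightarrow> \<bar>s\<bar> < \<kappa> / 2 \<longrightarrow>
        ((\<lambda>z. A (fst z) (snd z)) has_derivative (\<lambda>v. (F1 (x, f x + s) + F2 (x, f x + s) * f' x) * fst v + As x s * snd v)) (at (x, s)))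
    \<and> (\<forall>x. \<bar>x\<bar> < \<rho> \<longrightarrow> continuous_on {- (\<kappa> / 2)<..<\<kappa> / 2} (As x))
    \<and> (\<forall>x x' s. \<bar>x\<bar> < \<rho> \<longrightarrow> \<bar>x'\<bar> < \<rho> \<longrightarrow> \<bar>s\<bar> < \<kappa> / 2 \<longrightarrow>
        \<bar>(F2 (x, f x + s) - As x s) - (F2 (x', f x' + s) - As x' s)\<bar> \<le> (4 * M) * \<bar>x - x'\<bar>)"
proof -
  let ?Q = "{z. \<bar>fst z\<bar> < \<rho>0 \<and> \<bar>snd z\<bar> < \<kappa>}" and ?J = "{- (\<kappa> / 2)<..<\<kappa> / 2}"
  have cF: "continuous_on ?Q F1" "continuous_on ?Q F2"
    by (intro continuous_at_imp_continuous_on ballI, (use F has_derivative_continuous in blast))+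
  have cf: "continuous_on {-\<rho>0<..<\<rho>0} f"
    by (intro continuous_at_imp_continuous_on ballI DERIV_isCont[OF f(1)]) auto
  have inQ: "(t, f t + s) \<in> ?Q" if "\<bar>t\<bar> < \<rho>0" "\<bar>s\<bar> < \<kappa> / 2" for t s
    using f(3)[OF that(1)] that by (auto simp: abs_less_iff)
  have comp: "continuous_on S (\<lambda>z. G (p z, f (p z) + q z))"
    if "continuous_on ?Q G" "continuous_on S p" "continuous_on S q" "\<And>z. z \<in> S \<Longrightarrow> \<bar>p z\<bar> < \<rho>0 \<and> \<bar>q z\<bar> < \<kappa> / 2"
    for G :: "real \<times> real \<Rightarrow> real" and S :: "'t::topological_space set" and p q
  proof (rule continuous_on_compose2[OF that(1)])
    have "continuous_on S (\<lambda>z. f (p z))"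
      by (rule continuous_on_compose2[OF cf that(2)]) (use that(4) in \<open>auto simp: abs_less_iff minus_less_iff\<close>)
    then show "continuous_on S (\<lambda>z. (p z, f (p z) + q z))" by (intro continuous_intros that)
    show "(\<lambda>z. (p z, f (p z) + q z)) ` S \<subseteq> ?Q" using that(4) inQ by blast
  qed
  have cf': "continuous_on S (\<lambda>z. f' (p z))" if "continuous_on S p" "\<And>z. z \<in> S \<Longrightarrow> \<bar>p z\<bar> < \<rho>0"
    for S :: "'t::topological_space set" and p
    by (rule continuous_on_compose2[OF f(2) that(1)]) (use that(2) in \<open>auto simp: abs_less_iff minus_less_iff\<close>)
  define \<phi> where "\<phi> z = F1 (fst z, f (fst z) + snd z) + F2 (fst z, f (fst z) + snd z) * f' (fst z)" for z
  define \<psi> where "\<psi> z = F1y (fst z, f (fst z) + snd z) + F2y (fst z, f (fst z) + snd z) * f' (fst z)" for z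
  let ?R = "{-\<rho>0<..<\<rho>0} \<times> ?J"
  have R: "\<bar>fst z\<bar> < \<rho>0 \<and> \<bar>snd z\<bar> < \<kappa> / 2" if "z \<in> ?R" for z using that by (auto simp: abs_less_iff)
  have c\<phi>: "continuous_on ?R \<phi>" and c\<psi>: "continuous_on ?R \<psi>"
    unfolding \<phi>_def \<psi>_def
    by (intro continuous_on_add continuous_on_mult comp[OF cF(1)] comp[OF cF(2)] comp[OF c(1)] comp[OF c(2)] cf'
        continuous_on_fst continuous_on_snd continuous_on_id R; use R in blast)+
  have c\<phi>': "continuous_on {-\<rho>..x} (\<lambda>t. \<phi> (t, s))" "continuous_on {-\<rho>..x} (\<lambda>t. \<psi> (t, s))"
    if "x < \<rho>0" "\<bar>s\<bar> < \<kappa> / 2" for x s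
    by (rule continuous_on_compose2[OF c\<phi>], use that \<rho> in \<open>auto intro!: continuous_intros simp: abs_less_iff\<close>,
        rule continuous_on_compose2[OF c\<psi>], use that \<rho> in \<open>auto intro!: continuous_intros simp: abs_less_iff\<close>)
  have \<psi>b: "\<bar>\<psi> (t, s)\<bar> \<le> 2 * M" if "\<bar>t\<bar> < \<rho>0" "\<bar>s\<bar> < \<kappa> / 2" for t s
  proof -
    have z: "\<bar>F1y (t, f t + s)\<bar> \<le> M" "\<bar>F2y (t, f t + s)\<bar> \<le> M" using b[of "(t, f t + s)"] inQ[OF that] by auto
    have "\<bar>F2y (t, f t + s) * f' t\<bar> \<le> M * 1" unfolding abs_mult using z f(4)[OF that(1)] M by (intro mult_mono) auto
    then show ?thesis using z unfolding \<psi>_def by simp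
  qed
  define A where "A x s = integral {-\<rho>..x} (\<lambda>t. \<phi> (t, s))" for x s
  define As where "As x s = integral {-\<rho>..x} (\<lambda>t. \<psi> (t, s))" for x s
  have d: "((\<lambda>z. A (fst z) (snd z)) has_derivative (\<lambda>v. \<phi> (x, s) * fst v + As x s * snd v)) (at (x, s))"
    if xs: "\<bar>x\<bar> < \<rho>" "\<bar>s\<bar> < \<kappa> / 2" for x s
  proof (rule has_derivative_partials_real[where S = "{-\<rho><..<\<rho>} \<times> ?J"])
    show "open ({-\<rho><..<\<rho>} \<times> ?J)" by (intro open_Times) auto
    show "(x, s) \<in> {-\<rho><..<\<rho>} \<times> ?J" using xs by (auto simp: abs_less_iff)
    show "continuous_on ({-\<rho><..<\<rho>} \<times> ?J) \<phi>" using \<rho> by (intro continuous_on_subset[OF c\<phi>]) auto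
    show "((\<lambda>x. A x (snd z)) has_real_derivative \<phi> z) (at (fst z))" if z: "z \<in> {-\<rho><..<\<rho>} \<times> ?J" for z
    proof -
      have "continuous_on {-\<rho>..\<rho>} (\<lambda>t. \<phi> (t, snd z))" using z \<rho> by (intro c\<phi>'(1)) (auto simp: abs_less_iff)
      from integral_has_real_derivative[OF this, of "fst z"]
      have "((\<lambda>x. A x (snd z)) has_real_derivative \<phi> z) (at (fst z) within {-\<rho>..\<rho>})"
        using z by (auto simp: A_def)
      then show ?thesis using z by (auto simp: at_within_Icc_at)
    qed
    show "((\<lambda>s. A x s) has_real_derivative As x s) (at s)"
    proof -
      \<comment> \<open>Differentiation under the integral sign in s: \<open>f'\<close> enters only
        as a factor independent of s, so no second derivative of f is required.\<close>
      have "((\<lambda>s. integral (cbox (-\<rho>) x) (\<lambda>t. \<phi> (t, s))) has_field_derivative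
          integral (cbox (-\<rho>) x) (\<lambda>t. \<psi> (t, s))) (at s within ?J)"
      proof (rule leibniz_rule_field_derivative)
        fix s' t assume st: "s' \<in> ?J" "t \<in> cbox (-\<rho>) x"
        have t: "\<bar>t\<bar> < \<rho>0" "\<bar>s'\<bar> < \<kappa> / 2" using st xs \<rho> by (auto simp: abs_less_iff)
        have q: "\<bar>fst (t, f t + s')\<bar> < \<rho>0" "\<bar>snd (t, f t + s')\<bar> < \<kappa>" using inQ[OF t] by auto
        have k: "((\<lambda>s. f t + s) has_real_derivative 1) (at s')" by (auto intro!: derivative_eq_intros)
        have "((\<lambda>s. F1 (t, f t + s)) has_real_derivative F1x (t, f t + s') * 0 + F1y (t, f t + s') * 1) (at s')"
          by (rule chain_two[where F = F1 and g = "\<lambda>_. t" and k = "\<lambda>s. f t + s", OF F(1)[OF q] DERIV_const k])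
        moreover have "((\<lambda>s. F2 (t, f t + s)) has_real_derivative F2x (t, f t + s') * 0 + F2y (t, f t + s') * 1) (at s')"
          by (rule chain_two[where F = F2 and g = "\<lambda>_. t" and k = "\<lambda>s. f t + s", OF F(2)[OF q] DERIV_const k])
        ultimately have "((\<lambda>s. \<phi> (t, s)) has_field_derivative \<psi> (t, s')) (at s')"
          unfolding \<phi>_def \<psi>_def by (auto intro!: derivative_eq_intros)
        then show "((\<lambda>s. \<phi> (t, s)) has_field_derivative \<psi> (t, s')) (at s' within ?J)"
          by (rule has_field_derivative_at_within)
      next
        show "(\<lambda>t. \<phi> (t, s')) integrable_on cbox (-\<rho>) x" if "s' \<in> ?J" for s'
          using c\<phi>'(1)[of x s'] that xs \<rho> by (intro integrable_continuous) (auto simp: abs_less_iff)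
        show "continuous_on (?J \<times> cbox (-\<rho>) x) (\<lambda>(s, t). \<psi> (t, s))"
          unfolding split_beta
          by (rule continuous_on_compose2[OF c\<psi>]) (use xs \<rho> in \<open>auto intro!: continuous_intros simp: abs_less_iff\<close>)
      qed (use xs in \<open>auto simp: abs_less_iff\<close>)
      then have "(A x has_real_derivative As x s) (at s within ?J)" by (simp add: A_def[abs_def] As_def)
      moreover have "at s within ?J = at s" by (rule at_within_open) (use xs in \<open>auto simp: abs_less_iff\<close>)
      ultimately show ?thesis by (simp only:)
    qed
  qed
  have cAs: "continuous_on ?J (As x)" if x: "\<bar>x\<bar> < \<rho>" for x
  proof -
    have "continuous_on (?J \<times> cbox (-\<rho>) x) (\<lambda>(s, t). \<psi> (t, s))"
      unfolding split_beta
      by (rule continuous_on_compose2[OF c\<psi>]) (use x \<rho> in \<open>auto intro!: continuous_intros simp: abs_less_iff\<close>)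
    from integral_continuous_on_param[OF this] show ?thesis by (simp add: As_def[abs_def])
  qed
  \<comment> \<open>The constant 4 M is 2 M for \<open>As\<close>, whose integrand is bounded by 2
    M, plus 2 M for \<open>F2\<close> along a translate of slope at most 1.\<close>
  have lip: "\<bar>(F2 (x, f x + s) - As x s) - (F2 (x', f x' + s) - As x' s)\<bar> \<le> (4 * M) * \<bar>x - x'\<bar>"
    if x: "\<bar>x\<bar> < \<rho>" "\<bar>x'\<bar> < \<rho>" "\<bar>s\<bar> < \<kappa> / 2" for x x' s
  proof -
    have "\<bar>As x s - As x' s\<bar> \<le> (2 * M) * \<bar>x - x'\<bar>"
      unfolding As_def using c\<phi>'(2)[of \<rho> s] \<psi>b[OF _ x(3)] x \<rho> by (intro lipschitz_integral) (auto simp: abs_less_iff)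
    moreover have "norm (F2 (x, f x + s) - F2 (x', f x' + s)) \<le> (2 * M) * norm (x - x')"
    proof (rule field_differentiable_bound[of "{-\<rho>0<..<\<rho>0}" "\<lambda>t. F2 (t, f t + s)" "\<lambda>t. F2x (t, f t + s) * 1 + F2y (t, f t + s) * f' t"])
      fix t assume "t \<in> {-\<rho>0<..<\<rho>0}"
      then have t: "\<bar>t\<bar> < \<rho>0" by auto
      have q: "\<bar>fst (t, f t + s)\<bar> < \<rho>0" "\<bar>snd (t, f t + s)\<bar> < \<kappa>" using inQ[OF t x(3)] by auto
      have k: "((\<lambda>t. f t + s) has_real_derivative f' t) (at t)" using DERIV_add[OF f(1)[OF t] DERIV_const[of s]] by simp
      have "((\<lambda>t. F2 (t, f t + s)) has_real_derivative F2x (t, f t + s) * 1 + F2y (t, f t + s) * f' t) (at t)"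
        by (rule chain_two[where F = F2 and g = "\<lambda>t. t" and k = "\<lambda>t. f t + s", OF F(2)[OF q] DERIV_ident k])
      then show "((\<lambda>t. F2 (t, f t + s)) has_field_derivative F2x (t, f t + s) * 1 + F2y (t, f t + s) * f' t) (at t within {-\<rho>0<..<\<rho>0})"
        by (rule has_field_derivative_at_within)
      have "\<bar>F2y (t, f t + s) * f' t\<bar> \<le> M * 1" unfolding abs_mult using b[OF q] f(4)[OF t] M by (intro mult_mono) auto
      then show "norm (F2x (t, f t + s) * 1 + F2y (t, f t + s) * f' t) \<le> 2 * M"
        using b[OF q] abs_triangle_ineq[of "F2x (t, f t + s)" "F2y (t, f t + s) * f' t"] by simp
    qed (use x \<rho> in \<open>auto simp: abs_less_iff\<close>)
    ultimately show ?thesis unfolding real_norm_def abs_if by argo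
  qed
  show ?thesis
    by (rule exI[of _ A], rule exI[of _ As]) (use d lip cAs in \<open>auto simp: \<phi>_def\<close>)
qed

section \<open>The curve as a local graph and its two sides\<close>

definition graph_at :: "(real^2) set \<Rightarrow> real^2 \<Rightarrow> real^2 \<Rightarrow> real^2 \<Rightarrow> real \<Rightarrow> real \<Rightarrow> (real \<Rightarrow> real) \<Rightarrow> (real \<Rightarrow> real) \<Rightarrow> bool" where
  "graph_at \<gamma> p T \<nu> \<rho> \<kappa> f f' \<longleftrightarrow> orthoframe T \<nu> \<and> 0 < \<rho> \<and> 0 < \<kappa> \<and>
     (\<forall>x. \<bar>x\<bar> < \<rho> \<longrightarrow> (f has_real_derivative f' x) (at x)) \<and> continuous_on {-\<rho><..<\<rho>} f' \<and> f 0 = 0 \<and> f' 0 = 0 \<and>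
     (\<forall>x y. \<bar>x\<bar> < \<rho> \<longrightarrow> \<bar>y\<bar> < \<kappa> \<longrightarrow> (frame_point p T \<nu> (x, y) \<in> \<gamma> \<longleftrightarrow> y = f x))"

lemma graph_at_shrink:
  assumes "graph_at \<gamma> p T \<nu> \<rho> \<kappa> f f'" "0 < \<rho>'" "\<rho>' \<le> \<rho>" "0 < \<kappa>'" "\<kappa>' \<le> \<kappa>"
  shows "graph_at \<gamma> p T \<nu> \<rho>' \<kappa>' f f'"
  using assms unfolding graph_at_def by (auto elim: continuous_on_subset)

text \<open>Used to make the tangential component of the limit from above positive. The normal is
  kept, so the upper side stays the upper side.\<close>

lemma graph_at_flip:
  assumes "graph_at \<gamma> p T \<nu> \<rho> \<kappa> f f'"
  shows "graph_at \<gamma> p (- T) \<nu> \<rho> \<kappa> (\<lambda>x. f (- x)) (\<lambda>x. - f' (- x))"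
  unfolding graph_at_def
proof (intro conjI allI impI)
  show "orthoframe (- T) \<nu>" using assms by (auto simp: graph_at_def orthoframe_def)
  show "((\<lambda>x. f (- x)) has_real_derivative - f' (- x)) (at x)" if "\<bar>x\<bar> < \<rho>" for x
  proof -
    have "(f has_real_derivative f' (- x)) (at (- x))" using assms that by (simp add: graph_at_def)
    moreover have "((\<lambda>x. - x) has_real_derivative - 1) (at x)" by (auto intro!: derivative_eq_intros)
    ultimately have "((\<lambda>x. f (- x)) has_real_derivative f' (- x) * - 1) (at x)" by (rule DERIV_chain2)
    then show ?thesis by simp
  qed
  have cf': "continuous_on {-\<rho><..<\<rho>} f'" using assms by (simp add: graph_at_def)
  show "continuous_on {-\<rho><..<\<rho>} (\<lambda>x. - f' (- x))"
    by (rule continuous_on_minus[OF continuous_on_compose2[OF cf' continuous_on_minus[OF continuous_on_id]]]) auto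
  fix x y :: real assume "\<bar>x\<bar> < \<rho>" "\<bar>y\<bar> < \<kappa>"
  moreover have "frame_point p (- T) \<nu> (x, y) = frame_point p T \<nu> (- x, y)" by (simp add: frame_point_def)
  ultimately show "(frame_point p (- T) \<nu> (x, y) \<in> \<gamma>) = (y = f (- x))" using assms by (simp add: graph_at_def)
qed (use assms in \<open>simp_all add: graph_at_def\<close>)

text \<open>With \<open>T\<close> the unit tangent, the tangential coordinate \<open>X\<close> of
  the parametrisation is strictly increasing near \<open>t0\<close>. Its inverse turns the normal
  coordinate \<open>Y\<close> into a function of x with derivative 0 at 0.\<close>

lemma C1_curve_graph:
  assumes \<gamma>: "C1_curve \<gamma>" and p: "p \<in> \<gamma>"
  shows "\<exists>T \<nu> \<rho> \<kappa> f f'. graph_at \<gamma> p T \<nu> \<rho> \<kappa> f f'"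
proof -
  let ?I = "{-1<..<1::real}"
  obtain B g h where B: "open B" "p \<in> B" and hom: "homeomorphism ?I (\<gamma> \<inter> B) g h"
    and gC1: "g C1_differentiable_on ?I" and gnz: "\<And>t. t \<in> ?I \<Longrightarrow> vector_derivative g (at t) \<noteq> 0"
    using \<gamma> p unfolding C1_curve_def by metis
  obtain D where D: "\<And>t. t \<in> ?I \<Longrightarrow> (g has_vector_derivative D t) (at t)" "continuous_on ?I D"
    using gC1 unfolding C1_differentiable_on_def by blast
  have Dnz: "D t \<noteq> 0" if "t \<in> ?I" for t using gnz[OF that] vector_derivative_at[OF D(1)[OF that]] by simp
  have gh: "g (h q) = q" "h q \<in> ?I" if "q \<in> \<gamma> \<inter> B" for q
    using hom that unfolding homeomorphism_def by auto
  have gI: "g t \<in> \<gamma>" if "t \<in> ?I" for t using hom that unfolding homeomorphism_def by auto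
  have hcont: "continuous_on (\<gamma> \<inter> B) h" using hom unfolding homeomorphism_def by auto
  define t0 where "t0 = h p"
  have t0: "t0 \<in> ?I" "g t0 = p" using gh[of p] p B by (auto simp: t0_def)
  define T where "T = D t0 /\<^sub>R norm (D t0)"
  define \<nu> :: "real^2" where "\<nu> = vector [- T $ 2, T $ 1]"
  have T1: "T \<bullet> T = 1" using Dnz[OF t0(1)] by (simp add: T_def dot_square_norm power2_eq_square)
  have fr: "orthoframe T \<nu>"
    using T1 unfolding orthoframe_def by (simp add: \<nu>_def inner_vec_def sum_2 algebra_simps)
  define X Y where "X t = (g t - p) \<bullet> T" and "Y t = (g t - p) \<bullet> \<nu>" for t
  have comp: "((\<lambda>t. (g t - p) \<bullet> w) has_real_derivative D t \<bullet> w) (at t)" if "t \<in> ?I" for t w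
  proof -
    have "((\<lambda>t. g t - p) has_vector_derivative D t - 0) (at t)"
      by (intro has_vector_derivative_diff D that has_vector_derivative_const)
    from bounded_linear.has_vector_derivative[OF bounded_linear_inner_left this, of w]
    show ?thesis by (simp add: has_real_derivative_iff_has_vector_derivative)
  qed
  have Xd: "(X has_real_derivative D t \<bullet> T) (at t)" and Yd: "(Y has_real_derivative D t \<bullet> \<nu>) (at t)" if "t \<in> ?I" for t
    using comp[OF that] by (simp_all add: X_def[abs_def] Y_def[abs_def])
  have X0: "X t0 = 0" "Y t0 = 0" by (simp_all add: X_def Y_def t0)
  have DT: "D t0 \<bullet> T > 0" using Dnz[OF t0(1)] by (simp add: T_def)
  have D\<nu>: "D t0 \<bullet> \<nu> = 0"
  proof -
    have "T \<bullet> \<nu> = 0" using fr by (simp add: orthoframe_def)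
    then show ?thesis using Dnz[OF t0(1)] by (simp add: T_def)
  qed
  have cD: "continuous_on ?I (\<lambda>t. D t \<bullet> w)" for w by (intro continuous_intros D)
  have oS: "open (?I \<inter> (\<lambda>t. D t \<bullet> T) -` {0<..})"
    by (intro continuous_open_preimage cD) auto
  moreover have "t0 \<in> ?I \<inter> (\<lambda>t. D t \<bullet> T) -` {0<..}" using t0 DT by auto
  ultimately obtain d where d: "d > 0" "cball t0 d \<subseteq> ?I \<inter> (\<lambda>t. D t \<bullet> T) -` {0<..}"
    unfolding open_contains_cball by blast
  have J: "t \<in> ?I" "D t \<bullet> T > 0" if "t \<in> {t0 - d..t0 + d}" for t
    using d(2) that by (auto simp: cball_eq_atLeastAtMost subset_iff)
  have Xmono: "X s < X t" if "s \<in> {t0 - d..t0 + d}" "t \<in> {t0 - d..t0 + d}" "s < t" for s t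
    by (rule DERIV_pos_imp_increasing[OF that(3)]) (use J Xd that in \<open>meson atLeastAtMost_iff order_trans\<close>)
  have inj: "inj_on X {t0 - d..t0 + d}"
    by (rule linorder_inj_onI) (use Xmono in \<open>auto dest: less_imp_neq\<close>)
  define \<tau> where "\<tau> = the_inv_into {t0 - d..t0 + d} X"
  have \<tau>X: "\<tau> (X t) = t" if "t \<in> {t0 - d..t0 + d}" for t
    unfolding \<tau>_def by (rule the_inv_into_f_f[OF inj that])
  define \<rho>1 where "\<rho>1 = min (X (t0 + d)) (- X (t0 - d))"
  have \<rho>1: "\<rho>1 > 0" using Xmono[of t0 "t0 + d"] Xmono[of "t0 - d" t0] X0 d(1) by (auto simp: \<rho>1_def)
  have X\<tau>: "\<tau> x \<in> {t0 - d<..<t0 + d} \<and> X (\<tau> x) = x" if x: "\<bar>x\<bar> < \<rho>1" for x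
  proof -
    have "continuous_on {t0 - d..t0 + d} X"
      by (intro continuous_at_imp_continuous_on ballI DERIV_isCont[OF Xd] J)
    moreover have b: "X (t0 - d) < x" "x < X (t0 + d)" using x by (auto simp: \<rho>1_def)
    ultimately obtain t where t: "t0 - d \<le> t" "t \<le> t0 + d" "X t = x"
      using IVT'[of X "t0 - d" x "t0 + d"] d(1) by auto
    then have "t \<noteq> t0 - d" "t \<noteq> t0 + d" using b by auto
    then show ?thesis using t \<tau>X[of t] by auto
  qed
  have \<tau>0: "\<tau> 0 = t0" using \<tau>X[of t0] X0 d(1) by simp
  have \<tau>d: "(\<tau> has_real_derivative inverse (D (\<tau> x) \<bullet> T)) (at x)" if x: "\<bar>x\<bar> < \<rho>1" for x
  proof (rule DERIV_inverse_function[where f = X and a = "-\<rho>1" and b = "\<rho>1"])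
    have r: "\<tau> x \<in> {t0 - d..t0 + d}" using X\<tau>[OF x] by auto
    show "(X has_real_derivative D (\<tau> x) \<bullet> T) (at (\<tau> x))" by (rule Xd[OF J(1)[OF r]])
    show "D (\<tau> x) \<bullet> T \<noteq> 0" using J(2)[OF r] by simp
    show "-\<rho>1 < x" "x < \<rho>1" using x by auto
    show "X (\<tau> y) = y" if "-\<rho>1 < y" "y < \<rho>1" for y using X\<tau>[of y] that by auto
    have "isCont \<tau> (X (\<tau> x))"
    proof (rule isCont_inverse_function2[where f = X and g = \<tau> and x = "\<tau> x" and a = "t0 - d" and b = "t0 + d"])
      show "t0 - d < \<tau> x" "\<tau> x < t0 + d" using X\<tau>[OF x] by auto
      show "\<tau> (X z) = z" "isCont X z" if "t0 - d \<le> z" "z \<le> t0 + d" for z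
        using \<tau>X[of z] J(1)[of z] that DERIV_isCont[OF Xd] by auto
    qed
    then show "isCont \<tau> x" using X\<tau>[OF x] by simp
  qed
  define f where "f x = Y (\<tau> x)" for x
  define f' where "f' x = (D (\<tau> x) \<bullet> \<nu>) * inverse (D (\<tau> x) \<bullet> T)" for x
  have \<tau>I: "\<tau> x \<in> ?I" "D (\<tau> x) \<bullet> T > 0" if "\<bar>x\<bar> < \<rho>1" for x using J[of "\<tau> x"] X\<tau>[OF that] by auto
  have fd: "(f has_real_derivative f' x) (at x)" if x: "\<bar>x\<bar> < \<rho>1" for x
    unfolding f_def[abs_def] f'_def by (rule DERIV_chain2[OF Yd[OF \<tau>I(1)[OF x]] \<tau>d[OF x]])
  have c\<tau>: "continuous_on {-\<rho>1<..<\<rho>1} \<tau>"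
    by (intro continuous_at_imp_continuous_on ballI DERIV_isCont[OF \<tau>d]) auto
  have cD\<tau>: "continuous_on {-\<rho>1<..<\<rho>1} (\<lambda>x. D (\<tau> x) \<bullet> w)" for w
    by (rule continuous_on_compose2[OF cD c\<tau>]) (use \<tau>I in \<open>auto simp: abs_less_iff\<close>)
  have f'c: "continuous_on {-\<rho>1<..<\<rho>1} f'"
    unfolding f'_def by (intro continuous_intros cD\<tau>) (use \<tau>I(2) in \<open>force simp: abs_less_iff\<close>)
  have f0: "f 0 = 0" "f' 0 = 0" by (simp_all add: f_def f'_def \<tau>0 X0 D\<nu>)
  have on: "frame_point p T \<nu> (x, f x) = g (\<tau> x)" if "\<bar>x\<bar> < \<rho>1" for x
    using frame_point_coords(3)[OF fr, of p "g (\<tau> x)"] X\<tau>[OF that] by (simp add: f_def X_def Y_def)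
  \<comment> \<open>Continuity of the inverse parametrisation excludes a second branch: points of
    \<gamma> near p have parameters near \<open>t0\<close>, hence lie on the arc that is already a
    graph.\<close>
  have "continuous (at p within \<gamma> \<inter> B) h" using hcont p B by (simp add: continuous_on_eq_continuous_within)
  then obtain e1 where e1: "e1 > 0" "\<And>q. q \<in> \<gamma> \<inter> B \<Longrightarrow> dist q p < e1 \<Longrightarrow> dist (h q) t0 < d"
    unfolding continuous_within_eps_delta t0_def using d(1) by blast
  obtain e2 where e2: "e2 > 0" "ball p e2 \<subseteq> B" using B by (auto elim: openE)
  define e where "e = min e1 e2"
  define \<rho> where "\<rho> = min \<rho>1 (e / 2)"
  have e: "e > 0" using e1 e2 by (simp add: e_def)
  have near: "dist (frame_point p T \<nu> (x, y)) p < e" if "\<bar>x\<bar> < \<rho>" "\<bar>y\<bar> < e / 2" for x y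
  proof -
    have n: "norm T = 1" "norm \<nu> = 1" using fr by (auto simp: orthoframe_def norm_eq_sqrt_inner)
    have "dist (frame_point p T \<nu> (x, y)) p = norm (x *\<^sub>R T + y *\<^sub>R \<nu>)" by (simp add: frame_point_def dist_norm)
    also have "\<dots> \<le> \<bar>x\<bar> + \<bar>y\<bar>" using norm_triangle_ineq[of "x *\<^sub>R T" "y *\<^sub>R \<nu>"] n by simp
    also have "\<dots> < e" using that by (simp add: \<rho>_def)
    finally show ?thesis .
  qed
  have "graph_at \<gamma> p T \<nu> \<rho> (e / 2) f f'"
    unfolding graph_at_def
  proof (intro conjI allI impI fr f0)
    show "0 < \<rho>" "0 < e / 2" using \<rho>1 e by (auto simp: \<rho>_def)
    show "(f has_real_derivative f' x) (at x)" if "\<bar>x\<bar> < \<rho>" for x using fd that by (simp add: \<rho>_def)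
    show "continuous_on {-\<rho><..<\<rho>} f'" by (rule continuous_on_subset[OF f'c]) (auto simp: \<rho>_def)
    fix x y assume xy: "\<bar>x\<bar> < \<rho>" "\<bar>y\<bar> < e / 2"
    have x1: "\<bar>x\<bar> < \<rho>1" using xy by (simp add: \<rho>_def)
    show "(frame_point p T \<nu> (x, y) \<in> \<gamma>) = (y = f x)"
    proof
      assume "y = f x"
      then show "frame_point p T \<nu> (x, y) \<in> \<gamma>" using on[OF x1] gI[OF \<tau>I(1)[OF x1]] by simp
    next
      assume q: "frame_point p T \<nu> (x, y) \<in> \<gamma>"
      let ?q = "frame_point p T \<nu> (x, y)"
      have qe: "dist ?q p < e" by (rule near[OF xy])
      then have "?q \<in> ball p e2" by (simp add: e_def dist_commute)
      then have qB: "?q \<in> \<gamma> \<inter> B" using q e2 by blast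
      have "dist (h ?q) t0 < d" using e1(2)[OF qB] qe by (simp add: e_def)
      then have hq: "h ?q \<in> {t0 - d..t0 + d}" by (auto simp: dist_real_def)
      have "X (h ?q) = x" "Y (h ?q) = y" using gh[OF qB] frame_point_coords(1,2)[OF fr, of p "(x, y)"] by (auto simp: X_def Y_def)
      then show "y = f x" using \<tau>X[OF hq] by (simp add: f_def)
    qed
  qed
  then show ?thesis by blast
qed

text \<open>The parts of the box above and below the graph are connected and avoid \<gamma>, so each
  lies in one of the two regions. They cannot lie in the same one, because p is in the closure of
  both regions and the box is a neighbourhood of p.\<close>

lemma graph_sides:
  assumes div: "divides_domain \<gamma> U Up Um" and gr: "graph_at \<gamma> p T \<nu> \<rho> \<kappa> f f'"
    and inU: "\<And>x y. \<bar>x\<bar> < \<rho> \<Longrightarrow> \<bar>y\<bar> < \<kappa> \<Longrightarrow> frame_point p T \<nu> (x, y) \<in> U"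
    and f: "\<And>x. \<bar>x\<bar> < \<rho> \<Longrightarrow> \<bar>f x\<bar> < \<kappa>"
    and cl: "p \<in> closure Up" "p \<in> closure Um"
  shows "\<exists>W1 W2. (W1 = Up \<and> W2 = Um \<or> W1 = Um \<and> W2 = Up) \<and>
    (\<forall>x y. \<bar>x\<bar> < \<rho> \<longrightarrow> \<bar>y\<bar> < \<kappa> \<longrightarrow> f x < y \<longrightarrow> frame_point p T \<nu> (x, y) \<in> W1) \<and>
    (\<forall>x y. \<bar>x\<bar> < \<rho> \<longrightarrow> \<bar>y\<bar> < \<kappa> \<longrightarrow> y < f x \<longrightarrow> frame_point p T \<nu> (x, y) \<in> W2)"
proof -
  let ?Z = "frame_point p T \<nu>"
  have fr: "orthoframe T \<nu>" and pos: "0 < \<rho>" "0 < \<kappa>"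
    and on: "\<And>x y. \<bar>x\<bar> < \<rho> \<Longrightarrow> \<bar>y\<bar> < \<kappa> \<Longrightarrow> ?Z (x, y) \<in> \<gamma> \<longleftrightarrow> y = f x"
    using gr by (auto simp: graph_at_def)
  have UU: "U - \<gamma> = Up \<union> Um" "open Up" "open Um" "Up \<inter> Um = {}" using div by (auto simp: divides_domain_def)
  have fd: "(f has_real_derivative f' x) (at x)" if "\<bar>x\<bar> < \<rho>" for x using gr that by (auto simp: graph_at_def)
  have cf: "continuous_on {-\<rho><..<\<rho>} f"
    by (intro continuous_at_imp_continuous_on ballI DERIV_isCont[OF fd]) auto
  have side: "S \<subseteq> Up \<or> S \<subseteq> Um" if "connected S" "S \<subseteq> U - \<gamma>" for S
  proof (rule ccontr)
    assume n: "\<not> (S \<subseteq> Up \<or> S \<subseteq> Um)"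
    have s: "S \<subseteq> Up \<union> Um" "Up \<inter> Um \<inter> S = {}" using that UU by auto
    then have "Up \<inter> S \<noteq> {}" "Um \<inter> S \<noteq> {}" using n by auto
    then show False using that(1) s UU(2,3) unfolding connected_def by blast
  qed
  let ?P = "{-\<rho><..<\<rho>} \<times> {0<..<1::real}"
  have conP: "connected ?P" by (intro convex_connected convex_Times) auto
  \<comment> \<open>Affine maps on each vertical line, carrying a rectangle onto the parts of the
    box above and below the graph; connectedness is inherited from the rectangle.\<close>
  let ?a = "\<lambda>z. (fst z, f (fst z) + snd z * (\<kappa> - f (fst z)))"
  let ?b = "\<lambda>z. (fst z, f (fst z) - snd z * (\<kappa> + f (fst z)))"
  have cfP: "continuous_on ?P (\<lambda>z. f (fst z))" by (rule continuous_on_compose2[OF cf]) (auto intro!: continuous_intros)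
  have con: "connected (?Z ` ?a ` ?P)" "connected (?Z ` ?b ` ?P)"
    by (intro connected_continuous_image continuous_frame_point continuous_intros cfP conP)+
  have inb: "\<bar>x\<bar> < \<rho> \<and> f x < f x + t * (\<kappa> - f x) \<and> f x + t * (\<kappa> - f x) < \<kappa>
      \<and> f x - t * (\<kappa> + f x) < f x \<and> - \<kappa> < f x - t * (\<kappa> + f x)" if "(x, t) \<in> ?P" for x t
  proof -
    have x: "\<bar>x\<bar> < \<rho>" "0 < t" "t < 1" using that by auto
    have p: "0 < \<kappa> - f x" "0 < \<kappa> + f x" using f[OF x(1)] by (auto simp: abs_less_iff)
    have "t * (\<kappa> - f x) < 1 * (\<kappa> - f x)" "t * (\<kappa> + f x) < 1 * (\<kappa> + f x)"
      using x p by (intro mult_strict_right_mono; simp)+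
    moreover have "0 < t * (\<kappa> - f x)" "0 < t * (\<kappa> + f x)" using x p by (auto intro: mult_pos_pos)
    ultimately show ?thesis using x(1) by auto
  qed
  have ina: "?Z (?a z) \<in> U - \<gamma>" "?Z (?b z) \<in> U - \<gamma>" if z: "z \<in> ?P" for z
  proof -
    obtain x t where zz: "z = (x, t)" by (cases z)
    note i = inb[OF z[unfolded zz]]
    have "\<bar>f x + t * (\<kappa> - f x)\<bar> < \<kappa>" "\<bar>f x - t * (\<kappa> + f x)\<bar> < \<kappa>"
      using i f[of x] by (auto simp: abs_less_iff)
    then show "?Z (?a z) \<in> U - \<gamma>" "?Z (?b z) \<in> U - \<gamma>"
      using i inU on unfolding zz by auto
  qed
  have sa: "?Z (x, y) \<in> ?Z ` ?a ` ?P" if "\<bar>x\<bar> < \<rho>" "\<bar>y\<bar> < \<kappa>" "f x < y" for x y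
  proof -
    have p: "0 < \<kappa> - f x" using f[OF that(1)] by (auto simp: abs_less_iff)
    let ?t = "(y - f x) / (\<kappa> - f x)"
    have "(x, ?t) \<in> ?P" using that p by (auto simp: abs_less_iff)
    moreover have "(x, y) = ?a (x, ?t)" using p by simp
    ultimately have "(x, y) \<in> ?a ` ?P" by (rule rev_image_eqI)
    then show ?thesis by (rule imageI)
  qed
  have sb: "?Z (x, y) \<in> ?Z ` ?b ` ?P" if "\<bar>x\<bar> < \<rho>" "\<bar>y\<bar> < \<kappa>" "y < f x" for x y
  proof -
    have p: "0 < \<kappa> + f x" using f[OF that(1)] by (auto simp: abs_less_iff)
    let ?t = "(f x - y) / (\<kappa> + f x)"
    have "(x, ?t) \<in> ?P" using that p by (auto simp: abs_less_iff)
    moreover have "(x, y) = ?b (x, ?t)" using p by simp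
    ultimately have "(x, y) \<in> ?b ` ?P" by (rule rev_image_eqI)
    then show ?thesis by (rule imageI)
  qed
  have sub: "?Z ` ?a ` ?P \<subseteq> U - \<gamma>" "?Z ` ?b ` ?P \<subseteq> U - \<gamma>" using ina by blast+
  let ?V = "{q. \<bar>(q - p) \<bullet> T\<bar> < \<rho> \<and> \<bar>(q - p) \<bullet> \<nu>\<bar> < \<kappa>}"
  have oV: "open ?V" by (intro open_Collect_conj open_Collect_less continuous_intros)
  have pV: "p \<in> ?V" using pos by simp
  have meets: "\<exists>x y. \<bar>x\<bar> < \<rho> \<and> \<bar>y\<bar> < \<kappa> \<and> y \<noteq> f x \<and> ?Z (x, y) \<in> W" if W: "p \<in> closure W" "W \<subseteq> U - \<gamma>" for W
  proof -
    have "W \<inter> ?V \<noteq> {}" using open_Int_closure_eq_empty[OF oV, of W] W(1) pV by blast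
    then obtain q where q: "q \<in> W" "q \<in> ?V" by blast
    have Zq: "?Z ((q - p) \<bullet> T, (q - p) \<bullet> \<nu>) = q" by (rule frame_point_coords(3)[OF fr])
    then have "(q - p) \<bullet> \<nu> \<noteq> f ((q - p) \<bullet> T)" using on[of "(q - p) \<bullet> T" "(q - p) \<bullet> \<nu>"] q W(2) by auto
    moreover have "?Z ((q - p) \<bullet> T, (q - p) \<bullet> \<nu>) \<in> W" using q(1) Zq by simp
    ultimately show ?thesis using q(2) by blast
  qed
  have not_same: "\<not> (?Z ` ?a ` ?P \<subseteq> W \<and> ?Z ` ?b ` ?P \<subseteq> W)" if W: "p \<in> closure W'" "W' \<subseteq> U - \<gamma>" "W \<inter> W' = {}" for W W'
  proof
    assume a: "?Z ` ?a ` ?P \<subseteq> W \<and> ?Z ` ?b ` ?P \<subseteq> W"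
    obtain x y where xy: "\<bar>x\<bar> < \<rho>" "\<bar>y\<bar> < \<kappa>" "y \<noteq> f x" "?Z (x, y) \<in> W'" using meets[OF W(1,2)] by blast
    then have "?Z (x, y) \<in> W" using sa[OF xy(1,2)] sb[OF xy(1,2)] a by (cases "f x < y") auto
    then show False using xy W(3) by blast
  qed
  have "?Z ` ?a ` ?P \<subseteq> Up \<and> ?Z ` ?b ` ?P \<subseteq> Um \<or> ?Z ` ?a ` ?P \<subseteq> Um \<and> ?Z ` ?b ` ?P \<subseteq> Up"
  proof -
    have W: "Up \<subseteq> U - \<gamma>" "Um \<subseteq> U - \<gamma>" "Um \<inter> Up = {}" using UU by auto
    show ?thesis
      using side[OF con(1) sub(1)] side[OF con(2) sub(2)] not_same[OF cl(1) W(1) W(3)] not_same[OF cl(2) W(2) UU(4)] by argo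
  qed
  then show ?thesis
  proof
    assume *: "?Z ` ?a ` ?P \<subseteq> Up \<and> ?Z ` ?b ` ?P \<subseteq> Um"
    show ?thesis
      using subsetD[OF *[THEN conjunct1] sa] subsetD[OF *[THEN conjunct2] sb]
      by (intro exI[of _ Up] exI[of _ Um]) simp
  next
    assume *: "?Z ` ?a ` ?P \<subseteq> Um \<and> ?Z ` ?b ` ?P \<subseteq> Up"
    show ?thesis
      using subsetD[OF *[THEN conjunct1] sa] subsetD[OF *[THEN conjunct2] sb]
      by (intro exI[of _ Um] exI[of _ Up]) simp
  qed
qed

text \<open>The characteristic curve issuing from q stays in W at positive times and tends to q as
  the time tends to 0.\<close>

lemma unique_issuing_closure:
  assumes "unique_issuing_characteristic N W q"
  shows "q \<in> closure W"
proof -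
  obtain \<delta> c where "issuing_characteristic N W q \<delta> c" using assms unfolding unique_issuing_characteristic_def by blast
  then have \<delta>: "0 < \<delta>" "continuous_on {0..<\<delta>} c" "c 0 = q" "\<And>s. s \<in> {0<..<\<delta>} \<Longrightarrow> c s \<in> W"
    unfolding issuing_characteristic_def by blast+
  show ?thesis
  proof (rule Lim_in_closed_set[OF closed_closure])
    have "(c \<longlongrightarrow> c 0) (at 0 within {0..<\<delta>})" using \<delta>(1,2) by (simp add: continuous_on_def)
    then show "(c \<longlongrightarrow> q) (at 0 within {0<..<\<delta>})" unfolding \<delta>(3) by (rule tendsto_within_subset) auto
    have "c s \<in> closure W" if "s \<in> {0<..<\<delta>}" for s using \<delta>(4)[OF that] closure_subset[of W] by blast
    then show "\<forall>\<^sub>F s in at 0 within {0<..<\<delta>}. c s \<in> closure W"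
      by (simp add: eventually_at_filter)
    show "at 0 within {0<..<\<delta>} \<noteq> bot"
      using \<delta>(1) by (simp add: at_within_eq_bot_iff)
  qed
qed

section \<open>Both sides of the curve\<close>

lemma C1_on_grad:
  fixes u :: "real^2 \<Rightarrow> real"
  assumes "C1_on u S"
  shows "x \<in> S \<Longrightarrow> (u has_derivative (\<lambda>v. grad u x \<bullet> v)) (at x)" "continuous_on S (grad u)"
proof -
  obtain D where D: "continuous_on S D" "\<And>x. x \<in> S \<Longrightarrow> (u has_derivative blinfun_apply (D x)) (at x)"
    using assms unfolding C1_on_def by blast
  have g: "grad u x = (\<Sum>b\<in>Basis. blinfun_apply (D x) b *\<^sub>R b)"
    and e: "blinfun_apply (D x) = (\<lambda>v. (\<Sum>b\<in>Basis. blinfun_apply (D x) b *\<^sub>R b) \<bullet> v)" if "x \<in> S" for x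
  proof -
    have "blinfun_apply (D x) v = (\<Sum>b\<in>Basis. blinfun_apply (D x) b *\<^sub>R b) \<bullet> v" for v
    proof -
      have "blinfun_apply (D x) v = blinfun_apply (D x) (\<Sum>b\<in>Basis. (v \<bullet> b) *\<^sub>R b)" by (simp add: euclidean_representation)
      also have "\<dots> = (\<Sum>b\<in>Basis. (v \<bullet> b) * blinfun_apply (D x) b)"
        by (simp add: blinfun.sum_right blinfun.scaleR_right)
      also have "\<dots> = (\<Sum>b\<in>Basis. blinfun_apply (D x) b * (b \<bullet> v))" by (simp add: inner_commute[of v] mult.commute)
      finally show ?thesis by (simp add: inner_sum_left)
    qed
    then show e: "blinfun_apply (D x) = (\<lambda>v. (\<Sum>b\<in>Basis. blinfun_apply (D x) b *\<^sub>R b) \<bullet> v)" by (rule ext)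
    show "grad u x = (\<Sum>b\<in>Basis. blinfun_apply (D x) b *\<^sub>R b)"
      by (rule grad_eqI) (use D(2)[OF that] e in simp)
  qed
  show "(u has_derivative (\<lambda>v. grad u x \<bullet> v)) (at x)" if "x \<in> S"
    using D(2)[OF that] e[OF that] g[OF that] by simp
  have "continuous_on S (\<lambda>x. \<Sum>b\<in>Basis. blinfun_apply (D x) b *\<^sub>R b)"
    by (intro continuous_on_sum continuous_on_scaleR blinfun.continuous_on D continuous_on_const)
  then show "continuous_on S (grad u)" using g by (simp cong: continuous_on_cong)
qed

lemma C1_onI:
  fixes u :: "real^2 \<Rightarrow> real"
  assumes "\<And>x. x \<in> S \<Longrightarrow> (u has_derivative (\<lambda>v. W x \<bullet> v)) (at x)" "continuous_on S W"
  shows "C1_on u S"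
  unfolding C1_on_def
  by (rule exI[of _ "\<lambda>x. blinfun_inner_right (W x)"])
    (use assms in \<open>auto intro!: bounded_linear.continuous_on[OF bounded_linear_blinfun_inner_right]\<close>)

text \<open>Realises the abstract one-sided setting. \<open>Z\<close>, \<open>N\<close> and
  \<open>E\<close> are variables bound by equations, so that the estimate applies equally to the
  half-turned frame that represents the lower side.\<close>

lemma side_estimate:
  fixes p T \<nu> :: "real^2" and f f' :: "real \<Rightarrow> real" and uh :: "real \<times> real \<Rightarrow> real" and B :: "real \<Rightarrow> real \<Rightarrow> real"
    and u H :: "real^2 \<Rightarrow> real" and F :: "real^2 \<Rightarrow> real^2"
  assumes Z_def: "Z = frame_point p T \<nu>" and N_def: "N = normal_field u F" and E_def: "E = (\<lambda>q. norm (grad u q + F q))"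
    and fr: "orthoframe T \<nu>" and U: "open U" "open (U - \<gamma>)"
    and N: "continuous_on (U - \<gamma>) N" and H: "continuous_on U H" and weak: "weak_solution U \<gamma> u F H"
    and nz: "\<And>q. q \<in> U - \<gamma> \<Longrightarrow> grad u q + F q \<noteq> 0"
    and params: "0 < \<rho>" "0 < \<kappa>" "0 < c" "0 \<le> L" "0 \<le> K"
    and f: "\<And>x. \<bar>x\<bar> < \<rho> \<Longrightarrow> (f has_real_derivative f' x) (at x)" "\<And>x. \<bar>x\<bar> < \<rho> \<Longrightarrow> \<bar>f' x\<bar> \<le> c / 2"
      "\<And>x. \<bar>x\<bar> < \<rho> \<Longrightarrow> \<bar>f x\<bar> < \<kappa> / 2"
    and reg: "\<And>x y. \<bar>x\<bar> < \<rho> \<Longrightarrow> f x < y \<Longrightarrow> y < \<kappa> \<Longrightarrow> Z (x, y) \<in> U - \<gamma>"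
    and n_ge: "\<And>x y. \<bar>x\<bar> < \<rho> \<Longrightarrow> f x < y \<Longrightarrow> y < \<kappa> \<Longrightarrow> c \<le> N (Z (x, y)) \<bullet> T"
    and h_lip: "\<And>x x' y. \<bar>x\<bar> < \<rho> \<Longrightarrow> \<bar>x'\<bar> < \<rho> \<Longrightarrow> \<bar>y\<bar> < \<kappa> \<Longrightarrow> \<bar>H (Z (x, y)) - H (Z (x', y))\<bar> \<le> L * \<bar>x - x'\<bar>"
    and uh: "\<And>x s. \<bar>x\<bar> < \<rho> \<Longrightarrow> 0 < s \<Longrightarrow> s < \<kappa> / 2 \<Longrightarrow>
        (uh has_derivative (\<lambda>v. (E (Z (x, f x + s)) * (N (Z (x, f x + s)) \<bullet> T + N (Z (x, f x + s)) \<bullet> \<nu> * f' x)) * fst v +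
          (E (Z (x, f x + s)) * (N (Z (x, f x + s)) \<bullet> \<nu>) - B x s) * snd v)) (at (x, s))"
    and B: "\<And>x x' s. \<bar>x\<bar> < \<rho> \<Longrightarrow> \<bar>x'\<bar> < \<rho> \<Longrightarrow> 0 < s \<Longrightarrow> s < \<kappa> / 2 \<Longrightarrow> \<bar>B x s - B x' s\<bar> \<le> K * \<bar>x - x'\<bar>"
    and uh_cont: "continuous_on ({-\<rho><..<\<rho>} \<times> {0..<\<kappa> / 2}) uh"
    and uh_boundary: "\<And>x x'. \<bar>x\<bar> < \<rho> \<Longrightarrow> \<bar>x'\<bar> < \<rho> \<Longrightarrow> x \<le> x' \<Longrightarrow> uh (x', 0) \<le> uh (x, 0)"
  shows "\<exists>C r. 0 < r \<and> 0 \<le> C \<and> (\<forall>x s. \<bar>x\<bar> < r \<longrightarrow> 0 < s \<longrightarrow> s < r \<longrightarrow> E (Z (x, f x + s)) \<le> C * s)"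
proof -
  let ?S = "{z. \<bar>fst z\<bar> < \<rho> \<and> f (fst z) < snd z \<and> snd z < \<kappa>}"
  have ZS: "Z ` ?S \<subseteq> U - \<gamma>" using reg by (auto simp: image_subset_iff)
  have cf: "continuous_on {-\<rho><..<\<rho>} f" by (intro continuous_at_imp_continuous_on ballI DERIV_isCont[OF f(1)]) auto
  have oS: "open ?S"
  proof -
    have "continuous_on ({-\<rho><..<\<rho>} \<times> {..<\<kappa>}) (\<lambda>z. snd z - f (fst z))"
      by (intro continuous_intros continuous_on_compose2[OF cf]) auto
    then have "open (({-\<rho><..<\<rho>} \<times> {..<\<kappa>}) \<inter> (\<lambda>z. snd z - f (fst z)) -` {0<..})"
      by (intro continuous_open_preimage) (auto intro!: open_Times)
    also have "({-\<rho><..<\<rho>} \<times> {..<\<kappa>}) \<inter> (\<lambda>z. snd z - f (fst z)) -` {0<..} = ?S" by auto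
    finally show ?thesis .
  qed
  have cNZ: "continuous_on ?S (\<lambda>z. N (Z z))"
    by (rule continuous_on_compose2[OF N _ ZS]) (simp add: Z_def continuous_frame_point)
  interpret transverse_side \<rho> \<kappa> c L K f f' "\<lambda>z. N (Z z) \<bullet> T" "\<lambda>z. N (Z z) \<bullet> \<nu>" "\<lambda>z. H (Z z)" uh
    "\<lambda>x s. E (Z (x, f x + s))" B
  proof
    show "continuous_on ?S (\<lambda>z. N (Z z) \<bullet> T)" "continuous_on ?S (\<lambda>z. N (Z z) \<bullet> \<nu>)"
      by (intro continuous_intros cNZ)+
    show "continuous_on ?S (\<lambda>z. H (Z z))"
      by (rule continuous_on_compose2[OF H]) (use ZS in \<open>auto simp: Z_def continuous_frame_point\<close>)
    show "(N (Z (x, y)) \<bullet> T)\<^sup>2 + (N (Z (x, y)) \<bullet> \<nu>)\<^sup>2 = 1" if "\<bar>x\<bar> < \<rho>" "f x < y" "y < \<kappa>" for x y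
    proof -
      have "norm (N (Z (x, y))) = 1" using nz[OF reg[OF that]] by (simp add: N_def normal_field_def)
      then have "N (Z (x, y)) \<bullet> N (Z (x, y)) = 1" by (simp add: norm_eq_1)
      then show ?thesis using orthoframe_inner[OF fr, of "N (Z (x, y))" "N (Z (x, y))"] by (simp add: power2_eq_square)
    qed
    show "balance_on ?S (\<lambda>z. N (Z z) \<bullet> T) (\<lambda>z. N (Z z) \<bullet> \<nu>) (\<lambda>z. H (Z z))"
      using weak_balance[OF fr U N[unfolded N_def] H weak oS ZS[unfolded Z_def]] by (simp add: N_def Z_def)
    show "\<bar>H (Z (x, y)) - H (Z (x', y))\<bar> \<le> L * \<bar>x - x'\<bar>"
      if "\<bar>x\<bar> < \<rho>" "\<bar>x'\<bar> < \<rho>" "f x < y" "f x' < y" "y < \<kappa>" for x x' y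
      using h_lip[OF that(1,2), of y] f(3)[OF that(1)] that params by (auto simp: abs_less_iff)
    show "0 < E (Z (x, f x + s))" if "\<bar>x\<bar> < \<rho>" "0 < s" "s < \<kappa> / 2" for x s
    proof -
      have "Z (x, f x + s) \<in> U - \<gamma>" using that f(3)[OF that(1)] by (intro reg) (auto simp: abs_less_iff)
      then show ?thesis using nz by (simp add: E_def)
    qed
  qed (use params f n_ge uh B uh_cont uh_boundary in blast)+
  show ?thesis
  proof (intro exI conjI allI impI)
    show "0 < R" by (rule R_bounds)
    show "0 \<le> 6 * K * growth / c" using params by (simp add: growth_def)
    show "E (Z (x, f x + s)) \<le> 6 * K * growth / c * s" if "\<bar>x\<bar> < R" "0 < s" "s < R" for x s
      using D_le_height[OF that] .
  qed
qed

lemma increment_bound_off_zero: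
  fixes k :: "real \<Rightarrow> real"
  assumes c: "continuous_on {-d<..<d} k" and e: "0 \<le> e"
    and k: "\<And>\<sigma>. \<sigma> \<in> {-d<..<d} \<Longrightarrow> \<sigma> \<noteq> 0 \<Longrightarrow> \<exists>l. (k has_real_derivative l) (at \<sigma>) \<and> \<bar>l\<bar> \<le> e"
    and s: "s \<in> {-d<..<d}"
  shows "\<bar>k s - k 0\<bar> \<le> e * \<bar>s\<bar>"
proof -
  have *: "\<bar>k b - k a\<bar> \<le> e * (b - a)" if ab: "a < b" "a \<in> {-d<..<d}" "b \<in> {-d<..<d}" "0 \<le> a \<or> b \<le> 0" for a b
  proof -
    have "continuous_on {a..b} k" using ab by (intro continuous_on_subset[OF c]) auto
    moreover have "k differentiable (at x)" if "a < x" "x < b" for x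
    proof -
      have "x \<in> {-d<..<d}" "x \<noteq> 0" using ab that by auto
      from k[OF this] obtain l where "(k has_real_derivative l) (at x)" by blast
      then show ?thesis by (auto simp: real_differentiable_def)
    qed
    ultimately obtain l z where z: "a < z" "z < b" "(k has_real_derivative l) (at z)" "k b - k a = (b - a) * l"
      using MVT[OF ab(1), of k] by auto
    have "z \<in> {-d<..<d}" "z \<noteq> 0" using ab z by auto
    from k[OF this] obtain l' where l': "(k has_real_derivative l') (at z)" "\<bar>l'\<bar> \<le> e" by blast
    have "l = l'" using DERIV_unique[OF z(3) l'(1)] .
    then have "\<bar>(b - a) * l\<bar> \<le> (b - a) * e" unfolding abs_mult using l'(2) ab(1) by (intro mult_mono) auto
    then show ?thesis using z(4) by (simp add: mult.commute)
  qed
  have d0: "0 \<in> {-d<..<d}" using s by auto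
  consider "s = 0" | "0 < s" | "s < 0" by linarith
  then show ?thesis
  proof cases
    case 2 then show ?thesis using *[OF 2 d0 s] by simp
  next
    case 3 then show ?thesis using *[OF 3 s d0] by (simp add: abs_minus_commute)
  qed simp
qed

lemma frame_point_has_derivative:
  assumes "(a has_derivative a') (at z)" "(b has_derivative b') (at z)"
  shows "((\<lambda>z. frame_point p T \<nu> (a z, b z)) has_derivative (\<lambda>v. a' v *\<^sub>R T + b' v *\<^sub>R \<nu>)) (at z)"
  using has_derivative_add[OF has_derivative_add[OF has_derivative_const[of p]
    has_derivative_scaleR_left[OF assms(1), of T]] has_derivative_scaleR_left[OF assms(2), of \<nu>]]
  by (simp add: frame_point_def)

text \<open>The sign condition places the field on opposite tangential sides above and below the
  curve. This gives constancy of the corrected function on the curve and then allows the one-sided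
  estimate on both sides.\<close>

lemma framed_conclusion:
  fixes p T \<nu> :: "real^2" and f f' :: "real \<Rightarrow> real" and u H :: "real^2 \<Rightarrow> real" and F :: "real^2 \<Rightarrow> real^2"
  defines "Z \<equiv> frame_point p T \<nu>" and "N \<equiv> normal_field u F" and "E \<equiv> \<lambda>q. norm (grad u q + F q)"
  assumes gr: "graph_at \<gamma> p T \<nu> \<rho>0 \<kappa>0 f f'" and U: "open U" "open (U - \<gamma>)"
    and u: "C1_on u (U - \<gamma>)" "continuous_on U u" and nz: "\<And>q. q \<in> U - \<gamma> \<Longrightarrow> grad u q + F q \<noteq> 0"
    and FH: "C1_on F U" "C1_on H U" and weak: "weak_solution U \<gamma> u F H"
    and inU: "\<And>x y. \<bar>x\<bar> < \<rho>0 \<Longrightarrow> \<bar>y\<bar> < \<kappa>0 \<Longrightarrow> Z (x, y) \<in> U"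
    and up: "\<And>x y. \<bar>x\<bar> < \<rho>0 \<Longrightarrow> \<bar>y\<bar> < \<kappa>0 \<Longrightarrow> f x < y \<Longrightarrow> Z (x, y) \<in> W1"
    and dn: "\<And>x y. \<bar>x\<bar> < \<rho>0 \<Longrightarrow> \<bar>y\<bar> < \<kappa>0 \<Longrightarrow> y < f x \<Longrightarrow> Z (x, y) \<in> W2"
    and W: "W1 \<subseteq> U - \<gamma>" "W2 \<subseteq> U - \<gamma>"
    and lim: "(N \<longlongrightarrow> N1) (at p within W1)" "(N \<longlongrightarrow> N2) (at p within W2)"
    and sgn: "0 < N1 \<bullet> T" "N2 \<bullet> T < 0"
  shows "\<exists>V\<subseteq>U. open V \<and> p \<in> V \<and> C1_on u V \<and> grad u p + F p = 0"
proof -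
  have fr: "orthoframe T \<nu>" and pos0: "0 < \<rho>0" "0 < \<kappa>0"
    and fd0: "\<And>x. \<bar>x\<bar> < \<rho>0 \<Longrightarrow> (f has_real_derivative f' x) (at x)" and cf'0: "continuous_on {-\<rho>0<..<\<rho>0} f'"
    and f0: "f 0 = 0" "f' 0 = 0"
    and on: "\<And>x y. \<bar>x\<bar> < \<rho>0 \<Longrightarrow> \<bar>y\<bar> < \<kappa>0 \<Longrightarrow> Z (x, y) \<in> \<gamma> \<longleftrightarrow> y = f x"
    using gr unfolding graph_at_def Z_def by simp_all
  have nT: "norm T = 1" "norm \<nu> = 1" using fr by (simp_all add: orthoframe_def norm_eq_sqrt_inner)
  have p0: "Z (0, 0) = p" by (simp add: Z_def frame_point_def)
  have p\<gamma>: "p \<in> \<gamma>" using on[of 0 0] pos0 f0 p0 by simp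
  have gu: "\<And>q. q \<in> U - \<gamma> \<Longrightarrow> (u has_derivative (\<lambda>v. grad u q \<bullet> v)) (at q)" "continuous_on (U - \<gamma>) (grad u)"
    using C1_on_grad[OF u(1)] by auto
  obtain DF where DF: "continuous_on U DF" "\<And>q. q \<in> U \<Longrightarrow> (F has_derivative blinfun_apply (DF q)) (at q)"
    using FH(1) unfolding C1_on_def by blast
  have cF: "continuous_on U F"
    by (intro continuous_at_imp_continuous_on ballI has_derivative_continuous[OF DF(2)])
  have gH: "\<And>q. q \<in> U \<Longrightarrow> (H has_derivative (\<lambda>v. grad H q \<bullet> v)) (at q)" "continuous_on U (grad H)"
    using C1_on_grad[OF FH(2)] by auto
  have cH: "continuous_on U H"
    by (intro continuous_at_imp_continuous_on ballI has_derivative_continuous[OF gH(1)])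
  have cN: "continuous_on (U - \<gamma>) N"
    unfolding N_def normal_field_def
    by (intro continuous_intros gu(2) continuous_on_subset[OF cF]) (use nz in auto)
  \<comment> \<open>Half of the smaller tangential component, so that both one-sided limits satisfy
    strict inequalities that persist near p.\<close>
  define c where "c = min (N1 \<bullet> T) (- (N2 \<bullet> T)) / 2"
  have c: "0 < c" "c < N1 \<bullet> T" "N2 \<bullet> T < - c" using sgn by (auto simp: c_def min_def)
  have "((\<lambda>q. N q \<bullet> T) \<longlongrightarrow> N1 \<bullet> T) (at p within W1)" "((\<lambda>q. N q \<bullet> T) \<longlongrightarrow> N2 \<bullet> T) (at p within W2)"
    by (intro tendsto_inner lim tendsto_const)+
  then have "\<forall>\<^sub>F q in at p within W1. c < N q \<bullet> T" "\<forall>\<^sub>F q in at p within W2. N q \<bullet> T < - c"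
    using order_tendstoD c(2,3) by blast+
  then obtain d1 d2 where d12: "0 < d1" "\<And>q. q \<in> W1 \<Longrightarrow> q \<noteq> p \<Longrightarrow> dist q p < d1 \<Longrightarrow> c < N q \<bullet> T"
      "0 < d2" "\<And>q. q \<in> W2 \<Longrightarrow> q \<noteq> p \<Longrightarrow> dist q p < d2 \<Longrightarrow> N q \<bullet> T < - c"
    unfolding eventually_at by metis
  define d where "d = min d1 d2"
  have d: "0 < d" using d12 by (simp add: d_def)
  define \<kappa> where "\<kappa> = min (\<kappa>0 / 2) (d / 3)"
  have \<kappa>: "0 < \<kappa>" "\<kappa> < \<kappa>0" "\<kappa> \<le> d / 3" using pos0 d by (auto simp: \<kappa>_def)
  have "isCont f 0" "isCont f' 0"
    using fd0[of 0] cf'0 pos0 by (auto intro: DERIV_isCont simp: continuous_on_eq_continuous_at)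
  then obtain e1 e2 where e12: "0 < e1" "\<And>x. dist x 0 < e1 \<Longrightarrow> dist (f x) (f 0) < \<kappa> / 2"
      "0 < e2" "\<And>x. dist x 0 < e2 \<Longrightarrow> dist (f' x) (f' 0) < min (c / 2) 1"
    unfolding continuous_at_eps_delta using \<kappa>(1) c(1) by (metis half_gt_zero min_less_iff_conj zero_less_one)
  \<comment> \<open>\<open>e2\<close> keeps |f'| below c / 2, for transversality, and below 1, for
    the correction; d / 3 for both x and y keeps the box within distance d of p.\<close>
  define \<rho>1 where "\<rho>1 = Min {\<rho>0 / 2, d / 3, e1, e2}"
  have \<rho>1: "0 < \<rho>1" "\<rho>1 < \<rho>0" "\<rho>1 \<le> d / 3" "\<rho>1 \<le> e1" "\<rho>1 \<le> e2" using pos0 d e12 by (auto simp: \<rho>1_def min_def)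
  define \<rho> where "\<rho> = \<rho>1 / 2"
  have \<rho>: "0 < \<rho>" "\<rho> < \<rho>1" "\<rho> < \<rho>0" using \<rho>1 by (auto simp: \<rho>_def)
  have fd: "(f has_real_derivative f' x) (at x)" if "\<bar>x\<bar> < \<rho>1" for x using fd0[of x] that \<rho>1 by simp
  have fb: "\<bar>f x\<bar> < \<kappa> / 2" "\<bar>f' x\<bar> \<le> c / 2" "\<bar>f' x\<bar> \<le> 1" if "\<bar>x\<bar> < \<rho>1" for x
    using e12(2)[of x] e12(4)[of x] that \<rho>1 f0 by (auto simp: dist_real_def)
  have ZU: "Z (x, y) \<in> U" if "\<bar>x\<bar> < \<rho>1" "\<bar>y\<bar> < \<kappa>" for x y using inU[of x y] that \<rho>1 \<kappa> by simp
  have near: "dist (Z (x, y)) p < d" if "\<bar>x\<bar> < \<rho>1" "\<bar>y\<bar> < \<kappa>" for x y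
  proof -
    have "dist (Z (x, y)) p = norm (x *\<^sub>R T + y *\<^sub>R \<nu>)" by (simp add: Z_def frame_point_def dist_norm)
    also have "\<dots> \<le> \<bar>x\<bar> + \<bar>y\<bar>" using norm_triangle_ineq[of "x *\<^sub>R T" "y *\<^sub>R \<nu>"] nT by simp
    also have "\<dots> < d" using that \<rho>1 \<kappa> d by linarith
    finally show ?thesis .
  qed
  have above: "Z (x, y) \<in> U - \<gamma>" "c < N (Z (x, y)) \<bullet> T" if "\<bar>x\<bar> < \<rho>1" "\<bar>y\<bar> < \<kappa>" "f x < y" for x y
  proof -
    have w: "Z (x, y) \<in> W1" using up[of x y] that \<rho>1 \<kappa> by simp
    then show "Z (x, y) \<in> U - \<gamma>" using W by blast
    then have "Z (x, y) \<noteq> p" using p\<gamma> by auto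
    then show "c < N (Z (x, y)) \<bullet> T" using d12(2)[OF w] near[OF that(1,2)] by (simp add: d_def)
  qed
  have below: "Z (x, y) \<in> U - \<gamma>" "N (Z (x, y)) \<bullet> T < - c" if "\<bar>x\<bar> < \<rho>1" "\<bar>y\<bar> < \<kappa>" "y < f x" for x y
  proof -
    have w: "Z (x, y) \<in> W2" using dn[of x y] that \<rho>1 \<kappa> by simp
    then show "Z (x, y) \<in> U - \<gamma>" using W by blast
    then have "Z (x, y) \<noteq> p" using p\<gamma> by auto
    then show "N (Z (x, y)) \<bullet> T < - c" using d12(4)[OF w] near[OF that(1,2)] by (simp add: d_def)
  qed
  have lev: "\<bar>f x + s\<bar> < \<kappa>" if "\<bar>x\<bar> < \<rho>1" "\<bar>s\<bar> < \<kappa> / 2" for x s using fb(1)[OF that(1)] that by (auto simp: abs_less_iff)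
  define Kc where "Kc = Z ` ({-\<rho>1..\<rho>1} \<times> {-\<kappa>..\<kappa>})"
  have Kc: "compact Kc" "Kc \<subseteq> U"
  proof -
    show "compact Kc" unfolding Kc_def Z_def by (intro compact_continuous_image continuous_frame_point compact_Times compact_Icc)
    show "Kc \<subseteq> U" unfolding Kc_def using inU \<rho>1 \<kappa> by (auto simp: abs_less_iff)
  qed
  have ZK: "Z (x, y) \<in> Kc" if "\<bar>x\<bar> < \<rho>1" "\<bar>y\<bar> < \<kappa>" for x y unfolding Kc_def using that by (intro imageI) auto
  have "bounded (DF ` Kc)" "bounded (grad H ` Kc)"
    by (intro compact_imp_bounded compact_continuous_image continuous_on_subset[OF DF(1)] continuous_on_subset[OF gH(2)] Kc)+
  then obtain M L where bd0: "\<And>q. q \<in> Kc \<Longrightarrow> norm (DF q) \<le> M" "\<And>q. q \<in> Kc \<Longrightarrow> norm (grad H q) \<le> L"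
    unfolding bounded_iff by auto
  have pK: "p \<in> Kc" using ZK[of 0 0] \<rho>1 \<kappa> p0 by simp
  have bd: "0 \<le> M" "0 \<le> L" using bd0(1)[OF pK] bd0(2)[OF pK] norm_ge_zero order_trans by blast+
  have DFb: "\<bar>blinfun_apply (DF q) v \<bullet> w\<bar> \<le> M" if "q \<in> Kc" "norm v = 1" "norm w = 1" for q v w
  proof -
    have "\<bar>blinfun_apply (DF q) v \<bullet> w\<bar> \<le> norm (blinfun_apply (DF q) v) * norm w" by (rule Cauchy_Schwarz_ineq2)
    also have "\<dots> \<le> norm (DF q) * norm v * norm w" by (intro mult_right_mono norm_blinfun) simp
    finally show ?thesis using bd0(1)[OF that(1)] that by simp
  qed
  have Zd: "(Z has_derivative (\<lambda>v. fst v *\<^sub>R T + snd v *\<^sub>R \<nu>)) (at z)" for z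
    using frame_point_has_derivative[of fst fst z snd snd p T \<nu>] by (simp add: Z_def has_derivative_fst has_derivative_snd)
  have Fc: "((\<lambda>z. F (Z z) \<bullet> w) has_derivative (\<lambda>v. (blinfun_apply (DF (Z z)) T \<bullet> w) * fst v + (blinfun_apply (DF (Z z)) \<nu> \<bullet> w) * snd v)) (at z)"
    if "Z z \<in> U" for z w
  proof -
    have "((\<lambda>z. F (Z z)) has_derivative (\<lambda>v. blinfun_apply (DF (Z z)) (fst v *\<^sub>R T + snd v *\<^sub>R \<nu>))) (at z)"
      by (rule has_derivative_compose[OF Zd DF(2)[OF that]])
    from has_derivative_inner_left[OF this, of w] show ?thesis
      by (rule has_derivative_eq_rhs) (auto simp: blinfun.add_right blinfun.scaleR_right inner_add_left mult.commute)
  qed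
  let ?Q = "{z. \<bar>fst z\<bar> < \<rho>1 \<and> \<bar>snd z\<bar> < \<kappa>}"
  have QU: "Z z \<in> U" "Z z \<in> Kc" if "z \<in> ?Q" for z using ZU[of "fst z" "snd z"] ZK[of "fst z" "snd z"] that by auto
  have cZ: "continuous_on S Z" for S by (simp add: Z_def continuous_frame_point)
  have cDF: "continuous_on ?Q (\<lambda>z. blinfun_apply (DF (Z z)) v \<bullet> w)" for v w
    by (intro continuous_on_inner blinfun.continuous_on continuous_on_compose2[OF DF(1) cZ] continuous_on_const) (use QU in auto)
  have cf': "continuous_on {-\<rho>1<..<\<rho>1} f'" by (rule continuous_on_subset[OF cf'0]) (use \<rho>1 in auto)
  have "\<exists>A As. (\<forall>x s. \<bar>x\<bar> < \<rho> \<longrightarrow> \<bar>s\<bar> < \<kappa> / 2 \<longrightarrow>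
        ((\<lambda>z. A (fst z) (snd z)) has_derivative (\<lambda>v. (F (Z (x, f x + s)) \<bullet> T + F (Z (x, f x + s)) \<bullet> \<nu> * f' x) * fst v + As x s * snd v)) (at (x, s)))
      \<and> (\<forall>x. \<bar>x\<bar> < \<rho> \<longrightarrow> continuous_on {- (\<kappa> / 2)<..<\<kappa> / 2} (As x))
      \<and> (\<forall>x x' s. \<bar>x\<bar> < \<rho> \<longrightarrow> \<bar>x'\<bar> < \<rho> \<longrightarrow> \<bar>s\<bar> < \<kappa> / 2 \<longrightarrow>
        \<bar>(F (Z (x, f x + s)) \<bullet> \<nu> - As x s) - (F (Z (x', f x' + s)) \<bullet> \<nu> - As x' s)\<bar> \<le> (4 * M) * \<bar>x - x'\<bar>)"
    (is "\<exists>A As. ?P A As")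
  proof (rule gauge_potential[where ?F1.0 = "\<lambda>z. F (Z z) \<bullet> T" and ?F2.0 = "\<lambda>z. F (Z z) \<bullet> \<nu>" and ?\<rho>0.0 = \<rho>1,
        OF \<rho>(1,2) bd(1) fd cf' fb(1) fb(3)])
      show "((\<lambda>z. F (Z z) \<bullet> T) has_derivative (\<lambda>v. (blinfun_apply (DF (Z z)) T \<bullet> T) * fst v + (blinfun_apply (DF (Z z)) \<nu> \<bullet> T) * snd v)) (at z)"
        "((\<lambda>z. F (Z z) \<bullet> \<nu>) has_derivative (\<lambda>v. (blinfun_apply (DF (Z z)) T \<bullet> \<nu>) * fst v + (blinfun_apply (DF (Z z)) \<nu> \<bullet> \<nu>) * snd v)) (at z)"
        if "\<bar>fst z\<bar> < \<rho>1" "\<bar>snd z\<bar> < \<kappa>" for z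
        by (intro Fc QU(1); use that in simp)+
      show "continuous_on ?Q (\<lambda>z. blinfun_apply (DF (Z z)) \<nu> \<bullet> T)" "continuous_on ?Q (\<lambda>z. blinfun_apply (DF (Z z)) \<nu> \<bullet> \<nu>)"
        by (rule cDF)+
      show "\<bar>blinfun_apply (DF (Z z)) \<nu> \<bullet> T\<bar> \<le> M \<and> \<bar>blinfun_apply (DF (Z z)) T \<bullet> \<nu>\<bar> \<le> M \<and> \<bar>blinfun_apply (DF (Z z)) \<nu> \<bullet> \<nu>\<bar> \<le> M"
        if "\<bar>fst z\<bar> < \<rho>1" "\<bar>snd z\<bar> < \<kappa>" for z
        by (intro conjI DFb QU(2) nT; use that in simp)
    qed
  then obtain A where "\<exists>As. ?P A As" ..
  then obtain As where AA0: "?P A As" ..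
  note AA = AA0[THEN conjunct1, rule_format] AA0[THEN conjunct2, THEN conjunct1, rule_format]
    AA0[THEN conjunct2, THEN conjunct2, rule_format]
  define B where "B x s = F (Z (x, f x + s)) \<bullet> \<nu> - As x s" for x s
  \<comment> \<open>The chart that straightens the curve: s is the height above it, and horizontal
    lines become its vertical translates.\<close>
  define G where "G z = Z (fst z, f (fst z) + snd z)" for z :: "real \<times> real"
  define uh where "uh z = u (G z) + A (fst z) (snd z)" for z
  have Blip: "\<bar>B x s - B x' s\<bar> \<le> (4 * M) * \<bar>x - x'\<bar>" if "\<bar>x\<bar> < \<rho>" "\<bar>x'\<bar> < \<rho>" "\<bar>s\<bar> < \<kappa> / 2" for x x' s
    unfolding B_def by (rule AA(3)[OF that])
  let ?O = "{-\<rho><..<\<rho>} \<times> {- (\<kappa> / 2)<..<\<kappa> / 2}"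
  have cf: "continuous_on {-\<rho>1<..<\<rho>1} f" by (intro continuous_at_imp_continuous_on ballI DERIV_isCont[OF fd]) auto
  have cG: "continuous_on ?O G"
    unfolding G_def
    by (intro continuous_on_compose2[OF cZ[of UNIV]] continuous_on_Pair continuous_on_add continuous_on_compose2[OF cf]
        continuous_on_fst continuous_on_snd continuous_on_id) (use \<rho> in auto)
  have OG: "G z \<in> U" if "z \<in> ?O" for z
  proof -
    have "\<bar>fst z\<bar> < \<rho>1" "\<bar>snd z\<bar> < \<kappa> / 2" using that \<rho> by (auto simp: abs_less_iff)
    then show ?thesis unfolding G_def by (intro ZU lev)
  qed
  have uhc: "continuous_on ?O uh"
  proof -
    have "continuous_on ?O (\<lambda>z. A (fst z) (snd z))"
    proof (intro continuous_at_imp_continuous_on ballI)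
      fix z assume "z \<in> ?O"
      then have "\<bar>fst z\<bar> < \<rho>" "\<bar>snd z\<bar> < \<kappa> / 2" by (auto simp: abs_less_iff)
      from has_derivative_continuous[OF AA(1)[OF this]] show "isCont (\<lambda>z. A (fst z) (snd z)) z" by simp
    qed
    moreover have "continuous_on ?O (\<lambda>z. u (G z))"
      by (rule continuous_on_compose2[OF u(2) cG]) (use OG in blast)
    ultimately show ?thesis unfolding uh_def by (intro continuous_on_add)
  qed
  have offg: "Z (x, f x + s) \<in> U - \<gamma>" if "\<bar>x\<bar> < \<rho>1" "\<bar>s\<bar> < \<kappa> / 2" "s \<noteq> 0" for x s
    using above(1)[OF that(1) lev[OF that(1,2)]] below(1)[OF that(1) lev[OF that(1,2)]] that(3) by (cases "0 < s") auto
  have uhd: "(uh has_derivative (\<lambda>v. (E (Z (x, f x + s)) * (N (Z (x, f x + s)) \<bullet> T + N (Z (x, f x + s)) \<bullet> \<nu> * f' x)) * fst v +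
      (E (Z (x, f x + s)) * (N (Z (x, f x + s)) \<bullet> \<nu>) - B x s) * snd v)) (at (x, s))"
    if x: "\<bar>x\<bar> < \<rho>" "\<bar>s\<bar> < \<kappa> / 2" "s \<noteq> 0" for x s
  proof -
    let ?q = "Z (x, f x + s)"
    have x1: "\<bar>x\<bar> < \<rho>1" using x \<rho> by simp
    have q: "?q \<in> U - \<gamma>" by (rule offg[OF x1 x(2,3)])
    have EN: "E ?q *\<^sub>R N ?q = grad u ?q + F ?q" using nz[OF q] by (simp add: E_def N_def normal_field_def)
    have gw: "grad u ?q \<bullet> w = E ?q * (N ?q \<bullet> w) - F ?q \<bullet> w" for w
    proof -
      have "grad u ?q = E ?q *\<^sub>R N ?q - F ?q" unfolding EN by simp
      then show ?thesis by (simp add: inner_diff_left)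
    qed
    have fdv: "((\<lambda>z. f (fst z) + snd z) has_derivative (\<lambda>v. f' x * fst v + snd v)) (at (x, s))"
    proof -
      have "(f has_derivative (*) (f' x)) (at (fst (x, s)))" using fd[OF x1] by (simp add: has_field_derivative_def)
      from has_derivative_compose[OF has_derivative_fst[OF has_derivative_ident] this]
      show ?thesis by (intro has_derivative_add has_derivative_snd[OF has_derivative_ident]) simp
    qed
    have Gd: "(G has_derivative (\<lambda>v. fst v *\<^sub>R T + (f' x * fst v + snd v) *\<^sub>R \<nu>)) (at (x, s))"
      unfolding G_def[abs_def] Z_def
      by (rule frame_point_has_derivative[OF has_derivative_fst[OF has_derivative_ident] fdv])
    have "(u has_derivative (\<lambda>v. grad u ?q \<bullet> v)) (at (G (x, s)))" using gu(1)[OF q] by (simp add: G_def)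
    from has_derivative_compose[OF Gd this]
    have "((\<lambda>z. u (G z)) has_derivative (\<lambda>v. grad u ?q \<bullet> (fst v *\<^sub>R T + (f' x * fst v + snd v) *\<^sub>R \<nu>))) (at (x, s))" .
    from has_derivative_add[OF this AA(1)[OF x(1,2)]] show ?thesis
      unfolding uh_def[abs_def]
      by (rule has_derivative_eq_rhs, simp add: fun_eq_iff inner_add_right gw B_def, simp add: algebra_simps)
  qed
  have cs: "continuous_on {- (\<kappa> / 2)<..<\<kappa> / 2} (\<lambda>s. uh (x, s))" if "\<bar>x\<bar> < \<rho>" for x
    by (rule continuous_on_compose2[OF uhc]) (use that in \<open>auto intro!: continuous_intros simp: abs_less_iff\<close>)
  have c0: "isCont (\<lambda>s. uh (x, s)) 0" if "\<bar>x\<bar> < \<rho>" for x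
    using cs[OF that] \<kappa>(1) by (simp add: continuous_on_eq_continuous_at)
  have n2f: "\<bar>N q \<bullet> \<nu> * f' x\<bar> \<le> c / 2" if "\<bar>x\<bar> < \<rho>1" for q x
  proof -
    have "\<bar>N q \<bullet> \<nu>\<bar> \<le> norm (N q) * norm \<nu>" by (rule Cauchy_Schwarz_ineq2)
    also have "\<dots> \<le> 1" using norm_normal_field_le_1[of u F q] nT by (simp add: N_def)
    finally have "\<bar>N q \<bullet> \<nu>\<bar> * \<bar>f' x\<bar> \<le> 1 * (c / 2)" using fb(2)[OF that] by (intro mult_mono) auto
    then show ?thesis by (simp add: abs_mult)
  qed
  have dx: "((\<lambda>t. uh (t, s)) has_real_derivative E (Z (x, f x + s)) * (N (Z (x, f x + s)) \<bullet> T + N (Z (x, f x + s)) \<bullet> \<nu> * f' x)) (at x)"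
    if "\<bar>x\<bar> < \<rho>" "\<bar>s\<bar> < \<kappa> / 2" "s \<noteq> 0" for x s
    using chain_two[where F = uh and g = "\<lambda>t. t" and k = "\<lambda>_. s", OF uhd[OF that] DERIV_ident DERIV_const] by simp
  have E0: "0 \<le> E q" for q by (simp add: E_def)
  \<comment> \<open>At a height s > 0 the derivative of \<open>uh\<close> in x is nonnegative, since
    N . T > c dominates the other term, of size at most c / 2; at s < 0 it is nonpositive. Letting s
    tend to 0 from both sides gives the two inequalities.\<close>
  have const: "uh (x, 0) = uh (x', 0)" if xx: "\<bar>x\<bar> < \<rho>" "\<bar>x'\<bar> < \<rho>" "x \<le> x'" for x x'
  proof (rule antisym)
    have lims: "((\<lambda>s. uh (y, s)) \<longlongrightarrow> uh (y, 0)) (at_right 0)" "((\<lambda>s. uh (y, s)) \<longlongrightarrow> uh (y, 0)) (at_left 0)" if "\<bar>y\<bar> < \<rho>" for y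
      using c0[OF that] unfolding isCont_def filterlim_at_split by auto
    have "uh (x, s) \<le> uh (x', s)" if s: "0 < s" "s < \<kappa> / 2" for s
    proof (rule DERIV_nonneg_imp_nondecreasing[OF xx(3), where f = "\<lambda>t. uh (t, s)"])
      fix t assume "x \<le> t" "t \<le> x'"
      then have t: "\<bar>t\<bar> < \<rho>" "\<bar>t\<bar> < \<rho>1" using xx \<rho> by (auto simp: abs_less_iff)
      have s': "\<bar>s\<bar> < \<kappa> / 2" "s \<noteq> 0" using s by auto
      have "c < N (Z (t, f t + s)) \<bullet> T" by (rule above(2)[OF t(2) lev[OF t(2) s'(1)]]) (use s in simp)
      then have "0 \<le> N (Z (t, f t + s)) \<bullet> T + N (Z (t, f t + s)) \<bullet> \<nu> * f' t"
        using n2f[OF t(2), of "Z (t, f t + s)"] c(1) by linarith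
      then have "0 \<le> E (Z (t, f t + s)) * (N (Z (t, f t + s)) \<bullet> T + N (Z (t, f t + s)) \<bullet> \<nu> * f' t)"
        by (rule mult_nonneg_nonneg[OF E0])
      then show "\<exists>D. ((\<lambda>t. uh (t, s)) has_real_derivative D) (at t) \<and> 0 \<le> D" using dx[OF t(1) s'] by blast
    qed
    then have "\<forall>\<^sub>F s in at_right 0. uh (x, s) \<le> uh (x', s)"
      using \<kappa>(1) by (auto simp: eventually_at_right_field intro!: exI[of _ "\<kappa> / 2"])
    then show "uh (x, 0) \<le> uh (x', 0)" by (rule tendsto_le[OF trivial_limit_at_right_real lims(1)[OF xx(2)] lims(1)[OF xx(1)]])
    have "uh (x', s) \<le> uh (x, s)" if s: "s < 0" "- (\<kappa> / 2) < s" for s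
    proof (rule DERIV_nonpos_imp_nonincreasing[OF xx(3), where f = "\<lambda>t. uh (t, s)"])
      fix t assume "x \<le> t" "t \<le> x'"
      then have t: "\<bar>t\<bar> < \<rho>" "\<bar>t\<bar> < \<rho>1" using xx \<rho> by (auto simp: abs_less_iff)
      have s': "\<bar>s\<bar> < \<kappa> / 2" "s \<noteq> 0" using s by auto
      have "N (Z (t, f t + s)) \<bullet> T < - c" by (rule below(2)[OF t(2) lev[OF t(2) s'(1)]]) (use s in simp)
      then have "N (Z (t, f t + s)) \<bullet> T + N (Z (t, f t + s)) \<bullet> \<nu> * f' t \<le> 0"
        using n2f[OF t(2), of "Z (t, f t + s)"] c(1) by linarith
      then have "E (Z (t, f t + s)) * (N (Z (t, f t + s)) \<bullet> T + N (Z (t, f t + s)) \<bullet> \<nu> * f' t) \<le> 0"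
        by (rule mult_nonneg_nonpos[OF E0])
      then show "\<exists>D. ((\<lambda>t. uh (t, s)) has_real_derivative D) (at t) \<and> D \<le> 0" using dx[OF t(1) s'] by blast
    qed
    then have "\<forall>\<^sub>F s in at_left 0. uh (x', s) \<le> uh (x, s)"
      using \<kappa>(1) by (auto simp: eventually_at_left_field intro!: exI[of _ "- (\<kappa> / 2)"])
    then show "uh (x', 0) \<le> uh (x, 0)" by (rule tendsto_le[OF trivial_limit_at_left_real lims(2)[OF xx(1)] lims(2)[OF xx(2)]])
  qed
  have hlip: "\<bar>H (Z (x, y)) - H (Z (x', y))\<bar> \<le> L * \<bar>x - x'\<bar>" if "\<bar>x\<bar> < \<rho>" "\<bar>x'\<bar> < \<rho>" "\<bar>y\<bar> < \<kappa>" for x x' y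
  proof -
    have "norm (H (Z (x, y)) - H (Z (x', y))) \<le> L * norm (x - x')"
    proof (rule field_differentiable_bound[of "{-\<rho><..<\<rho>}" "\<lambda>t. H (Z (t, y))" "\<lambda>t. grad H (Z (t, y)) \<bullet> T"])
      fix t assume "t \<in> {-\<rho><..<\<rho>}"
      then have t: "\<bar>t\<bar> < \<rho>1" using \<rho> by auto
      have "((\<lambda>t. Z (t, y)) has_derivative (\<lambda>v. v *\<^sub>R T + 0 *\<^sub>R \<nu>)) (at t)"
        unfolding Z_def by (rule frame_point_has_derivative[OF has_derivative_ident has_derivative_const])
      from has_derivative_compose[OF this gH(1)[OF ZU[OF t that(3)]]]
      have "((\<lambda>t. H (Z (t, y))) has_real_derivative grad H (Z (t, y)) \<bullet> T) (at t)"
        unfolding has_field_derivative_def by (rule has_derivative_eq_rhs) (auto simp: fun_eq_iff mult.commute)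
      then show "((\<lambda>t. H (Z (t, y))) has_field_derivative grad H (Z (t, y)) \<bullet> T) (at t within {-\<rho><..<\<rho>})"
        by (rule has_field_derivative_at_within)
      have "\<bar>grad H (Z (t, y)) \<bullet> T\<bar> \<le> norm (grad H (Z (t, y))) * norm T" by (rule Cauchy_Schwarz_ineq2)
      then show "norm (grad H (Z (t, y)) \<bullet> T) \<le> L" using bd0(2)[OF ZK[OF t that(3)]] nT by simp
    qed (use that in auto)
    then show ?thesis by simp
  qed
  have M4: "0 \<le> 4 * M" using bd by simp
  have "\<exists>C r. 0 < r \<and> 0 \<le> C \<and> (\<forall>x s. \<bar>x\<bar> < r \<longrightarrow> 0 < s \<longrightarrow> s < r \<longrightarrow> E (Z (x, f x + s)) \<le> C * s)"
  proof (rule side_estimate[OF Z_def[THEN meta_eq_to_obj_eq] N_def[THEN meta_eq_to_obj_eq] E_def[THEN meta_eq_to_obj_eq]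
        fr U cN cH weak nz \<rho>(1) \<kappa>(1) c(1) bd(2) M4, where f' = f' and uh = uh and B = B])
    fix x assume "\<bar>x\<bar> < \<rho>"
    then have x: "\<bar>x\<bar> < \<rho>1" using \<rho> by simp
    show "(f has_real_derivative f' x) (at x)" "\<bar>f' x\<bar> \<le> c / 2" "\<bar>f x\<bar> < \<kappa> / 2" using fd[OF x] fb[OF x] by auto
  next
    fix x y assume xy: "\<bar>x\<bar> < \<rho>" "f x < y" "y < \<kappa>"
    then have x: "\<bar>x\<bar> < \<rho>1" using \<rho> by simp
    have y: "\<bar>y\<bar> < \<kappa>" using fb(1)[OF x] xy \<kappa>(1) by (auto simp: abs_less_iff)
    show "Z (x, y) \<in> U - \<gamma>" "c \<le> N (Z (x, y)) \<bullet> T" using above[OF x y xy(2)] by auto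
  next
    fix x x' y assume "\<bar>x\<bar> < \<rho>" "\<bar>x'\<bar> < \<rho>" "\<bar>y\<bar> < \<kappa>"
    then show "\<bar>H (Z (x, y)) - H (Z (x', y))\<bar> \<le> L * \<bar>x - x'\<bar>" by (rule hlip)
  next
    fix x s assume "\<bar>x\<bar> < \<rho>" "0 < s" "s < \<kappa> / 2"
    then show "(uh has_derivative (\<lambda>v. (E (Z (x, f x + s)) * (N (Z (x, f x + s)) \<bullet> T + N (Z (x, f x + s)) \<bullet> \<nu> * f' x)) * fst v +
      (E (Z (x, f x + s)) * (N (Z (x, f x + s)) \<bullet> \<nu>) - B x s) * snd v)) (at (x, s))"
      by (intro uhd) auto
  next
    fix x x' s assume "\<bar>x\<bar> < \<rho>" "\<bar>x'\<bar> < \<rho>" "0 < s" "s < \<kappa> / 2"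
    then show "\<bar>B x s - B x' s\<bar> \<le> (4 * M) * \<bar>x - x'\<bar>" by (intro Blip) auto
  next
    show "continuous_on ({-\<rho><..<\<rho>} \<times> {0..<\<kappa> / 2}) uh" by (rule continuous_on_subset[OF uhc]) (use \<kappa>(1) in auto)
  next
    fix x x' assume "\<bar>x\<bar> < \<rho>" "\<bar>x'\<bar> < \<rho>" "x \<le> x'"
    then have "uh (x, 0) = uh (x', 0)" by (rule const)
    then show "uh (x', 0) \<le> uh (x, 0)" by simp
  qed simp
  then obtain C1 r1 where r1: "0 < r1" "0 \<le> C1" "\<And>x s. \<bar>x\<bar> < r1 \<Longrightarrow> 0 < s \<Longrightarrow> s < r1 \<Longrightarrow> E (Z (x, f x + s)) \<le> C1 * s" by blast
  \<comment> \<open>A half-turn about p maps the lower side to an upper side: reversing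
    \<open>T\<close> and \<open>\<nu>\<close> together turns N . T < - c into the required lower
    bound, reflects \<open>uh\<close> in both variables and changes the sign of
    \<open>B\<close>.\<close>
  define f2 where "f2 x = - f (- x)" for x
  define f2' where "f2' x = f' (- x)" for x
  define uh2 where "uh2 z = uh (- fst z, - snd z)" for z :: "real \<times> real"
  define B2 where "B2 x s = - B (- x) (- s)" for x s
  define Z2 where "Z2 = frame_point p (- T) (- \<nu>)"
  have Zm: "Z2 (x, y) = Z (- x, - y)" for x y by (simp add: Z_def Z2_def frame_point_def)
  have fr2: "orthoframe (- T) (- \<nu>)" using fr by (simp add: orthoframe_def)
  have lvl: "Z (- x, - (f2 x + s)) = Z (- x, f (- x) + - s)" for x s by (simp add: f2_def)
  have "\<exists>C r. 0 < r \<and> 0 \<le> C \<and> (\<forall>x s. \<bar>x\<bar> < r \<longrightarrow> 0 < s \<longrightarrow> s < r \<longrightarrow> E (Z2 (x, f2 x + s)) \<le> C * s)"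
    unfolding Zm
  proof (rule side_estimate[OF Z2_def N_def[THEN meta_eq_to_obj_eq] E_def[THEN meta_eq_to_obj_eq]
        fr2 U cN cH weak nz \<rho>(1) \<kappa>(1) c(1) bd(2) M4, where f' = f2' and uh = uh2 and B = B2, unfolded Zm])
    fix x assume "\<bar>x\<bar> < \<rho>"
    then have x: "\<bar>- x\<bar> < \<rho>1" using \<rho> by simp
    show "\<bar>f2' x\<bar> \<le> c / 2" "\<bar>f2 x\<bar> < \<kappa> / 2" using fb[OF x] by (auto simp: f2_def f2'_def)
    have "((\<lambda>x. - x) has_real_derivative - 1) (at x)" by (auto intro!: derivative_eq_intros)
    from DERIV_minus[OF DERIV_chain2[OF fd[OF x] this]] show "(f2 has_real_derivative f2' x) (at x)"
      by (simp add: f2_def[abs_def] f2'_def)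
  next
    fix x y assume xy: "\<bar>x\<bar> < \<rho>" "f2 x < y" "y < \<kappa>"
    then have x: "\<bar>- x\<bar> < \<rho>1" using \<rho> by simp
    have y: "\<bar>- y\<bar> < \<kappa>" using fb(1)[OF x] xy \<kappa>(1) by (auto simp: abs_less_iff f2_def)
    have "- y < f (- x)" using xy(2) by (simp add: f2_def)
    from below[OF x y this] show "Z (- x, - y) \<in> U - \<gamma>" "c \<le> N (Z (- x, - y)) \<bullet> - T" by auto
  next
    fix x x' y assume "\<bar>x\<bar> < \<rho>" "\<bar>x'\<bar> < \<rho>" "\<bar>y\<bar> < \<kappa>"
    then have "\<bar>H (Z (- x, - y)) - H (Z (- x', - y))\<bar> \<le> L * \<bar>- x - - x'\<bar>" by (intro hlip) auto
    then show "\<bar>H (Z (- x, - y)) - H (Z (- x', - y))\<bar> \<le> L * \<bar>x - x'\<bar>" by (simp add: abs_minus_commute)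
  next
    fix x s assume xs: "\<bar>x\<bar> < \<rho>" "0 < s" "s < \<kappa> / 2"
    let ?q = "Z (- x, f (- x) + - s)"
    have "((\<lambda>z::real \<times> real. (- fst z, - snd z)) has_derivative (\<lambda>v. (- fst v, - snd v))) (at (x, s))"
      by (intro has_derivative_Pair has_derivative_minus has_derivative_fst has_derivative_snd has_derivative_ident)
    moreover have "(uh has_derivative (\<lambda>v. (E ?q * (N ?q \<bullet> T + N ?q \<bullet> \<nu> * f' (- x))) * fst v +
      (E ?q * (N ?q \<bullet> \<nu>) - B (- x) (- s)) * snd v)) (at (- fst (x, s), - snd (x, s)))"
      using uhd[of "- x" "- s"] xs by simp
    ultimately have "(uh2 has_derivative (\<lambda>v. (E ?q * (N ?q \<bullet> T + N ?q \<bullet> \<nu> * f' (- x))) * - fst v +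
      (E ?q * (N ?q \<bullet> \<nu>) - B (- x) (- s)) * - snd v)) (at (x, s))"
      unfolding uh2_def[abs_def] using has_derivative_compose[where g = uh] by fastforce
    then show "(uh2 has_derivative (\<lambda>v. (E (Z (- x, - (f2 x + s))) * (N (Z (- x, - (f2 x + s))) \<bullet> - T + N (Z (- x, - (f2 x + s))) \<bullet> - \<nu> * f2' x)) * fst v +
      (E (Z (- x, - (f2 x + s))) * (N (Z (- x, - (f2 x + s))) \<bullet> - \<nu>) - B2 x s) * snd v)) (at (x, s))"
      unfolding lvl by (rule has_derivative_eq_rhs) (auto simp: fun_eq_iff B2_def f2'_def algebra_simps)
  next
    fix x x' s assume "\<bar>x\<bar> < \<rho>" "\<bar>x'\<bar> < \<rho>" "0 < s" "s < \<kappa> / 2"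
    then have "\<bar>B (- x) (- s) - B (- x') (- s)\<bar> \<le> (4 * M) * \<bar>- x - - x'\<bar>" by (intro Blip) auto
    then show "\<bar>B2 x s - B2 x' s\<bar> \<le> (4 * M) * \<bar>x - x'\<bar>" by (simp add: B2_def abs_minus_commute)
  next
    show "continuous_on ({-\<rho><..<\<rho>} \<times> {0..<\<kappa> / 2}) uh2"
      unfolding uh2_def
      by (rule continuous_on_compose2[OF uhc]) (use \<kappa>(1) in \<open>auto intro!: continuous_intros\<close>)
  next
    fix x x' assume xx: "\<bar>x\<bar> < \<rho>" "\<bar>x'\<bar> < \<rho>" "x \<le> x'"
    have "uh (- x', 0) = uh (- x, 0)" by (rule const) (use xx in auto)
    then show "uh2 (x', 0) \<le> uh2 (x, 0)" by (simp add: uh2_def)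
  qed simp
  then obtain C2 r2 where r2: "0 < r2" "0 \<le> C2"
    "\<And>x s. \<bar>x\<bar> < r2 \<Longrightarrow> 0 < s \<Longrightarrow> s < r2 \<Longrightarrow> E (Z (- x, f (- x) + - s)) \<le> C2 * s"
    unfolding Zm lvl by blast
  define C where "C = max C1 C2"
  define r where "r = Min {r1, r2, \<rho>, \<kappa> / 2}"
  have r: "0 < r" "r \<le> r1" "r \<le> r2" "r \<le> \<rho>" "r \<le> \<kappa> / 2" using r1 r2 \<rho> \<kappa> by (auto simp: r_def min_def)
  have C: "0 \<le> C" "C1 \<le> C" "C2 \<le> C" using r1 r2 by (auto simp: C_def)
  have small: "E (Z (x, f x + s)) \<le> C * \<bar>s\<bar>" if "\<bar>x\<bar> < r" "s \<noteq> 0" "\<bar>s\<bar> < r" for x s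
  proof (cases "0 < s")
    case True
    have "E (Z (x, f x + s)) \<le> C1 * s" by (rule r1(3)) (use that True r in auto)
    also have "\<dots> \<le> C * s" using C True by (intro mult_right_mono) auto
    finally show ?thesis using True by simp
  next
    case False
    have "E (Z (- (- x), f (- (- x)) + - (- s))) \<le> C2 * (- s)" by (rule r2(3)) (use that False r in auto)
    then have "E (Z (x, f x + s)) \<le> C2 * (- s)" by simp
    also have "\<dots> \<le> C * (- s)" using C False by (intro mult_right_mono) auto
    finally show ?thesis using False by simp
  qed
  have "isCont f 0" using fd[of 0] \<rho>1 by (auto intro: DERIV_isCont)
  then obtain r4 where r4: "0 < r4" "\<And>x. dist x 0 < r4 \<Longrightarrow> dist (f x) (f 0) < r / 2"
    unfolding continuous_at_eps_delta using r(1) by (meson half_gt_zero)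
  define r3 where "r3 = min r r4"
  have r3: "0 < r3" "r3 \<le> r" using r r4 by (auto simp: r3_def)
  have fr3: "\<bar>f x\<bar> < r / 2" if "\<bar>x\<bar> < r3" for x using r4(2)[of x] that f0 by (simp add: r3_def dist_real_def)
  define V where "V = {q. \<bar>(q - p) \<bullet> T\<bar> < r3 \<and> \<bar>(q - p) \<bullet> \<nu>\<bar> < r / 2}"
  define xc where "xc q = (q - p) \<bullet> T" for q
  define sc where "sc q = (q - p) \<bullet> \<nu> - f (xc q)" for q
  have oV: "open V" unfolding V_def by (intro open_Collect_conj open_Collect_less continuous_intros)
  have pV: "p \<in> V" using r3 r by (simp add: V_def)
  have Vc: "\<bar>xc q\<bar> < r" "\<bar>xc q\<bar> < r3" "\<bar>sc q\<bar> < r" "Z (xc q, f (xc q) + sc q) = q" "q \<in> U" "q \<in> \<gamma> \<longleftrightarrow> sc q = 0" if "q \<in> V" for q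
  proof -
    show x: "\<bar>xc q\<bar> < r3" using that by (simp add: V_def xc_def)
    then show "\<bar>xc q\<bar> < r" using r3 by simp
    have y: "\<bar>(q - p) \<bullet> \<nu>\<bar> < r / 2" using that by (simp add: V_def)
    then show "\<bar>sc q\<bar> < r" using fr3[OF x] by (auto simp: sc_def abs_less_iff)
    show Zq: "Z (xc q, f (xc q) + sc q) = q"
      using frame_point_coords(3)[OF fr, of p q] by (simp add: Z_def xc_def sc_def)
    have xr: "\<bar>xc q\<bar> < \<rho>0" using x r3 r \<rho> by simp
    have yk: "\<bar>f (xc q) + sc q\<bar> < \<kappa>0" using y r \<kappa> by (simp add: sc_def)
    show "q \<in> U" using inU[OF xr yk] Zq by simp
    show "q \<in> \<gamma> \<longleftrightarrow> sc q = 0" using on[OF xr yk] Zq by simp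
  qed
  have r\<rho>: "r \<le> \<rho>" by (rule r(4))
  \<comment> \<open>The candidate for the gradient of \<open>u\<close>, with value
    \<open>- F\<close> on the curve; \<open>W + F\<close> is bounded by C times the height, which
    yields continuity across the curve.\<close>
  define W where "W q = (if q \<in> \<gamma> then - F q else grad u q)" for q
  have WE: "norm (W q + F q) \<le> C * \<bar>sc q\<bar>" if "q \<in> V" for q
  proof (cases "q \<in> \<gamma>")
    case True then show ?thesis using C by (simp add: W_def)
  next
    case False
    have "E (Z (xc q, f (xc q) + sc q)) \<le> C * \<bar>sc q\<bar>"
      by (rule small) (use Vc[OF that] False in auto)
    then show ?thesis using Vc(4)[OF that] False by (simp add: W_def E_def)
  qed
  have cxc: "continuous_on S xc" for S unfolding xc_def by (intro continuous_intros)
  have csc: "continuous_on V sc"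
    unfolding sc_def
    by (intro continuous_intros continuous_on_compose2[OF cf cxc]) (use Vc(1) r\<rho> \<rho> in \<open>force simp: abs_less_iff\<close>)
  have cWF: "continuous_on V (\<lambda>q. W q + F q)"
  proof (intro continuous_at_imp_continuous_on ballI)
    fix q assume q: "q \<in> V"
    show "isCont (\<lambda>q. W q + F q) q"
    proof (cases "q \<in> \<gamma>")
      case False
      have "continuous_on (U - \<gamma>) (\<lambda>q. grad u q + F q)" by (intro continuous_intros gu(2) continuous_on_subset[OF cF]) auto
      then have "continuous_on (U - \<gamma>) (\<lambda>q. W q + F q)" by (rule continuous_on_eq) (simp add: W_def)
      then show ?thesis using U(2) False Vc(5)[OF q] by (simp add: continuous_on_eq_continuous_at)
    next
      case True
      have "isCont sc q" using csc oV q by (simp add: continuous_on_eq_continuous_at)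
      then have "((\<lambda>q. C * \<bar>sc q\<bar>) \<longlongrightarrow> C * \<bar>sc q\<bar>) (at q)" unfolding isCont_def by (intro tendsto_intros)
      then have "((\<lambda>q. C * \<bar>sc q\<bar>) \<longlongrightarrow> 0) (at q)" using Vc(6)[OF q] True by simp
      moreover have "\<forall>\<^sub>F q' in at q. norm (W q' + F q') \<le> C * \<bar>sc q'\<bar>"
        using eventually_at_topological oV q WE by blast
      ultimately have "((\<lambda>q. W q + F q) \<longlongrightarrow> 0) (at q)" by (rule Lim_null_comparison[rotated])
      then show ?thesis using True by (simp add: isCont_def W_def)
    qed
  qed
  have cW: "continuous_on V W"
  proof -
    have "continuous_on V (\<lambda>q. (W q + F q) - F q)"
      by (intro continuous_on_diff cWF continuous_on_subset[OF cF]) (use Vc(5) in auto)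
    then show ?thesis by simp
  qed
  \<comment> \<open>Since \<open>uh\<close> is constant at height 0, an increment from (x0, 0)
    equals the vertical one above the new x. There the derivative is E (N . \<nu>) - B, and
    \<open>E\<close> vanishes linearly with the height.\<close>
  have uh0: "(uh has_derivative (\<lambda>v. - B x0 0 * snd v)) (at (x0, 0))" if x0: "\<bar>x0\<bar> < r" for x0
  proof -
    have x0\<rho>: "\<bar>x0\<bar> < \<rho>" "\<bar>x0\<bar> < \<rho>1" using x0 r\<rho> \<rho> by auto
    have "continuous_on {- (\<kappa> / 2)<..<\<kappa> / 2} (\<lambda>s. F (Z (x0, f x0 + s)) \<bullet> \<nu>)"
      by (intro continuous_on_inner continuous_on_const continuous_on_compose2[OF cF] continuous_on_compose2[OF cZ[of UNIV]])
        (use ZU[OF x0\<rho>(2) lev[OF x0\<rho>(2)]] in \<open>auto intro!: continuous_intros simp: abs_less_iff\<close>)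
    then have "continuous_on {- (\<kappa> / 2)<..<\<kappa> / 2} (B x0)"
      unfolding B_def[abs_def] by (intro continuous_on_diff AA(2)[OF x0\<rho>(1)])
    then have "isCont (B x0) 0" using \<kappa>(1) by (simp add: continuous_on_eq_continuous_at)
    note Bc = this
    show ?thesis
      unfolding has_derivative_at_alt
    proof (intro conjI allI impI)
      show "bounded_linear (\<lambda>v::real \<times> real. - B x0 0 * snd v)"
        by (intro bounded_linear_mult_right[THEN bounded_linear_compose] bounded_linear_snd)
      fix e :: real assume e: "0 < e"
      obtain d3 where d3: "0 < d3" "\<And>s. dist s 0 < d3 \<Longrightarrow> dist (B x0 s) (B x0 0) < e / 3"
        using Bc e unfolding continuous_at_eps_delta by (metis divide_pos_pos zero_less_numeral)
      \<comment> \<open>Three errors of size e / 3 each: \<open>E\<close> at small height, the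
        change of \<open>B\<close> in x, and the change of \<open>B x0\<close> in the height. The
        last two entries keep the points in the region where the estimates hold.\<close>
      define d' where "d' = Min {d3, e / (3 * (4 * M + 1)), e / (3 * (C + 1)), r - \<bar>x0\<bar>, r}"
      have d': "0 < d'" "d' \<le> d3" "d' \<le> e / (3 * (4 * M + 1))" "d' \<le> e / (3 * (C + 1))" "d' \<le> r - \<bar>x0\<bar>" "d' \<le> r"
        using d3 e bd C x0 r by (auto simp: d'_def min_def)
      have dM: "4 * M * t \<le> e / 3" "C * t \<le> e / 3" if "0 \<le> t" "t < d'" for t
      proof -
        have "t * (3 * (4 * M + 1)) \<le> e" "t * (3 * (C + 1)) \<le> e"
          using that d'(3,4) bd C by (simp_all add: pos_le_divide_eq[symmetric])
        then show "4 * M * t \<le> e / 3" "C * t \<le> e / 3" using that by (simp_all add: algebra_simps)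
      qed
      have "norm (uh z - uh (x0, 0) - - B x0 0 * snd (z - (x0, 0))) \<le> e * norm (z - (x0, 0))"
        if z: "norm (z - (x0, 0)) < d'" for z
      proof -
        define x s where "x = fst z" and "s = snd z"
        have le: "\<bar>x - x0\<bar> \<le> norm (z - (x0, 0))" "\<bar>s\<bar> \<le> norm (z - (x0, 0))"
          using norm_fst_le[of "x - x0" s] norm_snd_le[of s "x - x0"] by (cases z; simp add: x_def s_def)+
        have xs: "\<bar>x - x0\<bar> < d'" "\<bar>s\<bar> < d'" using le z by auto
        have xr: "\<bar>x\<bar> < r" using xs(1) d'(5) by linarith
        have x\<rho>: "\<bar>x\<bar> < \<rho>" "\<bar>x\<bar> < \<rho>1" using xr r\<rho> \<rho> by auto
        have "\<bar>(uh (x, s) + B x0 0 * s) - (uh (x, 0) + B x0 0 * 0)\<bar> \<le> e * \<bar>s\<bar>"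
        proof (rule increment_bound_off_zero[where d = d' and k = "\<lambda>s. uh (x, s) + B x0 0 * s"])
          show "continuous_on {- d'<..<d'} (\<lambda>s. uh (x, s) + B x0 0 * s)"
            by (intro continuous_intros continuous_on_subset[OF cs[OF x\<rho>(1)]]) (use d'(6) r(5) in auto)
          fix \<sigma> assume \<sigma>: "\<sigma> \<in> {- d'<..<d'}" "\<sigma> \<noteq> 0"
          then have s': "\<bar>\<sigma>\<bar> < \<kappa> / 2" "\<bar>\<sigma>\<bar> < r" "\<bar>\<sigma>\<bar> < d'" using d'(6) r(5) by (auto simp: abs_less_iff)
          let ?q = "Z (x, f x + \<sigma>)"
          have "((\<lambda>s. uh (x, s)) has_real_derivative E ?q * (N ?q \<bullet> \<nu>) - B x \<sigma>) (at \<sigma>)"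
            using chain_two[where F = uh and g = "\<lambda>_. x" and k = "\<lambda>s. s", OF uhd[OF x\<rho>(1) s'(1) \<sigma>(2)] DERIV_const DERIV_ident] by simp
          then have "((\<lambda>s. uh (x, s) + B x0 0 * s) has_real_derivative (E ?q * (N ?q \<bullet> \<nu>) - B x \<sigma>) + B x0 0) (at \<sigma>)"
            by (rule DERIV_add) (auto intro!: derivative_eq_intros)
          moreover have "\<bar>(E ?q * (N ?q \<bullet> \<nu>) - B x \<sigma>) + B x0 0\<bar> \<le> e"
          proof -
            have "\<bar>N ?q \<bullet> \<nu>\<bar> \<le> norm (N ?q) * norm \<nu>" by (rule Cauchy_Schwarz_ineq2)
            also have "\<dots> \<le> 1" using norm_normal_field_le_1[of u F ?q] nT by (simp add: N_def)
            finally have "\<bar>E ?q * (N ?q \<bullet> \<nu>)\<bar> \<le> E ?q * 1"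
              unfolding abs_mult using E0[of ?q] by (intro mult_mono) auto
            also have "\<dots> \<le> C * \<bar>\<sigma>\<bar>" using small[OF xr \<sigma>(2) s'(2)] by simp
            also have "\<dots> \<le> e / 3" by (rule dM) (use s' in auto)
            finally have 1: "\<bar>E ?q * (N ?q \<bullet> \<nu>)\<bar> \<le> e / 3" .
            have "\<bar>B x \<sigma> - B x0 \<sigma>\<bar> \<le> 4 * M * \<bar>x - x0\<bar>" by (rule Blip[OF x\<rho>(1) x0\<rho>(1) s'(1)])
            also have "\<dots> \<le> e / 3" by (rule dM) (use xs in auto)
            finally have 2: "\<bar>B x \<sigma> - B x0 \<sigma>\<bar> \<le> e / 3" .
            have 3: "\<bar>B x0 \<sigma> - B x0 0\<bar> \<le> e / 3" using d3(2)[of \<sigma>] s'(3) d'(2) by (simp add: dist_real_def)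
            show ?thesis using 1 2 3 by linarith
          qed
          ultimately show "\<exists>l. ((\<lambda>s. uh (x, s) + B x0 0 * s) has_real_derivative l) (at \<sigma>) \<and> \<bar>l\<bar> \<le> e" by blast
        qed (use xs e in auto)
        moreover have "uh (x, 0) = uh (x0, 0)"
        proof (cases "x \<le> x0")
          case True
          then show ?thesis by (rule const[OF x\<rho>(1) x0\<rho>(1)])
        next
          case False
          then show ?thesis by (intro const[OF x0\<rho>(1) x\<rho>(1), symmetric]) simp
        qed
        ultimately have "\<bar>uh (x, s) - uh (x0, 0) + B x0 0 * s\<bar> \<le> e * \<bar>s\<bar>" by (simp add: algebra_simps)
        also have "\<dots> \<le> e * norm (z - (x0, 0))" using le(2) e by (intro mult_left_mono) auto
        finally show ?thesis by (simp add: x_def s_def)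
      qed
      then show "\<exists>d>0. \<forall>z. norm (z - (x0, 0)) < d \<longrightarrow> norm (uh z - uh (x0, 0) - - B x0 0 * snd (z - (x0, 0))) \<le> e * norm (z - (x0, 0))"
        using d'(1) by blast
    qed
  qed
  have dW: "(u has_derivative (\<lambda>v. W q \<bullet> v)) (at q)" if q: "q \<in> V" for q
  proof (cases "q \<in> \<gamma>")
    case False
    then show ?thesis using gu(1)[of q] Vc(5)[OF q] by (simp add: W_def)
  next
    case True
    have s0: "sc q = 0" using Vc(6)[OF q] True by simp
    have xr: "\<bar>xc q\<bar> < r" by (rule Vc(1)[OF q])
    have x\<rho>: "\<bar>xc q\<bar> < \<rho>" "\<bar>xc q\<bar> < \<rho>1" using xr r\<rho> \<rho> by auto
    have Zq: "Z (xc q, f (xc q)) = q" using Vc(4)[OF q] s0 by simp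
    have k0: "\<bar>0::real\<bar> < \<kappa> / 2" using \<kappa>(1) by simp
    have A0: "((\<lambda>z. A (fst z) (snd z)) has_derivative (\<lambda>v. (F q \<bullet> T + F q \<bullet> \<nu> * f' (xc q)) * fst v + As (xc q) 0 * snd v)) (at (xc q, sc q))"
      using AA(1)[OF x\<rho>(1) k0] Zq s0 by simp
    have U0: "(uh has_derivative (\<lambda>v. - B (xc q) 0 * snd v)) (at (xc q, sc q))" using uh0[OF xr] s0 by simp
    have xd: "(xc has_derivative (\<lambda>v. v \<bullet> T)) (at q)"
      unfolding xc_def[abs_def] by (auto intro!: derivative_eq_intros)
    have sd: "(sc has_derivative (\<lambda>v. v \<bullet> \<nu> - f' (xc q) * (v \<bullet> T))) (at q)"
    proof -
      have "((\<lambda>q. (q - p) \<bullet> \<nu>) has_derivative (\<lambda>v. v \<bullet> \<nu>)) (at q)" by (auto intro!: derivative_eq_intros)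
      moreover have "((\<lambda>q. f (xc q)) has_derivative (\<lambda>v. f' (xc q) * (v \<bullet> T))) (at q)"
        by (rule has_derivative_compose[OF xd fd[OF x\<rho>(2), unfolded has_field_derivative_def]])
      ultimately show ?thesis unfolding sc_def[abs_def] by (rule has_derivative_diff)
    qed
    have pd: "((\<lambda>q. (xc q, sc q)) has_derivative (\<lambda>v. (v \<bullet> T, v \<bullet> \<nu> - f' (xc q) * (v \<bullet> T)))) (at q)"
      by (rule has_derivative_Pair[OF xd sd])
    \<comment> \<open>Undoing the correction, u = uh - A: the terms in \<open>As\<close> cancel, and
      the rest is the frame expansion of - F . v.\<close>
    have "((\<lambda>q. uh (xc q, sc q) - A (xc q) (sc q)) has_derivative
      (\<lambda>v. - B (xc q) 0 * (v \<bullet> \<nu> - f' (xc q) * (v \<bullet> T)) - ((F q \<bullet> T + F q \<bullet> \<nu> * f' (xc q)) * (v \<bullet> T) + As (xc q) 0 * (v \<bullet> \<nu> - f' (xc q) * (v \<bullet> T))))) (at q)"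
      using has_derivative_diff[OF has_derivative_compose[OF pd U0] has_derivative_compose[OF pd A0]] by simp
    moreover have "- B (xc q) 0 * (v \<bullet> \<nu> - f' (xc q) * (v \<bullet> T)) - ((F q \<bullet> T + F q \<bullet> \<nu> * f' (xc q)) * (v \<bullet> T) + As (xc q) 0 * (v \<bullet> \<nu> - f' (xc q) * (v \<bullet> T))) = W q \<bullet> v" for v
    proof -
      have b: "B (xc q) 0 = F q \<bullet> \<nu> - As (xc q) 0" using Zq by (simp add: B_def)
      have w: "W q \<bullet> v = - ((F q \<bullet> T) * (v \<bullet> T) + (F q \<bullet> \<nu>) * (v \<bullet> \<nu>))"
        using True orthoframe_inner[OF fr, of "F q" v] by (simp add: W_def)
      show ?thesis unfolding b w by (simp add: algebra_simps)
    qed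
    ultimately have "((\<lambda>q. uh (xc q, sc q) - A (xc q) (sc q)) has_derivative (\<lambda>v. W q \<bullet> v)) (at q)" by simp
    then show ?thesis
    proof (rule has_derivative_transform_within_open[OF _ oV q])
      fix q' assume "q' \<in> V"
      then show "uh (xc q', sc q') - A (xc q') (sc q') = u q'" using Vc(4) by (simp add: uh_def G_def)
    qed
  qed
  have "C1_on u V" by (rule C1_onI[OF dW cW])
  moreover have "grad u p = - F p" using grad_eqI[OF dW[OF pV]] p\<gamma> by (simp add: W_def)
  moreover have "V \<subseteq> U" using Vc(5) by blast
  ultimately show ?thesis using oV pV by (intro exI[of _ V]) simp
qed

theorem theorem5p4:
  fixes U Up Um \<gamma> :: "(real^2) set" and u H :: "real^2 \<Rightarrow> real" and F :: "real^2 \<Rightarrow> real^2"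
    and p0 :: "real^2"
  assumes "divides_domain \<gamma> U Up Um"
    and "C1_on u (U - \<gamma>)" and "continuous_on U u"
    and "\<forall>p\<in>U - \<gamma>. grad u p + F p \<noteq> 0"
    and "C1_on F U" and "\<forall>p\<in>U. curl F p \<noteq> 0" and "C1_on H U"
    and "weak_solution U \<gamma> u F H"
    and "p0 \<in> \<gamma>"
    and "crack_point (normal_field u F) \<gamma> Up Um p0"
    and "nondegenerate_point (normal_field u F) H U \<gamma> Up Um p0"
  shows "\<exists>V\<subseteq>U. open V \<and> p0 \<in> V \<and> C1_on u V \<and> grad u p0 + F p0 = 0"
proof -
  let ?N = "normal_field u F"
  note div = assms(1)
  have dd: "open U" "\<gamma> \<subseteq> U" "C1_curve \<gamma>" "open Up" "open Um" "Up \<inter> Um = {}" "U - \<gamma> = Up \<union> Um"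
    using div by (simp_all add: divides_domain_def)
  have oG: "open (U - \<gamma>)" unfolding dd(7) using dd(4,5) by (rule open_Un)
  have nz: "\<And>q. q \<in> U - \<gamma> \<Longrightarrow> grad u q + F q \<noteq> 0" using assms(4) by blast
  obtain U' where U': "p0 \<in> U'" "\<And>q. q \<in> \<gamma> \<inter> U' \<Longrightarrow> unique_issuing_characteristic ?N (Up \<inter> U') q \<and> unique_issuing_characteristic ?N (Um \<inter> U') q"
    using assms(11) unfolding nondegenerate_point_def by blast
  \<comment> \<open>Characteristic curves issue from \<open>p0\<close> into both regions. So
    \<open>p0\<close> lies in both closures: the two regions really are the two sides of the graph,
    and the one-sided limits of \<open>N\<close> are not vacuous.\<close>
  have cl: "p0 \<in> closure Up" "p0 \<in> closure Um"
    using U'(2)[of p0] U'(1) assms(9) unique_issuing_closure closure_mono[of "Up \<inter> U'" Up] closure_mono[of "Um \<inter> U'" Um] by blast+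
  obtain T \<nu> \<rho>1 \<kappa>1 f f' where gr1: "graph_at \<gamma> p0 T \<nu> \<rho>1 \<kappa>1 f f'"
    using C1_curve_graph[OF dd(3) assms(9)] by blast
  have fr: "orthoframe T \<nu>" and pos1: "0 < \<rho>1" "0 < \<kappa>1" and f00: "f 0 = 0" "f' 0 = 0"
    and fd: "\<And>x. \<bar>x\<bar> < \<rho>1 \<Longrightarrow> (f has_real_derivative f' x) (at x)"
    using gr1 unfolding graph_at_def by simp_all
  have f0: "f 0 = 0" "(f has_real_derivative 0) (at 0)" using fd[of 0] f00 pos1 by simp_all
  have nT: "norm T = 1" "norm \<nu> = 1" using fr by (simp_all add: orthoframe_def norm_eq_sqrt_inner)
  obtain e where e: "0 < e" "ball p0 e \<subseteq> U" using dd(1,2) assms(9) by (meson openE subsetD)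
  define \<kappa> where "\<kappa> = min \<kappa>1 (e / 2)"
  have \<kappa>: "0 < \<kappa>" "\<kappa> \<le> \<kappa>1" "\<kappa> \<le> e / 2" using pos1 e by (auto simp: \<kappa>_def)
  obtain e1 where e1: "0 < e1" "\<And>x. dist x 0 < e1 \<Longrightarrow> dist (f x) (f 0) < \<kappa>"
    using DERIV_isCont[OF f0(2)] \<kappa>(1) unfolding continuous_at_eps_delta by blast
  define \<rho> where "\<rho> = Min {\<rho>1, e / 2, e1}"
  have \<rho>: "0 < \<rho>" "\<rho> \<le> \<rho>1" "\<rho> \<le> e / 2" "\<rho> \<le> e1" using pos1 e e1 by (auto simp: \<rho>_def)
  have gr: "graph_at \<gamma> p0 T \<nu> \<rho> \<kappa> f f'" by (rule graph_at_shrink[OF gr1 \<rho>(1,2) \<kappa>(1,2)])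
  have fb: "\<bar>f x\<bar> < \<kappa>" if "\<bar>x\<bar> < \<rho>" for x using e1(2)[of x] that \<rho>(4) f0 by (simp add: dist_real_def)
  have inU: "frame_point p0 T \<nu> (x, y) \<in> U" if "\<bar>x\<bar> < \<rho>" "\<bar>y\<bar> < \<kappa>" for x y
  proof -
    have "dist p0 (frame_point p0 T \<nu> (x, y)) = norm (x *\<^sub>R T + y *\<^sub>R \<nu>)"
      by (subst dist_commute) (simp add: frame_point_def dist_norm)
    also have "\<dots> \<le> \<bar>x\<bar> + \<bar>y\<bar>" using norm_triangle_ineq[of "x *\<^sub>R T" "y *\<^sub>R \<nu>"] nT by simp
    also have "\<dots> < e" using that \<rho>(3) \<kappa>(3) by linarith
    finally show ?thesis using e(2) by auto
  qed
  have "\<exists>W1 W2. (W1 = Up \<and> W2 = Um \<or> W1 = Um \<and> W2 = Up) \<and>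
      (\<forall>x y. \<bar>x\<bar> < \<rho> \<longrightarrow> \<bar>y\<bar> < \<kappa> \<longrightarrow> f x < y \<longrightarrow> frame_point p0 T \<nu> (x, y) \<in> W1) \<and>
      (\<forall>x y. \<bar>x\<bar> < \<rho> \<longrightarrow> \<bar>y\<bar> < \<kappa> \<longrightarrow> y < f x \<longrightarrow> frame_point p0 T \<nu> (x, y) \<in> W2)"
    by (rule graph_sides[OF div gr _ fb cl]) (rule inU)
  then obtain W1 W2 where W0: "(W1 = Up \<and> W2 = Um \<or> W1 = Um \<and> W2 = Up) \<and>
      (\<forall>x y. \<bar>x\<bar> < \<rho> \<longrightarrow> \<bar>y\<bar> < \<kappa> \<longrightarrow> f x < y \<longrightarrow> frame_point p0 T \<nu> (x, y) \<in> W1) \<and>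
      (\<forall>x y. \<bar>x\<bar> < \<rho> \<longrightarrow> \<bar>y\<bar> < \<kappa> \<longrightarrow> y < f x \<longrightarrow> frame_point p0 T \<nu> (x, y) \<in> W2)"
    by (elim exE)
  have W12: "W1 = Up \<and> W2 = Um \<or> W1 = Um \<and> W2 = Up"
    using W0 by (rule conjunct1)
  have up: "frame_point p0 T \<nu> (x, y) \<in> W1" if "\<bar>x\<bar> < \<rho>" "\<bar>y\<bar> < \<kappa>" "f x < y" for x y
    using W0 that by simp
  have dn: "frame_point p0 T \<nu> (x, y) \<in> W2" if "\<bar>x\<bar> < \<rho>" "\<bar>y\<bar> < \<kappa>" "y < f x" for x y
    using W0 that by simp
  obtain Np Nm where Npm: "(?N \<longlongrightarrow> Np) (at p0 within Up)" "(?N \<longlongrightarrow> Nm) (at p0 within Um)" "Np \<noteq> Nm"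
    using assms(10) unfolding crack_point_def by blast
  obtain N1 N2 where lim: "(?N \<longlongrightarrow> N1) (at p0 within W1)" "(?N \<longlongrightarrow> N2) (at p0 within W2)" and ne: "N1 \<noteq> N2"
  proof (cases "W1 = Up")
    case True
    then have "W2 = Um" using W12 by auto
    then show ?thesis using that[of Np Nm] Npm True by simp
  next
    case False
    then have "W1 = Um" "W2 = Up" using W12 by auto
    then show ?thesis using that[of Nm Np] Npm by simp
  qed
  have W: "W1 \<subseteq> U - \<gamma>" "W2 \<subseteq> U - \<gamma>" and clW: "p0 \<in> closure W1" "p0 \<in> closure W2"
    using W12 dd(7) cl by auto
  have C1c: "continuous_on U f" if "C1_on f U" for f :: "real^2 \<Rightarrow> 'b::euclidean_space"
    using that unfolding C1_on_def
    by (elim exE conjE, intro continuous_at_imp_continuous_on ballI) (auto intro: has_derivative_continuous)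
  have cF: "continuous_on U F" "continuous_on U H" using C1c assms(5,7) by auto
  have cN: "continuous_on (U - \<gamma>) ?N"
    unfolding normal_field_def
    by (intro continuous_intros C1_on_grad(2)[OF assms(2)] continuous_on_subset[OF cF(1)]) (use nz in auto)
  have unit: "norm N0 = 1" if "(?N \<longlongrightarrow> N0) (at p0 within W0)" "W0 \<subseteq> U - \<gamma>" "p0 \<in> closure W0" for N0 W0
  proof -
    have "p0 \<notin> W0" using that(2) assms(9) by auto
    then have "p0 islimpt W0" using that(3) by (simp add: closure_def)
    \<comment> \<open>Nontriviality of the filter is what transfers the unit length of
      \<open>N\<close> to its limit.\<close>
    then have nt: "at p0 within W0 \<noteq> bot" by (simp add: trivial_limit_within)
    have "((\<lambda>q. norm (?N q)) \<longlongrightarrow> norm N0) (at p0 within W0)" by (intro tendsto_norm that)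
    moreover have "((\<lambda>q. norm (?N q)) \<longlongrightarrow> 1) (at p0 within W0)"
    proof (rule tendsto_eventually)
      have "norm (?N q) = 1" if "q \<in> W0" for q using nz[of q] that \<open>W0 \<subseteq> U - \<gamma>\<close> by (auto simp: normal_field_def)
      then show "\<forall>\<^sub>F q in at p0 within W0. norm (?N q) = 1" by (simp add: eventually_at_filter)
    qed
    ultimately show ?thesis using tendsto_unique[OF nt] by blast
  qed
  have u1: "norm N1 = 1" "norm N2 = 1" using unit[OF lim(1) W(1) clW(1)] unit[OF lim(2) W(2) clW(2)] .
  define r where "r = min \<rho> \<kappa>"
  have r: "0 < r" "r \<le> \<rho>" "r \<le> \<kappa>" using \<rho> \<kappa> by (auto simp: r_def)
  have jump: "N1 \<bullet> \<nu> = N2 \<bullet> \<nu>"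
    by (rule normal_jump[OF fr dd(1) oG cN cF(2) assms(8) r(1) up dn W inU f0(2,1) lim]) (use r in auto)
  have sq: "(N1 \<bullet> T)\<^sup>2 = (N2 \<bullet> T)\<^sup>2"
  proof -
    have "N1 \<bullet> N1 = 1" "N2 \<bullet> N2 = 1" using u1 by (simp_all add: norm_eq_1)
    then show ?thesis using orthoframe_inner[OF fr, of N1 N1] orthoframe_inner[OF fr, of N2 N2] jump
      by (simp add: power2_eq_square)
  qed
  have "N1 \<bullet> T \<noteq> N2 \<bullet> T"
  proof
    assume "N1 \<bullet> T = N2 \<bullet> T"
    then have "N1 = N2" using orthoframe_expand[OF fr, of N1] orthoframe_expand[OF fr, of N2] jump by simp
    then show False using ne by simp
  qed
  then have opp: "N2 \<bullet> T = - (N1 \<bullet> T)" "N1 \<bullet> T \<noteq> 0" using sq by (auto simp: power2_eq_iff)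
  show ?thesis
  proof (cases "0 < N1 \<bullet> T")
    case True
    show ?thesis
      by (rule framed_conclusion[OF gr dd(1) oG assms(2,3) nz assms(5,7,8) inU up dn W lim])
        (use True opp in auto)
  next
    case False
    have fl: "frame_point p0 (- T) \<nu> (x, y) = frame_point p0 T \<nu> (- x, y)" for x y
      by (simp add: frame_point_def)
    show ?thesis
      by (rule framed_conclusion[OF graph_at_flip[OF gr] dd(1) oG assms(2,3) nz assms(5,7,8) _ _ _ W lim])
        (use False opp in \<open>auto simp: fl intro: inU up dn\<close>)
  qed
qed

end
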